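(* Every virtually polycyclic group is inner automorphism separable (IAS).
   Context: A group $G$ is inner automorphism separable (IAS) if for every $\phi \in \operatorname{Aut}(G)\setminus\operatorname{Inn}(G)$ there is a finite-index characteristic subgroup $K$ of $G$ such that $\tilde{\kappa}(\phi)\notin \operatorname{Inn}(G/K)$, where $\tilde{\kappa}\colon\operatorname{Aut}(G)\to\operatorname{Aut}(G/K)$ is given by $\tilde{\kappa}(\psi)(gK) = \psi(g)K$. *)

theory Defs
  imports "HOL-Algebra.Algebra"
begin

definition finite_index :: "'a set \<Rightarrow> ('a, 'b) monoid_scheme \<Rightarrow> bool"
  where "finite_index H G \<longleftrightarrow> subgroup H G \<and> finite (rcosets\<^bsub>G\<^esub> H)"

(* The analogue of solvable_seq: H is the last term of a series starting at the trivial
   subgroup in which each term is normal in the next, with cyclic quotient. *)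
inductive polycyclic_seq :: "('a, 'b) monoid_scheme \<Rightarrow> 'a set \<Rightarrow> bool"
  for G where
    unity: "polycyclic_seq G {\<one>\<^bsub>G\<^esub>}"
  | extension: "\<lbrakk> polycyclic_seq G K; K \<lhd> (G \<lparr> carrier := H \<rparr>); subgroup H G;
                  cyclic_group ((G \<lparr> carrier := H \<rparr>) Mod K) \<rbrakk> \<Longrightarrow> polycyclic_seq G H"

definition polycyclic :: "('a, 'b) monoid_scheme \<Rightarrow> bool"
  where "polycyclic G \<longleftrightarrow> polycyclic_seq G (carrier G)"

definition virtually_polycyclic :: "('a, 'b) monoid_scheme \<Rightarrow> bool"
  where "virtually_polycyclic G \<longleftrightarrow> (\<exists>H. finite_index H G \<and> polycyclic (G \<lparr> carrier := H \<rparr>))"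

(* Like the elements of auto G, inner automorphisms are extensional functions on the carrier,
   so that equality of functions is equality of automorphisms. *)
definition inner_auto :: "('a, 'b) monoid_scheme \<Rightarrow> ('a \<Rightarrow> 'a) set"
  where "inner_auto G =
    (\<lambda>a. \<lambda>x\<in>carrier G. a \<otimes>\<^bsub>G\<^esub> x \<otimes>\<^bsub>G\<^esub> inv\<^bsub>G\<^esub> a) ` carrier G"

definition characteristic :: "'a set \<Rightarrow> ('a, 'b) monoid_scheme \<Rightarrow> bool"
  where "characteristic K G \<longleftrightarrow> subgroup K G \<and> (\<forall>\<phi>\<in>auto G. \<phi> ` K = K)"

(* The map sending gK to \<psi>(g)K. As K is mapped onto itself by \<psi>, the coset \<psi>(g)K is the
   image of gK under \<psi>, which needs no choice of representative; see
   quotient_auto_coset. *)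
definition quotient_auto ::
  "('a, 'b) monoid_scheme \<Rightarrow> 'a set \<Rightarrow> ('a \<Rightarrow> 'a) \<Rightarrow> 'a set \<Rightarrow> 'a set"
  where "quotient_auto G K \<psi> = (\<lambda>C\<in>carrier (G Mod K). \<psi> ` C)"

definition inner_automorphism_separable :: "('a, 'b) monoid_scheme \<Rightarrow> bool"
  where "inner_automorphism_separable G \<longleftrightarrow>
    (\<forall>\<phi> \<in> auto G - inner_auto G.
       \<exists>K. characteristic K G \<and> finite_index K G \<and>
           quotient_auto G K \<phi> \<notin> inner_auto (G Mod K))"

lemma (in group) inner_auto_subset_auto: "inner_auto G \<subseteq> auto G"
proof
  fix f assume "f \<in> inner_auto G"
  then obtain a where a: "a \<in> carrier G"
    and f: "f = (\<lambda>x\<in>carrier G. a \<otimes> x \<otimes> inv a)"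
    by (auto simp: inner_auto_def)
  have hom: "f \<in> hom G G"
    unfolding f hom_def using a by (auto simp: m_assoc inv_solve_left)
  have "bij_betw f (carrier G) (carrier G)"
    unfolding f
    by (rule bij_betw_byWitness[where f' = "\<lambda>x. inv a \<otimes> x \<otimes> a"])
       (use a in \<open>auto simp: m_assoc inv_solve_left' simp flip: m_assoc[of a "inv a"] m_assoc[of "inv a" a]\<close>)
  with hom show "f \<in> auto G"
    by (auto simp: auto_def Bij_def f)
qed

lemma (in group) characteristic_imp_normal:
  assumes "characteristic K G"
  shows "K \<lhd> G"
proof -
  have K: "subgroup K G" using assms by (simp add: characteristic_def)
  have "a \<otimes> k \<otimes> inv a \<in> K" if a: "a \<in> carrier G" and k: "k \<in> K" for a k
  proof -
    let ?f = "\<lambda>x\<in>carrier G. a \<otimes> x \<otimes> inv a"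
    have "?f \<in> auto G"
      using a inner_auto_subset_auto by (auto simp: inner_auto_def)
    then have "?f ` K = K" using assms unfolding characteristic_def by blast
    then have "?f k \<in> K" using k by blast
    then show ?thesis using subgroup.mem_carrier[OF K k] by simp
  qed
  then show ?thesis using K by (simp add: normal_inv_iff)
qed

lemma (in group) image_auto_coset:
  assumes "characteristic K G" "\<psi> \<in> auto G" "g \<in> carrier G"
  shows "\<psi> ` (K #> g) = K #> \<psi> g"
proof -
  have K: "K \<subseteq> carrier G" and im: "\<psi> ` K = K"
    using assms by (auto simp: characteristic_def dest: subgroup.subset)
  have "\<psi> (k \<otimes> g) = \<psi> k \<otimes> \<psi> g" if "k \<in> K" for k
    using assms K that by (auto simp: auto_def hom_def)
  then have "\<psi> ` (K #> g) = \<psi> ` K #> \<psi> g"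
    by (auto simp: r_coset_def image_UN)
  then show ?thesis by (simp add: im)
qed

lemma (in group) quotient_auto_coset:
  assumes "characteristic K G" "\<psi> \<in> auto G" "g \<in> carrier G"
  shows "quotient_auto G K \<psi> (g <# K) = \<psi> g <# K"
proof -
  have K: "K \<lhd> G" using characteristic_imp_normal assms(1) .
  have g: "\<psi> g \<in> carrier G" using assms by (auto simp: auto_def hom_def)
  have "K #> g \<in> carrier (G Mod K)"
    using assms(3) by (auto simp: FactGroup_def RCOSETS_def)
  then have "quotient_auto G K \<psi> (K #> g) = K #> \<psi> g"
    by (simp add: quotient_auto_def image_auto_coset[OF assms])
  then show ?thesis using normal.coset_eq[OF K] assms(3) g by simp
qed

lemma (in group) quotient_auto_in_auto:
  assumes "characteristic K G" "\<psi> \<in> auto G"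
  shows "quotient_auto G K \<psi> \<in> auto (G Mod K)"
proof -
  have K: "K \<lhd> G" using characteristic_imp_normal assms(1) .
  have c: "carrier (G Mod K) = (\<lambda>g. K #> g) ` carrier G"
    by (auto simp: FactGroup_def RCOSETS_def)
  have sub: "C \<subseteq> carrier G" if "C \<in> carrier (G Mod K)" for C
    using that K unfolding c by (auto dest: normal_imp_subgroup subgroup.subset r_coset_subset_G)
  have bij: "bij_betw \<psi> (carrier G) (carrier G)" and hom: "\<psi> \<in> hom G G"
    using assms by (auto simp: auto_def Bij_def)
  let ?q = "quotient_auto G K \<psi>"
  have q: "?q (K #> g) = K #> \<psi> g" if "g \<in> carrier G" for g
    using that by (simp add: quotient_auto_def image_auto_coset[OF assms] c)
  have im: "?q ` carrier (G Mod K) = carrier (G Mod K)"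
  proof -
    have "?q ` carrier (G Mod K) = (\<lambda>g. K #> g) ` \<psi> ` carrier G"
      unfolding c image_image by (rule image_cong) (auto simp: q)
    then show ?thesis using bij c by (simp add: bij_betw_def)
  qed
  have "inj_on ?q (carrier (G Mod K))"
  proof (rule inj_onI)
    fix C D assume C: "C \<in> carrier (G Mod K)" and D: "D \<in> carrier (G Mod K)"
      and "?q C = ?q D"
    then have "\<psi> ` C = \<psi> ` D" by (simp add: quotient_auto_def)
    then show "C = D"
      using inj_on_image_eq_iff[of \<psi> "carrier G" C D] sub[OF C] sub[OF D] bij
      by (simp add: bij_betw_def)
  qed
  moreover have "?q \<in> hom (G Mod K) (G Mod K)"
  proof -
    have "?q (K #> g <#> (K #> h)) = ?q (K #> g) <#> ?q (K #> h)"
      if g: "g \<in> carrier G" and h: "h \<in> carrier G" for g h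
    proof -
      have "\<psi> g \<in> carrier G" "\<psi> h \<in> carrier G" "\<psi> (g \<otimes> h) = \<psi> g \<otimes> \<psi> h"
        using hom g h by (auto simp: hom_def)
      then show ?thesis using g h by (simp add: normal.rcos_sum[OF K] q)
    qed
    then have "?q (C \<otimes>\<^bsub>G Mod K\<^esub> D) = ?q C \<otimes>\<^bsub>G Mod K\<^esub> ?q D"
      if "C \<in> carrier (G Mod K)" "D \<in> carrier (G Mod K)" for C D
      using that unfolding c by (auto simp: FactGroup_def)
    then show ?thesis
      using im unfolding hom_def by blast
  qed
  ultimately show ?thesis
    using im by (auto simp: auto_def Bij_def bij_betw_def quotient_auto_def)
qed

end

theory Submission
 imports Defs "HOL-Computational_Algebra.Computational_Algebra"
begin

text \<open>Suppose that an automorphism phi becomes inner in every characteristic finite quotient of G. Some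
 subgroup G0 of finite index acts triangularly on itself by conjugation: it has a descending chain of
 subgroups A in which each is the kernel of an additive map u from the preceding one to the complex
 numbers, u being an eigenvector for the action, and whose last term is centralized. Descending this
 chain and composing phi with inner automorphisms, we keep phi congruent, modulo every finite index
 normal subgroup, to conjugation by an element of a subgroup C such that the commutators of C with the
 generators of G lie in A. At the bottom C centralizes G, so that phi is inner by residual finiteness.

 A step down the chain first replaces C by the kernel of its character chi on A / ker u, and then by
 the elements whose commutators lie in ker u; the second part follows from the separability of
 subgroups (Mal'cev). The first part concerns the finitely generated multiplicative group chi(C)
 acting on the finitely generated additive group u(A): its orbits are closed in the profinite topology
 and congruence conditions cut out subgroups of finite index. This is Chevalley's theorem on congruence
 subgroups of unit groups of orders. Its core is that a unit e of an order R which is a q-th power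
 modulo every M prime to q has a q-th root y in the field of fractions: otherwise pairs of
 ideals of R embed into the ideals of R[y], of which only O(n) have index at most n, whereas the
 principal ideals of R alone have a divergent sum of inverse indices.\<close>

section \<open>Orders of number fields\<close>

text \<open>Eliminating chi is of conjugacy separability type: congruences between chi(c) v and v
  modulo m must yield an element of C in K with the same character value as c, which separability of
  subgroups does not give. That chi and u are complex valued costs nothing, since the multipliers of
  a finitely generated group of complex numbers form an order. Counting ideals replaces the density
  theorem for primes. It needs a q-th root of unity zeta other than 1, because R[y] is evaluated
  both at y = z and at y = zeta z, and moduli prime to q, because 1 - zeta has to be invertible.
  Passing from q to its powers meets the obstruction of Grunwald and Wang: roots of unity of q-power
  order must be adjoined, and the root found there is brought back by Kummer theory, for which a
  root of unity of order q^2 is put into the ground field. The root then lies in the field of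
  fractions only; that a power of it with fixed exponent t belongs to the given group follows from
  the finiteness of integral elements of bounded growth.\<close>

lemmas sub_m = subgroup.m_closed and sub_inv = subgroup.m_inv_closed
 and sub_one = subgroup.one_closed and sub_mem = subgroup.mem_carrier

section \<open>Finitely generated additive subgroups of the complex numbers\<close>

definition zspan :: "nat \<Rightarrow> (nat \<Rightarrow> complex) \<Rightarrow> complex set" where
 "zspan d w = range (\<lambda>c::nat \<Rightarrow> int. \<Sum>i<d. of_int (c i) * w i)"

definition zindep :: "nat \<Rightarrow> (nat \<Rightarrow> complex) \<Rightarrow> bool" where
 "zindep d w \<longleftrightarrow> (\<forall>c::nat \<Rightarrow> int. (\<Sum>i<d. of_int (c i) * w i) = 0 \<longrightarrow> (\<forall>i<d. c i = 0))"

lemma zspanI: "x = (\<Sum>i<d. of_int (c i) * w i) \<Longrightarrow> x \<in> zspan d w"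
 by (auto simp: zspan_def)

lemma zspanE:
 assumes "x \<in> zspan d w"
 obtains c :: "nat \<Rightarrow> int" where "x = (\<Sum>i<d. of_int (c i) * w i)"
 using assms by (auto simp: zspan_def)

lemma zspan_0: "0 \<in> zspan d w"
 by (rule zspanI[where c = "\<lambda>_. 0"]) simp

lemma zspan_add: "x \<in> zspan d w \<Longrightarrow> y \<in> zspan d w \<Longrightarrow> x + y \<in> zspan d w"
proof (elim zspanE)
 fix c e :: "nat \<Rightarrow> int"
 assume "x = (\<Sum>i<d. of_int (c i) * w i)" "y = (\<Sum>i<d. of_int (e i) * w i)"
 then show ?thesis
  by (intro zspanI[where c = "\<lambda>i. c i + e i"]) (simp add: sum.distrib ring_distribs)
qed

lemma zspan_scale: "x \<in> zspan d w \<Longrightarrow> of_int k * x \<in> zspan d w"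
proof (elim zspanE)
 fix c :: "nat \<Rightarrow> int"
 assume "x = (\<Sum>i<d. of_int (c i) * w i)"
 then show ?thesis
  by (intro zspanI[where c = "\<lambda>i. k * c i"]) (simp add: sum_distrib_left mult.assoc)
qed

lemma zspan_minus: "x \<in> zspan d w \<Longrightarrow> - x \<in> zspan d w"
 using zspan_scale[of x d w "-1"] by simp

lemma zspan_diff: "x \<in> zspan d w \<Longrightarrow> y \<in> zspan d w \<Longrightarrow> x - y \<in> zspan d w"
 using zspan_add[of x d w "- y"] zspan_minus[of y] by simp

lemma zspan_sum: "(\<And>i. i \<in> I \<Longrightarrow> f i \<in> zspan d w) \<Longrightarrow> (\<Sum>i\<in>I. f i) \<in> zspan d w"
 by (induction I rule: infinite_finite_induct) (auto simp: zspan_0 zspan_add)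

lemma zspan_base: "i < d \<Longrightarrow> w i \<in> zspan d w"
 by (rule zspanI[where c = "\<lambda>j. if j = i then 1 else 0"])
   (simp add: if_distrib[of of_int] if_distrib[of "\<lambda>x. x * _"] sum.delta cong: if_cong)

lemma zspan_least:
 assumes "\<And>i. i < d \<Longrightarrow> w i \<in> zspan e v"
 shows "zspan d w \<subseteq> zspan e v"
proof
 fix x assume "x \<in> zspan d w"
 then obtain c :: "nat \<Rightarrow> int" where "x = (\<Sum>i<d. of_int (c i) * w i)" by (elim zspanE)
 then show "x \<in> zspan e v" using assms by (auto intro!: zspan_sum zspan_scale)
qed

lemma zspan_drop:
 assumes "j < d" "w j = 0"
 shows "zspan d w = zspan (d - 1) (\<lambda>i. if i < j then w i else w (Suc i))" (is "_ = zspan _ ?v")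
proof
 show "zspan d w \<subseteq> zspan (d - 1) ?v"
 proof (rule zspan_least)
  fix i assume i: "i < d"
  consider "i = j" | "i < j" | "i > j" by linarith
  then show "w i \<in> zspan (d - 1) ?v"
  proof cases
   case 1 then show ?thesis using assms by (simp add: zspan_0)
  next
   case 2 then show ?thesis using zspan_base[of i "d-1" ?v] i assms by simp
  next
   case 3
   then obtain i' where "i = Suc i'" by (cases i) auto
   then show ?thesis using zspan_base[of i' "d-1" ?v] i 3 by auto
  qed
 qed
 show "zspan (d - 1) ?v \<subseteq> zspan d w"
  by (rule zspan_least) (use assms in \<open>auto intro!: zspan_base\<close>)
qed

lemma zspan_shear:
 assumes "i < d" "j < d" "i \<noteq> j"
 shows "zspan d (w(j := w j + of_int s * w i)) = zspan d w" (is "zspan d ?v = _")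
proof
 show "zspan d ?v \<subseteq> zspan d w"
  by (rule zspan_least) (use assms in \<open>auto intro!: zspan_base zspan_add zspan_scale\<close>)
 show "zspan d w \<subseteq> zspan d ?v"
 proof (rule zspan_least)
  fix l assume l: "l < d"
  have "w j = ?v j - of_int s * ?v i" using assms by simp
  moreover have "?v j - of_int s * ?v i \<in> zspan d ?v"
   using assms by (intro zspan_diff zspan_scale zspan_base)
  moreover have "l \<noteq> j \<Longrightarrow> w l = ?v l" by simp
  ultimately show "w l \<in> zspan d ?v" using zspan_base[OF l, of ?v] by metis
 qed
qed

text \<open>Euclid's algorithm on the coefficients of a relation eventually exposes a redundant generator.\<close>

lemma zspan_shorten:
 fixes c :: "nat \<Rightarrow> int"
 assumes "(\<Sum>i<d. of_int (c i) * w i) = 0" "k < d" "c k \<noteq> 0"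
 shows "\<exists>v. zspan (d - 1) v = zspan d w"
 using assms
proof (induction "nat (\<Sum>i<d. \<bar>c i\<bar>)" arbitrary: c w k rule: less_induct)
 case less
 show ?case
 proof (cases "\<exists>j<d. j \<noteq> k \<and> c j \<noteq> 0")
  case False
  then have "(\<Sum>i<d. of_int (c i) * w i) = (\<Sum>i\<in>{k}. of_int (c i) * w i)"
   using less.prems by (intro sum.mono_neutral_right) auto
  then have "w k = 0" using less.prems by simp
  then show ?thesis using zspan_drop[of k d w] less.prems by metis
 next
  case True
  then obtain l where l: "l < d" "l \<noteq> k" "c l \<noteq> 0" by blast
  \<comment> \<open>The coefficient of larger absolute value is reduced by the other one, and the
    shear of \<open>w\<close> compensates: the relation and the span survive while the sum of the
    absolute values drops.\<close>
  define i j where "i = (if \<bar>c k\<bar> \<ge> \<bar>c l\<bar> then k else l)" and "j = (if \<bar>c k\<bar> \<ge> \<bar>c l\<bar> then l else k)"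
  have ij: "i < d" "j < d" "i \<noteq> j" "c i \<noteq> 0" "c j \<noteq> 0" "\<bar>c i\<bar> \<ge> \<bar>c j\<bar>"
   using l less.prems by (auto simp: i_def j_def)
  define s where "s = (if (c i > 0) = (c j > 0) then 1 else -1 :: int)"
  define c' where "c' = c(i := c i - s * c j)"
  define w' where "w' = w(j := w j + of_int s * w i)"
  have ci: "\<bar>c' i\<bar> < \<bar>c i\<bar>" using ij by (auto simp: c'_def s_def split: if_splits)
  have lt: "(\<Sum>i<d. \<bar>c' i\<bar>) < (\<Sum>i<d. \<bar>c i\<bar>)"
   by (rule sum_strict_mono_ex1) (use ij ci in \<open>auto simp: c'_def intro!: bexI[of _ i]\<close>)
  have ge: "(\<Sum>i<d. \<bar>c' i\<bar>) \<ge> 0" by (simp add: sum_nonneg)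
  have split: "(\<Sum>l<d. f l) = f i + f j + (\<Sum>l\<in>{..<d} - {i,j}. f l)" for f :: "nat \<Rightarrow> complex"
  proof -
   have "(\<Sum>l<d. f l) = f i + (\<Sum>l\<in>{..<d} - {i}. f l)" using ij by (intro sum.remove) auto
   also have "(\<Sum>l\<in>{..<d} - {i}. f l) = f j + (\<Sum>l\<in>{..<d} - {i} - {j}. f l)"
    using ij by (intro sum.remove) auto
   also have "{..<d} - {i} - {j} = {..<d} - {i,j}" by auto
   finally show ?thesis by simp
  qed
  have "(\<Sum>i<d. of_int (c' i) * w' i) = (\<Sum>i<d. of_int (c i) * w i)"
   unfolding split[of "\<lambda>l. of_int (c' l) * w' l"] split[of "\<lambda>l. of_int (c l) * w l"]
   using ij by (simp add: c'_def w'_def algebra_simps)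
  then have 0: "(\<Sum>i<d. of_int (c' i) * w' i) = 0" using less.prems by simp
  have cj: "c' j \<noteq> 0" using ij by (simp add: c'_def)
  have "\<exists>v. zspan (d - 1) v = zspan d w'"
   by (rule less.hyps[OF _ 0 ij(2) cj]) (use lt ge in linarith)
  then show ?thesis using zspan_shear[OF ij(1-3), of w s] by (simp add: w'_def)
 qed
qed

text \<open>Every nontrivial relation saves one generator, so the process stops at independence.
  Torsion cannot obstruct this inside the complex numbers: c * x = 0 with c nonzero forces x =
  0.\<close>

lemma zspan_basis: "\<exists>d' w'. zspan d' w' = zspan d w \<and> zindep d' w'"
proof (induction d arbitrary: w rule: less_induct)
 case (less d)
 show ?case
 proof (cases "zindep d w")
  case False
  then obtain c :: "nat \<Rightarrow> int" and k where c: "(\<Sum>i<d. of_int (c i) * w i) = 0" "k < d" "c k \<noteq> 0"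
   by (auto simp: zindep_def)
  obtain v where "zspan (d - 1) v = zspan d w" using zspan_shorten[OF c] by blast
  then show ?thesis using less.IH[of "d - 1" v] c(2) by auto
 qed auto
qed

definition subring_C :: "complex set \<Rightarrow> bool" where
 "subring_C R \<longleftrightarrow> 1 \<in> R \<and> (\<forall>x\<in>R. \<forall>y\<in>R. x - y \<in> R \<and> x * y \<in> R)"

text \<open>Generators may be dependent, so that an order is recognized without exhibiting a basis;
  \<open>is_order_iff\<close> supplies one.\<close>

definition is_order :: "complex set \<Rightarrow> bool" where
 "is_order R \<longleftrightarrow> subring_C R \<and> (\<exists>d w. R = zspan d w)"

lemma ringC:
 assumes "subring_C R"
 shows "0 \<in> R" "1 \<in> R" "x \<in> R \<Longrightarrow> - x \<in> R" "x \<in> R \<Longrightarrow> y \<in> R \<Longrightarrow> x + y \<in> R"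
  "x \<in> R \<Longrightarrow> y \<in> R \<Longrightarrow> x - y \<in> R" "x \<in> R \<Longrightarrow> y \<in> R \<Longrightarrow> x * y \<in> R"
  "x \<in> R \<Longrightarrow> x ^ n \<in> R" "of_nat n \<in> R" "of_int k \<in> R" "numeral m \<in> R"
  "(\<And>i. i \<in> I \<Longrightarrow> f i \<in> R) \<Longrightarrow> (\<Sum>i\<in>I. f i) \<in> R"
  "(\<And>i. i \<in> I \<Longrightarrow> f i \<in> R) \<Longrightarrow> (\<Prod>i\<in>I. f i) \<in> R"
proof -
 note d = assms[unfolded subring_C_def]
 show 1: "1 \<in> R" using d by blast
 show 0: "0 \<in> R" using d 1 by (metis cancel_comm_monoid_add_class.diff_cancel)
 show m: "\<And>x. x \<in> R \<Longrightarrow> - x \<in> R" using d 0 by (metis diff_0)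
 show a: "\<And>x y. x \<in> R \<Longrightarrow> y \<in> R \<Longrightarrow> x + y \<in> R" using d m by (metis diff_minus_eq_add)
 show "x \<in> R \<Longrightarrow> y \<in> R \<Longrightarrow> x - y \<in> R" using d by blast
 show t: "\<And>x y. x \<in> R \<Longrightarrow> y \<in> R \<Longrightarrow> x * y \<in> R" using d by blast
 show "x \<in> R \<Longrightarrow> x ^ n \<in> R" by (induction n) (auto simp: 1 t)
 show n: "of_nat n \<in> R" for n by (induction n) (auto simp: 0 1 a)
 show "of_int k \<in> R" by (cases k rule: int_cases2) (auto simp: n m)
 show "numeral m \<in> R" using n[of "numeral m"] by simp
 show "(\<And>i. i \<in> I \<Longrightarrow> f i \<in> R) \<Longrightarrow> (\<Sum>i\<in>I. f i) \<in> R"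
  by (induction I rule: infinite_finite_induct) (auto simp: 0 a)
 show "(\<And>i. i \<in> I \<Longrightarrow> f i \<in> R) \<Longrightarrow> (\<Prod>i\<in>I. f i) \<in> R"
  by (induction I rule: infinite_finite_induct) (auto simp: 1 t)
qed

section \<open>An order with a fixed basis: coordinates and height\<close>

locale num_order =
 fixes R :: "complex set" and d :: nat and w :: "nat \<Rightarrow> complex"
 assumes sub: "subring_C R" and R_eq: "R = zspan d w" and indep: "zindep d w"
begin

lemmas R_ring = ringC[OF sub]

lemma d_pos: "d > 0"
proof (rule ccontr)
 assume "\<not> d > 0"
 then have "R = {0}" by (auto simp: R_eq zspan_def)
 then show False using R_ring(2) by simp
qed

text \<open>The field of fractions of R: integers suffice as denominators because every nonzero
  principal ideal contains a positive integer. This needs the index bound for principal ideals, so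
  inverses are obtained only in \<open>K_subfield\<close>.\<close>

definition K :: "complex set" where "K = {x. \<exists>n>0. of_nat n * x \<in> R}"

lemma R_sub_K: "x \<in> R \<Longrightarrow> x \<in> K" by (auto simp: K_def intro!: exI[of _ 1])

definition comb :: "(nat \<Rightarrow> rat) \<Rightarrow> complex" where "comb c = (\<Sum>i<d. of_rat (c i) * w i)"

lemma comb_diff: "comb (\<lambda>i. c i - e i) = comb c - comb e"
 by (simp add: comb_def of_rat_diff sum_subtractf algebra_simps)

lemma comb_add: "comb (\<lambda>i. c i + e i) = comb c + comb e"
 by (simp add: comb_def of_rat_add sum.distrib algebra_simps)

lemma comb_scale: "comb (\<lambda>i. r * c i) = of_rat r * comb c"
 by (simp add: comb_def of_rat_mult sum_distrib_left algebra_simps)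

lemma common_denom: "\<exists>N>0::nat. \<forall>i<(e::nat). \<exists>k::int. of_nat N * (c i :: rat) = of_int k"
proof (induction e)
 case 0 then show ?case by (auto intro: exI[of _ 1])
next
 case (Suc e)
 then obtain N where N: "N > 0" "\<forall>i<e. \<exists>k::int. of_nat N * c i = of_int k" by blast
 obtain a b where ab: "quotient_of (c e) = (a, b)" by fastforce
 then have b: "b > 0" "c e = of_int a / of_int b"
  using quotient_of_denom_pos quotient_of_div by blast+
 have "\<exists>k::int. of_nat (N * nat b) * c i = of_int k" if "i < Suc e" for i
 proof (cases "i = e")
  case True
  then show ?thesis using b by (intro exI[of _ "int N * a"]) simp
 next
  case False
  then have "i < e" using that by simp
  then obtain k :: int where k: "of_nat N * c i = of_int k" using N(2) by blast
  have "of_nat (N * nat b) * c i = of_int b * (of_nat N * c i)" using b by simp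
  then show ?thesis unfolding k by (intro exI[of _ "b * k"]) simp
 qed
 then show ?case using N b by (intro exI[of _ "N * nat b"]) auto
qed

lemma comb_K: "comb c \<in> K"
proof -
 obtain N :: nat where N: "N > 0" "\<forall>i<d. \<exists>k::int. of_nat N * c i = of_int k"
  using common_denom by blast
 then obtain k :: "nat \<Rightarrow> int" where k: "\<And>i. i < d \<Longrightarrow> of_nat N * c i = of_int (k i)" by metis
 have "of_nat N * comb c = comb (\<lambda>i. of_nat N * c i)" using comb_scale[of "of_nat N" c] by simp
 also have "\<dots> = (\<Sum>i<d. of_int (k i) * w i)" using k by (auto simp: comb_def intro!: sum.cong)
 finally have "of_nat N * comb c \<in> R" unfolding R_eq by (rule zspanI)
 then show ?thesis using N(1) unfolding K_def by blast
qed

lemma comb_eq_0: assumes "comb c = 0" "i < d" shows "c i = 0"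
proof -
 obtain N :: nat where N: "N > 0" "\<forall>i<d. \<exists>k::int. of_nat N * c i = of_int k"
  using common_denom by blast
 then obtain k :: "nat \<Rightarrow> int" where k: "\<And>i. i < d \<Longrightarrow> of_nat N * c i = of_int (k i)" by metis
 have "of_nat N * comb c = comb (\<lambda>i. of_nat N * c i)" using comb_scale[of "of_nat N" c] by simp
 also have "\<dots> = (\<Sum>i<d. of_int (k i) * w i)" using k by (auto simp: comb_def intro!: sum.cong)
 finally have "k i = 0" using indep assms by (simp add: zindep_def)
 then show ?thesis using k[OF assms(2)] N(1) by simp
qed

lemma K_comb: assumes "x \<in> K" shows "\<exists>c. x = comb c"
proof -
 obtain n where n: "n > 0" "of_nat n * x \<in> R" using assms by (auto simp: K_def)
 then obtain k :: "nat \<Rightarrow> int" where k: "of_nat n * x = (\<Sum>i<d. of_int (k i) * w i)"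
  by (auto simp: R_eq elim: zspanE)
 have "comb (\<lambda>i. inverse (of_nat n) * of_int (k i)) = inverse (of_nat n) * (\<Sum>i<d. of_int (k i) * w i)"
  unfolding comb_scale by (simp add: comb_def of_rat_inverse)
 also have "\<dots> = x" using n k[symmetric] by simp
 finally show ?thesis by metis
qed

text \<open>Coordinates beyond the basis are pinned to 0, so that additivity and homogeneity hold
  for every index.\<close>

definition co :: "complex \<Rightarrow> nat \<Rightarrow> rat" where
 "co x = (SOME c. x = comb c \<and> (\<forall>i\<ge>d. c i = 0))"

lemma comb_cong: "(\<And>i. i < d \<Longrightarrow> c i = e i) \<Longrightarrow> comb c = comb e" by (simp add: comb_def)

lemma co_props: assumes "x \<in> K" shows "x = comb (co x)" "i \<ge> d \<Longrightarrow> co x i = 0"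
proof -
 obtain c where "x = comb c" using K_comb assms by blast
 then have "x = comb (\<lambda>i. if i < d then c i else 0) \<and> (\<forall>i\<ge>d. (if i < d then c i else 0) = 0)"
  by (auto simp: comb_def)
 then have "x = comb (co x) \<and> (\<forall>i\<ge>d. co x i = 0)" 
  unfolding co_def by (rule someI[where P = "\<lambda>c. x = comb c \<and> (\<forall>i\<ge>d. c i = 0)"])
 then show "x = comb (co x)" "i \<ge> d \<Longrightarrow> co x i = 0" by auto
qed

lemma comb_inj: "comb c = comb e \<Longrightarrow> i < d \<Longrightarrow> c i = e i"
 using comb_eq_0[of "\<lambda>i. c i - e i" i] by (simp add: comb_diff)

lemma co_comb: "i < d \<Longrightarrow> co (comb c) i = c i"
 using co_props(1)[OF comb_K[of c]] comb_inj by metis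

lemma co_add: assumes "x \<in> K" "y \<in> K" shows "co (x + y) i = co x i + co y i"
proof (cases "i < d")
 case True
 have "x + y = comb (\<lambda>i. co x i + co y i)" using assms co_props(1) comb_add by simp
 then show ?thesis using co_comb[OF True, of "\<lambda>i. co x i + co y i"] by simp
next
 case False
 have "x + y = comb (\<lambda>i. co x i + co y i)" using assms co_props(1) comb_add by simp
 then have "x + y \<in> K" using comb_K by simp
 then show ?thesis using co_props(2)[OF \<open>x + y \<in> K\<close>, of i] co_props(2)[of x i] co_props(2)[of y i] assms False by simp
qed

lemma K_scale: "x \<in> K \<Longrightarrow> of_rat r * x \<in> K"
 using co_props(1)[of x] comb_scale[of r "co x"] comb_K by metis

lemma co_scale: assumes "x \<in> K" shows "co (of_rat r * x) i = r * co x i"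
proof -
 have *: "of_rat r * x = comb (\<lambda>i. r * co x i)" using assms co_props(1) comb_scale by simp
 show ?thesis
 proof (cases "i < d")
  case True
  then show ?thesis using * co_comb[OF True, of "\<lambda>i. r * co x i"] by simp
 next
  case False
  then show ?thesis using co_props(2)[OF K_scale[OF assms, of r], of i] co_props(2)[OF assms, of i] by simp
 qed
qed

lemma K_0: "0 \<in> K" and K_1: "1 \<in> K" using R_sub_K R_ring by auto

lemma K_add: "x \<in> K \<Longrightarrow> y \<in> K \<Longrightarrow> x + y \<in> K"
 using co_props(1)[of x] co_props(1)[of y] comb_add[of "co x" "co y"] comb_K by metis

lemma K_minus: "x \<in> K \<Longrightarrow> - x \<in> K" using K_scale[of x "-1"] by simp

lemma K_diff: "x \<in> K \<Longrightarrow> y \<in> K \<Longrightarrow> x - y \<in> K" using K_add[of x "-y"] K_minus by simp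

lemma K_mult: assumes "x \<in> K" "y \<in> K" shows "x * y \<in> K"
proof -
 obtain m n where "m > 0" "n > 0" "of_nat m * x \<in> R" "of_nat n * y \<in> R"
  using assms by (auto simp: K_def)
 then have "of_nat (m * n) * (x * y) \<in> R" "m * n > 0"
  using R_ring(6)[of "of_nat m * x" "of_nat n * y"] by (auto simp: mult_ac)
 then show ?thesis unfolding K_def by blast
qed

lemma K_power: "x \<in> K \<Longrightarrow> x ^ n \<in> K" by (induction n) (auto simp: K_1 K_mult)

lemma co_diff: assumes "x \<in> K" "y \<in> K" shows "co (x - y) i = co x i - co y i"
 using co_add[of x "- y" i] co_scale[of y "-1" i] K_minus[of y] assms by simp

lemma R_iff_co: assumes "x \<in> K" shows "x \<in> R \<longleftrightarrow> (\<forall>i<d. co x i \<in> \<int>)"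
proof
 assume "x \<in> R"
 then obtain c :: "nat \<Rightarrow> int" where "x = (\<Sum>i<d. of_int (c i) * w i)" by (auto simp: R_eq elim: zspanE)
 then have "x = comb (\<lambda>i. of_int (c i))" by (simp add: comb_def)
 then show "\<forall>i<d. co x i \<in> \<int>" using co_comb by simp
next
 assume "\<forall>i<d. co x i \<in> \<int>"
 then have "\<forall>i<d. \<exists>k::int. co x i = of_int k" by (metis Ints_cases)
 then obtain c :: "nat \<Rightarrow> int" where c: "\<And>i. i < d \<Longrightarrow> co x i = of_int (c i)" by metis
 have "x = (\<Sum>i<d. of_int (c i) * w i)" using co_props(1)[OF assms] c by (simp add: comb_def)
 then show "x \<in> R" by (auto simp: R_eq zspan_def)
qed

text \<open>The maximum norm in the chosen basis. It stands in for the archimedean absolute values: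
  submultiplicative up to the constant \<open>C1\<close>, and at least 1 on nonzero elements of
  R.\<close>

definition nm :: "complex \<Rightarrow> rat" where "nm x = Max ((\<lambda>i. \<bar>co x i\<bar>) ` {..<d})"

lemma nm_ge: "i < d \<Longrightarrow> \<bar>co x i\<bar> \<le> nm x" unfolding nm_def by (intro Max_ge) auto

lemma nm_le_iff: "nm x \<le> B \<longleftrightarrow> (\<forall>i<d. \<bar>co x i\<bar> \<le> B)"
 unfolding nm_def using d_pos by (subst Max_le_iff) auto

lemma nm_attained: "\<exists>i<d. \<bar>co x i\<bar> = nm x"
proof -
 have "nm x \<in> (\<lambda>i. \<bar>co x i\<bar>) ` {..<d}" unfolding nm_def using d_pos by (intro Max_in) auto
 then show ?thesis by auto
qed

lemma nm_nonneg: "nm x \<ge> 0" using nm_attained[of x] by (metis abs_ge_zero)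

lemma nm_eq_0: assumes "x \<in> K" "nm x = 0" shows "x = 0"
proof -
 have "co x i = 0" if "i < d" for i using nm_ge[OF that, of x] assms by simp
 then show ?thesis using co_props(1)[OF assms(1)] by (simp add: comb_def)
qed

lemma nm_add: "x \<in> K \<Longrightarrow> y \<in> K \<Longrightarrow> nm (x + y) \<le> nm x + nm y"
 unfolding nm_le_iff using nm_ge[of _ x] nm_ge[of _ y] by (auto simp: co_add intro!: order_trans[OF abs_triangle_ineq] add_mono)

lemma nm_scale: assumes "x \<in> K" shows "nm (of_rat r * x) = \<bar>r\<bar> * nm x"
proof (rule antisym)
 show "nm (of_rat r * x) \<le> \<bar>r\<bar> * nm x"
  unfolding nm_le_iff using nm_ge[of _ x] by (auto simp: co_scale[OF assms] abs_mult intro!: mult_left_mono)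
 obtain i where "i < d" "\<bar>co x i\<bar> = nm x" using nm_attained by blast
 then show "\<bar>r\<bar> * nm x \<le> nm (of_rat r * x)" using nm_ge[of i "of_rat r * x"] by (simp add: co_scale[OF assms] abs_mult)
qed

lemma nm_minus: "x \<in> K \<Longrightarrow> nm (- x) = nm x" using nm_scale[of x "-1"] by simp

lemma nm_diff: "x \<in> K \<Longrightarrow> y \<in> K \<Longrightarrow> nm (x - y) \<le> nm x + nm y"
 using nm_add[of x "-y"] nm_minus[of y] K_minus[of y] by simp

lemma nm_sum: "(\<And>i. i \<in> I \<Longrightarrow> f i \<in> K) \<Longrightarrow> (\<Sum>i\<in>I. f i) \<in> K \<and> nm (\<Sum>i\<in>I. f i) \<le> (\<Sum>i\<in>I. nm (f i))"
proof (induction I rule: infinite_finite_induct)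
 case (insert a I)
 then show ?case using nm_add[of "f a" "sum f I"] by (auto simp: K_add)
next
 case empty
 have "nm 0 \<le> 0" unfolding nm_le_iff using co_scale[OF K_1, of 0] by simp
 then show ?case by (simp add: K_0)
next
 case (infinite I)
 have "nm 0 \<le> 0" unfolding nm_le_iff using co_scale[OF K_1, of 0] by simp
 then show ?case using infinite by (simp add: K_0)
qed

lemma w_R: "i < d \<Longrightarrow> w i \<in> R" by (simp add: R_eq zspan_base)

text \<open>Total height of the structure constants of the basis; the summand 1 makes the constant
  at least 1.\<close>

definition C1 :: rat where "C1 = 1 + (\<Sum>i<d. \<Sum>j<d. nm (w i * w j))"

lemma C1_ge1: "C1 \<ge> 1" unfolding C1_def by (simp add: sum_nonneg nm_nonneg)

lemma nm_mult: assumes "x \<in> K" "y \<in> K" shows "nm (x * y) \<le> C1 * nm x * nm y"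
proof -
 have wK: "w i * w j \<in> K" if "i < d" "j < d" for i j using that by (intro K_mult R_sub_K w_R)
 have "x * y = (\<Sum>i<d. \<Sum>j<d. of_rat (co x i * co y j) * (w i * w j))" (is "_ = ?S")
 proof -
  have "comb (co x) * comb (co y) = ?S"
   by (simp add: comb_def sum_product of_rat_mult mult_ac)
  then show ?thesis using co_props(1)[OF assms(1)] co_props(1)[OF assms(2)] by metis
 qed
 also have "nm ?S \<le> (\<Sum>i<d. \<Sum>j<d. nm (of_rat (co x i * co y j) * (w i * w j)))"
 proof -
  have in2: "(\<Sum>j<d. of_rat (co x i * co y j) * (w i * w j)) \<in> K \<and>
    nm (\<Sum>j<d. of_rat (co x i * co y j) * (w i * w j)) \<le> (\<Sum>j<d. nm (of_rat (co x i * co y j) * (w i * w j)))"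
   if "i < d" for i using that by (intro nm_sum K_scale wK) auto
  have "nm ?S \<le> (\<Sum>i<d. nm (\<Sum>j<d. of_rat (co x i * co y j) * (w i * w j)))"
   using nm_sum[of "{..<d}" "\<lambda>i. \<Sum>j<d. of_rat (co x i * co y j) * (w i * w j)"] in2 by auto
  also have "\<dots> \<le> (\<Sum>i<d. \<Sum>j<d. nm (of_rat (co x i * co y j) * (w i * w j)))"
   using in2 by (intro sum_mono) auto
  finally show ?thesis .
 qed
 also have "\<dots> \<le> (\<Sum>i<d. \<Sum>j<d. (nm x * nm y) * nm (w i * w j))"
  using nm_ge[of _ x] nm_ge[of _ y] nm_nonneg
  by (intro sum_mono) (auto simp: nm_scale[OF wK] abs_mult intro!: mult_right_mono mult_mono)
 also have "\<dots> = (nm x * nm y) * (C1 - 1)" by (simp add: C1_def sum_distrib_left)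
 also have "\<dots> \<le> (nm x * nm y) * C1" using nm_nonneg by (intro mult_left_mono) auto
 finally show ?thesis by (simp add: mult_ac)
qed

lemma nm_R_Ints: assumes "x \<in> R" shows "nm x \<in> \<int>"
proof -
 obtain i where "i < d" "\<bar>co x i\<bar> = nm x" using nm_attained by blast
 moreover have "co x i \<in> \<int>" if "i < d" for i using R_iff_co[OF R_sub_K[OF assms]] assms that by simp
 ultimately show ?thesis using Ints_abs by metis
qed

lemma nm_R_ge1: assumes "x \<in> R" "x \<noteq> 0" shows "nm x \<ge> 1"
proof -
 have "nm x \<noteq> 0" using nm_eq_0[OF R_sub_K[OF assms(1)]] assms(2) by blast
 then show ?thesis using Ints_nonzero_abs_ge1[OF nm_R_Ints[OF assms(1)]] nm_nonneg[of x] by simp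
qed

definition Box :: "nat \<Rightarrow> complex set" where "Box B = {x \<in> R. nm x \<le> of_nat B}"

lemma Box_eq: "Box B = (\<lambda>c. comb (\<lambda>i. of_int (c i))) ` (Pi\<^sub>E {..<d} (\<lambda>_. {- int B..int B}))"
proof (intro equalityI subsetI)
 fix x assume x: "x \<in> Box B"
 then have xR: "x \<in> R" and xK: "x \<in> K" by (auto simp: Box_def R_sub_K)
 have "\<forall>i<d. \<exists>k::int. co x i = of_int k" using R_iff_co[OF xK] xR by (metis Ints_cases)
 then obtain c :: "nat \<Rightarrow> int" where c: "\<And>i. i < d \<Longrightarrow> co x i = of_int (c i)" by metis
 have b: "\<bar>c i\<bar> \<le> int B" if "i < d" for i
 proof -
  have "\<bar>co x i\<bar> \<le> of_nat B" using nm_ge[OF that, of x] x by (auto simp: Box_def)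
  then have "of_int \<bar>c i\<bar> \<le> (of_int (int B) :: rat)" using c[OF that] by simp
  then show ?thesis by (simp only: of_int_le_iff)
 qed
 let ?c = "restrict c {..<d}"
 have "x = comb (\<lambda>i. of_int (?c i))" using co_props(1)[OF xK] c by (simp add: comb_def)
 moreover have "?c \<in> Pi\<^sub>E {..<d} (\<lambda>_. {- int B..int B})"
 proof (rule PiE_I)
  fix i assume "i \<in> {..<d}"
  then show "?c i \<in> {- int B..int B}" using b[of i] by (simp add: abs_le_iff)
 qed simp
 ultimately show "x \<in> (\<lambda>c. comb (\<lambda>i. of_int (c i))) ` (Pi\<^sub>E {..<d} (\<lambda>_. {- int B..int B}))" by blast
next
 fix x assume "x \<in> (\<lambda>c. comb (\<lambda>i. of_int (c i))) ` (Pi\<^sub>E {..<d} (\<lambda>_. {- int B..int B}))"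
 then obtain c where c: "c \<in> Pi\<^sub>E {..<d} (\<lambda>_. {- int B..int B})" "x = comb (\<lambda>i. of_int (c i))" by blast
 have "x \<in> R" unfolding R_iff_co[OF comb_K[of "\<lambda>i. of_int (c i)", folded c(2)]] using c(2) co_comb by simp
 moreover have "nm x \<le> of_nat B"
  unfolding nm_le_iff
 proof (intro allI impI)
  fix i assume i: "i < d"
  then have "c i \<in> {- int B..int B}" using c(1) by (intro PiE_mem[OF c(1)]) simp
  then have "\<bar>c i\<bar> \<le> int B" unfolding atLeastAtMost_iff by linarith
  then have "of_int \<bar>c i\<bar> \<le> (of_int (int B) :: rat)" by (simp only: of_int_le_iff)
  then show "\<bar>co x i\<bar> \<le> of_nat B" using i c(2) co_comb by simp
 qed
 ultimately show "x \<in> Box B" by (simp add: Box_def)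
qed

lemma card_Box: "card (Box B) = (2 * B + 1) ^ d" and finite_Box: "finite (Box B)"
proof -
 have inj: "inj_on (\<lambda>c. comb (\<lambda>i. of_int (c i))) (Pi\<^sub>E {..<d} (\<lambda>_. {- int B..int B}))"
 proof (rule inj_onI)
  fix c e assume ce: "c \<in> Pi\<^sub>E {..<d} (\<lambda>_. {- int B..int B})" "e \<in> Pi\<^sub>E {..<d} (\<lambda>_. {- int B..int B})"
   "comb (\<lambda>i. of_int (c i)) = comb (\<lambda>i. of_int (e i))"
  have "c i = e i" if "i < d" for i using comb_inj[OF ce(3) that] by simp
  then show "c = e" using ce(1,2) by (intro PiE_ext[of c "{..<d}"]) auto
 qed
 show "finite (Box B)" unfolding Box_eq by (intro finite_imageI finite_PiE) auto
 have "card {- int B..int B} = 2 * B + 1" by simp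
 then show "card (Box B) = (2 * B + 1) ^ d"
  unfolding Box_eq by (subst card_image[OF inj]) (simp add: card_PiE)
qed

end

lemma is_order_iff: "is_order R \<longleftrightarrow> (\<exists>d w. num_order R d w)"
proof
 assume R: "is_order R"
 then obtain d w where "R = zspan d w" by (auto simp: is_order_def)
 moreover obtain d' w' where "zspan d' w' = zspan d w" "zindep d' w'" using zspan_basis by blast
 ultimately have "num_order R d' w'" using R by (simp add: is_order_def num_order_def)
 then show "\<exists>d w. num_order R d w" by blast
next
 assume "\<exists>d w. num_order R d w"
 then show "is_order R" by (auto simp: is_order_def num_order_def)
qed

section \<open>Counting ideals\<close>

text \<open>I has index at most n in S; ideals and orders are mere sets of complex numbers here.\<close>
definition idxle :: "complex set \<Rightarrow> complex set \<Rightarrow> nat \<Rightarrow> bool" where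
 "idxle S I n \<longleftrightarrow> (\<exists>f::complex \<Rightarrow> nat. (\<forall>x\<in>S. f x < n) \<and> (\<forall>x\<in>S. \<forall>y\<in>S. f x = f y \<longrightarrow> x - y \<in> I))"

definition ideal_C :: "complex set \<Rightarrow> complex set \<Rightarrow> bool" where
 "ideal_C I S \<longleftrightarrow> 0 \<in> I \<and> I \<subseteq> S \<and> (\<forall>x\<in>I. \<forall>y\<in>I. x - y \<in> I) \<and> (\<forall>s\<in>S. \<forall>x\<in>I. s * x \<in> I)"

lemma idxle_mono: "idxle S I n \<Longrightarrow> n \<le> m \<Longrightarrow> idxle S I m"
 unfolding idxle_def by (meson order_less_le_trans)

text \<open>The map g admits pigeons that are not elements of S, such as multipliers j standing for
  j x, or pairs (t, j) standing for t + j x.\<close>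

lemma idxle_pigeonhole:
 assumes "idxle S I n" "finite T" "card T > n" "g ` T \<subseteq> S"
 obtains x y where "x \<in> T" "y \<in> T" "x \<noteq> y" "g x - g y \<in> I"
proof -
 obtain f :: "complex \<Rightarrow> nat" where f: "\<forall>x\<in>S. f x < n" "\<forall>x\<in>S. \<forall>y\<in>S. f x = f y \<longrightarrow> x - y \<in> I"
  using assms(1) by (auto simp: idxle_def)
 have "(\<lambda>x. f (g x)) ` T \<subseteq> {..<n}" using f(1) assms(4) by auto
 then have "card ((\<lambda>x. f (g x)) ` T) \<le> n" using card_mono[of "{..<n}"] by fastforce
 then have "\<not> inj_on (\<lambda>x. f (g x)) T" using assms(3) pigeonhole by (metis le_less_trans)
 then obtain x y where "x \<in> T" "y \<in> T" "x \<noteq> y" "f (g x) = f (g y)" by (auto simp: inj_on_def)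
 then show ?thesis using f(2) assms(4) that by blast
qed

text \<open>A largest set of pairwise incongruent elements meets every class; numbering its members
  numbers the classes.\<close>

lemma idxle_of_bound:
 assumes "0 \<in> I" "\<forall>x\<in>I. \<forall>y\<in>I. x - y \<in> I"
  and bound: "\<And>T. finite T \<Longrightarrow> T \<subseteq> S \<Longrightarrow> (\<forall>x\<in>T. \<forall>y\<in>T. x - y \<in> I \<longrightarrow> x = y) \<Longrightarrow> card T \<le> n"
 shows "idxle S I n"
proof -
 define P where "P T \<longleftrightarrow> finite T \<and> T \<subseteq> S \<and> (\<forall>x\<in>T. \<forall>y\<in>T. x - y \<in> I \<longrightarrow> x = y)" for T
 have "P {}" by (simp add: P_def)
 moreover have "\<forall>T. P T \<longrightarrow> card T < Suc n" using bound by (auto simp: P_def less_Suc_eq_le)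
 ultimately obtain T where T: "P T" "\<And>T'. P T' \<Longrightarrow> card T' \<le> card T"
  using ex_has_greatest_nat[of P "{}" card "Suc n"] by metis
 have neg: "- x \<in> I" if "x \<in> I" for x using assms(1,2) that by (metis diff_0)
 have cover: "\<exists>t\<in>T. x - t \<in> I" if x: "x \<in> S" for x
 proof (rule ccontr)
  assume no: "\<not> (\<exists>t\<in>T. x - t \<in> I)"
  then have "x \<notin> T" using assms(1) by auto
  moreover have "t - x \<notin> I" if "t \<in> T" for t using no that neg[of "t - x"] by auto
  then have "P (insert x T)" using T(1) x no by (auto simp: P_def)
  ultimately show False using T(2)[of "insert x T"] T(1) by (simp add: P_def)
 qed
 then obtain r where r: "\<And>x. x \<in> S \<Longrightarrow> r x \<in> T \<and> x - r x \<in> I" by metis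
 have "finite T" using T(1) by (simp add: P_def)
 then obtain e where e: "bij_betw e T {0..<card T}" using ex_bij_betw_finite_nat by blast
 have "card T \<le> n" using bound T(1) by (auto simp: P_def)
 show ?thesis unfolding idxle_def
 proof (intro exI[of _ "\<lambda>x. e (r x)"] conjI ballI impI)
  fix x assume "x \<in> S"
  then have "e (r x) \<in> {0..<card T}" using r e bij_betwE by blast
  then show "e (r x) < n" using \<open>card T \<le> n\<close> by simp
 next
  fix x y assume xy: "x \<in> S" "y \<in> S" "e (r x) = e (r y)"
  then have "r x = r y" using r inj_onD[OF bij_betw_imp_inj_on[OF e]] by blast
  then have "x - y = (x - r x) - (y - r y)" by simp
  then show "x - y \<in> I" using r xy assms(2) by metis
 qed
qed

definition idx :: "complex set \<Rightarrow> complex set \<Rightarrow> nat" where "idx S I = (LEAST n. idxle S I n)"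

lemma idxle_idx: "idxle S I n \<Longrightarrow> idxle S I (idx S I)"
 unfolding idx_def by (rule LeastI)

lemma idx_le: "idxle S I n \<Longrightarrow> idx S I \<le> n"
 unfolding idx_def by (rule Least_le)

lemma idx_pos: "idxle S I n \<Longrightarrow> S \<noteq> {} \<Longrightarrow> idx S I > 0"
 using idxle_idx[of S I n] by (auto simp: idxle_def intro: gr0I)

text \<open>Minimality of \<open>idx\<close> rules out that all incongruent sets are smaller, by
  \<open>idxle_of_bound\<close>.\<close>

lemma idx_reps:
 assumes "idxle S I n" "0 \<in> I" "\<forall>x\<in>I. \<forall>y\<in>I. x - y \<in> I"
 obtains T where "finite T" "T \<subseteq> S" "\<And>x y. x \<in> T \<Longrightarrow> y \<in> T \<Longrightarrow> x - y \<in> I \<Longrightarrow> x = y" "card T \<ge> idx S I"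
proof (cases "idx S I = 0")
 case True
 then show ?thesis using that[of "{}"] by simp
next
 case False
 have "\<not> idxle S I (idx S I - 1)" using idx_le[of S I "idx S I - 1"] False by auto
 then obtain T where "finite T" "T \<subseteq> S" "\<forall>x\<in>T. \<forall>y\<in>T. x - y \<in> I \<longrightarrow> x = y" "\<not> card T \<le> idx S I - 1"
  using idxle_of_bound[OF assms(2,3)] by metis
 then show ?thesis using that[of T] by auto
qed

text \<open>Two of the n + 1 elements 0, x, ..., n x are congruent, and their difference is a
  multiple of x.\<close>

lemma idxle_multiple:
 assumes "idxle S I n" "subring_C S" "x \<in> S" "\<forall>s\<in>S. \<forall>x\<in>I. s * x \<in> I"
 obtains j where "1 \<le> j" "j \<le> n" "of_nat j * x \<in> I"
proof -
 obtain i j where ij: "i \<in> {0..n}" "j \<in> {0..n}" "i \<noteq> j" "of_nat i * x - of_nat j * x \<in> I"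
 proof -
  have "(\<lambda>j. of_nat j * x) ` {0..n} \<subseteq> S"
   using ringC(6)[OF assms(2) ringC(8)[OF assms(2)] assms(3)] by auto
  then show ?thesis
   using idxle_pigeonhole[OF assms(1), of "{0..n}" "\<lambda>j. of_nat j * x"] that by auto
 qed
 have "- 1 \<in> S" using ringC(3)[OF assms(2) ringC(2)[OF assms(2)]] .
 then have "(- 1) * y \<in> I" if "y \<in> I" for y using assms(4) that by blast
 then have neg: "- y \<in> I" if "y \<in> I" for y using that by simp
 consider "i < j" | "j < i" using ij(3) by linarith
 then show ?thesis
 proof cases
  case 1
  have "of_nat (j - i) * x = - (of_nat i * x - of_nat j * x)" using 1 by (simp add: of_nat_diff left_diff_distrib)
  then have "of_nat (j - i) * x \<in> I" using neg[OF ij(4)] by simp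
  then show ?thesis by (rule that[rotated 2]) (use 1 ij(1,2) in auto)
 next
  case 2
  then have "of_nat (i - j) * x \<in> I" using ij(4) by (simp add: of_nat_diff left_diff_distrib)
  then show ?thesis by (rule that[rotated 2]) (use 2 ij(1,2) in auto)
 qed
qed

section \<open>Lattice points and the index of ideals\<close>

context num_order
begin

text \<open>An integral form of \<open>C1\<close>, so that products of elements of boxes lie in
  boxes of integral size.\<close>

definition Cn :: nat where "Cn = nat \<lceil>C1\<rceil>"

lemma Cn: "C1 \<le> of_nat Cn" "Cn \<ge> 1"
proof -
 have "of_nat (nat \<lceil>C1\<rceil>) = (of_int \<lceil>C1\<rceil> :: rat)" using C1_ge1 by simp
 then show "C1 \<le> of_nat Cn" unfolding Cn_def using le_of_int_ceiling[of C1] by simp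
 have "1 \<le> \<lceil>C1\<rceil>" using C1_ge1 by linarith
 then show "Cn \<ge> 1" unfolding Cn_def by linarith
qed

lemma nm_mult': assumes "x \<in> K" "y \<in> K" shows "nm (x * y) \<le> of_nat Cn * nm x * nm y"
proof -
 have "nm (x * y) \<le> C1 * (nm x * nm y)" using nm_mult[OF assms] by (simp add: mult_ac)
 also have "\<dots> \<le> of_nat Cn * (nm x * nm y)" using Cn nm_nonneg by (intro mult_right_mono) auto
 finally show ?thesis by (simp add: mult_ac)
qed

lemma nm_of_nat_mult: "x \<in> K \<Longrightarrow> nm (of_nat k * x) = of_nat k * nm x"
 using nm_scale[of x "of_nat k"] by simp

lemma Box_mono: "a \<le> b \<Longrightarrow> Box a \<subseteq> Box b"
proof
 fix x assume "a \<le> b" "x \<in> Box a"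
 then have "nm x \<le> of_nat a" "(of_nat a :: rat) \<le> of_nat b" "x \<in> R" by (simp_all add: Box_def)
 then show "x \<in> Box b" unfolding Box_def using order_trans by blast
qed

lemma Box_R: "x \<in> Box B \<Longrightarrow> x \<in> R" by (simp add: Box_def)

lemma R_in_Box: assumes "x \<in> R" obtains B where "x \<in> Box B"
proof -
 have "nm x \<le> of_nat (nat \<lceil>nm x\<rceil>)" by (rule of_nat_ceiling)
 then show ?thesis using that assms by (auto simp: Box_def)
qed

lemma Box_mult: assumes "x \<in> Box a" "y \<in> Box b" shows "x * y \<in> Box (Cn * a * b)"
proof -
 have xy: "x \<in> R" "y \<in> R" "nm x \<le> of_nat a" "nm y \<le> of_nat b" using assms by (auto simp: Box_def)
 have "nm (x * y) \<le> of_nat Cn * nm x * nm y" using nm_mult' xy R_sub_K by simp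
 also have "\<dots> \<le> of_nat Cn * of_nat a * of_nat b" using xy nm_nonneg by (intro mult_mono mult_nonneg_nonneg) auto
 finally show ?thesis using xy R_ring by (simp add: Box_def)
qed

lemma Box_add: assumes "x \<in> Box a" "y \<in> Box b" shows "x + y \<in> Box (a + b)"
 using assms nm_add[of x y] R_sub_K R_ring by (auto simp: Box_def)

lemma finite_R_in_Box: assumes "finite T" "T \<subseteq> R" obtains B where "T \<subseteq> Box B"
proof -
 have "\<exists>B. T \<subseteq> Box B" using assms
 proof (induction T rule: finite_induct)
  case (insert x T)
  then obtain B where "T \<subseteq> Box B" by auto
  moreover obtain B' where "x \<in> Box B'" using R_in_Box insert.prems by blast
  ultimately have "insert x T \<subseteq> Box (max B B')" using Box_mono[of B "max B B'"] Box_mono[of B' "max B B'"] by auto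
  then show ?case by blast
 qed auto
 then show ?thesis using that by blast
qed

definition princ :: "complex \<Rightarrow> complex set" where "princ s = (\<lambda>x. s * x) ` R"

lemma princ_ideal: "s \<in> R \<Longrightarrow> ideal_C (princ s) R"
 unfolding ideal_C_def
proof (intro conjI ballI subsetI)
 assume s: "s \<in> R"
 show "0 \<in> princ s" using R_ring(1) by (force simp: princ_def)
 show "x \<in> R" if "x \<in> princ s" for x using that s R_ring(6) by (auto simp: princ_def)
 show "x - y \<in> princ s" if x: "x \<in> princ s" and y: "y \<in> princ s" for x y
 proof -
  obtain a where a: "x = s * a" "a \<in> R" using x unfolding princ_def by (rule imageE)
  obtain b where b: "y = s * b" "b \<in> R" using y unfolding princ_def by (rule imageE)
  note ab = a(1) b(1) a(2) b(2)
  then have "x - y = s * (a - b)" by (simp add: right_diff_distrib)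
  then show ?thesis using R_ring(5)[OF ab(3,4)] unfolding princ_def by blast
 qed
 show "r * x \<in> princ s" if r: "r \<in> R" and x: "x \<in> princ s" for r x
 proof -
  obtain a where a: "x = s * a" "a \<in> R" using x unfolding princ_def by (rule imageE)
  then have "r * x = s * (r * a)" by simp
  then show ?thesis using R_ring(6)[OF r a(2)] unfolding princ_def by blast
 qed
qed

text \<open>A packing argument: the translates x + s * \<open>Box t\<close> for x in T are disjoint
  and fit into a box whose side grows like Cn * k * t. Comparing cardinalities and letting t tend to
  infinity leaves the ratio of the volumes.\<close>

lemma card_incongruent:
 assumes s: "s \<in> Box k" "s \<noteq> 0" and T: "finite T" "T \<subseteq> R"
  and inc: "\<forall>x\<in>T. \<forall>y\<in>T. x - y \<in> princ s \<longrightarrow> x = y"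
 shows "card T \<le> (Cn * k) ^ d"
proof -
 obtain L where L: "T \<subseteq> Box L" using finite_R_in_Box T by blast
 define A where "A = Cn * k"
 have *: "card T * (2 * t + 1) ^ d \<le> (2 * (L + A * t) + 1) ^ d" for t
 proof -
  let ?g = "\<lambda>(x, u). x + s * u"
  have "inj_on ?g (T \<times> Box t)"
  proof (rule inj_onI, clarify)
   fix x u x' u' assume a: "x \<in> T" "u \<in> Box t" "x' \<in> T" "u' \<in> Box t" "x + s * u = x' + s * u'"
   then have "x - x' = s * (u' - u)" by (simp add: algebra_simps)
   then have "x - x' \<in> princ s" using a Box_R R_ring(5) by (auto simp: princ_def)
   then have "x = x'" using inc a by blast
   then show "x = x' \<and> u = u'" using a(5) s by simp
  qed
  then have "card T * card (Box t) = card (?g ` (T \<times> Box t))" by (simp add: card_image card_cartesian_product)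
  also have "?g ` (T \<times> Box t) \<subseteq> Box (L + A * t)"
   using L Box_mult[OF s(1)] by (auto simp: A_def intro!: Box_add)
  then have "card (?g ` (T \<times> Box t)) \<le> card (Box (L + A * t))" using finite_Box by (intro card_mono)
  finally show ?thesis by (simp only: card_Box)
 qed
 \<comment> \<open>\<open>q (2 * t)\<close> is the quotient of the side lengths 2 (L + A t) + 1 and
   2 t + 1, written so that its limit A is visible.\<close>
 define q where "q t = real A + (2 * real L + 1 - real A) * inverse (real (Suc t))" for t
 have *: "real (card T) \<le> (q (2 * t)) ^ d" for t
 proof -
  have "real (card T) * (real (2 * t + 1)) ^ d \<le> (real (2 * (L + A * t) + 1)) ^ d"
   using *[of t] by (metis of_nat_le_iff of_nat_mult of_nat_power)
  also have "real (2 * (L + A * t) + 1) = q (2 * t) * real (2 * t + 1)"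
   by (simp add: q_def field_simps)
  finally show ?thesis by (simp add: power_mult_distrib)
 qed
 have "(\<lambda>t. inverse (real (Suc t))) \<longlonglongrightarrow> 0" by (rule LIMSEQ_inverse_real_of_nat)
 then have "q \<longlonglongrightarrow> real A + (2 * real L + 1 - real A) * 0"
  unfolding q_def by (intro tendsto_intros)
 then have "(\<lambda>t. q t ^ d) \<longlonglongrightarrow> real A ^ d" by (auto intro!: tendsto_eq_intros)
 then have "(\<lambda>t. q (2 * t) ^ d) \<longlonglongrightarrow> real A ^ d"
  using LIMSEQ_subseq_LIMSEQ[of "\<lambda>t. q t ^ d" "real A ^ d" "\<lambda>t. 2 * t"] by (simp add: strict_mono_def comp_def)
 then have "real (card T) \<le> real A ^ d"
  by (rule LIMSEQ_le_const) (use * in auto)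
 then show ?thesis unfolding A_def by (metis of_nat_le_iff of_nat_power)
qed

lemma princ_idxle: assumes "s \<in> Box k" "s \<noteq> 0" shows "idxle R (princ s) ((Cn * k) ^ d)"
proof (rule idxle_of_bound)
 have "ideal_C (princ s) R" using princ_ideal Box_R assms by blast
 then show "0 \<in> princ s" "\<forall>x\<in>princ s. \<forall>y\<in>princ s. x - y \<in> princ s" by (auto simp: ideal_C_def)
qed (use card_incongruent[OF assms] in blast)

lemma root_floor: fixes n :: nat assumes "n \<ge> 1" obtains k where "k \<ge> 1" "k ^ d \<le> n" "n < (k + 1) ^ d"
proof -
 have "\<forall>k. k ^ d \<le> n \<longrightarrow> k < Suc n"
 proof (intro allI impI)
  fix k assume "k ^ d \<le> n"
  moreover have "k \<le> k ^ d" using d_pos self_le_power[of k d] by (cases "k = 0") auto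
  ultimately show "k < Suc n" by simp
 qed
 then obtain k where k: "k ^ d \<le> n" "\<And>j. j ^ d \<le> n \<Longrightarrow> j \<le> k"
  using ex_has_greatest_nat[of "\<lambda>k. k ^ d \<le> n" 1 id "Suc n"] assms by auto
 have "k \<ge> 1" using k(2)[of 1] assms by simp
 moreover have "n < (k + 1) ^ d" using k(2)[of "k + 1"] by linarith
 ultimately show ?thesis using that k by blast
qed

text \<open>A representative of p modulo M R. On R the coordinates are integers; the floor only
  makes the function total.\<close>

definition red :: "nat \<Rightarrow> complex \<Rightarrow> complex" where
 "red M p = comb (\<lambda>i. of_int (\<lfloor>co p i\<rfloor> mod int M))"

lemma red_Box: assumes "M > 0" shows "red M p \<in> Box M"
proof -
 have K: "red M p \<in> K" by (simp add: red_def comb_K)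
 have co: "co (red M p) i = of_int (\<lfloor>co p i\<rfloor> mod int M)" if "i < d" for i
  unfolding red_def using co_comb[OF that] by simp
 have "red M p \<in> R" unfolding R_iff_co[OF K] using co by simp
 moreover have "\<bar>co (red M p) i\<bar> \<le> of_nat M" if "i < d" for i
 proof -
  have "\<lfloor>co p i\<rfloor> mod int M \<ge> 0" "\<lfloor>co p i\<rfloor> mod int M \<le> int M"
   using assms by (auto intro: less_imp_le)
  then have "of_int (\<lfloor>co p i\<rfloor> mod int M) \<le> (of_int (int M) :: rat)" "(0::rat) \<le> of_int (\<lfloor>co p i\<rfloor> mod int M)"
   by (simp_all only: of_int_le_iff of_int_0_le_iff)
  then show ?thesis using co[OF that] by simp
 qed
 ultimately show ?thesis by (simp add: Box_def nm_le_iff)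
qed

lemma red_eq: assumes "M > 0" "p \<in> R" "p' \<in> R" "red M p = red M p'"
 shows "\<exists>x\<in>R. p - p' = of_nat M * x"
proof -
 have e: "\<lfloor>co p i\<rfloor> mod int M = \<lfloor>co p' i\<rfloor> mod int M" if "i < d" for i
  using comb_inj[OF assms(4)[unfolded red_def] that] by simp
 have pK: "p \<in> K" "p' \<in> K" using assms R_sub_K by auto
 have "\<exists>k::int. co (p - p') i = of_int (int M * k)" if "i < d" for i
 proof -
  have "co p i \<in> \<int>" "co p' i \<in> \<int>" using R_iff_co pK assms(2,3) that by auto
  then have "co (p - p') i = of_int (\<lfloor>co p i\<rfloor> - \<lfloor>co p' i\<rfloor>)" by (simp add: co_diff[OF pK])
  moreover have "int M dvd \<lfloor>co p i\<rfloor> - \<lfloor>co p' i\<rfloor>" using e[OF that] by (simp add: mod_eq_dvd_iff)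
  then obtain k where "\<lfloor>co p i\<rfloor> - \<lfloor>co p' i\<rfloor> = int M * k" by (auto simp: dvd_def)
  ultimately show ?thesis by metis
 qed
 then have "\<forall>i. \<exists>k::int. i < d \<longrightarrow> co (p - p') i = of_int (int M * k)" by blast
 from choice[OF this] obtain k :: "nat \<Rightarrow> int"
  where k: "\<And>i. i < d \<Longrightarrow> co (p - p') i = of_int (int M * k i)" by blast
 have "p - p' = comb (co (p - p'))" using co_props(1) K_diff pK by blast
 also have "\<dots> = comb (\<lambda>i. of_nat M * of_int (k i))" using k by (intro comb_cong) simp
 also have "\<dots> = of_nat M * comb (\<lambda>i. of_int (k i))" using comb_scale[of "of_nat M"] by simp
 finally have "p - p' = of_nat M * comb (\<lambda>i. of_int (k i))" .
 moreover have "comb (\<lambda>i. of_int (k i)) \<in> R" by (auto simp: comb_def R_eq intro: zspanI)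
 ultimately show ?thesis by blast
qed

text \<open>By pigeonhole an ideal of index n contains some s of size at most the d-th root of n, and s R
 has bounded index in the ideal. Hence M x is a multiple of s for all x in the ideal, and the ideal
 is recovered from s and the residues of the cofactors modulo M.\<close>

lemma ideals_bounded:
 "\<exists>C::nat. C > 0 \<and> (\<forall>n. finite {I. ideal_C I R \<and> idxle R I n} \<and> card {I. ideal_C I R \<and> idxle R I n} \<le> C * n)"
proof -
 \<comment> \<open>\<open>C2\<close> will bound the index of s R in the ideal, so the factorial
   \<open>M\<close> annihilates the quotient. \<open>C\<close> bounds the number of pairs of an s in
   a box and a set of residues, divided by n.\<close>
 define C2 where "C2 = Cn ^ d"
 define M where "M = (fact C2 :: nat)"
 have M: "M > 0" by (simp add: M_def)
 define \<Phi> where "\<Phi> = (\<lambda>(s, Q). {x. \<exists>p\<in>R. of_nat M * x = s * p \<and> red M p \<in> Q})"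
 define C :: nat where "C = 3 ^ d * 2 ^ card (Box M)"
 have main: "finite {I. ideal_C I R \<and> idxle R I n} \<and> card {I. ideal_C I R \<and> idxle R I n} \<le> C * n" for n
 proof (cases "n = 0")
  case True
  then have "\<not> idxle R I n" for I using R_ring(1) by (auto simp: idxle_def intro!: bexI[of _ 0])
  then have "{I. ideal_C I R \<and> idxle R I n} = {}" by blast
  then show ?thesis by (simp only:) simp
 next
  case False
  then obtain kn where kn: "kn \<ge> 1" "kn ^ d \<le> n" "n < (kn + 1) ^ d" using root_floor[of n] by auto
  have "{I. ideal_C I R \<and> idxle R I n} \<subseteq> \<Phi> ` (Box kn \<times> Pow (Box M))"
  proof
   fix I assume "I \<in> {I. ideal_C I R \<and> idxle R I n}"
   then have I: "ideal_C I R" "idxle R I n" by auto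
   note I' = I(1)[unfolded ideal_C_def]
   \<comment> \<open>The exact index is needed: the index of s R in the ideal is estimated by
     dividing through the true number of classes, for which the bound n would be too coarse.\<close>
   define m where "m = idx R I"
   have m: "m \<ge> 1" "m \<le> n" "idxle R I m"
   proof -
    have "R \<noteq> {}" using R_ring(1) by blast
    then show "m \<ge> 1" using idx_pos[OF I(2)] by (simp add: m_def)
    show "m \<le> n" "idxle R I m" using idx_le[OF I(2)] idxle_idx[OF I(2)] by (simp_all add: m_def)
   qed
   obtain k where k: "k \<ge> 1" "k ^ d \<le> m" "m < (k + 1) ^ d" using root_floor[OF m(1)] by blast
   have "k \<le> kn"
   proof (rule ccontr)
    assume "\<not> k \<le> kn"
    then have "(kn + 1) ^ d \<le> k ^ d" by (intro power_mono) auto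
    then show False using kn k m by linarith
   qed
   \<comment> \<open>Coordinates run from 0 to k: these are (k + 1) ^ d points, more than m, and
     their differences stay in \<open>Box k\<close>.\<close>
   define T where "T = (\<lambda>c. comb (\<lambda>i. of_int (int (c i)))) ` (Pi\<^sub>E {..<d} (\<lambda>_. {..k}))"
   have inj: "inj_on (\<lambda>c. comb (\<lambda>i. of_int (int (c i)))) (Pi\<^sub>E {..<d} (\<lambda>_. {..k}))"
   proof (rule inj_onI)
    fix c e assume ce: "c \<in> Pi\<^sub>E {..<d} (\<lambda>_. {..k})" "e \<in> Pi\<^sub>E {..<d} (\<lambda>_. {..k})"
     "comb (\<lambda>i. of_int (int (c i))) = comb (\<lambda>i. of_int (int (e i)))"
    have "c i = e i" if "i < d" for i using comb_inj[OF ce(3) that] by simp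
    then show "c = e" using ce(1,2) by (intro PiE_ext[of c "{..<d}"]) auto
   qed
   have T: "finite T" "card T = (k + 1) ^ d" "T \<subseteq> R"
   proof -
    show "finite T" unfolding T_def by (intro finite_imageI finite_PiE) auto
    show "card T = (k + 1) ^ d" unfolding T_def card_image[OF inj] by (simp add: card_PiE)
    have "comb (\<lambda>i. of_int (int (c i))) \<in> R" for c :: "nat \<Rightarrow> nat"
     unfolding R_eq comb_def by (rule zspanI[where c = "\<lambda>i. int (c i)"]) simp
    then show "T \<subseteq> R" unfolding T_def by blast
   qed
   obtain x y where xy: "x \<in> T" "y \<in> T" "x \<noteq> y" "x - y \<in> I"
   proof (rule idxle_pigeonhole[OF m(3) T(1), where g = "\<lambda>x. x"])
    show "m < card T" unfolding T(2) by (rule k(3))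
    show "(\<lambda>x. x) ` T \<subseteq> R" using T(3) by simp
   qed blast
   define s where "s = x - y"
   have sI: "s \<in> I" "s \<noteq> 0" using xy by (auto simp: s_def)
   have sB: "s \<in> Box k"
   proof -
    obtain c where c: "c \<in> Pi\<^sub>E {..<d} (\<lambda>_. {..k})" "x = comb (\<lambda>i. of_int (int (c i)))"
     using xy(1) unfolding T_def by (rule imageE)
    obtain e where e: "e \<in> Pi\<^sub>E {..<d} (\<lambda>_. {..k})" "y = comb (\<lambda>i. of_int (int (e i)))"
     using xy(2) unfolding T_def by (rule imageE)
    note ce = c(1) e(1) c(2) e(2)
    have s: "s = comb (\<lambda>i. of_int (int (c i)) - of_int (int (e i)))" by (simp only: s_def ce comb_diff)
    have "\<bar>co s i\<bar> \<le> of_nat k" if "i < d" for i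
    proof -
     have "c i \<le> k" "e i \<le> k" using ce(1,2) that by (auto simp: PiE_def Pi_def)
     then have "(of_nat (c i) :: rat) \<le> of_nat k" "(of_nat (e i) :: rat) \<le> of_nat k" by simp_all
     then show ?thesis unfolding s using co_comb[OF that] by (simp add: abs_le_iff)
    qed
    then have "nm s \<le> of_nat k" by (simp add: nm_le_iff)
    moreover have "s \<in> R" using sI I' by auto
    ultimately show ?thesis by (simp add: Box_def)
   qed
   have sR: "s \<in> R" using sB Box_R by blast
   have ind: "idxle R (princ s) (C2 * m)"
   proof -
    have "(Cn * k) ^ d \<le> C2 * m" using k(2) by (simp add: C2_def power_mult_distrib)
    then show ?thesis using princ_idxle[OF sB sI(2)] idxle_mono by blast
   qed
   have psI: "princ s \<subseteq> I" using I' sI(1) by (auto simp: princ_def mult.commute)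
   obtain T where T: "finite T" "T \<subseteq> R" "\<And>x y. x \<in> T \<Longrightarrow> y \<in> T \<Longrightarrow> x - y \<in> I \<Longrightarrow> x = y" "card T \<ge> m"
    using idx_reps[OF I(2)] I' unfolding m_def by metis
   have mult: "\<exists>p\<in>R. of_nat M * x = s * p" if x: "x \<in> I" for x
   proof -
    have xR: "x \<in> R" using x I' by auto
    \<comment> \<open>There are more pairs (t, j) than classes modulo s R. In a collision both t
      agree, since T is incongruent modulo the ideal, and a multiple i x with 1 \<le> i \<le> C2
      lies in s R.\<close>
    have "C2 * m < m * (C2 + 1)" using m(1) by (simp add: algebra_simps)
    also have "\<dots> \<le> card T * (C2 + 1)" using T(4) by (rule mult_le_mono1)
    finally have card: "C2 * m < card (T \<times> {0..C2})" by (simp add: card_cartesian_product)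
    have sub: "(\<lambda>(t,j). t + of_nat j * x) ` (T \<times> {0..C2}) \<subseteq> R" using T(2) xR by (auto simp: R_ring)
    obtain a b where ab: "a \<in> T \<times> {0..C2}" "b \<in> T \<times> {0..C2}" "a \<noteq> b"
      "(\<lambda>(t,j). t + of_nat j * x) a - (\<lambda>(t,j). t + of_nat j * x) b \<in> princ s"
     by (rule idxle_pigeonhole[OF ind _ card sub]) (use T(1) in auto)
    obtain t j t' j' where tj: "a = (t, j)" "b = (t', j')" by (cases a, cases b)
    have in1: "(t - t') + (of_nat j * x - of_nat j' * x) \<in> princ s" using ab(4) tj by (simp add: algebra_simps)
    have jx: "of_nat i * x \<in> I" for i using I' x R_ring(8) by auto
    have "((t - t') + (of_nat j * x - of_nat j' * x)) - (of_nat j * x - of_nat j' * x) \<in> I"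
     using in1 psI jx I' by (metis subsetD)
    then have "t - t' \<in> I" by simp
    then have tt: "t = t'" using T(3) ab tj by auto
    then have jj: "j \<noteq> j'" using ab tj by auto
    obtain i where i: "1 \<le> i" "i \<le> C2" "of_nat i * x \<in> princ s"
    proof (cases "j > j'")
     case True
     then have "of_nat (j - j') * x \<in> princ s" using in1 tt by (simp add: of_nat_diff left_diff_distrib)
     then show ?thesis by (rule that[rotated 2]) (use True ab(1,2) tj in auto)
    next
     case False
     have "ideal_C (princ s) R" using sR by (rule princ_ideal)
     moreover have "of_nat j * x - of_nat j' * x \<in> princ s" using in1 tt by simp
     ultimately have "0 - (of_nat j * x - of_nat j' * x) \<in> princ s" unfolding ideal_C_def by blast
     then have "of_nat (j' - j) * x \<in> princ s" using False jj by (simp add: of_nat_diff left_diff_distrib)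
     then show ?thesis by (rule that[rotated 2]) (use False jj ab(1,2) tj in auto)
    qed
    obtain p where p: "p \<in> R" "of_nat i * x = s * p" using i(3) by (auto simp: princ_def)
    have "i dvd M" unfolding M_def using i by (intro dvd_fact)
    then obtain l where "M = i * l" by (auto simp: dvd_def)
    then have "of_nat M * x = s * (of_nat l * p)" using p(2) by (simp add: algebra_simps)
    then show ?thesis using p(1) R_ring(6,8) by blast
   qed
   define Q where "Q = {red M p | p x. p \<in> R \<and> x \<in> I \<and> of_nat M * x = s * p}"
   have "I = \<Phi> (s, Q)"
   proof (intro equalityI subsetI)
    fix x assume x: "x \<in> I"
    then obtain p where "p \<in> R" "of_nat M * x = s * p" using mult by blast
    then show "x \<in> \<Phi> (s, Q)" using x unfolding \<Phi>_def Q_def by blast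
   next
    fix x assume "x \<in> \<Phi> (s, Q)"
    then obtain p p' x' where p: "p \<in> R" "of_nat M * x = s * p" "red M p = red M p'" "p' \<in> R" "x' \<in> I"
      "of_nat M * x' = s * p'"
     unfolding \<Phi>_def Q_def by auto
    obtain u where u: "u \<in> R" "p - p' = of_nat M * u" using red_eq[OF M p(1,4,3)] by blast
    have "of_nat M * (x - x') = s * (p - p')" using p by (simp add: algebra_simps)
    then have "of_nat M * (x - x') = of_nat M * (s * u)" using u by simp
    then have "x - x' = u * s" using M by simp
    then have "x = x' - (- u) * s" by (simp add: algebra_simps)
    moreover have "(- u) * s \<in> I" using u(1) R_ring(3) sI(1) I' by blast
    ultimately show "x \<in> I" using p(5) I' by metis
   qed
   moreover have "Q \<subseteq> Box M" using red_Box[OF M] by (auto simp: Q_def)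
   moreover have "s \<in> Box kn" using sB Box_mono[OF \<open>k \<le> kn\<close>] by blast
   ultimately show "I \<in> \<Phi> ` (Box kn \<times> Pow (Box M))" by blast
  qed
  moreover have fin: "finite (Box kn \<times> Pow (Box M))" using finite_Box by simp
  ultimately have "finite {I. ideal_C I R \<and> idxle R I n}"
   and "card {I. ideal_C I R \<and> idxle R I n} \<le> card (Box kn \<times> Pow (Box M))"
   using finite_surj[OF fin] surj_card_le[OF fin] by blast+
  moreover have "card (Box kn \<times> Pow (Box M)) = (2 * kn + 1) ^ d * 2 ^ card (Box M)"
   by (simp add: card_cartesian_product card_Pow finite_Box card_Box)
  moreover have "(2 * kn + 1) ^ d \<le> 3 ^ d * n"
  proof -
   have "(2 * kn + 1) ^ d \<le> (3 * kn) ^ d" using kn(1) by (intro power_mono) auto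
   also have "\<dots> \<le> 3 ^ d * n" using kn(2) by (simp add: power_mult_distrib)
   finally show ?thesis .
  qed
  then have "(2 * kn + 1) ^ d * 2 ^ card (Box M) \<le> C * n"
   unfolding C_def using mult_right_mono[of _ _ "2 ^ card (Box M)"] by (simp add: mult_ac)
  ultimately show ?thesis by linarith
 qed
 have "C > 0" by (simp add: C_def)
 then show ?thesis using main by blast
qed

text \<open>A generator congruent to 1 modulo f makes f invertible modulo the ideal. Ideals rather
  than generators are counted, as the latter come in infinite families when R has infinitely many
  units.\<close>

definition princs :: "nat \<Rightarrow> nat \<Rightarrow> complex set set" where
 "princs f n = {J. \<exists>a\<in>R. J = princ a \<and> (\<exists>b\<in>R. a = 1 + of_nat f * b) \<and> idxle R J n}"

lemma princs_finite: "finite (princs f n)"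
 by (rule finite_subset[of _ "{I. ideal_C I R \<and> idxle R I n}"])
   (use princ_ideal ideals_bounded in \<open>auto simp: princs_def\<close>)

text \<open>Elements near a large integer t satisfy nm (a r) >= const * t * nm r, so that only boundedly
 many of them are associated to each other.\<close>

lemma princs_many:
 assumes "f \<ge> 1"
 shows "\<exists>c>0. \<exists>N. \<forall>n\<ge>N. n \<le> c * card (princs f n)"
proof -
 obtain k1 where k1: "1 \<in> Box k1" using R_in_Box R_ring(2) by blast
 define C3 where "C3 = (1 + f * (2 * Cn)) * k1 + f"
 \<comment> \<open>Multiplication by b in \<open>Box u\<close> increases heights at most by the
   factor Cn * u; the integer 2 * Cn * u dominates this and leaves a lower bound of the same
   order.\<close>
 define a where "a u b = 1 + of_nat f * (of_nat (2 * Cn * u) + b)" for u :: nat and b :: complex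
 have nm1: "nm 1 \<le> of_nat k1" using k1 by (simp add: Box_def)
 have f1: "of_nat f \<ge> (1::rat)" using assms by simp
 have low: "of_nat u * nm r \<le> nm (a u b * r)" if b: "b \<in> Box u" and r: "r \<in> R" for u b r
 proof -
  have bK: "b \<in> K" "b \<in> R" and rK: "r \<in> K" using b r Box_R R_sub_K by auto
  have aR: "a u b \<in> R" using bK R_ring by (simp add: a_def)
  have arK: "a u b * r \<in> K" using aR r R_ring(6) R_sub_K by blast
  let ?t = "1 + f * (2 * Cn * u)"
  have fbK: "of_nat f * (b * r) \<in> K" using bK r R_ring R_sub_K by simp
  have "of_nat ?t * r = a u b * r - of_nat f * (b * r)" by (simp add: a_def algebra_simps)
  then have "of_nat ?t * nm r \<le> nm (a u b * r) + nm (of_nat f * (b * r))"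
   using nm_diff[OF arK fbK] nm_of_nat_mult[OF rK, of ?t] by metis
  also have "nm (of_nat f * (b * r)) = of_nat f * nm (b * r)" using nm_of_nat_mult K_mult bK rK by blast
  also have "nm (b * r) \<le> of_nat Cn * nm b * nm r" using nm_mult' bK rK by blast
  also have "of_nat Cn * nm b * nm r \<le> of_nat Cn * of_nat u * nm r"
   using b nm_nonneg by (intro mult_right_mono mult_left_mono) (auto simp: Box_def)
  finally have "of_nat ?t * nm r \<le> nm (a u b * r) + of_nat f * (of_nat Cn * of_nat u * nm r)"
   using f1 by (auto intro: order_trans mult_left_mono)
  then have "nm r + of_nat f * (of_nat Cn * of_nat u * nm r) \<le> nm (a u b * r)"
   by (simp add: algebra_simps)
  moreover have "1 * (1 * of_nat u * nm r) \<le> of_nat f * (of_nat Cn * of_nat u * nm r)"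
   using f1 Cn(2) nm_nonneg[of r] by (intro mult_mono mult_right_mono) auto
  ultimately show ?thesis using nm_nonneg[of r] by simp
 qed
 have up: "a u b \<in> Box (C3 * u)" if b: "b \<in> Box u" and u: "u \<ge> 1" for u b
 proof -
  have bK: "b \<in> K" "b \<in> R" using b Box_R R_sub_K by auto
  have aR: "a u b \<in> R" using bK R_ring by (simp add: a_def)
  let ?t = "1 + f * (2 * Cn * u)"
  have "a u b = of_nat ?t * 1 + of_nat f * b" by (simp add: a_def algebra_simps)
  moreover have "of_nat ?t * 1 \<in> K" "of_nat f * b \<in> K" using R_ring bK R_sub_K by auto
  ultimately have "nm (a u b) \<le> nm (of_nat ?t * 1) + nm (of_nat f * b)" using nm_add by metis
  also have "\<dots> = of_nat ?t * nm 1 + of_nat f * nm b" using nm_of_nat_mult[OF K_1, of ?t] nm_of_nat_mult[OF bK(1), of f] by simp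
  also have "\<dots> \<le> of_nat ?t * of_nat k1 + of_nat f * of_nat u"
   using nm1 b by (intro add_mono mult_left_mono) (auto simp: Box_def)
  also have "\<dots> = of_nat (?t * k1 + f * u)" by (simp only: of_nat_add of_nat_mult)
  also have "\<dots> \<le> of_nat (C3 * u)"
  proof -
   have "?t * k1 + f * u \<le> C3 * u"
   proof -
    have "k1 \<le> k1 * u" using u by simp
    then show ?thesis by (simp add: C3_def algebra_simps)
   qed
   then show ?thesis by (simp only: of_nat_le_iff)
  qed
  finally show ?thesis using aR by (simp add: Box_def)
 qed
 have nz: "a u b \<noteq> 0" if "b \<in> Box u" "u \<ge> 1" for u b
 proof
  assume "a u b = 0"
  then have "of_nat u * nm 1 \<le> nm 0" using low[OF that(1) R_ring(2)] by simp
  moreover have "nm 0 = 0" using nm_scale[OF K_1, of 0] by simp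
  moreover have "nm 1 \<ge> 1" using nm_R_ge1[OF R_ring(2)] by simp
  moreover have "of_nat u \<ge> (1::rat)" using that(2) by simp
  ultimately show False using mult_mono[of 1 "of_nat u" 1 "nm 1"] by simp
 qed
 \<comment> \<open>Bound for the number of parameters b giving the same ideal: generators of one
   ideal differ by a factor of height at most \<open>C3\<close>.\<close>
 define B where "B = (2 * C3 + 1) ^ d"
 define c where "c = (Cn * C3) ^ d * B"
 have "k1 \<ge> 1"
 proof (rule ccontr)
  assume "\<not> k1 \<ge> 1"
  then have "nm 1 \<le> 0" using nm1 by simp
  then show False using nm_R_ge1[OF R_ring(2)] by simp
 qed
 then have C3: "C3 \<ge> 1" by (simp add: C3_def)
 have main: "n \<le> c * card (princs f n)" if n: "n \<ge> (Cn * C3) ^ d" for n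
 proof -
  have "n \<ge> 1" 
  proof -
   have "1 \<le> Cn * C3" using Cn(2) C3 by simp
   then have "1 \<le> (Cn * C3) ^ d" by (rule one_le_power)
   then show ?thesis using n by linarith
  qed
  then obtain k where k: "k ^ d \<le> n" "n < (k + 1) ^ d" using root_floor by metis
  \<comment> \<open>Largest u for which the elements \<open>a u b\<close>, lying in
    \<open>Box (C3 * u)\<close>, certainly generate ideals of index at most n.\<close>
  define u where "u = k div (Cn * C3)"
  have pos: "Cn * C3 > 0" using Cn(2) C3 by simp
  have "Cn * C3 < k + 1"
  proof (rule ccontr)
   assume "\<not> Cn * C3 < k + 1"
   then have "(k + 1) ^ d \<le> (Cn * C3) ^ d" by (intro power_mono) auto
   then show False using n k by linarith
  qed
  then have u: "u \<ge> 1" unfolding u_def using pos by (simp add: div_greater_zero_iff Suc_le_eq)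
  have "Cn * C3 * u \<le> k" unfolding u_def by simp
  then have un: "(Cn * C3 * u) ^ d \<le> n" using k(1) power_mono[of _ k d] by (meson le0 le_trans)
  have "k + 1 \<le> Cn * C3 * (u + 1)"
   using pos dividend_less_div_times[of "Cn * C3" k] by (simp add: u_def Suc_le_eq add.commute mult.commute algebra_simps)
  then have "n \<le> (Cn * C3 * (u + 1)) ^ d" using k(2) power_mono[of "k+1" "Cn * C3 * (u+1)" d] by linarith
  also have "\<dots> \<le> (Cn * C3) ^ d * (2 * u + 1) ^ d"
   unfolding power_mult_distrib[symmetric] by (intro power_mono mult_left_mono) auto
  also have "(2 * u + 1) ^ d \<le> B * card (princs f n)"
  proof -
   have "(2 * u + 1) ^ d = card (Box u)" by (simp add: card_Box)
   also have "Box u \<subseteq> (\<Union>J\<in>princs f n. {b \<in> Box u. princ (a u b) = J})"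
   proof
    fix b assume b: "b \<in> Box u"
    have "idxle R (princ (a u b)) ((Cn * (C3 * u)) ^ d)" using princ_idxle[OF up[OF b u] nz[OF b u]] .
    then have "idxle R (princ (a u b)) n" using un idxle_mono by (simp add: mult.assoc)
    moreover have "a u b \<in> R" using up[OF b u] Box_R by blast
    moreover have "of_nat (2 * Cn * u) + b \<in> R" using b Box_R R_ring by auto
    ultimately have "princ (a u b) \<in> princs f n" unfolding princs_def a_def by blast
    then show "b \<in> (\<Union>J\<in>princs f n. {b \<in> Box u. princ (a u b) = J})" using b by blast
   qed
   then have "card (Box u) \<le> card (\<Union>J\<in>princs f n. {b \<in> Box u. princ (a u b) = J})"
    using princs_finite finite_Box by (intro card_mono) auto
   also have "\<dots> \<le> (\<Sum>J\<in>princs f n. card {b \<in> Box u. princ (a u b) = J})"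
    using princs_finite by (rule card_UN_le)
   also have "\<dots> \<le> (\<Sum>J\<in>princs f n. B)"
   proof (rule sum_mono)
    fix J assume "J \<in> princs f n"
    show "card {b \<in> Box u. princ (a u b) = J} \<le> B"
    proof (cases "{b \<in> Box u. princ (a u b) = J} = {}")
     case True
     then show ?thesis by (simp only: card.empty)
    next
     case False
     then obtain b0 where b0: "b0 \<in> Box u" "princ (a u b0) = J" by blast
     have "a u ` {b \<in> Box u. princ (a u b) = J} \<subseteq> (\<lambda>r. a u b0 * r) ` Box C3"
     proof clarify
      fix b assume b: "b \<in> Box u" "J = princ (a u b)"
      have "a u b * 1 \<in> princ (a u b)" unfolding princ_def using R_ring(2) by blast
      then have "a u b \<in> princ (a u b0)" using b b0 by simp
      then obtain r where r: "r \<in> R" "a u b = a u b0 * r" by (auto simp: princ_def)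
      have "of_nat u * nm r \<le> nm (a u b)" using low[OF b0(1) r(1)] r(2) by simp
      also have "\<dots> \<le> of_nat u * of_nat C3" using up[OF b(1) u] by (simp add: Box_def mult.commute)
      finally have "nm r \<le> of_nat C3" using u by simp
      then show "a u b \<in> (\<lambda>r. a u b0 * r) ` Box C3" using r by (auto simp: Box_def)
     qed
     then have "card (a u ` {b \<in> Box u. princ (a u b) = J}) \<le> card ((\<lambda>r. a u b0 * r) ` Box C3)"
      using finite_Box by (intro card_mono) auto
     also have "\<dots> \<le> card (Box C3)" using finite_Box by (rule card_image_le)
     also have "card (a u ` {b \<in> Box u. princ (a u b) = J}) = card {b \<in> Box u. princ (a u b) = J}"
      by (rule card_image) (use assms in \<open>auto simp: inj_on_def a_def\<close>)
     finally show ?thesis by (simp add: card_Box B_def)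
    qed
   qed
   also have "\<dots> = B * card (princs f n)" by (simp only: sum_constant mult.commute of_nat_id)
   finally show ?thesis .
  qed
  finally show ?thesis by (simp add: c_def mult_ac)
 qed
 have "c > 0" using Cn(2) C3 by (simp add: c_def B_def)
 then show ?thesis using main by blast
qed

end

section \<open>Local powers\<close>

definition coeffs_in :: "complex set \<Rightarrow> complex poly \<Rightarrow> bool" where
 "coeffs_in R p \<longleftrightarrow> (\<forall>i. Polynomial.coeff p i \<in> R)"

definition adj :: "complex set \<Rightarrow> complex \<Rightarrow> complex set" where
 "adj R y = {poly p y | p. coeffs_in R p}"

lemma coeffs_in_add: "subring_C R \<Longrightarrow> coeffs_in R p \<Longrightarrow> coeffs_in R q \<Longrightarrow> coeffs_in R (p + q)"
 by (simp add: coeffs_in_def ringC)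

lemma coeffs_in_diff: "subring_C R \<Longrightarrow> coeffs_in R p \<Longrightarrow> coeffs_in R q \<Longrightarrow> coeffs_in R (p - q)"
 by (simp add: coeffs_in_def ringC)

lemma coeffs_in_mult: "subring_C R \<Longrightarrow> coeffs_in R p \<Longrightarrow> coeffs_in R q \<Longrightarrow> coeffs_in R (p * q)"
 unfolding coeffs_in_def coeff_mult by (auto intro!: ringC(11) ringC(6))

lemma coeffs_in_monom: "subring_C R \<Longrightarrow> c \<in> R \<Longrightarrow> coeffs_in R (Polynomial.monom c n)"
 by (simp add: coeffs_in_def ringC)

lemma coeffs_in_pCons: "c \<in> R \<Longrightarrow> coeffs_in R p \<Longrightarrow> coeffs_in R (pCons c p)"
 by (auto simp: coeffs_in_def coeff_pCons split: nat.split)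

lemma coeffs_in_0: "subring_C R \<Longrightarrow> coeffs_in R 0"
 by (simp add: coeffs_in_def ringC)

lemma coeffs_in_mono: "coeffs_in R p \<Longrightarrow> R \<subseteq> R' \<Longrightarrow> coeffs_in R' p"
 by (auto simp: coeffs_in_def)

lemma coeffs_in_poly: "subring_C R \<Longrightarrow> coeffs_in R p \<Longrightarrow> x \<in> R \<Longrightarrow> poly p x \<in> R"
 unfolding poly_altdef coeffs_in_def by (auto intro!: ringC)

text \<open>A leading coefficient 1 means that no division in R occurs. The remainder is bounded
  through its coefficients instead of its degree, so that the zero remainder is no special
  case.\<close>

lemma coeffs_in_division:
 assumes R: "subring_C R" and g: "coeffs_in R g" "lead_coeff g = 1" and p: "coeffs_in R p"
 obtains h r where "coeffs_in R h" "coeffs_in R r" "p = g * h + r" "\<And>i. i \<ge> Polynomial.degree g \<Longrightarrow> Polynomial.coeff r i = 0"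
proof -
 have "\<exists>h r. coeffs_in R h \<and> coeffs_in R r \<and> p = g * h + r \<and> (\<forall>i\<ge>Polynomial.degree g. Polynomial.coeff r i = 0)"
  if "\<forall>i\<ge>n. Polynomial.coeff p i = 0" "coeffs_in R p" for n p
  using that
 proof (induction n arbitrary: p)
  case 0
  then have "p = 0" by (simp add: poly_eq_iff)
  then show ?case using coeffs_in_0[OF R] by (intro exI[of _ 0]) auto
 next
  case (Suc n)
  show ?case
  proof (cases "Suc n \<le> Polynomial.degree g")
   case True
   then show ?thesis using Suc.prems coeffs_in_0[OF R] by (intro exI[of _ 0] exI[of _ p]) auto
  next
   case False
   define m where "m = Polynomial.monom (Polynomial.coeff p n) (n - Polynomial.degree g)"
   have m: "coeffs_in R m" using Suc.prems(2) R by (auto simp: m_def coeffs_in_def ringC)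
   define p' where "p' = p - m * g"
   have "coeffs_in R p'" unfolding p'_def using m g Suc.prems(2) R by (intro coeffs_in_diff coeffs_in_mult)
   moreover have "Polynomial.coeff p' i = 0" if "i \<ge> n" for i
   proof (cases "i = n")
    case True
    then show ?thesis using False g(2) by (simp add: p'_def m_def coeff_monom_mult)
   next
    case i: False
    then have "Polynomial.coeff p i = 0" using Suc.prems(1) that by auto
    moreover have "Polynomial.coeff g (i - (n - Polynomial.degree g)) = 0"
     using i that False by (intro coeff_eq_0) linarith
    ultimately show ?thesis by (simp add: p'_def m_def coeff_monom_mult)
   qed
   ultimately obtain h r where hr: "coeffs_in R h" "coeffs_in R r" "p' = g * h + r"
     "\<forall>i\<ge>Polynomial.degree g. Polynomial.coeff r i = 0"
    using Suc.IH[of p'] by blast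
   have "p = g * (h + m) + r" using hr(3) by (simp add: p'_def algebra_simps)
   then show ?thesis using hr m coeffs_in_add[OF R hr(1) m] by blast
  qed
 qed
 moreover have "\<forall>i\<ge>Suc (Polynomial.degree p). Polynomial.coeff p i = 0" by (simp add: coeff_eq_0)
 ultimately show ?thesis using that p by blast
qed

definition binom_poly :: "nat \<Rightarrow> complex \<Rightarrow> complex poly" where
 "binom_poly n e = Polynomial.monom 1 n - [:e:]"

lemma binom_poly:
 assumes "n \<ge> 1"
 shows "lead_coeff (binom_poly n e) = 1" "Polynomial.degree (binom_poly n e) = n"
  "poly (binom_poly n e) x = x ^ n - e"
  "subring_C R \<Longrightarrow> e \<in> R \<Longrightarrow> coeffs_in R (binom_poly n e)"
proof -
 have "Polynomial.degree [:e:] < Polynomial.degree (Polynomial.monom (1::complex) n)"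
  using assms by (simp add: Polynomial.degree_monom_eq)
 then show d: "Polynomial.degree (binom_poly n e) = n"
  unfolding binom_poly_def diff_conv_add_uminus
  by (subst Polynomial.degree_add_eq_left) (simp_all add: Polynomial.degree_monom_eq)
 show "lead_coeff (binom_poly n e) = 1" unfolding d using assms
  by (cases n) (auto simp: binom_poly_def)
 show "poly (binom_poly n e) x = x ^ n - e" by (simp add: binom_poly_def poly_monom)
 show "subring_C R \<Longrightarrow> e \<in> R \<Longrightarrow> coeffs_in R (binom_poly n e)"
  unfolding binom_poly_def
  by (intro coeffs_in_diff coeffs_in_monom coeffs_in_pCons coeffs_in_0) (auto simp: ringC)
qed

lemma adj_subring:
 assumes "subring_C R" shows "subring_C (adj R y)"
 unfolding subring_C_def adj_def
proof (intro conjI ballI)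
 have "coeffs_in R [:1:]" using assms by (intro coeffs_in_pCons coeffs_in_0) (auto simp: ringC)
 moreover have "poly [:1:] y = 1" by simp
 ultimately show "1 \<in> {poly p y |p. coeffs_in R p}" by (metis (mono_tags, lifting) mem_Collect_eq)
next
 fix x1 x2 assume "x1 \<in> {poly p y |p. coeffs_in R p}" "x2 \<in> {poly p y |p. coeffs_in R p}"
 then obtain p1 p2 where p: "coeffs_in R p1" "coeffs_in R p2" "x1 = poly p1 y" "x2 = poly p2 y" by blast
 have "x1 - x2 = poly (p1 - p2) y" "x1 * x2 = poly (p1 * p2) y" using p by simp_all
 then show "x1 - x2 \<in> {poly p y |p. coeffs_in R p}" "x1 * x2 \<in> {poly p y |p. coeffs_in R p}"
  using coeffs_in_diff[OF assms p(1,2)] coeffs_in_mult[OF assms p(1,2)] by blast+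
qed

lemma adj_superset: assumes "subring_C R" "x \<in> R" shows "x \<in> adj R y"
proof -
 have "coeffs_in R [:x:]" using assms by (intro coeffs_in_pCons coeffs_in_0)
 moreover have "poly [:x:] y = x" by simp
 ultimately show ?thesis unfolding adj_def by (metis (mono_tags, lifting) mem_Collect_eq)
qed

lemma adj_gen: assumes "subring_C R" shows "y \<in> adj R y"
proof -
 have "coeffs_in R [:0, 1:]" using assms by (intro coeffs_in_pCons coeffs_in_0) (auto simp: ringC)
 moreover have "poly [:0, 1:] y = y" by simp
 ultimately show ?thesis unfolding adj_def by (metis (mono_tags, lifting) mem_Collect_eq)
qed

lemma adj_reduced:
 assumes R: "subring_C R" and n: "n \<ge> 1" "y ^ n \<in> R" and x: "x \<in> adj R y"
 obtains c where "\<And>i. c i \<in> R" "x = (\<Sum>i<n. c i * y ^ i)"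
proof -
 obtain p where p: "coeffs_in R p" "x = poly p y" using x by (auto simp: adj_def)
 obtain h r where r: "coeffs_in R r" "p = binom_poly n (y^n) * h + r" "\<And>i. i \<ge> n \<Longrightarrow> Polynomial.coeff r i = 0"
  using coeffs_in_division[OF R binom_poly(4)[OF n(1) R n(2)] binom_poly(1)[OF n(1)] p(1)] binom_poly(2)[OF n(1)] by metis
 have "x = poly r y" using p r(2) binom_poly(3)[OF n(1)] by simp
 also have "\<dots> = (\<Sum>i<n. Polynomial.coeff r i * y ^ i)"
 proof -
  have "(\<Sum>i\<le>Polynomial.degree r. Polynomial.coeff r i * y ^ i) = (\<Sum>i\<le>Polynomial.degree r + n. Polynomial.coeff r i * y ^ i)"
   by (intro sum.mono_neutral_left) (auto simp: coeff_eq_0)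
  also have "\<dots> = (\<Sum>i<n. Polynomial.coeff r i * y ^ i)"
   by (intro sum.mono_neutral_right) (auto simp: r(3))
  finally show ?thesis by (simp add: poly_altdef)
 qed
 finally show ?thesis using that[of "Polynomial.coeff r"] r(1) by (simp add: coeffs_in_def)
qed

lemma adj_order:
 assumes R: "is_order R" and n: "n \<ge> 1" "y ^ n \<in> R"
 shows "is_order (adj R y)"
proof -
 have sub: "subring_C R" using R by (simp add: is_order_def)
 obtain d w where dw: "R = zspan d w" using R by (auto simp: is_order_def)
 \<comment> \<open>The products w j * y ^ i for i < n, listed at position j + d * i.\<close>
 define v where "v = (\<lambda>k. w (k mod d) * y ^ (k div d))"
 have "adj R y = zspan (d * n) v"
 proof
  show "adj R y \<subseteq> zspan (d * n) v"
  proof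
   fix x assume "x \<in> adj R y"
   then obtain c where c: "\<And>i. c i \<in> R" "x = (\<Sum>i<n. c i * y ^ i)" using adj_reduced[OF sub n] by blast
   have "c i * y ^ i \<in> zspan (d * n) v" if i: "i < n" for i
   proof -
    obtain k :: "nat \<Rightarrow> int" where k: "c i = (\<Sum>j<d. of_int (k j) * w j)" using c(1)[of i] dw by (auto elim: zspanE)
    have "w j * y ^ i \<in> zspan (d * n) v" if j: "j < d" for j
    proof -
     have "j + d * i < d * n"
     proof -
      have "j + d * i < d * Suc i" using j by simp
      also have "\<dots> \<le> d * n" using i by (intro mult_le_mono2) simp
      finally show ?thesis .
     qed
     moreover have "v (j + d * i) = w j * y ^ i" using j by (simp add: v_def)
     ultimately show ?thesis using zspan_base by metis
    qed
    then have "(\<Sum>j<d. of_int (k j) * (w j * y ^ i)) \<in> zspan (d * n) v"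
     by (intro zspan_sum zspan_scale) auto
    then show ?thesis by (simp add: k sum_distrib_right mult.assoc)
   qed
   then show "x \<in> zspan (d * n) v" unfolding c(2) by (intro zspan_sum) auto
  qed
  show "zspan (d * n) v \<subseteq> adj R y"
  proof
   fix x assume "x \<in> zspan (d * n) v"
   then obtain k :: "nat \<Rightarrow> int" where k: "x = (\<Sum>j<d*n. of_int (k j) * v j)" by (elim zspanE)
   have "v j \<in> adj R y" if "j < d * n" for j
   proof -
    have "d > 0" using that by (cases d) auto
    then have "w (j mod d) \<in> R" unfolding dw by (intro zspan_base) simp
    then show ?thesis unfolding v_def
     using adj_superset[OF sub] adj_gen[OF sub] ringC[OF adj_subring[OF sub, of y]] by simp
   qed
   then show "x \<in> adj R y" unfolding k
    by (intro ringC(11)[OF adj_subring[OF sub]] ringC(6)[OF adj_subring[OF sub]]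
       ringC(9)[OF adj_subring[OF sub]]) auto
  qed
 qed
 then have "\<exists>d w. adj R y = zspan d w" by blast
 then show ?thesis unfolding is_order_def using adj_subring[OF sub, of y] by blast
qed

definition subfield_C :: "complex set \<Rightarrow> bool" where
 "subfield_C F \<longleftrightarrow> subring_C F \<and> (\<forall>x\<in>F. inverse x \<in> F)"

text \<open>The constant coefficient of the minimal polynomial of y over F is, up to sign, a product of
 k roots of e, hence an element of F whose q-th power is e^k up to sign; as k is prime to q this
 produces a q-th root of e.\<close>

lemma root_independent:
 assumes F: "subfield_C F" and q: "Factorial_Ring.prime (q::nat)" and e: "y ^ q \<in> F" "y \<noteq> 0"
  and no: "\<And>v. v \<in> F \<Longrightarrow> v ^ q \<noteq> y ^ q"
  and p: "coeffs_in F p" "poly p y = 0" "\<And>i. i \<ge> q \<Longrightarrow> Polynomial.coeff p i = 0"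
 shows "p = 0"
proof (rule ccontr)
 assume "p \<noteq> 0"
 have sub: "subring_C F" and inv: "\<And>x. x \<in> F \<Longrightarrow> inverse x \<in> F" using F by (auto simp: subfield_C_def)
 have q1: "q \<ge> 1" using q prime_ge_1_nat by blast
 define P where "P g \<longleftrightarrow> coeffs_in F g \<and> lead_coeff g = 1 \<and> poly g y = 0" for g
 have monic: "\<exists>g. P g \<and> Polynomial.degree g = Polynomial.degree r" if "coeffs_in F r" "poly r y = 0" "r \<noteq> 0" for r
 proof (intro exI conjI)
  let ?g = "Polynomial.smult (inverse (lead_coeff r)) r"
  have "inverse (lead_coeff r) \<in> F" using that inv by (auto simp: coeffs_in_def)
  then show "P ?g" unfolding P_def using that sub by (auto simp: coeffs_in_def ringC)
  show "Polynomial.degree ?g = Polynomial.degree r" using that by simp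
 qed
 obtain g0 where "P g0" "Polynomial.degree g0 = Polynomial.degree p" using monic p(1,2) \<open>p \<noteq> 0\<close> by blast
 moreover define k where "k = (LEAST k. \<exists>g. P g \<and> Polynomial.degree g = k)"
 ultimately have ex: "\<exists>g. P g \<and> Polynomial.degree g = k" and kle: "k \<le> Polynomial.degree p"
  unfolding k_def using LeastI[of "\<lambda>k. \<exists>g. P g \<and> Polynomial.degree g = k" "Polynomial.degree p"]
   Least_le[of "\<lambda>k. \<exists>g. P g \<and> Polynomial.degree g = k" "Polynomial.degree p"] by blast+
 have kmin: "k \<le> Polynomial.degree g" if "P g" for g unfolding k_def using that by (intro Least_le) blast
 obtain g where g: "coeffs_in F g" "lead_coeff g = 1" "poly g y = 0" "Polynomial.degree g = k"
  using ex by (auto simp: P_def)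
 have "Polynomial.degree p < q" using p(3) \<open>p \<noteq> 0\<close> by (metis leading_coeff_0_iff not_le)
 then have kq: "k < q" using kle by simp
 have k1: "k \<ge> 1"
 proof (rule ccontr)
  assume "\<not> k \<ge> 1"
  then have "Polynomial.degree g = 0" using g(4) by simp
  then obtain c where "g = [:c:]" by (rule degree_eq_zeroE)
  then show False using g(2,3) by simp
 qed
 have "g dvd binom_poly q (y ^ q)"
 proof -
  obtain h r where r: "coeffs_in F r" "binom_poly q (y ^ q) = g * h + r" "\<And>i. i \<ge> k \<Longrightarrow> Polynomial.coeff r i = 0"
   using coeffs_in_division[OF sub g(1,2) binom_poly(4)[OF q1 sub e(1)]] g(4) by metis
  have "poly (binom_poly q (y ^ q)) y = 0" using binom_poly(3)[OF q1] by simp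
  then have "poly r y = 0" using r(2) g(3) by simp
  have "r = 0"
  proof (rule ccontr)
   assume "r \<noteq> 0"
   then obtain g' where "P g'" "Polynomial.degree g' = Polynomial.degree r" using monic r(1) \<open>poly r y = 0\<close> by blast
   then have "k \<le> Polynomial.degree r" using kmin by metis
   then show False using r(3) \<open>r \<noteq> 0\<close> by (metis leading_coeff_0_iff)
  qed
  then show ?thesis using r(2) by simp
 qed
 then have roots: "x ^ q = y ^ q" if "poly g x = 0" for x
  using that binom_poly(3)[OF q1, of "y ^ q" x] by (auto simp: dvd_def)
 have "g \<noteq> 0" using g(2) by auto
 then obtain A where A: "size A = k" "g = (\<Prod>x\<in>#A. [:- x, 1:])"
  using alg_closed_imp_factorization[of g] g(2,4) by auto
 have root: "x ^ q = y ^ q" if "x \<in># A" for x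
 proof (rule roots)
  have "[:- x, 1:] dvd g" unfolding A(2) using that by (intro dvd_prod_mset) auto
  then show "poly g x = 0" by (simp add: poly_eq_0_iff_dvd)
 qed
 define \<delta> where "\<delta> = (\<Prod>x\<in>#A. x)"
 have "poly g 0 = (\<Prod>x\<in>#A. - x)" unfolding A(2) by (simp add: poly_prod_mset)
 also have "\<dots> = (- 1) ^ k * \<delta>" unfolding \<delta>_def A(1)[symmetric] by (induction A) auto
 finally have "\<delta> = (- 1) ^ k * poly g 0" by (simp add: power_mult_distrib[symmetric] mult.assoc[symmetric])
 then have dF: "\<delta> \<in> F" using coeffs_in_poly[OF sub g(1), of 0] sub by (auto intro!: ringC)
 have dq: "\<delta> ^ q = (y ^ q) ^ k" unfolding \<delta>_def A(1)[symmetric] using root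
  by (induction A) (auto simp: power_mult_distrib)
 have "coprime k q" using q k1 kq by (metis coprime_commute nat_dvd_not_less prime_imp_coprime_nat zero_less_iff_neq_zero not_one_le_zero)
 then obtain a b where ab: "a * k = b * q + 1"
  using coprime_bezout_strong[of k q] q prime_gt_1_nat k1 by (metis mult.commute nat_neq_iff)
 define v where "v = \<delta> ^ a * inverse ((y ^ q) ^ b)"
 have "v \<in> F" unfolding v_def
  by (intro ringC(6)[OF sub] ringC(7)[OF sub] inv dF e(1))
 moreover have "v ^ q = y ^ q"
 proof -
  have "v ^ q = (\<delta> ^ q) ^ a * inverse ((y ^ q) ^ (b * q))"
   by (simp add: v_def power_mult_distrib power_inverse power_mult[symmetric] mult_ac)
  also have "(\<delta> ^ q) ^ a = (y ^ q) ^ (a * k)" unfolding dq by (simp add: power_mult[symmetric] mult_ac)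
  also have "\<dots> = (y ^ q) ^ (b * q) * y ^ q" unfolding ab by (simp add: power_add)
  finally show ?thesis using e(2) by simp
 qed
 ultimately show False using no by blast
qed

context num_order
begin

lemma is_order_R: "is_order R" using is_order_iff num_order_axioms by blast

text \<open>The nonzero principal ideal r R has finite index in R and thus contains a positive
  integer j = r * s, whence j / r lies in R.\<close>

lemma K_subfield: "subfield_C K"
 unfolding subfield_C_def subring_C_def
proof (intro conjI ballI)
 fix x assume x: "x \<in> K"
 show "inverse x \<in> K"
 proof (cases "x = 0")
  case False
  obtain n where n: "n > 0" "of_nat n * x \<in> R" using x by (auto simp: K_def)
  let ?r = "of_nat n * x"
  have r0: "?r \<noteq> 0" using n False by simp
  obtain B where "?r \<in> Box B" using R_in_Box n by blast
  then have "idxle R (princ ?r) ((Cn * B) ^ d)" using princ_idxle r0 by blast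
  moreover have "\<forall>s\<in>R. \<forall>x\<in>princ ?r. s * x \<in> princ ?r" using princ_ideal[OF n(2)] by (simp add: ideal_C_def)
  ultimately obtain j where j: "1 \<le> j" "of_nat j * 1 \<in> princ ?r"
   using idxle_multiple[OF _ sub R_ring(2)] by metis
  then obtain s where s: "s \<in> R" "of_nat j = ?r * s" by (auto simp: princ_def)
  then have "of_nat j * inverse x = of_nat n * s" using False by (simp add: field_simps)
  moreover have "of_nat n * s \<in> R" using s R_ring by simp
  ultimately have "of_nat j * inverse x \<in> R" by simp
  then show ?thesis using j(1) unfolding K_def by (auto intro!: exI[of _ j])
 qed (simp add: K_0)
qed (auto simp: K_1 K_diff K_mult)

end

section \<open>Local-global principle for powers with prime exponent\<close>

definition local_power :: "complex set \<Rightarrow> nat \<Rightarrow> nat \<Rightarrow> complex \<Rightarrow> bool" where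
 "local_power R q n e \<longleftrightarrow>
  (\<forall>M\<ge>1. coprime M q \<longrightarrow> (\<exists>z\<in>R. \<exists>r\<in>R. z ^ n - e = of_nat M * r))"

context num_order
begin

lemma princs_mono: "n \<le> m \<Longrightarrow> princs f n \<subseteq> princs f m"
 unfolding princs_def using idxle_mono by blast

lemma princs_idx: assumes "J \<in> princs f n" shows "idx R J \<ge> 1" "idx R J \<le> n" "idxle R J (idx R J)"
proof -
 have J: "idxle R J n" using assms by (auto simp: princs_def)
 have "R \<noteq> {}" using R_ring(1) by blast
 then show "idx R J \<ge> 1" using idx_pos[OF J] by simp
 show "idx R J \<le> n" using idx_le[OF J] .
 show "idxle R J (idx R J)" using idxle_idx[OF J] .
qed

text \<open>Linear growth of the count makes the sum of inverse indices diverge like the harmonic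
  series: n' is taken so large that the ideals beyond the first n number at least n' / (2 c), each
  of weight at least 1 / n'.\<close>

lemma princs_weight:
 assumes "f \<ge> 1"
 shows "\<exists>n. (\<Sum>J\<in>princs f n. 1 / real (idx R J)) \<ge> b0"
proof -
 obtain c N where c: "c > 0" "\<And>n. n \<ge> N \<Longrightarrow> n \<le> c * card (princs f n)"
  using princs_many[OF assms] by blast
 have step: "\<exists>n. (\<Sum>J\<in>princs f n. 1 / real (idx R J)) \<ge> real m / (2 * c)" for m :: nat
 proof (induction m)
  case 0
  show ?case by (auto intro!: sum_nonneg)
 next
  case (Suc m)
  then obtain n where n: "(\<Sum>J\<in>princs f n. 1 / real (idx R J)) \<ge> real m / (2 * c)" by blast
  define n' where "n' = Max {n, N, 2 * c * card (princs f n), 1}"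
  have n': "n' \<ge> n" "n' \<ge> N" "n' \<ge> 2 * c * card (princs f n)" "n' \<ge> 1" by (auto simp: n'_def)
  let ?D = "princs f n' - princs f n"
  have fin: "finite (princs f n')" "finite (princs f n)" by (rule princs_finite)+
  have "card ?D = card (princs f n') - card (princs f n)"
   using princs_mono[OF n'(1)] fin by (intro card_Diff_subset)
  then have "2 * c * card ?D = 2 * (c * card (princs f n')) - 2 * c * card (princs f n)"
   by (simp add: diff_mult_distrib2)
  moreover have "n' \<le> c * card (princs f n')" using c(2) n'(2) by blast
  ultimately have "n' \<le> 2 * c * card ?D" using n'(3) by linarith
  then have "real n' \<le> real (2 * c * card ?D)" by (simp only: of_nat_le_iff)
  then have D: "1 / (2 * real c) \<le> real (card ?D) / real n'" using c(1) n'(4) by (simp add: field_simps)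
  have "real (card ?D) * (1 / real n') \<le> (\<Sum>J\<in>?D. 1 / real (idx R J))"
  proof (rule sum_bounded_below)
   fix J assume "J \<in> ?D"
   then have "idx R J \<ge> 1" "idx R J \<le> n'" using princs_idx by blast+
   then show "1 / real n' \<le> 1 / real (idx R J)" by (intro divide_left_mono) auto
  qed
  then have "1 / (2 * real c) \<le> (\<Sum>J\<in>?D. 1 / real (idx R J))" using D by simp
  moreover have "(\<Sum>J\<in>princs f n'. 1 / real (idx R J)) = (\<Sum>J\<in>?D. 1 / real (idx R J)) + (\<Sum>J\<in>princs f n. 1 / real (idx R J))"
   using fin princs_mono[OF n'(1)] by (intro sum.subset_diff)
  moreover have "real (Suc m) / (2 * c) = 1 / (2 * real c) + real m / (2 * c)" by (simp add: add_divide_distrib)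
  ultimately show ?case using n by (intro exI[of _ n']) linarith
 qed
 obtain m :: nat where "real m \<ge> b0 * (2 * c)" using real_arch_simple by blast
 then have "real m / (2 * c) \<ge> b0" using c(1) by (simp add: field_simps)
 then show ?thesis using step[of m] by (meson order_trans)
qed

text \<open>If e has no q-th root in K, polynomials vanishing at y are multiples of X ^ q - e, so
  R[y] can be evaluated at z0 and at \<zeta> * z0 modulo J and J'. The pair (J, J') goes to the
  kernel of R[y] -> R/J x R/J', of index at most the product. One evaluation alone would yield O(n)
  ideals and no contradiction; with two, the divergent weight of J enters as a factor.\<close>

lemma local_power_prime:
 assumes q: "Factorial_Ring.prime (q::nat)" and z: "\<zeta> \<in> R" "\<zeta> ^ q = 1" "\<zeta> \<noteq> 1"
  and e: "e \<in> R" "e' \<in> R" "e * e' = 1" and loc: "local_power R q q e"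
 shows "\<exists>v\<in>K. v ^ q = e"
proof (rule ccontr)
 assume no: "\<not> (\<exists>v\<in>K. v ^ q = e)"
 have q1: "q \<ge> 1" "q > 0" using prime_ge_1_nat[OF q] by simp_all
 have e0: "e \<noteq> 0" using e(3) by auto
 have "card {y. y ^ q = e} = q" using e0 q1 by (intro card_nth_roots) auto
 then obtain y where y: "y ^ q = e" using q1 by (metis (mono_tags, lifting) Collect_empty_eq card.empty not_one_le_zero)
 have y0: "y \<noteq> 0" using y e0 q1 by auto
 define S where "S = adj R y"
 have "is_order S" unfolding S_def using adj_order[OF is_order_R q1(1)] y e by simp
 then obtain dS wS where "num_order S dS wS" using is_order_iff by blast
 then interpret S: num_order S dS wS .
 have bp: "coeffs_in R (binom_poly q e)" using binom_poly(4)[OF q1(1) sub e(1)] .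
 \<comment> \<open>Evaluation at x depends on the value at y only up to multiples of x ^ q -
   e.\<close>
 have welldef: "\<exists>r\<in>R. poly p x = (x ^ q - e) * r" if p: "coeffs_in R p" "poly p y = 0" and x: "x \<in> R" for p x
 proof -
  obtain h r where r: "coeffs_in R h" "coeffs_in R r" "p = binom_poly q e * h + r" "\<And>i. i \<ge> q \<Longrightarrow> Polynomial.coeff r i = 0"
   using coeffs_in_division[OF sub bp binom_poly(1)[OF q1(1)] p(1)] binom_poly(2)[OF q1(1)] by metis
  have "poly r y = 0" using r(3) p(2) binom_poly(3)[OF q1(1)] y by simp
  moreover have "coeffs_in K r" using r(2) R_sub_K by (auto simp: coeffs_in_def)
  moreover have "y ^ q \<in> K" using y e R_sub_K by simp
  ultimately have "r = 0" using root_independent[OF K_subfield q _ y0] no y r(4) by metis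
  then have "poly p x = (x ^ q - e) * poly h x" using r(3) binom_poly(3)[OF q1(1)] by simp
  then show ?thesis using coeffs_in_poly[OF sub r(1) x] by blast
 qed
 text \<open>q is invertible modulo the ideals counted by princs q, hence so is 1 - zeta.\<close>
 have qcancel: "x \<in> J" if "J \<in> princs q n" "x \<in> R" "of_nat q * x \<in> J" for x J n
 proof -
  obtain a b where a: "a \<in> R" "J = princ a" "b \<in> R" "a = 1 + of_nat q * b"
   using \<open>J \<in> princs q n\<close> unfolding princs_def by blast
  have J: "ideal_C J R" using princ_ideal a by blast
  have "x * a \<in> J" using a that(2) unfolding princ_def by (auto simp: mult.commute)
  moreover have "b * (of_nat q * x) \<in> J" using J a(3) that(3) by (auto simp: ideal_C_def)
  ultimately have "x * a - b * (of_nat q * x) \<in> J" using J by (auto simp: ideal_C_def)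
  then show ?thesis unfolding a(4) by (simp add: algebra_simps)
 qed
 \<comment> \<open>The cofactor of 1 - \<zeta> in q: each inner sum times 1 - \<zeta> is 1 - \<zeta>
   ^ i, and these add up to q.\<close>
 define wq where "wq = (\<Sum>i<q. \<Sum>j<i. \<zeta> ^ j)"
 have wR: "wq \<in> R" unfolding wq_def using z by (intro R_ring) auto
 have geo: "(1 - \<zeta>) * (\<Sum>j<n. \<zeta> ^ j) = 1 - \<zeta> ^ n" for n by (simp add: one_diff_power_eq)
 have "(\<Sum>j<q. \<zeta> ^ j) = 0" using geo[of q] z by simp
 then have "(\<Sum>i<q. 1 - \<zeta> ^ i) = of_nat q" by (simp add: sum_subtractf)
 then have wq: "(1 - \<zeta>) * wq = of_nat q" unfolding wq_def by (simp add: sum_distrib_left geo[symmetric])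
 have zcancel: "x \<in> J" if J: "J \<in> princs q n" "x \<in> R" "(1 - \<zeta>) * x \<in> J" for x J n
 proof (rule qcancel[OF J(1,2)])
  have "ideal_C J R" using J(1) princ_ideal by (auto simp: princs_def)
  then have "wq * ((1 - \<zeta>) * x) \<in> J" using J(3) wR by (auto simp: ideal_C_def)
  then show "of_nat q * x \<in> J" by (simp add: wq[symmetric] mult_ac)
 qed
 have Jideal: "ideal_C J R" if "J \<in> princs q n" for J n using that princ_ideal by (auto simp: princs_def)
 \<comment> \<open>One modulus prime to q that lies in all ideals of \<open>princs q N\<close> at
   once, so that a single local root z0 serves them all.\<close>
 define MM where "MM N = \<Prod>{j \<in> {1..N}. coprime j q}" for N :: nat
 have MM: "MM N \<ge> 1" "coprime (MM N) q" for N
  unfolding MM_def by (auto intro!: prod_coprime_left simp: Suc_le_eq prod_pos)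
 have MJ: "of_nat (MM N) \<in> J" if J: "J \<in> princs q N" for J N
 proof -
  have I: "ideal_C J R" using Jideal J .
  obtain j where j: "1 \<le> j" "j \<le> N" "of_nat j * 1 \<in> J"
   using idxle_multiple[of R J N 1] J I sub R_ring(2) by (auto simp: princs_def ideal_C_def)
  \<comment> \<open>Some integer up to N lies in J; its factors q can be cancelled, q being
    invertible modulo J.\<close>
  have strip: "\<exists>l. 1 \<le> l \<and> l \<le> j \<and> coprime l q \<and> of_nat l \<in> J" if "1 \<le> j" "of_nat j \<in> J" for j
   using that
  proof (induction j rule: less_induct)
   case (less j)
   show ?case
   proof (cases "q dvd j")
    case False
    then have "coprime j q" using prime_imp_coprime_nat[OF q] coprime_commute by blast
    then show ?thesis using less.prems by auto
   next
    case True
    then obtain l where l: "j = q * l" by (auto simp: dvd_def)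
    have "l \<noteq> 0" using l less.prems(1) by auto
    then have lj: "1 \<le> l" "l < j" using l n_less_m_mult_n[of l q] prime_gt_1_nat[OF q] by auto
    have "of_nat l \<in> J" using qcancel[OF J R_ring(8)] less.prems(2) l by simp
    then obtain l' where "1 \<le> l'" "l' \<le> l" "coprime l' q" "of_nat l' \<in> J" using less.IH[OF lj(2,1)] by blast
    then show ?thesis using lj by (intro exI[of _ l']) auto
   qed
  qed
  obtain l where l: "1 \<le> l" "l \<le> j" "coprime l q" "of_nat l \<in> J" using strip[OF j(1)] j(3) by auto
  have "l dvd MM N" unfolding MM_def using l j(2) by (intro dvd_prodI) auto
  then obtain k where k: "MM N = l * k" by (auto simp: dvd_def)
  have "of_nat k * of_nat l \<in> J" using I l(4) R_ring(8) by (auto simp: ideal_C_def)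
  then show ?thesis by (simp add: k mult.commute)
 qed
 obtain c N0 where c: "c > 0" "\<And>n. n \<ge> N0 \<Longrightarrow> n \<le> c * card (princs q n)"
  using princs_many[OF q1(1)] by blast
 obtain C where C: "\<And>n. finite {I. ideal_C I S \<and> idxle S I n}" "\<And>n. card {I. ideal_C I S \<and> idxle S I n} \<le> C * n"
  using S.ideals_bounded by blast
 obtain n where n: "(\<Sum>J\<in>princs q n. 1 / real (idx R J)) \<ge> 2 * real c * real C + 1" using princs_weight[OF q1(1)] by blast
 \<comment> \<open>N is large compared with n, so that N div idx J exceeds N0 for every J in
   \<open>princs q n\<close> and the linear lower bound applies to the second ideal.\<close>
 define N where "N = n * (N0 + 1)"
 define NJ where "NJ J = N div idx R J" for J
 have nN: "n \<le> N" by (simp add: N_def)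
 have NJ: "NJ J \<ge> N0" "real N / (2 * real (idx R J)) \<le> real (NJ J)" "idx R J * NJ J \<le> N" "NJ J \<le> N"
  if J: "J \<in> princs q n" for J
 proof -
  have i: "idx R J \<ge> 1" "idx R J \<le> n" using princs_idx[OF J] by auto
  have "N0 + 1 \<le> NJ J"
  proof -
   have "idx R J * (N0 + 1) \<le> N" unfolding N_def using i(2) by (intro mult_le_mono1)
   then show ?thesis unfolding NJ_def using i(1) by (simp add: less_eq_div_iff_mult_less_eq mult.commute)
  qed
  then show "NJ J \<ge> N0" by simp
  have g1: "NJ J \<ge> 1" using \<open>N0 + 1 \<le> NJ J\<close> by simp
  show "idx R J * NJ J \<le> N" unfolding NJ_def by simp
  show "NJ J \<le> N" unfolding NJ_def by simp
  have "N < idx R J * (NJ J + 1)" unfolding NJ_def using i(1) dividend_less_div_times[of "idx R J" N]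
   by (simp add: algebra_simps)
  also have "\<dots> \<le> idx R J * (2 * NJ J)" using g1 by (intro mult_le_mono2) simp
  finally have "real N \<le> real (idx R J * (2 * NJ J))" by (simp only: of_nat_le_iff less_imp_le)
  then show "real N / (2 * real (idx R J)) \<le> real (NJ J)" using i(1) by (simp add: field_simps)
 qed
 obtain z0 r0 where z0: "z0 \<in> R" "r0 \<in> R" "z0 ^ q - e = of_nat (MM N) * r0"
  using loc MM[of N] unfolding local_power_def by blast
 have z0cancel: "x \<in> J" if J: "J \<in> princs q N" "x \<in> R" "z0 * x \<in> J" for x J
 proof -
  have I: "ideal_C J R" using Jideal J(1) .
  have "(e' * z0 ^ (q - 1)) * (z0 * x) \<in> J" using I J(3) e z0 R_ring by (auto simp: ideal_C_def)
  moreover have "(e' * z0 ^ (q - 1)) * (z0 * x) = e' * (z0 ^ q) * x"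
   using q1 by (cases q) auto
  moreover have "z0 ^ q = e + of_nat (MM N) * r0" using z0(3) by (simp add: algebra_simps)
  ultimately have *: "x + (e' * r0 * x) * of_nat (MM N) \<in> J" using e(3) by (simp add: algebra_simps)
  have "(e' * r0 * x) * of_nat (MM N) \<in> J" using I MJ[OF J(1)] e z0 J(2) R_ring by (auto simp: ideal_C_def)
  then have "(x + (e' * r0 * x) * of_nat (MM N)) - (e' * r0 * x) * of_nat (MM N) \<in> J" using * I unfolding ideal_C_def by blast
  then show ?thesis by simp
 qed
 define z1 where "z1 = \<zeta> * z0"
 have z1: "z1 \<in> R" "z1 ^ q = z0 ^ q" using z z0 R_ring by (auto simp: z1_def power_mult_distrib)
 define II where "II = (\<lambda>(J, J'). {poly p y | p. coeffs_in R p \<and> poly p z0 \<in> J \<and> poly p z1 \<in> J'})"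
 \<comment> \<open>The exponents x ^ q and z0 ^ q agree for both evaluation points, and z0 ^ q - e
   is a multiple of \<open>MM N\<close>, hence in J.\<close>
 have evJ: "poly p x \<in> J" if ev: "coeffs_in R p" "coeffs_in R p'" "poly p y = poly p' y" "poly p' x \<in> J"
   "J \<in> princs q N" "x \<in> R" "x ^ q = z0 ^ q" for p p' x J
 proof -
  have I: "ideal_C J R" using Jideal ev(5) .
  have "coeffs_in R (p - p')" "poly (p - p') y = 0" using ev coeffs_in_diff[OF sub] by auto
  then obtain r where r: "r \<in> R" "poly (p - p') x = (x ^ q - e) * r" using welldef ev(6) by blast
  have "poly p x - poly p' x = (r0 * r) * of_nat (MM N)" using r(2) z0(3) ev(7) by (simp add: mult_ac)
  moreover have "(r0 * r) * of_nat (MM N) \<in> J" using I MJ[OF ev(5)] z0 r R_ring by (auto simp: ideal_C_def)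
  ultimately have "poly p x - poly p' x \<in> J" by simp
  moreover have "0 - poly p' x \<in> J" using I ev(4) unfolding ideal_C_def by blast
  ultimately have "(poly p x - poly p' x) - (0 - poly p' x) \<in> J" using I unfolding ideal_C_def by blast
  then show ?thesis by simp
 qed
 have II: "ideal_C (II (J, J')) S \<and> idxle S (II (J, J')) (m * m')"
  if J: "J \<in> princs q N" "J' \<in> princs q N" and m: "idxle R J m" "idxle R J' m'" for J J' m m'
 proof
  have I: "ideal_C J R" "ideal_C J' R" using Jideal J by blast+
  note I' = I[unfolded ideal_C_def]
  show "ideal_C (II (J, J')) S"
   unfolding ideal_C_def
  proof (intro conjI ballI)
   show "0 \<in> II (J, J')" unfolding II_def using coeffs_in_0[OF sub] I' by (auto intro!: exI[of _ 0])
   show "II (J, J') \<subseteq> S" by (auto simp: II_def S_def adj_def)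
  next
   fix x1 x2 assume "x1 \<in> II (J, J')" "x2 \<in> II (J, J')"
   then obtain p1 p2 where p: "x1 = poly p1 y" "coeffs_in R p1" "poly p1 z0 \<in> J" "poly p1 z1 \<in> J'"
     "x2 = poly p2 y" "coeffs_in R p2" "poly p2 z0 \<in> J" "poly p2 z1 \<in> J'" by (auto simp: II_def)
   have "x1 - x2 = poly (p1 - p2) y" "coeffs_in R (p1 - p2)" "poly (p1 - p2) z0 \<in> J" "poly (p1 - p2) z1 \<in> J'"
    using p I' coeffs_in_diff[OF sub p(2,6)] by auto
   then show "x1 - x2 \<in> II (J, J')" unfolding II_def by blast
  next
   fix s x assume "s \<in> S" "x \<in> II (J, J')"
   then obtain t p where p: "s = poly t y" "coeffs_in R t" "x = poly p y" "coeffs_in R p" "poly p z0 \<in> J" "poly p z1 \<in> J'"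
    by (auto simp: II_def S_def adj_def)
   have "poly t z0 \<in> R" "poly t z1 \<in> R" using coeffs_in_poly[OF sub p(2)] z0 z1 by auto
   then have "s * x = poly (t * p) y" "coeffs_in R (t * p)" "poly (t * p) z0 \<in> J" "poly (t * p) z1 \<in> J'"
    using p I' coeffs_in_mult[OF sub p(2,4)] by auto
   then show "s * x \<in> II (J, J')" unfolding II_def by blast
  qed
  have "\<forall>s. \<exists>p. s \<in> S \<longrightarrow> coeffs_in R p \<and> s = poly p y" by (auto simp: S_def adj_def)
  from choice[OF this] obtain P where P: "\<And>s. s \<in> S \<Longrightarrow> coeffs_in R (P s) \<and> s = poly (P s) y" by blast
  obtain f :: "complex \<Rightarrow> nat" where f: "\<forall>x\<in>R. f x < m" "\<forall>x\<in>R. \<forall>y\<in>R. f x = f y \<longrightarrow> x - y \<in> J"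
   using m(1) unfolding idxle_def by blast
  obtain g :: "complex \<Rightarrow> nat" where g: "\<forall>x\<in>R. g x < m'" "\<forall>x\<in>R. \<forall>y\<in>R. g x = g y \<longrightarrow> x - y \<in> J'"
   using m(2) unfolding idxle_def by blast
  have ev: "poly (P s) z0 \<in> R" "poly (P s) z1 \<in> R" if "s \<in> S" for s
   using coeffs_in_poly[OF sub] P[OF that] z0 z1 by blast+
  show "idxle S (II (J, J')) (m * m')"
   unfolding idxle_def
  proof (intro exI[of _ "\<lambda>s. f (poly (P s) z0) * m' + g (poly (P s) z1)"] conjI ballI impI)
   fix s assume s: "s \<in> S"
   have fs: "f (poly (P s) z0) < m" and gs: "g (poly (P s) z1) < m'" using f g ev[OF s] by auto
   have "f (poly (P s) z0) * m' + g (poly (P s) z1) < (f (poly (P s) z0) + 1) * m'" using gs by simp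
   also have "\<dots> \<le> m * m'" using fs by (intro mult_le_mono1) simp
   finally show "f (poly (P s) z0) * m' + g (poly (P s) z1) < m * m'" .
  next
   fix s t assume st: "s \<in> S" "t \<in> S"
    and eq: "f (poly (P s) z0) * m' + g (poly (P s) z1) = f (poly (P t) z0) * m' + g (poly (P t) z1)"
   have gs: "g (poly (P s) z1) < m'" "g (poly (P t) z1) < m'" using g ev st by auto
   then have "(f (poly (P s) z0) * m' + g (poly (P s) z1)) div m' = f (poly (P s) z0)"
    "(f (poly (P t) z0) * m' + g (poly (P t) z1)) div m' = f (poly (P t) z0)" by auto
   then have fe: "f (poly (P s) z0) = f (poly (P t) z0)" using eq by metis
   then have ge: "g (poly (P s) z1) = g (poly (P t) z1)" using eq by simp
   have "s - t = poly (P s - P t) y" using P st by (metis poly_diff)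
   moreover have "coeffs_in R (P s - P t)" using P st coeffs_in_diff[OF sub] by blast
   moreover have "poly (P s - P t) z0 \<in> J" "poly (P s - P t) z1 \<in> J'"
    using f(2) g(2) fe ge ev st by auto
   ultimately show "s - t \<in> II (J, J')" unfolding II_def by blast
  qed
 qed
 text \<open>r lies in J iff r times y - z1 lies in II (J, J'), and similarly for J'; so II is injective.\<close>
 have rec: "(\<exists>p. r * (y - b) = poly p y \<and> coeffs_in R p \<and> poly p a \<in> L \<and> poly p b \<in> L') \<longleftrightarrow> r \<in> L"
  if r: "r \<in> R" and ab: "(a, b) = (z0, z1) \<or> (a, b) = (z1, z0)" and L: "L \<in> princs q N" "L' \<in> princs q N" for r a b L L'
 proof -
  have I: "ideal_C L R" "ideal_C L' R" using Jideal L by blast+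
  have c: "a \<in> R" "b \<in> R" "a ^ q = z0 ^ q" using ab z0 z1 by auto
  let ?p = "[:- (r * b), r:]"
  have p: "coeffs_in R ?p" "poly ?p y = r * (y - b)" "poly ?p a = (a - b) * r" "poly ?p b = 0"
   using r c R_ring by (auto simp: algebra_simps intro!: coeffs_in_pCons coeffs_in_0 sub)
  have n: "- x \<in> L" if "x \<in> L" for x using I(1) that unfolding ideal_C_def by (metis diff_0)
  show ?thesis
  proof
   assume "\<exists>p. r * (y - b) = poly p y \<and> coeffs_in R p \<and> poly p a \<in> L \<and> poly p b \<in> L'"
   then obtain p' where p': "r * (y - b) = poly p' y" "coeffs_in R p'" "poly p' a \<in> L" by blast
   have "(a - b) * r \<in> L" using evJ[OF p(1) p'(2) _ p'(3) L(1) c(1,3)] p(2,3) p'(1) by simp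
   \<comment> \<open>Up to sign, a - b is z0 * (1 - \<zeta>), and both factors can be cancelled
     modulo L.\<close>
   then have "z0 * ((1 - \<zeta>) * r) \<in> L" using ab n[of "(a - b) * r"] by (auto simp: z1_def algebra_simps)
   then have "(1 - \<zeta>) * r \<in> L" using z0cancel[OF L(1)] r z R_ring by simp
   then show "r \<in> L" using zcancel[OF L(1) r] by blast
  next
   assume "r \<in> L"
   then have "poly ?p a \<in> L" unfolding p(3) using I(1) R_ring(5)[OF c(1,2)] by (auto simp: ideal_C_def)
   moreover have "poly ?p b \<in> L'" unfolding p(4) using I(2) by (simp add: ideal_C_def)
   ultimately show "\<exists>p. r * (y - b) = poly p y \<and> coeffs_in R p \<and> poly p a \<in> L \<and> poly p b \<in> L'"
    using p(1) p(2)[symmetric] by blast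
  qed
 qed
 have rec0: "r * (y - z1) \<in> II (J, J') \<longleftrightarrow> r \<in> J" "r * (y - z0) \<in> II (J, J') \<longleftrightarrow> r \<in> J'"
  if "r \<in> R" "J \<in> princs q N" "J' \<in> princs q N" for r J J'
  using rec[OF that(1) _ that(2,3), of z0 z1] rec[OF that(1) _ that(3,2), of z1 z0] by (auto simp: II_def)
 have inR: "J \<subseteq> R" if "J \<in> princs q N" for J using Jideal[OF that] by (auto simp: ideal_C_def)
 define PP where "PP = Sigma (princs q n) (\<lambda>J. princs q (NJ J))"
 have PPN: "J \<in> princs q N" "J' \<in> princs q N" if "(J, J') \<in> PP" for J J'
 proof -
  have J: "J \<in> princs q n" "J' \<in> princs q (NJ J)" using that by (auto simp: PP_def)
  show "J \<in> princs q N" using princs_mono[OF nN] J(1) by blast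
  show "J' \<in> princs q N" using princs_mono[OF NJ(4)[OF J(1)]] J(2) by blast
 qed
 have inj: "inj_on II PP"
 proof (rule inj_onI, clarify)
  fix J J' L L' assume a: "(J, J') \<in> PP" "(L, L') \<in> PP" "II (J, J') = II (L, L')"
  note p = PPN[OF a(1)] PPN[OF a(2)]
  have "r \<in> J \<longleftrightarrow> r \<in> L" "r \<in> J' \<longleftrightarrow> r \<in> L'" if "r \<in> R" for r
   using rec0[OF that p(1,2)] rec0[OF that p(3,4)] a(3) by auto
  then show "J = L \<and> J' = L'" using inR[OF p(1)] inR[OF p(2)] inR[OF p(3)] inR[OF p(4)] by blast
 qed
 have "II ` PP \<subseteq> {I. ideal_C I S \<and> idxle S I N}"
 proof clarify
  fix J J' assume JJ: "(J, J') \<in> PP"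
  then have J: "J \<in> princs q n" "J' \<in> princs q (NJ J)" by (auto simp: PP_def)
  have "idxle R J (idx R J)" "idxle R J' (NJ J)" using princs_idx[OF J(1)] J(2) by (auto simp: princs_def)
  then have "ideal_C (II (J, J')) S \<and> idxle S (II (J, J')) (idx R J * NJ J)" using II PPN[OF JJ] by blast
  then show "ideal_C (II (J, J')) S \<and> idxle S (II (J, J')) N" using idxle_mono NJ(3)[OF J(1)] by blast
 qed
 from card_mono[OF C(1) this] have "card (II ` PP) \<le> C * N" using C(2)[of N] by linarith
 then have "card PP \<le> C * N" using card_image[OF inj] by simp
 moreover have "card PP = (\<Sum>J\<in>princs q n. card (princs q (NJ J)))"
  unfolding PP_def using princs_finite by (intro card_SigmaI) auto
 ultimately have "(\<Sum>J\<in>princs q n. card (princs q (NJ J))) \<le> C * N" by simp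
 then have up: "(\<Sum>J\<in>princs q n. real (card (princs q (NJ J)))) \<le> real C * real N"
  by (metis of_nat_le_iff of_nat_mult of_nat_sum)
 \<comment> \<open>Every J admits at least N / (2 c idx J) ideals J'. As the weight of
   \<open>princs q n\<close> is at least 2 c C + 1, the pairs outnumber the C * N ideals of
   S.\<close>
 have "(real N / (2 * real c)) * (\<Sum>J\<in>princs q n. 1 / real (idx R J)) = (\<Sum>J\<in>princs q n. (real N / (2 * real (idx R J))) / real c)"
  unfolding sum_distrib_left by (intro sum.cong) auto
 also have "\<dots> \<le> (\<Sum>J\<in>princs q n. real (card (princs q (NJ J))))"
 proof (rule sum_mono)
  fix J assume J: "J \<in> princs q n"
  have "real (NJ J) \<le> real (c * card (princs q (NJ J)))" using c(2)[OF NJ(1)[OF J]] by (simp only: of_nat_le_iff)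
  then have "real N / (2 * real (idx R J)) \<le> real c * real (card (princs q (NJ J)))" using NJ(2)[OF J] by simp
  then show "real N / (2 * real (idx R J)) / real c \<le> real (card (princs q (NJ J)))"
   using c(1) pos_divide_le_eq[of "real c" "real N / (2 * real (idx R J))" "real (card (princs q (NJ J)))"]
   by (simp only: of_nat_0_less_iff mult.commute)
 qed
 finally have "(real N / (2 * real c)) * (\<Sum>J\<in>princs q n. 1 / real (idx R J)) \<le> real C * real N" using up by linarith
 moreover have "(real N / (2 * real c)) * (2 * real c * real C + 1) \<le> (real N / (2 * real c)) * (\<Sum>J\<in>princs q n. 1 / real (idx R J))"
  using n by (intro mult_left_mono) auto
 ultimately have "(real N / (2 * real c)) * (2 * real c * real C + 1) \<le> real C * real N" by linarith
 then have "real N / (2 * real c) \<le> 0" using c(1) by (simp add: field_simps)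
 moreover have "n \<noteq> 0"
 proof
  assume "n = 0"
  then have "princs q n = {}" using princs_idx[of _ q n] by fastforce
  then have "2 * real c * real C + 1 \<le> 0" using n by simp
  moreover have "0 \<le> 2 * real c * real C" by simp
  ultimately show False by linarith
 qed
 then have "N > 0" by (simp add: N_def)
 ultimately show False using c(1) by (simp add: divide_le_0_iff)
qed

end

text \<open>The field \<open>K\<close> without reference to a basis, so that it can be compared
  along extensions of orders.\<close>

definition frac :: "complex set \<Rightarrow> complex set" where
 "frac R = {x. \<exists>n>0. of_nat n * x \<in> R}"

lemma (in num_order) K_frac: "K = frac R" by (simp add: K_def frac_def)

lemma frac_subfield: "is_order R \<Longrightarrow> subfield_C (frac R)"
 using is_order_iff num_order.K_subfield num_order.K_frac by metis

lemma order_subring: "is_order R \<Longrightarrow> subring_C R" by (simp add: is_order_def)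

lemma frac_subring: "is_order R \<Longrightarrow> subring_C (frac R)"
 using frac_subfield by (simp add: subfield_C_def)

lemma frac_inverse: "is_order R \<Longrightarrow> x \<in> frac R \<Longrightarrow> inverse x \<in> frac R"
 using frac_subfield by (simp add: subfield_C_def)

lemma frac_superset: "x \<in> R \<Longrightarrow> x \<in> frac R"
 unfolding frac_def by (auto intro!: exI[of _ 1])

lemma frac_mono: "R \<subseteq> R' \<Longrightarrow> frac R \<subseteq> frac R'"
 unfolding frac_def by blast

lemma adj_mono: "R \<subseteq> R' \<Longrightarrow> adj R y \<subseteq> adj R' y"
 unfolding adj_def using coeffs_in_mono by blast

lemma adj_subset: assumes "subring_C R'" "R \<subseteq> R'" "y \<in> R'" shows "adj R y \<subseteq> R'"
proof
 fix x assume "x \<in> adj R y"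
 then obtain p where "coeffs_in R p" "x = poly p y" by (auto simp: adj_def)
 then show "x \<in> R'" using coeffs_in_poly[OF assms(1) coeffs_in_mono[OF _ assms(2)] assms(3)] by blast
qed

lemma frac_frac: assumes "of_nat n * x \<in> frac R" "n > 0" shows "x \<in> frac R"
proof -
 obtain m where "m > 0" "of_nat m * (of_nat n * x) \<in> R" using assms(1) by (auto simp: frac_def)
 then have "m * n > 0" "of_nat (m * n) * x \<in> R" using assms(2) by (simp_all add: mult.assoc)
 then show ?thesis unfolding frac_def by blast
qed

lemma frac_adj_same: assumes "is_order R" "y \<in> frac R" shows "frac (adj R y) = frac R"
proof
 have "adj R y \<subseteq> frac R" using adj_subset[OF frac_subring[OF assms(1)] _ assms(2)] frac_superset by blast
 then show "frac (adj R y) \<subseteq> frac R" using frac_frac by (auto simp: frac_def[of "adj R y"])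
 show "frac R \<subseteq> frac (adj R y)"
  using adj_superset[OF order_subring[OF assms(1)]] by (intro frac_mono) blast
qed

text \<open>Only an integer denominator has to be inverted, so an element of the field of fractions
  of R[y] is already a polynomial in y over \<open>frac R\<close>.\<close>

lemma frac_adj_adj: assumes "is_order R" "w \<in> frac (adj R y)" shows "w \<in> adj (frac R) y"
proof -
 obtain n where n: "n > 0" "of_nat n * w \<in> adj R y" using assms(2) by (auto simp: frac_def)
 have s: "subring_C (adj (frac R) y)" using adj_subring frac_subring assms(1) by blast
 have "of_nat n * w \<in> adj (frac R) y" using n(2) adj_mono[of R "frac R" y] frac_superset by blast
 moreover have "inverse (of_nat n) \<in> frac R"
  using frac_inverse[OF assms(1), of "of_nat n"] ringC(8)[OF frac_subring[OF assms(1)]] by blast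
 then have "inverse (of_nat n) \<in> adj (frac R) y" using adj_superset frac_subring assms(1) by blast
 ultimately have "inverse (of_nat n) * (of_nat n * w) \<in> adj (frac R) y" using ringC(6)[OF s] by blast
 then show ?thesis using n(1) by (simp add: mult.assoc[symmetric])
qed

lemma local_power_prime_order:
 assumes "is_order R" "Factorial_Ring.prime (q::nat)" "\<zeta> \<in> R" "\<zeta> ^ q = 1" "\<zeta> \<noteq> 1"
  "e \<in> R" "e' \<in> R" "e * e' = 1" "local_power R q q e"
 obtains v where "v \<in> frac R" "v ^ q = e"
proof -
 obtain d w where "num_order R d w" using assms(1) is_order_iff by blast
 then interpret num_order R d w .
 show ?thesis using local_power_prime[OF assms(2-9)] that K_frac by blast
qed

section \<open>Congruences modulo integers\<close>

definition cg :: "complex set \<Rightarrow> nat \<Rightarrow> complex \<Rightarrow> complex \<Rightarrow> bool" where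
 "cg R M x y \<longleftrightarrow> (\<exists>r\<in>R. x - y = of_nat M * r)"

context
 fixes R :: "complex set" and M :: nat assumes R: "subring_C R"
begin

lemma cg_refl: "cg R M x x"
 unfolding cg_def using ringC(1)[OF R] by (intro bexI[of _ 0]) auto

lemma cg_sym: assumes "cg R M x y" shows "cg R M y x"
proof -
 obtain r where "r \<in> R" "x - y = of_nat M * r" using assms by (auto simp: cg_def)
 then have "y - x = of_nat M * (- r)" "- r \<in> R" using ringC(3)[OF R] by (auto simp: algebra_simps)
 then show ?thesis unfolding cg_def by blast
qed

lemma cg_trans: assumes "cg R M x y" "cg R M y z" shows "cg R M x z"
proof -
 obtain r s where "r \<in> R" "x - y = of_nat M * r" "s \<in> R" "y - z = of_nat M * s" using assms by (auto simp: cg_def)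
 then have "x - z = of_nat M * (r + s)" "r + s \<in> R" using ringC(4)[OF R] by (auto simp: algebra_simps)
 then show ?thesis unfolding cg_def by blast
qed

lemma cg_add: assumes "cg R M x y" "cg R M x' y'" shows "cg R M (x + x') (y + y')"
proof -
 obtain r s where "r \<in> R" "x - y = of_nat M * r" "s \<in> R" "x' - y' = of_nat M * s" using assms by (auto simp: cg_def)
 then have "(x + x') - (y + y') = of_nat M * (r + s)" "r + s \<in> R" using ringC(4)[OF R] by (auto simp: algebra_simps)
 then show ?thesis unfolding cg_def by blast
qed

lemma cg_mult: assumes "cg R M x y" "cg R M x' y'" "x' \<in> R" "y \<in> R" shows "cg R M (x * x') (y * y')"
proof -
 obtain r s where rs: "r \<in> R" "x - y = of_nat M * r" "s \<in> R" "x' - y' = of_nat M * s" using assms by (auto simp: cg_def)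
 have "x * x' - y * y' = (x - y) * x' + y * (x' - y')" by (simp add: algebra_simps)
 also have "\<dots> = of_nat M * (r * x' + y * s)" unfolding rs by (simp add: algebra_simps)
 finally have "x * x' - y * y' = of_nat M * (r * x' + y * s)" .
 moreover have "r * x' + y * s \<in> R" using rs assms by (simp add: ringC[OF R])
 ultimately show ?thesis unfolding cg_def by blast
qed

lemma cg_lmult: "cg R M x y \<Longrightarrow> z \<in> R \<Longrightarrow> cg R M (z * x) (z * y)"
proof -
 assume "cg R M x y" "z \<in> R"
 then obtain r where "r \<in> R" "x - y = of_nat M * r" by (auto simp: cg_def)
 then have "z * x - z * y = of_nat M * (z * r)" "z * r \<in> R"
  using \<open>z \<in> R\<close> ringC(6)[OF R] by (auto simp: right_diff_distrib[symmetric])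
 then show ?thesis unfolding cg_def by blast
qed

lemma cg_power: assumes "cg R M x y" "x \<in> R" "y \<in> R" shows "cg R M (x ^ n) (y ^ n)"
proof (induction n)
 case (Suc n)
 then show ?case using cg_mult[OF assms(1) Suc] assms ringC(7)[OF R] by simp
qed (simp add: cg_refl)

lemma cg_sum: "(\<And>i. i \<in> I \<Longrightarrow> cg R M (f i) (g i)) \<Longrightarrow> cg R M (\<Sum>i\<in>I. f i) (\<Sum>i\<in>I. g i)"
 by (induction I rule: infinite_finite_induct) (auto simp: cg_refl cg_add)

end

section \<open>Roots of unity and prime power exponents\<close>

lemma local_power_cg: "local_power R q n e \<longleftrightarrow> (\<forall>M\<ge>1. coprime M q \<longrightarrow> (\<exists>z\<in>R. cg R M (z ^ n) e))"
 by (simp add: local_power_def cg_def)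

lemma power_swap: "((x::complex) ^ a) ^ b = (x ^ b) ^ a"
 by (simp only: power_mult[symmetric] mult.commute)

text \<open>For l prime to q, a Bezout relation would turn \<xi> ^ l = 1 into \<xi> = 1.\<close>

lemma root_of_unity_power_neq_1:
 fixes \<xi> :: complex
 assumes q: "Factorial_Ring.prime (q::nat)" and x: "\<xi> ^ q = 1" "\<xi> \<noteq> 1" and l: "\<not> q dvd l"
 shows "\<xi> ^ l \<noteq> 1"
proof
 assume 1: "\<xi> ^ l = 1"
 have "coprime l q" using prime_imp_coprime_nat[OF q l] coprime_commute by blast
 moreover have "l \<noteq> 0" using l by (cases l) auto
 ultimately obtain a b where ab: "a * l = b * q + 1"
  using coprime_bezout_strong[of l q] q prime_gt_1_nat by (metis mult.commute nat_neq_iff)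
 have "\<xi> ^ (a * l) = (\<xi> ^ l) ^ a" by (simp add: power_mult power_swap[of _ l])
 moreover have "\<xi> ^ (b * q + 1) = (\<xi> ^ q) ^ b * \<xi>" by (simp add: power_mult power_swap[of _ q])
 ultimately show False using ab 1 x by simp
qed

lemma roots_of_unity_powers:
 fixes \<xi> :: complex
 assumes q: "Factorial_Ring.prime (q::nat)" and x: "\<xi> ^ q = 1" "\<xi> \<noteq> 1" and u: "u ^ q = 1"
 obtains b where "b < q" "u = \<xi> ^ b"
proof -
 have q0: "q > 0" using prime_gt_0_nat[OF q] .
 have x0: "\<xi> \<noteq> 0" using x q0 by (auto simp: zero_power)
 have inj: "inj_on (\<lambda>b. \<xi> ^ b) {..<q}"
 proof (rule linorder_inj_onI')
  fix i j assume ij: "i \<in> {..<q}" "j \<in> {..<q}" "i < j"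
  show "\<xi> ^ i \<noteq> \<xi> ^ j"
  proof
   assume "\<xi> ^ i = \<xi> ^ j"
   moreover have "\<xi> ^ j = \<xi> ^ i * \<xi> ^ (j - i)" using ij by (simp add: power_add[symmetric])
   ultimately have "\<xi> ^ (j - i) = 1" using x0 by simp
   moreover have "\<not> q dvd j - i" using ij by (intro nat_dvd_not_less) auto
   ultimately show False using root_of_unity_power_neq_1[OF q x] by blast
  qed
 qed
 have "(\<lambda>b. \<xi> ^ b) ` {..<q} \<subseteq> {z. z ^ q = 1}"
  using x(1) by (auto simp: power_swap[of \<xi> _ q])
 moreover have "card ((\<lambda>b. \<xi> ^ b) ` {..<q}) = card {z::complex. z ^ q = 1}"
  using card_image[OF inj] card_roots_unity_eq[OF q0] by simp
 ultimately have "(\<lambda>b. \<xi> ^ b) ` {..<q} = {z. z ^ q = 1}"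
  using finite_roots_unity[of q] q0 by (intro card_subset_eq) simp_all
 then show ?thesis using u that by blast
qed

text \<open>An element eps with eps^q = 1 modulo M is the combination of the idempotents idm i (on which it
 acts as xi^i), so that replacing xi by a root of xi produces a root of eps modulo M.\<close>

lemma torsion_local_root:
 assumes R: "subring_C R" and q: "Factorial_Ring.prime (q::nat)" and M: "coprime M q"
  and z: "\<zeta> \<in> R" and xi: "\<xi> = \<zeta> ^ m" "\<xi> ^ q = 1" "\<xi> \<noteq> 1"
  and eps: "\<epsilon> \<in> R" "cg R M (\<epsilon> ^ q) 1"
 shows "\<exists>\<tau>\<in>R. cg R M (\<tau> ^ m) \<epsilon>"
proof -
 note Rr = ringC[OF R]
 note cgs = cg_refl[OF R] cg_sym[OF R] cg_trans[OF R] cg_add[OF R] cg_lmult[OF R] cg_power[OF R] cg_sum[OF R]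
 have q0: "q > 0" "q > 1" using prime_gt_1_nat[OF q] by auto
 have xiR: "\<xi> \<in> R" using z Rr by (simp add: xi(1))
 define \<xi>' where "\<xi>' = \<xi> ^ (q - 1)"
 have xi': "\<xi>' \<in> R" "\<xi> * \<xi>' = 1" 
  using Rr(7)[OF xiR] xi(2) power_minus_mult[OF q0(1), of \<xi>] by (simp_all add: \<xi>'_def mult.commute)
 have xi'q: "\<xi>' ^ q = 1" unfolding \<xi>'_def using xi(2) by (simp add: power_swap[of \<xi> _ q])
 have geo0: "(\<Sum>l<q. u ^ l) = 0" if "u ^ q = 1" "u \<noteq> 1" for u :: complex
  using one_diff_power_eq[of u q] that by simp
 obtain h l :: int where h: "h * int q + l * int M = 1"
 proof -
  have "gcd (int q) (int M) = 1" using M by (simp add: coprime_commute)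
  then show ?thesis using that bezout_int[of "int q" "int M"] by metis
 qed
 have hq: "cg R M (of_int h * of_nat q) 1"
 proof -
  define k where "k = - l"
  have "h * int q - 1 = int M * k" using h by (simp add: k_def algebra_simps)
  then have "(of_int (h * int q - 1) :: complex) = of_int (int M * k)" by (rule arg_cong)
  then have "of_int h * of_nat q - 1 = of_nat M * (of_int k :: complex)" by simp
  then show ?thesis unfolding cg_def using Rr(9) by blast
 qed
 define t where "t i = \<xi>' ^ i * \<epsilon>" for i :: nat
 \<comment> \<open>Fourier projector onto the part where \<epsilon> acts as \<xi> ^ i; the integer h
   stands for 1 / q, which exists modulo M.\<close>
 define idm where "idm i = of_int h * (\<Sum>l<q. t i ^ l)" for i :: nat
 have tR: "t i \<in> R" for i using xi' eps Rr by (simp add: t_def)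
 have idR: "idm i \<in> R" for i unfolding idm_def by (intro Rr(6) Rr(9) Rr(11) Rr(7) tR)
 have tq: "cg R M (t i ^ q) 1" for i
 proof -
  have "t i ^ q = \<epsilon> ^ q" unfolding t_def power_mult_distrib by (simp add: power_swap[of \<xi>' _ q] xi'q)
  then show ?thesis using eps by simp
 qed
 have tid: "cg R M (t i * idm i) (idm i)" for i
 proof -
  have "(\<Sum>l<Suc q. t i ^ l) = 1 + (\<Sum>l<q. t i ^ Suc l)" by (subst sum.lessThan_Suc_shift) simp
  then have "1 + t i * (\<Sum>l<q. t i ^ l) = (\<Sum>l<q. t i ^ l) + t i ^ q" by (simp add: sum_distrib_left)
  then have "t i * (\<Sum>l<q. t i ^ l) = (\<Sum>l<q. t i ^ l) + (t i ^ q - 1)" by (simp add: algebra_simps)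
  moreover have "t i * idm i = of_int h * (t i * (\<Sum>l<q. t i ^ l))" by (simp add: idm_def)
  ultimately have "t i * idm i - idm i = of_int h * (t i ^ q - 1)"
   by (simp only: idm_def ring_distribs) (simp add: algebra_simps)
  moreover have "cg R M (of_int h * (t i ^ q)) (of_int h * 1)" by (intro cgs(5) tq Rr(9))
  ultimately show ?thesis unfolding cg_def by (simp only: right_diff_distrib)
 qed
 have eid: "cg R M (\<epsilon> * idm i) (\<xi> ^ i * idm i)" for i
 proof -
  have "\<xi> ^ i * (t i * idm i) = (\<xi> * \<xi>') ^ i * (\<epsilon> * idm i)" by (simp add: t_def power_mult_distrib mult_ac)
  then have "\<xi> ^ i * (t i * idm i) = \<epsilon> * idm i" using xi' by simp
  then show ?thesis using cgs(5)[OF tid[of i] Rr(7)[OF xiR, of i]] by (simp only:)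
 qed
 have epow: "cg R M (\<epsilon> ^ n * idm i) ((\<xi> ^ i) ^ n * idm i)" for n i
 proof (induction n)
  case 0 then show ?case by (simp add: cgs(1))
 next
  case (Suc n)
  have "cg R M (\<epsilon> * (\<epsilon> ^ n * idm i)) (\<epsilon> * ((\<xi> ^ i) ^ n * idm i))" using cgs(5)[OF Suc] eps by blast
  moreover have "\<epsilon> * ((\<xi> ^ i) ^ n * idm i) = (\<xi> ^ i) ^ n * (\<epsilon> * idm i)" by (simp add: mult_ac)
  moreover have "cg R M ((\<xi> ^ i) ^ n * (\<epsilon> * idm i)) ((\<xi> ^ i) ^ n * (\<xi> ^ i * idm i))"
   by (intro cgs(5) eid Rr(7) xiR)
  ultimately have "cg R M (\<epsilon> * (\<epsilon> ^ n * idm i)) ((\<xi> ^ i) ^ n * (\<xi> ^ i * idm i))"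
   using cgs(3) by metis
  then show ?case by (simp add: mult_ac)
 qed
 \<comment> \<open>As \<epsilon> acts on the i-th part by \<xi> ^ i, the product is h times a
   geometric sum in a q-th root of unity u, which is q or 0.\<close>
 have orth: "cg R M (idm j * idm i) (if i = j then idm i else 0)" if ij: "i < q" "j < q" for i j
 proof -
  define u where "u = \<xi>' ^ j * \<xi> ^ i"
  have uq: "u ^ q = 1" unfolding u_def power_mult_distrib
   by (simp add: power_swap[of _ _ q] xi'q xi(2))
  have "idm j * idm i = of_int h * (\<Sum>l<q. (\<xi>' ^ j) ^ l * (\<epsilon> ^ l * idm i))"
   unfolding idm_def[of j] t_def by (simp add: sum_distrib_left sum_distrib_right power_mult_distrib power_mult mult_ac)
  moreover have "cg R M (of_int h * (\<Sum>l<q. (\<xi>' ^ j) ^ l * (\<epsilon> ^ l * idm i))) (of_int h * (\<Sum>l<q. (\<xi>' ^ j) ^ l * ((\<xi> ^ i) ^ l * idm i)))"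
   by (intro cgs(5) cgs(7) epow Rr(9) Rr(7) xi'(1))
  moreover have "(\<Sum>l<q. (\<xi>' ^ j) ^ l * ((\<xi> ^ i) ^ l * idm i)) = (\<Sum>l<q. u ^ l) * idm i"
   unfolding u_def sum_distrib_right power_mult_distrib by (simp add: mult.assoc)
  ultimately have *: "cg R M (idm j * idm i) (of_int h * ((\<Sum>l<q. u ^ l) * idm i))" by simp
  show ?thesis
  proof (cases "i = j")
   case True
   have "u = (\<xi> * \<xi>') ^ i" unfolding u_def True power_mult_distrib by simp
   then have "u = 1" using xi' by simp
   then have e: "of_int h * ((\<Sum>l<q. u ^ l) * idm i) = idm i * (of_int h * of_nat q)" by simp
   have "cg R M (idm i * (of_int h * of_nat q)) (idm i * 1)" using cgs(5)[OF hq idR] .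
   then show ?thesis using cgs(3)[OF *[unfolded e]] True by simp
  next
   case False
   have "u \<noteq> 1"
   proof
    assume "u = 1"
    then have "\<xi> ^ j * u = \<xi> ^ j" by simp
    moreover have "\<xi> ^ j * u = (\<xi> * \<xi>') ^ j * \<xi> ^ i" unfolding u_def power_mult_distrib by (simp add: mult_ac)
    ultimately have "\<xi> ^ i = \<xi> ^ j" using xi' by simp
    moreover have "\<xi> \<noteq> 0" using xi(2) q0 by (auto simp: zero_power)
    ultimately have "\<xi> ^ (max i j - min i j) = 1" by (auto simp: max_def min_def power_diff)
    moreover have "\<not> q dvd max i j - min i j" using False ij by (intro nat_dvd_not_less) auto
    ultimately show False using root_of_unity_power_neq_1[OF q xi(2,3)] by blast
   qed
   then show ?thesis using * False geo0[OF uq] by simp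
  qed
 qed
 have one: "cg R M (\<Sum>i<q. idm i) 1"
 proof -
  have "(\<Sum>i<q. idm i) = of_int h * (\<Sum>l<q. \<epsilon> ^ l * (\<Sum>i<q. (\<xi>' ^ l) ^ i))"
  proof -
   have "(\<Sum>i<q. idm i) = of_int h * (\<Sum>i<q. \<Sum>l<q. t i ^ l)" by (simp add: idm_def sum_distrib_left)
   also have "(\<Sum>i<q. \<Sum>l<q. t i ^ l) = (\<Sum>l<q. \<Sum>i<q. t i ^ l)" by (rule sum.swap)
   also have "\<dots> = (\<Sum>l<q. \<epsilon> ^ l * (\<Sum>i<q. (\<xi>' ^ l) ^ i))"
   proof (rule sum.cong)
    fix l :: nat
    have "t i ^ l = \<epsilon> ^ l * (\<xi>' ^ l) ^ i" for i
     unfolding t_def power_mult_distrib by (metis power_swap mult.commute)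
    then show "(\<Sum>i<q. t i ^ l) = \<epsilon> ^ l * (\<Sum>i<q. (\<xi>' ^ l) ^ i)" by (simp add: sum_distrib_left)
   qed simp
   finally show ?thesis .
  qed
  also have "(\<Sum>l<q. \<epsilon> ^ l * (\<Sum>i<q. (\<xi>' ^ l) ^ i)) = (\<Sum>l<q. if l = 0 then of_nat q else 0)"
  proof (rule sum.cong)
   fix l assume l: "l \<in> {..<q}"
   show "\<epsilon> ^ l * (\<Sum>i<q. (\<xi>' ^ l) ^ i) = (if l = 0 then of_nat q else 0)"
   proof (cases "l = 0")
    case False
    have "\<xi>' \<noteq> 1" using xi' xi(3) by auto
    moreover have "\<not> q dvd l" using l False by (intro nat_dvd_not_less) auto
    ultimately have "\<xi>' ^ l \<noteq> 1" using root_of_unity_power_neq_1[OF q xi'q] by blast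
    moreover have "(\<xi>' ^ l) ^ q = 1" by (simp add: power_swap[of \<xi>' _ q] xi'q)
    ultimately show ?thesis using geo0 False by simp
   qed simp
  qed simp
  also have "\<dots> = of_nat q" using q0 by (simp add: sum.delta)
  finally show ?thesis using hq by simp
 qed
 define \<tau> where "\<tau> = (\<Sum>j<q. \<zeta> ^ j * idm j)"
 have tauR: "\<tau> \<in> R" unfolding \<tau>_def by (intro Rr(6) Rr(11) Rr(7) z idR)
 have tauid: "cg R M (\<tau> * idm i) (\<zeta> ^ i * idm i)" if i: "i < q" for i
 proof -
  have "\<tau> * idm i = (\<Sum>j<q. \<zeta> ^ j * (idm j * idm i))" by (simp add: \<tau>_def sum_distrib_right mult.assoc)
  moreover have "cg R M (\<Sum>j<q. \<zeta> ^ j * (idm j * idm i)) (\<Sum>j<q. \<zeta> ^ j * (if i = j then idm i else 0))"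
   by (intro cgs(7) cgs(5) orth Rr(7) z i) simp
  moreover have "(\<Sum>j<q. \<zeta> ^ j * (if i = j then idm i else 0)) = (\<Sum>j<q. if i = j then \<zeta> ^ j * idm i else 0)"
   by (intro sum.cong) auto
  then have "(\<Sum>j<q. \<zeta> ^ j * (if i = j then idm i else 0)) = \<zeta> ^ i * idm i" using i by (simp add: sum.delta)
  ultimately show ?thesis by simp
 qed
 have taupow: "cg R M (\<tau> ^ n * idm i) ((\<zeta> ^ i) ^ n * idm i)" if i: "i < q" for n i
 proof (induction n)
  case 0 then show ?case by (simp add: cgs(1))
 next
  case (Suc n)
  have "cg R M (\<tau> * (\<tau> ^ n * idm i)) (\<tau> * ((\<zeta> ^ i) ^ n * idm i))" using cgs(5)[OF Suc] tauR by blast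
  moreover have "\<tau> * ((\<zeta> ^ i) ^ n * idm i) = (\<zeta> ^ i) ^ n * (\<tau> * idm i)" by (simp add: mult_ac)
  moreover have "cg R M ((\<zeta> ^ i) ^ n * (\<tau> * idm i)) ((\<zeta> ^ i) ^ n * (\<zeta> ^ i * idm i))"
   by (intro cgs(5) tauid[OF i] Rr(7) z)
  ultimately have "cg R M (\<tau> * (\<tau> ^ n * idm i)) ((\<zeta> ^ i) ^ n * (\<zeta> ^ i * idm i))"
   using cgs(3) by metis
  then show ?case by (simp add: mult_ac)
 qed
 have "cg R M (\<tau> ^ m * (\<Sum>i<q. idm i)) (\<tau> ^ m * 1)" by (intro cgs(5) one Rr(7) tauR)
 then have "cg R M (\<Sum>i<q. \<tau> ^ m * idm i) (\<tau> ^ m)" by (simp add: sum_distrib_left)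
 then have 1: "cg R M (\<tau> ^ m) (\<Sum>i<q. \<tau> ^ m * idm i)" by (rule cgs(2))
 have 2: "cg R M (\<Sum>i<q. \<tau> ^ m * idm i) (\<Sum>i<q. \<xi> ^ i * idm i)"
 proof (rule cgs(7))
  fix i assume "i \<in> {..<q}"
  moreover have "(\<zeta> ^ i) ^ m = \<xi> ^ i" unfolding xi(1) by (rule power_swap)
  ultimately show "cg R M (\<tau> ^ m * idm i) (\<xi> ^ i * idm i)" using taupow[of i m] by simp
 qed
 have 3: "cg R M (\<Sum>i<q. \<xi> ^ i * idm i) (\<Sum>i<q. \<epsilon> * idm i)"
  by (intro cgs(7) cgs(2)[OF eid])
 have 4: "cg R M (\<Sum>i<q. \<epsilon> * idm i) (\<epsilon> * 1)"
  unfolding sum_distrib_left[symmetric] by (rule cgs(5)[OF one eps(1)])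
 have "cg R M (\<tau> ^ m) (\<epsilon> * 1)" by (rule cgs(3)[OF 1 cgs(3)[OF 2 cgs(3)[OF 3 4]]])
 then show ?thesis using tauR by auto
qed

text \<open>Let y be a q-th root of e in the field of fractions. If z ^ (q ^ Suc k) is congruent to
  e, then y / z ^ (q ^ k) is a q-th root of unity modulo M, and \<open>torsion_local_root\<close>
  makes it a q ^ k-th power. So y is a local q ^ k-th power in R[y], which has the same field of
  fractions. The primitive root \<zeta> in R excludes the exceptional cases.\<close>

lemma local_prime_power:
 assumes q: "Factorial_Ring.prime (q::nat)"
 shows "is_order R \<Longrightarrow> \<zeta> \<in> R \<Longrightarrow> \<zeta> ^ (q ^ k) = 1 \<Longrightarrow> (k > 0 \<longrightarrow> \<zeta> ^ (q ^ (k - 1)) \<noteq> 1) \<Longrightarrow>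
  e \<in> R \<Longrightarrow> e' \<in> R \<Longrightarrow> e * e' = 1 \<Longrightarrow> local_power R q (q ^ k) e \<Longrightarrow> \<exists>v\<in>frac R. v ^ (q ^ k) = e"
proof (induction k arbitrary: R \<zeta> e e')
 case 0
 then show ?case using frac_superset by auto
next
 case (Suc k)
 have sub: "subring_C R" using Suc.prems order_subring by blast
 note Rr = ringC[OF sub]
 define \<xi> where "\<xi> = \<zeta> ^ (q ^ k)"
 have xi: "\<xi> \<in> R" "\<xi> ^ q = 1" "\<xi> \<noteq> 1"
  using Suc.prems(3,4) Rr(7)[OF Suc.prems(2)] by (simp_all add: \<xi>_def power_mult[symmetric] mult.commute)
 have q0: "q \<ge> 1" "q > 1" using prime_gt_1_nat[OF q] by auto
 have "local_power R q q e"
  unfolding local_power_cg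
 proof (intro allI impI)
  fix M :: nat assume "M \<ge> 1" "coprime M q"
  then obtain z where z: "z \<in> R" "cg R M (z ^ (q ^ Suc k)) e" using Suc.prems unfolding local_power_cg by blast
  moreover have "z ^ (q ^ Suc k) = (z ^ (q ^ k)) ^ q" by (simp add: power_mult[symmetric] mult.commute)
  ultimately have "cg R M ((z ^ (q ^ k)) ^ q) e" by simp
  then show "\<exists>z\<in>R. cg R M (z ^ q) e" using Rr(7)[OF z(1)] by blast
 qed
 then obtain y where y: "y \<in> frac R" "y ^ q = e"
  using local_power_prime_order[OF Suc.prems(1) q xi Suc.prems(5-7)] by blast
 define S where "S = adj R y"
 have S: "is_order S" unfolding S_def using adj_order[OF Suc.prems(1) q0(1)] y Suc.prems(5) by simp
 have Ss: "subring_C S" using S order_subring by blast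
 note Sr = ringC[OF Ss]
 have RS: "r \<in> R \<Longrightarrow> r \<in> S" for r unfolding S_def by (rule adj_superset[OF sub])
 have yS: "y \<in> S" unfolding S_def by (rule adj_gen[OF sub])
 define y' where "y' = y ^ (q - 1) * e'"
 have y': "y' \<in> S" "y * y' = 1"
 proof -
  show "y' \<in> S" unfolding y'_def by (intro Sr(6) Sr(7) yS RS Suc.prems(6))
  have "y * y ^ (q - 1) = e" using power_minus_mult[of q y] q0 y(2) by (simp add: mult.commute)
  then show "y * y' = 1" using Suc.prems(7) by (simp add: y'_def mult.assoc[symmetric])
 qed
 have "local_power S q (q ^ k) y"
  unfolding local_power_cg
 proof (intro allI impI)
  fix M :: nat assume M: "M \<ge> 1" "coprime M q"
  define n where "n = q ^ Suc k"
  have n: "n \<ge> 1" using q0 by (simp add: n_def)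
  obtain z where z: "z \<in> R" "cg R M (z ^ n) e" using Suc.prems M unfolding local_power_cg n_def by blast
  have zS: "z \<in> S" using z RS by blast
  have z2: "cg S M (z ^ n) e" using z(2) RS unfolding cg_def by blast
  \<comment> \<open>An inverse of z modulo M, since z ^ n is congruent to e and e * e' = 1.\<close>
  define zi where "zi = z ^ (n - 1) * e'"
  have ziS: "zi \<in> S" using zS RS Suc.prems(6) Sr by (simp add: zi_def)
  have zzi: "cg S M (z * zi) 1"
  proof -
   have "e' * z ^ n = z * zi" using power_minus_mult[of n z] n by (simp add: zi_def mult_ac)
   then show ?thesis using cg_lmult[OF Ss z2, of e'] RS Suc.prems(6,7) by (simp add: mult.commute)
  qed
  \<comment> \<open>The discrepancy between y and the approximate root z ^ (q ^ k).\<close>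
  define \<epsilon> where "\<epsilon> = y * zi ^ (q ^ k)"
  have eS: "\<epsilon> \<in> S" using yS ziS Sr by (simp add: \<epsilon>_def)
  have "\<epsilon> ^ q = e * zi ^ n" unfolding \<epsilon>_def n_def power_mult_distrib y(2) by (simp add: power_mult[symmetric] mult.commute)
  moreover have "cg S M (zi ^ n * z ^ n) (zi ^ n * e)" by (intro cg_lmult[OF Ss] z2 Sr(7) ziS)
  moreover have "cg S M ((z * zi) ^ n) (1 ^ n)" by (intro cg_power[OF Ss] zzi Sr(6) zS ziS Sr(2))
  ultimately have "cg S M (zi ^ n * z ^ n) (\<epsilon> ^ q)" "cg S M (zi ^ n * z ^ n) 1"
   by (simp_all add: power_mult_distrib mult.commute)
  then have "cg S M (\<epsilon> ^ q) 1" using cg_sym[OF Ss] cg_trans[OF Ss] by blast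
  then obtain \<tau> where tau: "\<tau> \<in> S" "cg S M (\<tau> ^ (q ^ k)) \<epsilon>"
   using torsion_local_root[OF Ss q M(2) RS[OF Suc.prems(2)] \<xi>_def xi(2,3) eS] by blast
  have "cg S M (z ^ (q ^ k) * \<tau> ^ (q ^ k)) (z ^ (q ^ k) * \<epsilon>)" by (intro cg_lmult[OF Ss] tau(2) Sr(7) zS)
  moreover have "z ^ (q ^ k) * \<epsilon> = y * (z * zi) ^ (q ^ k)" by (simp add: \<epsilon>_def power_mult_distrib mult_ac)
  moreover have "cg S M (y * (z * zi) ^ (q ^ k)) (y * 1 ^ (q ^ k))"
   by (intro cg_lmult[OF Ss] cg_power[OF Ss] zzi yS Sr(6) Sr(2) zS ziS)
  ultimately have "cg S M (z ^ (q ^ k) * \<tau> ^ (q ^ k)) (y * 1 ^ (q ^ k))" using cg_trans[OF Ss] by metis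
  then have "cg S M ((z * \<tau>) ^ (q ^ k)) y" by (simp add: power_mult_distrib)
  then show "\<exists>z\<in>S. cg S M (z ^ q ^ k) y" using Sr(6)[OF zS tau(1)] by blast
 qed
 moreover have "\<zeta> ^ q \<in> S" using RS Suc.prems(2) Sr by simp
 moreover have "(\<zeta> ^ q) ^ (q ^ k) = 1" using Suc.prems(3) by (simp add: power_mult)
 moreover have "k > 0 \<longrightarrow> (\<zeta> ^ q) ^ (q ^ (k - 1)) \<noteq> 1"
 proof
  assume "k > 0"
  then have "q * q ^ (k - 1) = q ^ k" using power_minus_mult[of k q] by (simp add: mult.commute)
  then show "(\<zeta> ^ q) ^ (q ^ (k - 1)) \<noteq> 1" using Suc.prems(4) by (simp add: power_mult[symmetric])
 qed
 ultimately obtain v where v: "v \<in> frac S" "v ^ (q ^ k) = y"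
  using Suc.IH[OF S _ _ _ yS y'] by blast
 have "v \<in> frac R" using v(1) frac_adj_same[OF Suc.prems(1) y(1)] S_def by simp
 moreover have "v ^ (q ^ Suc k) = e" using v(2) y(2) by (metis power_Suc2 power_mult)
 ultimately show ?case by blast
qed

section \<open>Chevalley's theorem\<close>

definition mspan :: "nat \<Rightarrow> (nat \<Rightarrow> complex) \<Rightarrow> complex set" where
 "mspan e g = range (\<lambda>k::nat \<Rightarrow> int. \<Prod>i<e. g i powi k i)"

lemma mspanE:
 assumes "x \<in> mspan e g"
 obtains k :: "nat \<Rightarrow> int" where "x = (\<Prod>i<e. g i powi k i)"
 using assms by (auto simp: mspan_def)

lemma mspanI: "x = (\<Prod>i<e. g i powi k i) \<Longrightarrow> x \<in> mspan e g"
 by (auto simp: mspan_def)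

context
 fixes e :: nat and g :: "nat \<Rightarrow> complex"
 assumes nz: "\<And>i. i < e \<Longrightarrow> g i \<noteq> 0"
begin

lemma mspan_1: "1 \<in> mspan e g"
 by (rule mspanI[where k = "\<lambda>_. 0"]) simp

lemma mspan_mult: assumes "x \<in> mspan e g" "y \<in> mspan e g" shows "x * y \<in> mspan e g"
proof -
 obtain k l :: "nat \<Rightarrow> int" where "x = (\<Prod>i<e. g i powi k i)" "y = (\<Prod>i<e. g i powi l i)"
  using assms by (metis mspanE)
 then have "x * y = (\<Prod>i<e. g i powi (k i + l i))" using nz by (simp add: prod.distrib[symmetric] power_int_add)
 then show ?thesis by (rule mspanI)
qed

lemma mspan_inverse: assumes "x \<in> mspan e g" shows "inverse x \<in> mspan e g"
proof -
 obtain k :: "nat \<Rightarrow> int" where "x = (\<Prod>i<e. g i powi k i)" using assms by (rule mspanE)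
 then have "inverse x = (\<Prod>i<e. g i powi (- k i))"
  by (simp add: prod_inversef[symmetric] power_int_minus comp_def)
 then show ?thesis by (rule mspanI)
qed

lemma mspan_power: "x \<in> mspan e g \<Longrightarrow> x ^ n \<in> mspan e g"
 by (induction n) (auto simp: mspan_1 mspan_mult)

lemma mspan_nonzero: "x \<in> mspan e g \<Longrightarrow> x \<noteq> 0"
 using nz by (auto simp: mspan_def)

lemma mspan_subset: assumes "subring_C R" "\<And>i. i < e \<Longrightarrow> g i \<in> R \<and> inverse (g i) \<in> R" shows "mspan e g \<subseteq> R"
proof
 fix x assume "x \<in> mspan e g"
 then obtain k :: "nat \<Rightarrow> int" where x: "x = (\<Prod>i<e. g i powi k i)" by (rule mspanE)
 have "g i powi k i \<in> R" if "i < e" for i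
 proof (cases "k i \<ge> 0")
  case True
  then have "g i powi k i = g i ^ nat (k i)" by (simp add: power_int_def)
  then show ?thesis using assms that by (simp add: ringC(7))
 next
  case False
  then have "g i powi k i = inverse (g i) ^ nat (- k i)" by (simp add: power_int_def)
  then show ?thesis using assms that by (simp add: ringC(7))
 qed
 then show "x \<in> R" unfolding x by (intro ringC(12)[OF assms(1)]) simp
qed

text \<open>Division of the exponents with remainder: what stays outside the n-th power has
  exponents below n, whatever x is.\<close>

lemma mspan_division:
 assumes "x \<in> mspan e g" "n \<ge> 1"
 obtains u b where "u \<in> mspan e g" "\<And>i. b i < n" "x = u ^ n * (\<Prod>i<e. g i ^ b i)"
proof -
 obtain k :: "nat \<Rightarrow> int" where x: "x = (\<Prod>i<e. g i powi k i)" using assms(1) by (rule mspanE)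
 define u where "u = (\<Prod>i<e. g i powi (k i div int n))"
 define b where "b i = nat (k i mod int n)" for i
 have "g i powi k i = (g i powi (k i div int n)) ^ n * g i ^ b i" if "i < e" for i
 proof -
  have "k i = (k i div int n) * int n + int (b i)" using assms(2) by (simp add: b_def)
  then have "g i powi k i = g i powi ((k i div int n) * int n) * g i powi int (b i)"
   using power_int_add[of "g i"] nz[OF that] by metis
  then show ?thesis by (simp add: power_int_mult)
 qed
 then have "x = u ^ n * (\<Prod>i<e. g i ^ b i)"
  unfolding x u_def by (simp add: prod.distrib[symmetric] prod_power_distrib)
 moreover have "u \<in> mspan e g" unfolding u_def by (rule mspanI) simp
 moreover have "b i < n" for i using assms(2) by (simp add: b_def nat_less_iff)
 ultimately show ?thesis using that by blast
qed

lemma mspan_power_reps: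
 assumes "n \<ge> 1"
 obtains P where "finite P" "P \<subseteq> mspan e g" "\<And>x. x \<in> mspan e g \<Longrightarrow> \<exists>p\<in>P. \<exists>u\<in>mspan e g. x = p * u ^ n"
proof -
 define P where "P = (\<lambda>b. \<Prod>i<e. g i ^ b i) ` (Pi\<^sub>E {..<e} (\<lambda>_. {..<n}))"
 have "finite P" unfolding P_def by (intro finite_imageI finite_PiE) auto
 moreover have "P \<subseteq> mspan e g" 
 proof -
  have "(\<Prod>i<e. g i ^ b i) \<in> mspan e g" for b by (rule mspanI[where k = "\<lambda>i. int (b i)"]) simp
  then show ?thesis unfolding P_def by blast
 qed
 moreover have "\<exists>p\<in>P. \<exists>u\<in>mspan e g. x = p * u ^ n" if "x \<in> mspan e g" for x
 proof -
  obtain u b where u: "u \<in> mspan e g" "\<And>i. b i < n" "x = u ^ n * (\<Prod>i<e. g i ^ b i)"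
   using mspan_division[OF \<open>x \<in> mspan e g\<close> assms] by metis
  have "(\<Prod>i<e. g i ^ b i) = (\<Prod>i<e. g i ^ (restrict b {..<e}) i)" by simp
  moreover have "restrict b {..<e} \<in> Pi\<^sub>E {..<e} (\<lambda>_. {..<n})" using u(2) by simp
  ultimately have "(\<Prod>i<e. g i ^ b i) \<in> P" unfolding P_def by blast
  then show ?thesis using u by (metis mult.commute)
 qed
 ultimately show ?thesis using that by blast
qed

end

lemma mspan_group:
 assumes "\<forall>i<e. g i \<noteq> 0"
 shows "1 \<in> mspan e g" "x \<in> mspan e g \<Longrightarrow> y \<in> mspan e g \<Longrightarrow> x * y \<in> mspan e g"
  "x \<in> mspan e g \<Longrightarrow> inverse x \<in> mspan e g" "x \<in> mspan e g \<Longrightarrow> x ^ n \<in> mspan e g"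
  "x \<in> mspan e g \<Longrightarrow> x \<noteq> 0"
 using mspan_1[of e g] mspan_mult[of e g] mspan_inverse[of e g] mspan_power[of e g] mspan_nonzero[of e g] assms by blast+

section \<open>Integral elements of bounded growth\<close>

context num_order
begin

text \<open>Bounded denominators of all powers amount to integrality over the integers, without a
  polynomial equation.\<close>

definition integral_K :: "complex \<Rightarrow> bool" where
 "integral_K y \<longleftrightarrow> (\<exists>l>0. \<forall>n. of_nat l * y ^ n \<in> R)"

text \<open>The exponential growth rate of the powers bounds all conjugates of y by c, without any
  embeddings of the field.\<close>

definition grow :: "rat \<Rightarrow> complex \<Rightarrow> bool" where
 "grow c y \<longleftrightarrow> y \<in> K \<and> (\<exists>A. \<forall>n. nm (y ^ n) \<le> A * c ^ n)"

lemma growE: assumes "grow c y" obtains A where "A \<ge> 0" "\<And>n. nm (y ^ n) \<le> A * c ^ n" "y \<in> K"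
proof -
 obtain A where A: "\<And>n. nm (y ^ n) \<le> A * c ^ n" "y \<in> K" using assms by (auto simp: grow_def)
 have "0 \<le> A" using A(1)[of 0] nm_nonneg[of "y ^ 0"] by simp
 then show ?thesis using that A by blast
qed

text \<open>By the binomial theorem the factors A and B, together with \<open>Cn\<close>, are
  absorbed into the new constant, while the rates simply add.\<close>

lemma grow_add:
 assumes "grow c x" "grow c' y" "c \<ge> 0" "c' \<ge> 0"
 shows "grow (c + c') (x + y)"
proof -
 obtain A where A: "A \<ge> 0" "\<And>n. nm (x ^ n) \<le> A * c ^ n" "x \<in> K" using assms(1) by (rule growE) blast
 obtain B where B: "B \<ge> 0" "\<And>n. nm (y ^ n) \<le> B * c' ^ n" "y \<in> K" using assms(2) by (rule growE) blast
 have "nm ((x + y) ^ n) \<le> (of_nat Cn * A * B) * (c + c') ^ n" for n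
 proof -
  have inK: "x ^ k * y ^ (n - k) \<in> K" for k using A(3) B(3) K_mult K_power by blast
  have inK': "of_nat (n choose k) * (x ^ k * y ^ (n - k)) \<in> K" for k
   using K_scale[OF inK, of "of_nat (n choose k)"] by simp
  have "nm ((x + y) ^ n) = nm (\<Sum>k\<le>n. of_nat (n choose k) * (x ^ k * y ^ (n - k)))"
   by (simp add: binomial_ring mult.assoc)
  also have "\<dots> \<le> (\<Sum>k\<le>n. nm (of_nat (n choose k) * (x ^ k * y ^ (n - k))))"
   using nm_sum[of "{..n}" "\<lambda>k. of_nat (n choose k) * (x ^ k * y ^ (n - k))"] inK' by simp
  also have "\<dots> \<le> (\<Sum>k\<le>n. (of_nat Cn * A * B) * (of_nat (n choose k) * c ^ k * c' ^ (n - k)))"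
  proof (rule sum_mono)
   fix k
   have "nm (of_nat (n choose k) * (x ^ k * y ^ (n - k))) = of_nat (n choose k) * nm (x ^ k * y ^ (n - k))"
    using nm_of_nat_mult[OF inK] .
   also have "nm (x ^ k * y ^ (n - k)) \<le> of_nat Cn * nm (x ^ k) * nm (y ^ (n - k))"
    using nm_mult' K_power A(3) B(3) by blast
   also have "\<dots> \<le> of_nat Cn * (A * c ^ k) * (B * c' ^ (n - k))"
    using A B assms nm_nonneg by (intro mult_mono mult_nonneg_nonneg) auto
   finally have "nm (of_nat (n choose k) * (x ^ k * y ^ (n - k))) \<le> of_nat (n choose k) * (of_nat Cn * (A * c ^ k) * (B * c' ^ (n - k)))"
    by (simp only: mult_left_mono of_nat_0_le_iff)
   then show "nm (of_nat (n choose k) * (x ^ k * y ^ (n - k))) \<le> (of_nat Cn * A * B) * (of_nat (n choose k) * c ^ k * c' ^ (n - k))"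
    by (simp only: mult_ac)
  qed
  also have "\<dots> = (of_nat Cn * A * B) * (c + c') ^ n"
   by (simp add: binomial_ring sum_distrib_left)
  finally show ?thesis .
 qed
 then show ?thesis unfolding grow_def using K_add A(3) B(3) by blast
qed

lemma grow_scale: assumes "grow c x" shows "grow (\<bar>r\<bar> * c) (of_rat r * x)"
proof -
 obtain A where A: "\<And>n. nm (x ^ n) \<le> A * c ^ n" "x \<in> K" using assms by (rule growE) blast
 have "nm ((of_rat r * x) ^ n) \<le> A * (\<bar>r\<bar> * c) ^ n" for n
 proof -
  have "(of_rat r * x) ^ n = of_rat (r ^ n) * x ^ n" by (simp add: power_mult_distrib of_rat_power)
  then have "nm ((of_rat r * x) ^ n) = \<bar>r\<bar> ^ n * nm (x ^ n)"
   using nm_scale[OF K_power[OF A(2)]] by (simp add: power_abs)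
  also have "\<dots> \<le> \<bar>r\<bar> ^ n * (A * c ^ n)" using A(1) by (intro mult_left_mono) auto
  finally show ?thesis by (simp add: power_mult_distrib mult_ac)
 qed
 then show ?thesis unfolding grow_def using K_scale[OF A(2)] by blast
qed

lemma grow_nm: assumes "x \<in> K" "of_nat Cn * nm x \<le> c" shows "grow c x"
proof -
 have c0: "0 \<le> c" using assms(2) nm_nonneg[of x] by (meson mult_nonneg_nonneg of_nat_0_le_iff order_trans)
 have "nm (x ^ n) \<le> nm 1 * c ^ n" for n
 proof (induction n)
  case (Suc n)
  have "nm (x ^ Suc n) \<le> of_nat Cn * nm x * nm (x ^ n)" using nm_mult'[OF assms(1) K_power[OF assms(1)]] by simp
  also have "\<dots> \<le> c * (nm 1 * c ^ n)" using Suc assms(2) c0 nm_nonneg by (intro mult_mono) auto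
  finally show ?case by (simp add: mult_ac)
 qed simp
 then show ?thesis using assms(1) by (auto simp: grow_def)
qed

text \<open>The powers of y, multiplied by the fixed denominator l, lie in R and eventually have
  height below 1, so they vanish.\<close>

lemma integral_small:
 assumes "integral_K y" "grow (1/2) y"
 shows "y = 0"
proof -
 obtain l where l: "l > 0" "\<And>n. of_nat l * y ^ n \<in> R" using assms(1) by (auto simp: integral_K_def)
 obtain A where A: "A \<ge> 0" "\<And>n. nm (y ^ n) \<le> A * (1/2) ^ n" "y \<in> K" using assms(2) by (rule growE) blast
 obtain n :: nat where n: "of_nat l * A < of_nat n" using reals_Archimedean2 by blast
 have "(of_nat n :: rat) < 2 ^ n" using of_nat_less_two_power by blast
 then have lt: "of_nat l * A < 2 ^ n" using n by (rule less_trans[rotated])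
 have "nm (of_nat l * y ^ n) = of_nat l * nm (y ^ n)" using nm_of_nat_mult K_power[OF A(3)] by blast
 also have "\<dots> \<le> of_nat l * (A * (1/2) ^ n)" using A(2) by (intro mult_left_mono) auto
 also have "\<dots> < 1" using lt by (simp add: power_one_over field_simps)
 finally have "nm (of_nat l * y ^ n) < 1" .
 then have "of_nat l * y ^ n = 0" using nm_R_ge1[OF l(2)[of n]] by force
 then show ?thesis using l(1) by simp
qed

lemma integral_diff:
 assumes "integral_K x" "integral_K y"
 shows "integral_K (x - y)"
proof -
 obtain l where l: "l > 0" "\<And>n. of_nat l * x ^ n \<in> R" using assms(1) by (auto simp: integral_K_def)
 obtain m where m: "m > 0" "\<And>n. of_nat m * y ^ n \<in> R" using assms(2) by (auto simp: integral_K_def)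
 have "of_nat (l * m) * (x - y) ^ n \<in> R" for n
 proof -
  have "(x - y) ^ n = (\<Sum>k\<le>n. of_nat (n choose k) * x ^ k * (- y) ^ (n - k))"
   using binomial_ring[of x "- y" n] by simp
  then have "of_nat (l * m) * (x - y) ^ n = (\<Sum>k\<le>n. of_nat (n choose k) * (- 1) ^ (n - k) * ((of_nat l * x ^ k) * (of_nat m * y ^ (n - k))))"
   by (simp add: sum_distrib_left power_minus[of y] mult_ac)
  also have "\<dots> \<in> R" by (intro R_ring(11) R_ring(6) R_ring(7) R_ring(8) R_ring(3) R_ring(2) l m)
  finally show ?thesis .
 qed
 then show ?thesis unfolding integral_K_def using l(1) m(1) by (intro exI[of _ "l * m"]) auto
qed

text \<open>If y had a huge coordinate, Dirichlet's box principle would yield a nonzero element of the order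
 near a small multiple of y, whose powers tend to zero.\<close>

lemma integral_grow_bounded:
 assumes y: "integral_K y" "grow c y" and c: "c \<ge> 0"
 shows "nm y \<le> 4 * of_nat ((4 * Cn) ^ d) * c"
proof (rule ccontr)
 assume big: "\<not> nm y \<le> 4 * of_nat ((4 * Cn) ^ d) * c"
 \<comment> \<open>With Q = 4 * Cn, height 1 / Q forces growth rate 1/4 (\<open>grow_nm\<close>).
   The threshold 4 * Q ^ d * c makes the other summand, k / H times y, grow at rate at most 1/4 as
   well.\<close>
 define Q where "Q = 4 * Cn"
 have Q: "Q \<ge> 4" using Cn by (simp add: Q_def)
 define H where "H = nm y"
 have yK: "y \<in> K" using y(2) by (simp add: grow_def)
 have "0 \<le> 4 * of_nat ((4 * Cn) ^ d) * c" using c by (intro mult_nonneg_nonneg) auto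
 moreover have "4 * of_nat ((4 * Cn) ^ d) * c < nm y" using big by (simp only: not_le)
 ultimately have H: "H > 0" "H > 4 * of_nat (Q ^ d) * c" unfolding H_def Q_def by linarith+
 define x where "x i = co y i / H" for i
 \<comment> \<open>The cell of side 1 / Q containing the fractional parts of k x: Q ^ d cells for Q
   ^ d + 1 multiples.\<close>
 define b where "b k = restrict (\<lambda>i. nat \<lfloor>of_nat Q * Archimedean_Field.frac (of_nat k * x i)\<rfloor>) {..<d}" for k :: nat
 have "b ` {..Q ^ d} \<subseteq> Pi\<^sub>E {..<d} (\<lambda>_. {..<Q})"
 proof (clarsimp simp: b_def)
  fix k i
  have "of_nat Q * Archimedean_Field.frac (of_nat k * x i) < of_nat Q * 1"
   using Q frac_lt_1 by (intro mult_strict_left_mono) auto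
  moreover have "0 \<le> of_nat Q * Archimedean_Field.frac (of_nat k * x i)" by (intro mult_nonneg_nonneg) auto
  ultimately show "nat \<lfloor>of_nat Q * Archimedean_Field.frac (of_nat k * x i)\<rfloor> < Q"
   using floor_less_iff[of "of_nat Q * Archimedean_Field.frac (of_nat k * x i)" "int Q"] by (simp add: nat_less_iff)
 qed
 moreover have "finite (Pi\<^sub>E {..<d} (\<lambda>_. {..<Q}))" by (intro finite_PiE) auto
 ultimately have "card (b ` {..Q ^ d}) \<le> card (Pi\<^sub>E {..<d} (\<lambda>_. {..<Q}))" by (intro card_mono)
 also have "\<dots> = Q ^ d" by (simp add: card_PiE)
 also have "\<dots> < card {..Q ^ d}" by simp
 finally have "\<not> inj_on b {..Q ^ d}" by (rule pigeonhole)
 then obtain k1 k2 where k12: "k1 \<in> {..Q ^ d}" "k2 \<in> {..Q ^ d}" "b k1 = b k2" "k1 < k2"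
  unfolding inj_on_def by (metis linorder_neqE_nat)
 define k where "k = k2 - k1"
 define n where "n i = \<lfloor>of_nat k2 * x i\<rfloor> - \<lfloor>of_nat k1 * x i\<rfloor>" for i
 have k: "k \<ge> 1" "k \<le> Q ^ d" "k2 = k + k1" using k12 by (auto simp: k_def)
 have close: "\<bar>of_int (n i) - of_nat k * x i\<bar> \<le> 1 / of_nat Q" if i: "i < d" for i
 proof -
  define f1 f2 where "f1 = Archimedean_Field.frac (of_nat k1 * x i)" and "f2 = Archimedean_Field.frac (of_nat k2 * x i)"
  have e: "of_int (n i) - of_nat k * x i = f1 - f2"
   by (simp add: n_def f1_def f2_def Archimedean_Field.frac_def k(3) algebra_simps)
  have "nat \<lfloor>of_nat Q * f1\<rfloor> = nat \<lfloor>of_nat Q * f2\<rfloor>"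
   using fun_cong[OF k12(3), of i] i by (simp add: b_def f1_def f2_def)
  moreover have "0 \<le> of_nat Q * f1" "0 \<le> of_nat Q * f2" by (auto simp: f1_def f2_def intro!: mult_nonneg_nonneg)
  ultimately have "\<lfloor>of_nat Q * f1\<rfloor> = \<lfloor>of_nat Q * f2\<rfloor>" by (simp add: nat_eq_iff)
  then have "\<bar>of_nat Q * f1 - of_nat Q * f2\<bar> \<le> 1" by linarith
  then have "of_nat Q * \<bar>f1 - f2\<bar> \<le> 1" by (simp add: abs_mult right_diff_distrib[symmetric])
  then have "\<bar>f1 - f2\<bar> \<le> 1 / of_nat Q" using Q by (simp add: field_simps)
  then show ?thesis using e by simp
 qed
 define v where "v = comb (\<lambda>i. of_int (n i))"
 have vR: "v \<in> R" unfolding v_def comb_def R_eq by (rule zspanI[where c = n]) simp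
 define z where "z = of_rat (of_nat k / H) * y"
 have zK: "z \<in> K" unfolding z_def by (rule K_scale[OF yK])
 have "v - z \<in> K" using vR zK K_diff R_sub_K by blast
 have nmvz: "nm (v - z) \<le> 1 / of_nat Q"
  unfolding nm_le_iff
 proof (intro allI impI)
  fix i assume i: "i < d"
  have "co (v - z) i = co v i - co z i" using co_diff[OF R_sub_K[OF vR] zK] .
  also have "co v i = of_int (n i)" unfolding v_def by (rule co_comb[OF i])
  also have "co z i = of_nat k * x i" unfolding z_def co_scale[OF yK] by (simp add: x_def)
  finally show "\<bar>co (v - z) i\<bar> \<le> 1 / of_nat Q" using close[OF i] by simp
 qed
 have "of_nat Cn * nm (v - z) \<le> of_nat Cn * (1 / of_nat Q)" using nmvz by (intro mult_left_mono) auto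
 also have "of_nat Cn * (1 / of_nat Q) = (1/4 :: rat)" using Cn by (simp add: Q_def)
 finally have g1: "grow (1/4) (v - z)" by (intro grow_nm \<open>v - z \<in> K\<close>)
 have g2: "grow (\<bar>of_nat k / H\<bar> * c) z" unfolding z_def by (rule grow_scale[OF y(2)])
 have "of_nat k * c \<le> of_nat (Q ^ d) * c" using k(2) c by (intro mult_right_mono) (simp_all only: of_nat_le_iff)
 then have "4 * (of_nat k * c) \<le> H" using H(2) by linarith
 then have le: "\<bar>of_nat k / H\<bar> * c \<le> 1/4" using H(1) by (simp add: field_simps)
 have "grow (1/4 + \<bar>of_nat k / H\<bar> * c) ((v - z) + z)" using grow_add[OF g1 g2] c by simp
 then obtain A where A: "A \<ge> 0" "\<And>n. nm (v ^ n) \<le> A * (1/4 + \<bar>of_nat k / H\<bar> * c) ^ n" by (rule growE) auto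
 have "grow (1/2) v"
  unfolding grow_def
 proof (intro conjI exI allI)
  fix n
  have "A * (1/4 + \<bar>of_nat k / H\<bar> * c) ^ n \<le> A * (1/2) ^ n"
  proof (intro mult_left_mono power_mono)
   show "1 / 4 + \<bar>of_nat k / H\<bar> * c \<le> 1 / 2" using le by linarith
   show "0 \<le> 1 / 4 + \<bar>of_nat k / H\<bar> * c" using c by (intro add_nonneg_nonneg mult_nonneg_nonneg) auto
  qed (use A(1) in auto)
  then show "nm (v ^ n) \<le> A * (1/2) ^ n" using A(2)[of n] by linarith
 qed (use vR R_sub_K in blast)
 moreover have "integral_K v" unfolding integral_K_def using vR R_ring(7) by (intro exI[of _ 1]) simp
 ultimately have "v = 0" using integral_small by blast
 then have "nm z \<le> 1 / of_nat Q" using nmvz nm_minus[OF zK] by simp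
 moreover have "nm z = of_nat k" unfolding z_def nm_scale[OF yK] using H(1) by (simp add: H_def)
 moreover have "(1::rat) \<le> of_nat k" using k(1) by simp
 moreover have "1 / of_nat Q < (1::rat)" using Q by simp
 ultimately show False by linarith
qed

text \<open>A substitute for the finiteness of algebraic integers with bounded conjugates: heights
  are bounded, and two such elements in the same cell of side 1 / Q differ by an integral element of
  rate at most 1/2, hence by 0.\<close>

lemma integral_grow_finite:
 assumes c: "c \<ge> 0"
 shows "finite {y. integral_K y \<and> grow c y}"
proof -
 define Q where "Q = 4 * Cn"
 have Q: "Q \<ge> 4" using Cn by (simp add: Q_def)
 define H where "H = 4 * of_nat ((4 * Cn) ^ d) * c"
 define \<phi> where "\<phi> y = restrict (\<lambda>i. \<lfloor>co y i * of_nat Q\<rfloor>) {..<d}" for y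
 let ?Y = "{y. integral_K y \<and> grow c y}"
 have "inj_on \<phi> ?Y"
 proof (rule inj_onI)
  fix x y assume xy: "x \<in> ?Y" "y \<in> ?Y" "\<phi> x = \<phi> y"
  have K: "x \<in> K" "y \<in> K" using xy by (auto simp: grow_def)
  have "nm (x - y) \<le> 1 / of_nat Q" unfolding nm_le_iff
  proof (intro allI impI)
   fix i assume i: "i < d"
   have "\<lfloor>co x i * of_nat Q\<rfloor> = \<lfloor>co y i * of_nat Q\<rfloor>" using fun_cong[OF xy(3), of i] i by (simp add: \<phi>_def)
   then have "\<bar>co x i * of_nat Q - co y i * of_nat Q\<bar> \<le> 1" by linarith
   then have "\<bar>co x i - co y i\<bar> * of_nat Q \<le> 1" by (simp add: abs_mult left_diff_distrib[symmetric])
   then show "\<bar>co (x - y) i\<bar> \<le> 1 / of_nat Q" unfolding co_diff[OF K] using Q by (simp add: field_simps)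
  qed
  then have "of_nat Cn * nm (x - y) \<le> of_nat Cn * (1 / of_nat Q)" by (intro mult_left_mono) auto
  also have "\<dots> \<le> 1/2" using Cn by (simp add: Q_def)
  finally have "grow (1/2) (x - y)" by (intro grow_nm K_diff K)
  moreover have "integral_K (x - y)" using integral_diff xy by blast
  ultimately show "x = y" using integral_small[of "x - y"] by simp
 qed
 moreover have "\<phi> ` ?Y \<subseteq> Pi\<^sub>E {..<d} (\<lambda>_. {\<lfloor>- (H * of_nat Q)\<rfloor>..\<lfloor>H * of_nat Q\<rfloor>})"
 proof (rule image_subsetI)
  fix y assume y: "y \<in> ?Y"
  have "nm y \<le> H" unfolding H_def using integral_grow_bounded y c by blast
  then have co: "\<bar>co y i\<bar> \<le> H" if "i < d" for i using nm_ge[OF that, of y] by linarith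
  show "\<phi> y \<in> Pi\<^sub>E {..<d} (\<lambda>_. {\<lfloor>- (H * of_nat Q)\<rfloor>..\<lfloor>H * of_nat Q\<rfloor>})"
   unfolding \<phi>_def
  proof (rule restrict_PiE_iff[THEN iffD2], rule ballI)
   fix i assume "i \<in> {..<d}"
   then have "- H \<le> co y i" "co y i \<le> H" using co[of i] by (auto simp: abs_le_iff)
   then have "(- H) * of_nat Q \<le> co y i * of_nat Q" "co y i * of_nat Q \<le> H * of_nat Q"
    by (simp_all only: mult_right_mono of_nat_0_le_iff)
   then show "\<lfloor>co y i * of_nat Q\<rfloor> \<in> {\<lfloor>- (H * of_nat Q)\<rfloor>..\<lfloor>H * of_nat Q\<rfloor>}"
    by (auto intro!: floor_mono)
  qed
 qed
 moreover have "finite (Pi\<^sub>E {..<d} (\<lambda>_. {\<lfloor>- (H * of_nat Q)\<rfloor>..\<lfloor>H * of_nat Q\<rfloor>}))" by (intro finite_PiE) auto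
 ultimately show ?thesis by (rule inj_on_finite)
qed

text \<open>Write v ^ n as a power of v ^ j times one of the finitely many v ^ i with i < j; the
  latter affect only the denominator and the constant.\<close>

lemma root_integral_grow:
 assumes v: "v \<in> K" and j: "j \<ge> 1" and c: "c \<ge> 1"
  and x: "\<And>s. (v ^ j) ^ s \<in> R" "\<And>s. nm ((v ^ j) ^ s) \<le> B * c ^ (j * s)"
 shows "integral_K v \<and> grow c v"
proof
 have split: "v ^ n = (v ^ j) ^ (n div j) * v ^ (n mod j)" for n
  by (simp add: power_mult[symmetric] power_add[symmetric])
 have "\<forall>i. \<exists>l::nat. l > 0 \<and> of_nat l * v ^ i \<in> R" using K_power[OF v] by (auto simp: K_def)
 from choice[OF this] obtain l :: "nat \<Rightarrow> nat" where l: "\<And>i. l i > 0" "\<And>i. of_nat (l i) * v ^ i \<in> R" by blast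
 define L where "L = (\<Prod>i<j. l i)"
 have "of_nat L * v ^ n \<in> R" for n
 proof -
  have "n mod j < j" using j by simp
  then have "L = l (n mod j) * (\<Prod>i\<in>{..<j} - {n mod j}. l i)" unfolding L_def by (intro prod.remove) auto
  then have "of_nat L * v ^ n = (of_nat (l (n mod j)) * v ^ (n mod j)) * (of_nat (\<Prod>i\<in>{..<j} - {n mod j}. l i) * (v ^ j) ^ (n div j))"
   by (subst split[of n]) simp
  then show ?thesis using l(2) x(1) R_ring(6,8) by metis
 qed
 moreover have "L > 0" unfolding L_def using l(1) by (simp add: prod_pos)
 ultimately show "integral_K v" unfolding integral_K_def by blast
 define m where "m = (\<Sum>i<j. nm (v ^ i))"
 have B: "B \<ge> 0" using x(2)[of 0] nm_nonneg[of 1] by simp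
 have "nm (v ^ n) \<le> (of_nat Cn * B * m) * c ^ n" for n
 proof -
  have nj: "n mod j < j" using j by simp
  have "nm (v ^ n) \<le> of_nat Cn * nm ((v ^ j) ^ (n div j)) * nm (v ^ (n mod j))"
   by (subst split[of n]) (intro nm_mult' K_power v)
  also have "\<dots> \<le> of_nat Cn * (B * c ^ n) * m"
  proof (intro mult_mono mult_nonneg_nonneg)
   have "c ^ (j * (n div j)) \<le> c ^ n" using c by (intro power_increasing) auto
   then have "B * c ^ (j * (n div j)) \<le> B * c ^ n" using B by (rule mult_left_mono)
   then show "nm ((v ^ j) ^ (n div j)) \<le> B * c ^ n" using x(2)[of "n div j"] by linarith
   show "nm (v ^ (n mod j)) \<le> m" unfolding m_def using nj nm_nonneg by (intro member_le_sum) auto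
  qed (use B c nm_nonneg in auto)
  finally show ?thesis by (simp add: mult_ac)
 qed
 then show "grow c v" unfolding grow_def using v by blast
qed

text \<open>Dividing v by an element of the group reduces v ^ j to a product of generators with
  exponents below j. The quotient y is then integral with growth rate at most c, a bound independent
  of j, so only finitely many y occur; t is the product of exponents that carry them into the
  group.\<close>

lemma saturation_exponent:
 assumes g: "\<And>i. i < e \<Longrightarrow> g i \<noteq> 0 \<and> g i \<in> R \<and> inverse (g i) \<in> R"
 shows "\<exists>t\<ge>1. \<forall>v\<in>K. \<forall>j\<ge>1. v ^ j \<in> mspan e g \<longrightarrow> v ^ t \<in> mspan e g"
proof -
 let ?U = "mspan e g"
 have nz: "\<forall>i<e. g i \<noteq> 0" using g by blast
 note U = mspan_group[OF nz]
 have UR: "?U \<subseteq> R" using mspan_subset[of e g R] nz sub g by blast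
 \<comment> \<open>A growth rate for multiplication by \<open>g i\<close>, at least 1 so that larger
   exponents give larger bounds.\<close>
 define G where "G i = max 1 (of_nat Cn * nm (g i))" for i
 define c where "c = (\<Prod>i<e. G i)"
 have G1: "G i \<ge> 1" for i by (simp add: G_def)
 have c1: "c \<ge> 1" unfolding c_def using G1 by (intro prod_ge_1)
 have nmprod: "nm (\<Prod>i<e'. g i ^ n i) \<le> nm 1 * (\<Prod>i<e'. G i ^ n i) \<and> (\<Prod>i<e'. g i ^ n i) \<in> K" if "e' \<le> e" for e' n
  using that
 proof (induction e')
  case (Suc e')
  let ?P = "\<Prod>i<e'. g i ^ n i"
  have gK: "g e' \<in> K" using g Suc.prems R_sub_K by simp
  have PK: "?P \<in> K" and IH: "nm ?P \<le> nm 1 * (\<Prod>i<e'. G i ^ n i)" using Suc by auto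
  have "nm (?P * g e' ^ m) \<le> G e' ^ m * nm ?P" for m
  proof (induction m)
   case (Suc m)
   have "nm (?P * g e' ^ Suc m) = nm (g e' * (?P * g e' ^ m))" by (simp add: mult_ac)
   also have "\<dots> \<le> of_nat Cn * nm (g e') * nm (?P * g e' ^ m)" by (intro nm_mult' gK K_mult PK K_power)
   also have "\<dots> \<le> G e' * nm (?P * g e' ^ m)" using nm_nonneg by (intro mult_right_mono) (auto simp: G_def)
   also have "\<dots> \<le> G e' * (G e' ^ m * nm ?P)" using Suc G1[of e'] by (intro mult_left_mono) auto
   finally show ?case by (simp add: mult_ac)
  qed simp
  then have "nm (?P * g e' ^ n e') \<le> G e' ^ n e' * nm ?P" .
  also have "\<dots> \<le> G e' ^ n e' * (nm 1 * (\<Prod>i<e'. G i ^ n i))" using IH G1[of e'] by (intro mult_left_mono) auto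
  finally show ?case using PK gK K_mult K_power by (simp add: mult_ac)
 qed (simp add: K_1)
 define Y where "Y = {y. integral_K y \<and> grow c y}"
 have Yfin: "finite Y" unfolding Y_def using integral_grow_finite c1 by simp
 define Y' where "Y' = {y \<in> Y. \<exists>j\<ge>1. y ^ j \<in> ?U}"
 have "\<forall>y. \<exists>j. y \<in> Y' \<longrightarrow> j \<ge> 1 \<and> y ^ j \<in> ?U" by (auto simp: Y'_def)
 from choice[OF this] obtain J where J: "\<And>y. y \<in> Y' \<Longrightarrow> J y \<ge> 1 \<and> y ^ J y \<in> ?U" by blast
 define t where "t = (\<Prod>y\<in>Y'. J y)"
 have "v ^ t \<in> ?U" if v: "v \<in> K" "j \<ge> 1" "v ^ j \<in> ?U" for v j
 proof -
  obtain u b where u: "u \<in> ?U" "\<And>i. b i < j" "v ^ j = u ^ j * (\<Prod>i<e. g i ^ b i)"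
   using mspan_division[of e g, OF _ v(3,2)] nz by metis
  define y where "y = v * inverse u"
  have u0: "u \<noteq> 0" using U(5) u(1) by blast
  have yK: "y \<in> K" unfolding y_def using v(1) U(3)[OF u(1)] UR R_sub_K by (intro K_mult) blast+
  have yj: "y ^ j = (\<Prod>i<e. g i ^ b i)" using u(3) u0 by (simp add: y_def power_mult_distrib power_inverse)
  have yU: "y ^ j \<in> ?U"
   using U(2)[OF v(3) U(3)[OF U(4)[OF u(1), of j]]] by (simp add: y_def power_mult_distrib power_inverse)
  have "integral_K y \<and> grow c y"
  proof (rule root_integral_grow[OF yK v(2) c1])
   fix s
   show "(y ^ j) ^ s \<in> R" using U(4)[OF yU] UR by blast
   have "(y ^ j) ^ s = (\<Prod>i<e. g i ^ (b i * s))" unfolding yj by (simp add: prod_power_distrib power_mult)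
   then have "nm ((y ^ j) ^ s) \<le> nm 1 * (\<Prod>i<e. G i ^ (b i * s))" using nmprod[of e "\<lambda>i. b i * s"] by simp
   also have "\<dots> \<le> nm 1 * (\<Prod>i<e. G i ^ (j * s))"
   proof (intro mult_left_mono prod_mono conjI)
    fix i
    show "0 \<le> G i ^ (b i * s)" using G1[of i] by (intro zero_le_power) linarith
    have "b i * s \<le> j * s" using u(2)[of i] by (intro mult_le_mono1) simp
    then show "G i ^ (b i * s) \<le> G i ^ (j * s)" using G1[of i] by (rule power_increasing)
   qed (rule nm_nonneg)
   also have "(\<Prod>i<e. G i ^ (j * s)) = c ^ (j * s)" by (simp add: c_def prod_power_distrib)
   finally show "nm ((y ^ j) ^ s) \<le> nm 1 * c ^ (j * s)" .
  qed
  then have yY: "y \<in> Y'" using yU v(2) by (auto simp: Y'_def Y_def)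
  then have "t = J y * (\<Prod>y\<in>Y' - {y}. J y)" unfolding t_def using Yfin by (intro prod.remove) (auto simp: Y'_def)
  then have "y ^ t = (y ^ J y) ^ (\<Prod>y\<in>Y' - {y}. J y)" by (simp add: power_mult)
  then have yt: "y ^ t \<in> ?U" using J[OF yY] U(4) by simp
  have "v = y * u" using u0 by (simp add: y_def)
  then have "v ^ t = y ^ t * u ^ t" by (simp add: power_mult_distrib)
  then show ?thesis using U(2)[OF yt U(4)[OF u(1)]] by simp
 qed
 moreover have "t \<ge> 1" unfolding t_def using J by (simp add: Suc_le_eq prod_pos)
 ultimately show ?thesis by blast
qed

end

text \<open>The F-automorphism \<theta> \<mapsto> \<omega> * \<theta> multiplies w by some u in F,
  so w is an eigenvector and hence a monomial \<kappa> * \<theta> ^ i; then u = \<omega> ^ i gives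
  \<omega> ^ c = u ^ q = 1. That u lies in F is due to \<omega>2, which for q = 2 is a square root
  of -1: over the rationals, with \<theta> = i, the identity (1 + i)^2 = 2 i would have c =
  1.\<close>

lemma kummer_step:
 assumes F: "subfield_C F" and q: "Factorial_Ring.prime (q::nat)"
  and \<omega>: "\<omega> ^ q = 1" "\<omega> \<noteq> 1" and \<omega>2: "\<omega>2 \<in> F" "\<omega>2 ^ q = \<omega>"
  and \<theta>: "\<theta> ^ q \<in> F" "\<theta> \<noteq> 0" "\<theta> \<notin> F"
  and w: "w \<in> adj F \<theta>" "w \<noteq> 0" "w ^ q = x * \<theta> ^ c" "x \<in> F"
 shows "q dvd c \<and> (\<exists>\<kappa>\<in>F. \<exists>i. w = \<kappa> * \<theta> ^ i)"
proof -
 have sub: "subring_C F" and inv: "\<And>x. x \<in> F \<Longrightarrow> inverse x \<in> F" using F by (auto simp: subfield_C_def)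
 note Fr = ringC[OF sub]
 have q1: "q \<ge> 1" using prime_ge_1_nat[OF q] .
 have \<omega>F: "\<omega> \<in> F" using Fr(7)[OF \<omega>2(1), of q] \<omega>2(2) by simp
 have no: "v ^ q \<noteq> \<theta> ^ q" if v: "v \<in> F" for v
 proof
  assume eq: "v ^ q = \<theta> ^ q"
  then have v0: "v \<noteq> 0" 
  proof -
   have "v \<noteq> 0" if "0 < q"
   proof
    assume "v = 0"
    then have "\<theta> ^ q = 0" using eq that by (simp add: zero_power)
    then show False using \<theta>(2) by simp
   qed
   then show ?thesis using q1 by simp
  qed
  have "(\<theta> * inverse v) ^ q = 1" using eq v0 by (simp add: power_mult_distrib power_inverse flip: eq)
  then obtain b where "\<theta> * inverse v = \<omega> ^ b" using roots_of_unity_powers[OF q \<omega>] by metis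
  then have "\<theta> = \<omega> ^ b * v" using v0 by (simp add: field_simps)
  then show False using \<theta>(3) v Fr(6)[OF Fr(7)[OF \<omega>F]] by simp
 qed
 obtain a where a: "\<And>i. a i \<in> F" "w = (\<Sum>i<q. a i * \<theta> ^ i)" using adj_reduced[OF sub q1 \<theta>(1) w(1)] by blast
 have zero: "b i = 0" if b: "\<And>i. b i \<in> F" "(\<Sum>i<q. b i * \<theta> ^ i) = 0" and i: "i < q" for b i
 proof -
  define p where "p = (\<Sum>i<q. Polynomial.monom (b i) i)"
  have co: "Polynomial.coeff p i = (if i < q then b i else 0)" for i
   by (simp add: p_def coeff_sum sum.delta)
  have "p = 0"
  proof (rule root_independent[OF F q \<theta>(1,2) no])
   show "coeffs_in F p" unfolding coeffs_in_def co using b(1) Fr(1) by simp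
   show "poly p \<theta> = 0" using b(2) by (simp add: p_def poly_sum poly_monom)
   show "Polynomial.coeff p j = 0" if "j \<ge> q" for j unfolding co using that by simp
  qed
  then show ?thesis using co[of i] i by simp
 qed
 define P where "P = (\<Sum>i<q. Polynomial.monom (a i) i)"
 have Pw: "poly P \<theta> = w" by (simp add: P_def poly_sum poly_monom a(2))
 have PF: "coeffs_in F P" unfolding coeffs_in_def P_def using a(1) Fr(1) by (simp add: coeff_sum sum.delta)
 define w' where "w' = poly P (\<omega> * \<theta>)"
 text \<open>The F-automorphism sending theta to omega theta, applied to the relation w^q = x theta^c.\<close>
 have w'q: "w' ^ q = x * (\<omega> * \<theta>) ^ c"
 proof -
  define T where "T = P ^ q - Polynomial.monom x c"
  have Pq: "coeffs_in F (P ^ n)" for n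
  proof (induction n)
   case 0
   have "coeffs_in F [:1:]" by (intro coeffs_in_pCons coeffs_in_0 sub Fr(2))
   then show ?case by (simp add: one_pCons)
  qed (use PF coeffs_in_mult[OF sub] in simp)
  have TF: "coeffs_in F T" unfolding T_def by (intro coeffs_in_diff coeffs_in_monom sub Pq w(4))
  have T0: "poly T \<theta> = 0" using w(3) by (simp add: T_def Pw poly_monom)
  obtain h r where r: "coeffs_in F r" "T = binom_poly q (\<theta> ^ q) * h + r" "\<And>i. i \<ge> q \<Longrightarrow> Polynomial.coeff r i = 0"
   using coeffs_in_division[OF sub binom_poly(4)[OF q1 sub \<theta>(1)] binom_poly(1)[OF q1] TF] binom_poly(2)[OF q1] by metis
  have "poly r \<theta> = 0" using r(2) T0 binom_poly(3)[OF q1] by simp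
  then have "r = 0" using root_independent[OF F q \<theta>(1,2) no r(1) _ r(3)] by blast
  then have "poly T (\<omega> * \<theta>) = 0" using r(2) binom_poly(3)[OF q1] \<omega>(1) by (simp add: power_mult_distrib)
  then show ?thesis by (simp add: T_def w'_def poly_monom)
 qed
 \<comment> \<open>The transformed relation differs from the original by \<omega> ^ c, which is the
   q-th power of \<omega>2 ^ c; the remaining quotient is a q-th root of unity.\<close>
 define u0 where "u0 = w' * inverse (w * \<omega>2 ^ c)"
 have \<omega>20: "\<omega>2 \<noteq> 0" using \<omega>2(2) \<omega>(1) q1 by (auto simp: zero_power)
 have "u0 ^ q = 1"
 proof -
  have "w' ^ q = (w * \<omega>2 ^ c) ^ q" using w'q w(3) \<omega>2(2)
   by (simp add: power_mult_distrib power_swap[of \<omega>2 c q])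
  then have "u0 ^ q = (w * \<omega>2 ^ c) ^ q * inverse ((w * \<omega>2 ^ c) ^ q)"
   unfolding u0_def power_mult_distrib[of w'] power_inverse by simp
  then show ?thesis using w(2) \<omega>20 by (simp only: right_inverse power_not_zero mult_eq_0_iff not_False_eq_True simp_thms)
 qed
 then obtain b where b: "u0 = \<omega> ^ b" using roots_of_unity_powers[OF q \<omega>] by metis
 define u where "u = \<omega>2 ^ c * \<omega> ^ b"
 have uF: "u \<in> F" unfolding u_def by (intro Fr(6) Fr(7) \<omega>2 \<omega>F)
 have "w * \<omega>2 ^ c \<noteq> 0" using w(2) \<omega>20 by simp
 then have "u0 * (w * \<omega>2 ^ c) = w'" unfolding u0_def by (metis mult.assoc left_inverse mult_1_right)
 then have w'w: "w' = u * w" unfolding b u_def by (simp add: mult_ac)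
 have sum0: "(\<Sum>i<q. (a i * (\<omega> ^ i - u)) * \<theta> ^ i) = 0"
 proof -
  have "w' = (\<Sum>i<q. a i * \<omega> ^ i * \<theta> ^ i)" by (simp add: w'_def P_def poly_sum poly_monom power_mult_distrib mult_ac)
  moreover have "u * w = (\<Sum>i<q. a i * u * \<theta> ^ i)" by (simp add: a(2) sum_distrib_left mult_ac)
  moreover have "(\<Sum>i<q. (a i * (\<omega> ^ i - u)) * \<theta> ^ i) = (\<Sum>i<q. a i * \<omega> ^ i * \<theta> ^ i) - (\<Sum>i<q. a i * u * \<theta> ^ i)"
   by (simp add: sum_subtractf[symmetric] algebra_simps)
  ultimately show ?thesis using w'w by simp
 qed
 have ai: "a i * (\<omega> ^ i - u) = 0" if "i < q" for i
  by (rule zero[where b = "\<lambda>i. a i * (\<omega> ^ i - u)", OF _ sum0 that]) (intro Fr(5,6,7) a(1) \<omega>F uF)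
 have "\<exists>i<q. a i \<noteq> 0"
 proof (rule ccontr)
  assume "\<not> (\<exists>i<q. a i \<noteq> 0)"
  then have "w = 0" unfolding a(2) by (intro sum.neutral) auto
  then show False using w(2) by simp
 qed
 then obtain i where i: "i < q" "a i \<noteq> 0" by blast
 have ui: "u = \<omega> ^ i" using ai[OF i(1)] i(2) by simp
 have "u ^ q = \<omega> ^ c" unfolding u_def power_mult_distrib using \<omega>2(2) \<omega>(1)
  by (simp add: power_swap[of _ _ q])
 moreover have "u ^ q = 1" unfolding ui using \<omega>(1) by (simp add: power_swap[of _ _ q])
 ultimately have "\<omega> ^ c = 1" by simp
 then have "q dvd c" using root_of_unity_power_neq_1[OF q \<omega>] by blast
 moreover have "a j = 0" if j: "j < q" "j \<noteq> i" for j
 proof (rule ccontr)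
  assume "a j \<noteq> 0"
  then have "\<omega> ^ j = \<omega> ^ i" using ai[OF j(1)] ui by simp
  moreover have "\<omega> \<noteq> 0" using \<omega>(1) q1 by (auto simp: zero_power)
  ultimately have "\<omega> ^ (max i j - min i j) = 1" by (auto simp: max_def min_def power_diff)
  moreover have "\<not> q dvd max i j - min i j" using i j by (intro nat_dvd_not_less) auto
  ultimately show False using root_of_unity_power_neq_1[OF q \<omega>] by blast
 qed
 then have "w = (\<Sum>j<q. if j = i then a i * \<theta> ^ i else 0)" unfolding a(2) by (intro sum.cong) auto
 then have "w = a i * \<theta> ^ i" using i(1) by (simp add: sum.delta)
 ultimately show ?thesis using a(1) by blast
qed

section \<open>The tower of cyclotomic extensions of q-power order\<close>

definition zt :: "nat \<Rightarrow> nat \<Rightarrow> complex" where "zt q N = cis (2 * pi / real q ^ N)"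

context
 fixes q :: nat
 assumes q: "Factorial_Ring.prime q"
begin

lemma q_pos: "q > 0" "q \<ge> 1" "q > 1"
 using prime_gt_1_nat[OF q] by auto

lemma zt_Suc: "zt q (Suc N) ^ q = zt q N"
 using q_pos by (simp add: zt_def DeMoivre)

lemma zt_power: "zt q (N + n) ^ (q ^ n) = zt q N"
proof (induction n)
 case (Suc n)
 have "zt q (N + Suc n) ^ (q ^ Suc n) = (zt q (Suc (N + n)) ^ q) ^ (q ^ n)" by (simp add: power_mult)
 then show ?case using zt_Suc Suc by simp
qed simp

lemma zt_0: "zt q 0 = 1" by (simp add: zt_def complex_eq_iff)

lemma zt_one: "zt q N ^ (q ^ N) = 1"
 using zt_power[of 0 N] zt_0 by simp

lemma zt_nonzero: "zt q N \<noteq> 0" by (simp add: zt_def)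

lemma zt_roots: assumes "\<epsilon> ^ (q ^ N) = 1" obtains c where "\<epsilon> = zt q N ^ c"
proof -
 have "bij_betw (\<lambda>k. cis (2 * pi * real k / real (q ^ N))) {..<q ^ N} {z. z ^ (q ^ N) = 1}"
  using q_pos by (intro bij_betw_roots_unity) simp
 then obtain k where "\<epsilon> = cis (2 * pi * real k / real (q ^ N))"
  using assms by (auto simp: bij_betw_def)
 then have "\<epsilon> = zt q N ^ k" by (simp add: zt_def DeMoivre mult_ac)
 then show ?thesis using that by blast
qed

lemma zt_1_neq: "zt q 1 \<noteq> 1"
proof
 assume 1: "zt q 1 = 1"
 have "\<forall>\<epsilon>. \<epsilon> ^ q = 1 \<longrightarrow> \<epsilon> = (1::complex)"
 proof (intro allI impI)
  fix \<epsilon> :: complex assume "\<epsilon> ^ q = 1"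
  then obtain c where "\<epsilon> = zt q 1 ^ c" using zt_roots[of \<epsilon> 1] by auto
  then show "\<epsilon> = 1" using 1 by simp
 qed
 then have "{z::complex. z ^ q = 1} = {1}" by auto
 then have "q = 1" using card_roots_unity_eq[of q] q_pos by simp
 then show False using q_pos by simp
qed

lemma zt_primitive: "zt q (Suc N) ^ (q ^ N) \<noteq> 1"
 using zt_power[of 1 N] zt_1_neq by simp

fun tower :: "complex set \<Rightarrow> nat \<Rightarrow> nat \<Rightarrow> complex set" where
 "tower R r 0 = R"
| "tower R r (Suc j) = adj (tower R r j) (zt q (Suc (r + j)))"

context
 fixes R :: "complex set" and r :: nat
 assumes R: "is_order R" and r: "r \<ge> 2" "zt q r \<in> R" "zt q (Suc r) \<notin> frac R"
begin

lemma tower_props: "is_order (tower R r j) \<and> zt q (r + j) \<in> tower R r j"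
proof (induction j)
 case 0 then show ?case using R r by simp
next
 case (Suc j)
 have "zt q (Suc (r + j)) ^ q \<in> tower R r j" using zt_Suc Suc by simp
 then show ?case using adj_order[of "tower R r j" q] q_pos Suc adj_gen order_subring by simp
qed

lemma tower_order: "is_order (tower R r j)" using tower_props by blast

lemma tower_mono: "i \<le> j \<Longrightarrow> tower R r i \<subseteq> tower R r j"
proof (induction j)
 case (Suc j)
 have "tower R r j \<subseteq> tower R r (Suc j)" using adj_superset[OF order_subring[OF tower_order]] by auto
 then show ?case using Suc by (cases "i = Suc j") auto
qed simp

lemma tower_zt: assumes "n \<le> r + j" shows "zt q n \<in> tower R r j"
proof -
 have "zt q n = zt q (r + j) ^ (q ^ (r + j - n))" using zt_power[of n "r + j - n"] assms by simp
 then show ?thesis using tower_props ringC(7)[OF order_subring[OF tower_order]] by metis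
qed

lemma tower_kummer:
 assumes "zt q (Suc (r + j)) \<notin> frac (tower R r j)" "w \<in> frac (tower R r (Suc j))" "w \<noteq> 0"
  "w ^ q = x * zt q (Suc (r + j)) ^ c" "x \<in> frac (tower R r j)"
 shows "q dvd c \<and> (\<exists>\<kappa>\<in>frac (tower R r j). \<exists>i. w = \<kappa> * zt q (Suc (r + j)) ^ i)"
proof (rule kummer_step[OF frac_subfield[OF tower_order] q])
 show "zt q 1 ^ q = 1" using zt_one[of 1] by simp
 show "zt q 1 \<noteq> 1" by (rule zt_1_neq)
 show "zt q 2 \<in> frac (tower R r j)" using tower_zt[of 2 j] r frac_superset by simp
 show "zt q 2 ^ q = zt q 1" using zt_Suc[of 1] by (simp add: numeral_2_eq_2)
 show "zt q (Suc (r + j)) ^ q \<in> frac (tower R r j)" using zt_Suc tower_zt frac_superset by simp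
 show "zt q (Suc (r + j)) \<noteq> 0" by (rule zt_nonzero)
 show "w \<in> adj (frac (tower R r j)) (zt q (Suc (r + j)))"
  using frac_adj_adj[OF tower_order] assms(2) by simp
qed (use assms in auto)

text \<open>A root of unity of the next order would be a w with w ^ q = 1 * \<theta> ^ 1, and Kummer
  theory would give q dvd 1.\<close>

lemma tower_new: "zt q (Suc (r + j)) \<notin> frac (tower R r j)"
proof (induction j)
 case 0 then show ?case using r by simp
next
 case (Suc j)
 show ?case
 proof
  assume w: "zt q (Suc (r + Suc j)) \<in> frac (tower R r (Suc j))"
  have "zt q (Suc (r + Suc j)) ^ q = 1 * zt q (Suc (r + j)) ^ 1" using zt_Suc[of "Suc (r + j)"] by simp
  then have "q dvd 1" using tower_kummer[OF Suc w zt_nonzero] ringC(2)[OF frac_subring[OF tower_order]] by blast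
  then show False using q_pos by simp
 qed
qed

text \<open>One storey at a time: Kummer theory gives w = \<kappa> * \<theta> ^ i and q dvd c, so
  every \<theta> in the formula for x occurs as \<theta> ^ q, which is the root of unity one storey
  below.\<close>

lemma tower_descent:
 assumes "x \<in> frac R" "x \<noteq> 0" "w \<in> frac (tower R r j)" "x = zt q (r + j) ^ c * w ^ q"
 shows "\<exists>\<kappa>\<in>frac R. \<exists>\<epsilon>\<in>frac R. \<exists>b. \<epsilon> ^ (q ^ b) = 1 \<and> x = \<epsilon> * \<kappa> ^ q"
 using assms
proof (induction j arbitrary: w c)
 case 0
 have "zt q r ^ c \<in> frac R" using r(2) frac_superset ringC(7)[OF frac_subring[OF R]] by blast
 moreover have "(zt q r ^ c) ^ (q ^ r) = 1" by (simp add: power_swap[of _ c] zt_one)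
 ultimately show ?case using 0 by auto
next
 case (Suc j)
 define \<theta> where "\<theta> = zt q (Suc (r + j))"
 define n where "n = q ^ Suc (r + j)"
 have th: "\<theta> ^ n = 1" "\<theta> \<noteq> 0" "n \<ge> 1" 
  unfolding \<theta>_def n_def using zt_one[of "Suc (r + j)"] zt_nonzero q_pos by (simp_all del: power_Suc add: Suc_le_eq)
 have x: "x = \<theta> ^ c * w ^ q" using Suc.prems(4) by (simp add: \<theta>_def)
 have w0: "w \<noteq> 0" using x Suc.prems(2) q_pos by auto
 \<comment> \<open>The exponent c * (n - 1) replaces - c, as \<theta> ^ n = 1; because q divides n,
   divisibility of it by q is divisibility of c.\<close>
 have "\<theta> ^ (c * (n - 1)) * \<theta> ^ c = (\<theta> ^ n) ^ c"
  using th(3) by (simp add: power_add[symmetric] power_mult[symmetric] algebra_simps)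
 then have "w ^ q = x * \<theta> ^ (c * (n - 1))" unfolding x using th(1) by (simp add: mult_ac)
 moreover have "x \<in> frac (tower R r j)" using Suc.prems(1) frac_mono[OF tower_mono[of 0 j]] by auto
 ultimately have k: "q dvd c * (n - 1)" "\<exists>\<kappa>\<in>frac (tower R r j). \<exists>i. w = \<kappa> * \<theta> ^ i"
  using tower_kummer[OF tower_new Suc.prems(3) w0] unfolding \<theta>_def by blast+
 have "q dvd c"
 proof -
  have "q dvd c * (n - 1) + c" if "q dvd c * n" using that th(3) by (simp add: algebra_simps)
  moreover have "q dvd c * n" by (simp add: n_def)
  ultimately show ?thesis using k(1) by (meson dvd_add_right_iff)
 qed
 then obtain c' where c': "c = q * c'" by (auto simp: dvd_def)
 obtain \<kappa> i where \<kappa>: "\<kappa> \<in> frac (tower R r j)" "w = \<kappa> * \<theta> ^ i" using k(2) by blast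
 have "\<theta> ^ q = zt q (r + j)" unfolding \<theta>_def by (rule zt_Suc)
 then have "x = zt q (r + j) ^ (c' + i) * \<kappa> ^ q"
  unfolding x \<kappa>(2) c' by (simp add: power_mult power_mult_distrib power_add power_swap[of \<theta> i q])
 then show ?case using Suc.IH[OF Suc.prems(1,2) \<kappa>(1)] by blast
qed

end

end

lemma zt_inj:
 assumes q: "Factorial_Ring.prime q"
 shows "inj (zt q)"
proof (rule injI)
 have "zt q m \<noteq> zt q n" if "m < n" for m n
 proof
  assume "zt q m = zt q n"
  moreover obtain k where k: "n = Suc (m + k)" using less_imp_Suc_add[OF \<open>m < n\<close>] by blast
  ultimately have "zt q (Suc (m + k)) ^ (q ^ (m + k)) = (zt q m ^ (q ^ m)) ^ (q ^ k)"
   by (simp add: power_mult[symmetric] power_add)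
  then show False using zt_primitive[OF q, of "m + k"] zt_one[OF q, of m] by simp
 qed
 then show "m = n" if "zt q m = zt q n" for m n using that by (metis linorder_neqE_nat)
qed

context num_order
begin

text \<open>Roots of unity are integral with growth rate 1, so K contains finitely many.\<close>

lemma zt_bounded:
 assumes q: "Factorial_Ring.prime q"
 shows "\<exists>r. zt q r \<notin> K"
proof (rule ccontr)
 assume "\<not> (\<exists>r. zt q r \<notin> K)"
 then have K: "zt q r \<in> K" for r by blast
 have "integral_K (zt q r) \<and> grow 1 (zt q r)" for r
 proof (rule root_integral_grow[OF K])
  have q1: "q > 0" using prime_gt_0_nat[OF q] .
  then show "1 \<le> q ^ r" by simp
  show "(1::rat) \<le> 1" by simp
  fix s
  show "(zt q r ^ (q ^ r)) ^ s \<in> R" "nm ((zt q r ^ (q ^ r)) ^ s) \<le> nm 1 * 1 ^ (q ^ r * s)"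
   using R_ring(2) by (simp_all add: zt_one[OF q])
 qed
 then have "range (zt q) \<subseteq> {y. integral_K y \<and> grow 1 y}" by blast
 then have "finite (range (zt q))" using integral_grow_finite[of 1] finite_subset by auto
 then show False using range_inj_infinite[OF zt_inj[OF q]] by blast
qed

end

text \<open>Modulo q ^ N-th powers the group U has finitely many classes, and m detects each
  representative p that is not a local q ^ N-th power in S. For u congruent to 1 the representative
  is therefore a local power and has a q ^ N-th root in \<open>frac S\<close>; the tower brings it
  down to \<open>frac R\<close> up to a root of unity, and saturation returns to U at the price of a
  factor of the exponent.\<close>

lemma chevalley_prime_power:
 assumes R0: "is_order R0" and q: "Factorial_Ring.prime (q::nat)"
  and g: "\<And>i. i < e \<Longrightarrow> g i \<noteq> 0 \<and> g i \<in> R0 \<and> inverse (g i) \<in> R0"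
  and tf: "\<And>u n. u \<in> mspan e g \<Longrightarrow> n \<ge> 1 \<Longrightarrow> u ^ n = 1 \<Longrightarrow> u = 1"
 shows "\<exists>m\<ge>1. \<forall>u\<in>mspan e g. cg R0 m u 1 \<longrightarrow> (\<exists>w\<in>mspan e g. u = w ^ (q ^ l))"
proof -
 let ?U = "mspan e g"
 have nz: "\<forall>i<e. g i \<noteq> 0" using g by blast
 note U = mspan_group[OF nz]
 have U_inj: "u = v" if "u \<in> ?U" "v \<in> ?U" "n \<ge> 1" "u ^ n = v ^ n" for u v n
 proof -
  have "(u * inverse v) ^ n = 1" using that U(5)[OF that(2)] by (simp add: power_mult_distrib power_inverse)
  then have "u * inverse v = 1" using tf U(2)[OF that(1) U(3)[OF that(2)]] that(3) by blast
  then show ?thesis using U(5)[OF that(2)] by (simp add: field_simps)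
 qed
 have q1: "q \<ge> 1" "q > 1" using prime_gt_1_nat[OF q] by auto
 have ztint: "zt q n ^ (q ^ n) \<in> S" if "subring_C S" for n S
  using that zt_one[OF q] ringC(2) by simp
 \<comment> \<open>The root of unity of order q ^ 2 demanded by \<open>kummer_step\<close>.\<close>
 define R1 where "R1 = adj R0 (zt q 2)"
 have R1: "is_order R1" unfolding R1_def
  using adj_order[OF R0, of "q ^ 2"] ztint[OF order_subring[OF R0]] q1 by simp
 have R01: "R0 \<subseteq> R1" unfolding R1_def using adj_superset[OF order_subring[OF R0]] by blast
 \<comment> \<open>Level of the first root of unity missing from the field, minus one; it exists by
   \<open>zt_bounded\<close>.\<close>
 define r where "r = (LEAST r. zt q (Suc r) \<notin> frac R1)"
 have "\<exists>r. zt q r \<notin> frac R1"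
 proof -
  obtain d w where "num_order R1 d w" using R1 is_order_iff by blast
  then show ?thesis using num_order.zt_bounded[OF _ q] num_order.K_frac by metis
 qed
 then obtain r0 where r0: "zt q r0 \<notin> frac R1" by blast
 have low: "zt q i \<in> frac R1" if "i \<le> 2" for i
 proof -
  have "zt q i = zt q 2 ^ (q ^ (2 - i))" using zt_power[OF q, of i "2 - i"] that by simp
  moreover have "zt q 2 \<in> R1" unfolding R1_def by (rule adj_gen[OF order_subring[OF R0]])
  ultimately show ?thesis using ringC(7)[OF order_subring[OF R1]] frac_superset by metis
 qed
 then have "r0 \<noteq> 0" using r0 by (metis zero_le)
 then have ex: "zt q (Suc (r0 - 1)) \<notin> frac R1" using r0 by simp
 have r1: "zt q (Suc r) \<notin> frac R1" unfolding r_def using ex by (rule LeastI)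
 have r2: "r \<ge> 2" using low[of "Suc r"] r1 by (metis not_less_eq_eq numeral_2_eq_2 le_SucE nat_le_linear not_less_eq)
 have r3: "zt q r \<in> frac R1"
 proof (rule ccontr)
  assume "zt q r \<notin> frac R1"
  then have "zt q (Suc (r - 1)) \<notin> frac R1" using r2 by simp
  then have "r \<le> r - 1" unfolding r_def by (rule Least_le)
  then show False using r2 by simp
 qed
 \<comment> \<open>The root zt q r lies in the field but perhaps not in the order R1; adjoining it
   leaves the field unchanged.\<close>
 define R where "R = adj R1 (zt q r)"
 have R: "is_order R" unfolding R_def
  using adj_order[OF R1, of "q ^ r"] ztint[OF order_subring[OF R1]] q1 by simp
 have R0R: "R0 \<subseteq> R" unfolding R_def using R01 adj_superset[OF order_subring[OF R1]] by blast
 have fR: "frac R = frac R1" unfolding R_def by (rule frac_adj_same[OF R1 r3])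
 have rR: "zt q r \<in> R" "zt q (Suc r) \<notin> frac R"
  using adj_gen[OF order_subring[OF R1]] r1 fR by (auto simp: R_def)
 note tw = tower_order[OF q R r2 rR] tower_mono[OF q R r2 rR] tower_zt[OF q R r2 rR] tower_descent[OF q R r2 rR]
 have UR: "?U \<subseteq> R" using mspan_subset[of e g R] nz order_subring[OF R] g R0R by blast
 obtain t where t: "t \<ge> 1" "\<And>v j. v \<in> frac R \<Longrightarrow> j \<ge> 1 \<Longrightarrow> v ^ j \<in> ?U \<Longrightarrow> v ^ t \<in> ?U"
 proof -
  obtain d w where d: "num_order R d w" using R is_order_iff by blast
  have "\<exists>t\<ge>1. \<forall>v\<in>frac R. \<forall>j\<ge>1. v ^ j \<in> mspan e g \<longrightarrow> v ^ t \<in> mspan e g"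
   using num_order.saturation_exponent[OF d, of e g] g R0R num_order.K_frac[OF d] by blast
  then show ?thesis using that by blast
 qed
 define a where "a = multiplicity q t"
 obtain t' where t': "t = q ^ a * t'" "\<not> q dvd t'"
  using multiplicity_decompose'[of t q] t(1) q1 unfolding a_def by (metis not_one_le_zero not_prime_unit q)
 \<comment> \<open>Here l is the wanted exponent and a is lost with the q-part of t. Storey j
   contains the roots of unity of order q ^ (r + j) that \<open>local_prime_power\<close> needs for
   the exponent q ^ N.\<close>
 define j where "j = l + a"
 define N where "N = r + j"
 define S where "S = tower q R r j"
 have S: "is_order S" unfolding S_def by (rule tw(1))
 have RS: "R \<subseteq> S" unfolding S_def using tw(2)[of 0 j] tower.simps(1)[OF q] by auto
 have good: "\<exists>w\<in>?U. u = w ^ (q ^ l)" if u: "u \<in> ?U" and loc: "local_power S q (q ^ N) u" for u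
 proof -
  have u0: "u \<noteq> 0" using U(5)[OF u] .
  have uS: "u \<in> S" "inverse u \<in> S" using u U(3)[OF u] UR RS by auto
  have uR: "u \<in> frac R" using u UR frac_superset by blast
  have zN: "zt q N \<in> S" unfolding S_def N_def using tw(3)[of "r + j" j] by simp
  have "N > 0" using r2 by (simp add: N_def)
  then have "zt q N ^ (q ^ (N - 1)) \<noteq> 1" using zt_primitive[OF q, of "N - 1"] by simp
  then obtain v where v: "v \<in> frac S" "v ^ (q ^ N) = u"
   using local_prime_power[OF q S zN zt_one[OF q] _ uS _ loc] u0 by auto
  \<comment> \<open>One q-th root at a time: \<kappa> and y ^ q have the same q ^ s-th power up to
    torsion, so \<kappa> is a root of unity times y ^ q with y in the tower, and
    \<open>tower_descent\<close> extracts a q-th root of \<kappa> in \<open>frac R\<close> up to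
    torsion.\<close>
  have desc: "\<exists>\<kappa>\<in>frac R. \<exists>\<epsilon>. \<exists>b. \<epsilon> \<in> frac R \<and> \<epsilon> ^ (q ^ b) = 1 \<and> u = \<epsilon> * \<kappa> ^ (q ^ s)" if "s \<le> N" for s
   using that
  proof (induction s)
   case 0
   show ?case using uR ringC(2)[OF frac_subring[OF R]]
    by (intro bexI[of _ u] exI[of _ 1] exI[of _ 0]) auto
  next
   case (Suc s)
   then obtain \<kappa> \<epsilon> b where k: "\<kappa> \<in> frac R" "\<epsilon> \<in> frac R" "\<epsilon> ^ (q ^ b) = 1" "u = \<epsilon> * \<kappa> ^ (q ^ s)" by auto
   have k0: "\<kappa> \<noteq> 0" using k(4) u0 q1 by auto
   have e0: "\<epsilon> \<noteq> 0" using k(4) u0 by auto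
   define y where "y = v ^ (q ^ (N - Suc s))"
   have yq: "(y ^ q) ^ (q ^ s) = u"
   proof -
    have "q ^ (N - Suc s) * q * q ^ s = q ^ N"
     using Suc.prems by (simp add: power_add[symmetric] power_Suc2[symmetric] del: power_Suc)
    then show ?thesis using v(2) by (simp add: y_def power_mult[symmetric])
   qed
   define \<eta> where "\<eta> = \<kappa> * inverse (y ^ q)"
   have y0: "y \<noteq> 0" using yq u0 q1 by auto
   have "\<eta> ^ (q ^ (s + b)) = 1"
   proof -
    have "\<eta> ^ (q ^ s) = inverse \<epsilon>"
     unfolding \<eta>_def power_mult_distrib power_inverse yq k(4) using k0 e0 by (simp add: field_simps)
    then have "(\<eta> ^ (q ^ s)) ^ (q ^ b) = 1" using k(3) by (simp add: power_inverse)
    then show ?thesis by (simp add: power_add power_mult)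
   qed
   then have "(\<eta> ^ (q ^ (s + b))) ^ (q ^ (r + j)) = 1" by simp
   then have "\<eta> ^ (q ^ (r + (j + s + b))) = 1" by (simp add: power_mult[symmetric] power_add[symmetric] add_ac)
   then obtain c where c: "\<eta> = zt q (r + (j + s + b)) ^ c" using zt_roots[OF q] by metis
   have "\<kappa> = zt q (r + (j + s + b)) ^ c * y ^ q" unfolding c[symmetric] \<eta>_def using y0 by simp
   moreover have "y \<in> frac (tower q R r (j + s + b))"
   proof -
    have "S \<subseteq> tower q R r (j + s + b)" unfolding S_def by (rule tw(2)) simp
    then have "v \<in> frac (tower q R r (j + s + b))" using v(1) frac_mono by blast
    then show ?thesis unfolding y_def by (rule ringC(7)[OF frac_subring[OF tw(1)]])
   qed
   ultimately obtain \<kappa>' \<epsilon>' b' where k': "\<kappa>' \<in> frac R" "\<epsilon>' \<in> frac R" "\<epsilon>' ^ (q ^ b') = 1" "\<kappa> = \<epsilon>' * \<kappa>' ^ q"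
    using tw(4)[OF k(1) k0] by blast
   have "u = (\<epsilon> * \<epsilon>' ^ (q ^ s)) * \<kappa>' ^ (q ^ Suc s)"
    unfolding k(4) k'(4) by (simp add: power_mult_distrib power_mult)
   moreover have "(\<epsilon> * \<epsilon>' ^ (q ^ s)) ^ (q ^ (b + b')) = 1"
   proof -
    have "\<epsilon> ^ (q ^ (b + b')) = 1" using k(3) by (simp add: power_add power_mult)
    moreover have "\<epsilon>' ^ (q ^ (b + b')) = 1" using k'(3) by (simp add: power_add power_mult power_swap[of _ "q ^ b" "q ^ b'"])
    ultimately show ?thesis by (simp add: power_mult_distrib power_swap[of _ "q ^ s"])
   qed
   moreover have "\<epsilon> * \<epsilon>' ^ (q ^ s) \<in> frac R"
    by (intro ringC(6,7)[OF frac_subring[OF R]] k k')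
   ultimately show ?case using k'(1) by blast
  qed
  obtain \<kappa> \<epsilon> b where k: "\<kappa> \<in> frac R" "\<epsilon> ^ (q ^ b) = 1" "u = \<epsilon> * \<kappa> ^ (q ^ N)" using desc[of N] by auto
  have "u ^ (q ^ b) = \<kappa> ^ (q ^ (N + b))" unfolding k(3) power_mult_distrib using k(2) by (simp add: power_add power_mult)
  then have "\<kappa> ^ (q ^ (N + b)) \<in> ?U" using U(4)[OF u] by metis
  moreover have "q ^ (N + b) \<ge> 1" using q1 by simp
  ultimately have kt: "\<kappa> ^ t \<in> ?U" using t(2)[OF k(1)] by blast
  have "(u ^ t) ^ (q ^ b) = ((\<kappa> ^ t) ^ (q ^ N)) ^ (q ^ b)"
  proof -
   have "(u ^ t) ^ (q ^ b) = (u ^ (q ^ b)) ^ t" by (rule power_swap)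
   also have "\<dots> = (\<kappa> ^ (q ^ (N + b))) ^ t" using \<open>u ^ (q ^ b) = \<kappa> ^ (q ^ (N + b))\<close> by simp
   also have "\<dots> = (\<kappa> ^ t) ^ (q ^ (N + b))" by (rule power_swap)
   finally show ?thesis by (simp add: power_add power_mult)
  qed
  then have ut: "u ^ t = (\<kappa> ^ t) ^ (q ^ N)" using U_inj U(4) u kt q1 by (metis one_le_power)
  have Na: "q ^ N = q ^ (r + l) * q ^ a" by (simp add: N_def j_def power_add[symmetric] add_ac)
  have "(u ^ t') ^ (q ^ a) = ((\<kappa> ^ t) ^ (q ^ (r + l))) ^ (q ^ a)"
   using ut unfolding Na t'(1) by (simp add: power_mult[symmetric] mult_ac)
  then have ut': "u ^ t' = (\<kappa> ^ t) ^ (q ^ (r + l))" using U_inj U(4) u kt q1 by (metis one_le_power)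
  \<comment> \<open>The surplus r of the exponent is absorbed in the base; the prime-to-q factor t'
    is then removed by a Bezout relation with q ^ l.\<close>
  define k2 where "k2 = (\<kappa> ^ t) ^ (q ^ r)"
  have k2: "k2 \<in> ?U" "u ^ t' = k2 ^ (q ^ l)" using U(4)[OF kt] ut' by (simp_all add: k2_def power_add power_mult)
  have "coprime t' (q ^ l)" using prime_imp_coprime_nat[OF q t'(2)] coprime_commute coprime_power_right_iff by blast
  moreover have "t' \<noteq> 0" using t'(2) by (cases t') auto
  moreover have "q ^ l \<noteq> 1 \<or> l = 0" using q1 by auto
  ultimately obtain \<alpha> \<beta> where ab: "\<alpha> * t' = \<beta> * q ^ l + 1"
  proof (cases "l = 0")
   case True
   have "t' = (t' - 1) * q ^ l + 1" using True \<open>t' \<noteq> 0\<close> by simp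
   then show ?thesis using that[of 1 "t' - 1"] by simp
  next
   case False
   then have "q ^ l \<noteq> 1" using \<open>q ^ l \<noteq> 1 \<or> l = 0\<close> by blast
   then show ?thesis using coprime_bezout_strong[of t' "q ^ l"] \<open>coprime t' (q ^ l)\<close> that by (metis mult.commute)
  qed
  define w where "w = k2 ^ \<alpha> * inverse (u ^ \<beta>)"
  have "w \<in> ?U" unfolding w_def by (intro U(2) U(3) U(4) k2 u)
  moreover have "w ^ (q ^ l) = u"
  proof -
   have "(k2 ^ \<alpha>) ^ (q ^ l) = (k2 ^ (q ^ l)) ^ \<alpha>" by (rule power_swap)
   also have "\<dots> = u ^ (\<alpha> * t')" unfolding k2(2)[symmetric] by (simp add: power_mult[symmetric] mult.commute)
   also have "\<dots> = (u ^ \<beta>) ^ (q ^ l) * u" unfolding ab by (simp add: power_mult)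
   finally show ?thesis using u0 by (simp add: w_def power_mult_distrib power_inverse)
  qed
  ultimately show ?thesis by blast
 qed
 obtain P where P: "finite P" "P \<subseteq> ?U" "\<And>x. x \<in> ?U \<Longrightarrow> \<exists>p\<in>P. \<exists>u\<in>?U. x = p * u ^ (q ^ N)"
  using mspan_power_reps[of e g "q ^ N"] nz q1 by (metis one_le_power)
 \<comment> \<open>A modulus at which p fails to be a power. If u = p * w ^ (q ^ N) is congruent to
   1 there, then p is congruent to a power of inverse w, so p cannot have failed.\<close>
 have "\<forall>p. \<exists>M\<ge>1. \<not> local_power S q (q ^ N) p \<longrightarrow> (\<forall>z\<in>S. \<not> cg S M (z ^ (q ^ N)) p)"
  unfolding local_power_cg by (metis le_refl)
 from choice[OF this] obtain M :: "complex \<Rightarrow> nat" where M: "\<And>p. M p \<ge> 1"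
  "\<And>p z. \<not> local_power S q (q ^ N) p \<Longrightarrow> z \<in> S \<Longrightarrow> \<not> cg S (M p) (z ^ (q ^ N)) p" by blast
 define m where "m = (\<Prod>p\<in>P. M p)"
 have "m \<ge> 1" unfolding m_def using M(1) by (simp add: Suc_le_eq prod_pos)
 moreover have "\<exists>w\<in>?U. u = w ^ (q ^ l)" if u: "u \<in> ?U" "cg R0 m u 1" for u
 proof -
  obtain p w where p: "p \<in> P" "w \<in> ?U" "u = p * w ^ (q ^ N)" using P(3)[OF u(1)] by blast
  have pU: "p \<in> ?U" using p(1) P(2) by blast
  have "local_power S q (q ^ N) p"
  proof (rule ccontr)
   assume bad: "\<not> local_power S q (q ^ N) p"
   have Ss: "subring_C S" using order_subring[OF S] .
   obtain s where s: "s \<in> R0" "u - 1 = of_nat m * s" using u(2) by (auto simp: cg_def)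
   have "m = M p * (\<Prod>p\<in>P - {p}. M p)" unfolding m_def using P(1) p(1) by (intro prod.remove)
   then have "u - 1 = of_nat (M p) * (of_nat (\<Prod>p\<in>P - {p}. M p) * s)" using s(2) by (simp only: of_nat_mult mult.assoc)
   moreover have "of_nat (\<Prod>p\<in>P - {p}. M p) * s \<in> S"
    using s(1) R0R RS by (intro ringC(6)[OF Ss] ringC(8)[OF Ss]) blast
   ultimately have "cg S (M p) u 1" unfolding cg_def by blast
   moreover define x where "x = inverse w"
   have xU: "x \<in> ?U" unfolding x_def by (rule U(3)[OF p(2)])
   then have xS: "x \<in> S" using UR RS by blast
   ultimately have "cg S (M p) (x ^ (q ^ N) * u) (x ^ (q ^ N) * 1)"
    using cg_lmult[OF Ss] ringC(7)[OF Ss xS] by blast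
   moreover have "x ^ (q ^ N) * u = p" unfolding p(3) x_def using U(5)[OF p(2)] by (simp add: power_inverse)
   ultimately have "cg S (M p) (x ^ (q ^ N)) p" using cg_sym[OF Ss] by simp
   then show False using M(2)[OF bad xS] by blast
  qed
  then obtain v where v: "v \<in> ?U" "p = v ^ (q ^ l)" using good[OF pU] by blast
  have "N = (r + a) + l" by (simp add: N_def j_def)
  then have "u = (v * w ^ (q ^ (r + a))) ^ (q ^ l)"
   unfolding p(3) v(2) by (simp add: power_mult_distrib power_add power_mult)
  then show ?thesis using U(2)[OF v(1) U(4)[OF p(2)]] by blast
 qed
 ultimately show ?thesis by blast
qed

lemma cg_dvd:
 assumes "subring_C R" "cg R m u v" "n dvd m"
 shows "cg R n u v"
proof -
 obtain s where s: "s \<in> R" "u - v = of_nat m * s" using assms(2) by (auto simp: cg_def)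
 obtain k where "m = n * k" using assms(3) by (auto simp: dvd_def)
 then have "u - v = of_nat n * (of_nat k * s)" using s(2) by (simp add: mult.assoc)
 moreover have "of_nat k * s \<in> R" using s(1) assms(1) by (simp add: ringC)
 ultimately show ?thesis unfolding cg_def by blast
qed

text \<open>Split n into a prime power and a coprime factor n': from u = w ^ (q ^ l) = w' ^ n' and a
  Bezout relation, the quotient of powers of w' and w is an n-th root of u.\<close>

lemma chevalley:
 assumes R0: "is_order R"
  and g: "\<And>i. i < e \<Longrightarrow> g i \<noteq> 0 \<and> g i \<in> R \<and> inverse (g i) \<in> R"
  and tf: "\<And>u n. u \<in> mspan e g \<Longrightarrow> n \<ge> 1 \<Longrightarrow> u ^ n = 1 \<Longrightarrow> u = 1"
  and n: "n \<ge> 1"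
 shows "\<exists>m\<ge>1. \<forall>u\<in>mspan e g. cg R m u 1 \<longrightarrow> (\<exists>w\<in>mspan e g. u = w ^ n)"
 using n
proof (induction n rule: less_induct)
 case (less n)
 let ?U = "mspan e g"
 have nz: "\<forall>i<e. g i \<noteq> 0" using g by blast
 note U = mspan_group[OF nz]
 show ?case
 proof (cases "n = 1")
  case True
  then show ?thesis by (intro exI[of _ 1]) auto
 next
  case False
  then obtain q :: nat where q: "Factorial_Ring.prime q" "q dvd n" using prime_factor_nat by blast
  have q1: "q > 1" using prime_gt_1_nat[OF q(1)] .
  define l where "l = multiplicity q n"
  obtain n' where n': "n = q ^ l * n'" "\<not> q dvd n'"
   using multiplicity_decompose'[of n q] less.prems q1 unfolding l_def by (metis not_one_le_zero not_prime_unit q(1))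
  have "l \<noteq> 0" using n' q(2) by (cases l) auto
  have n'0: "n' \<ge> 1" using n'(2) by (cases n') auto
  have "1 < q ^ l" using q1 \<open>l \<noteq> 0\<close> using one_less_power[of q l] by blast
  then have "n' < n" using n'(1) n'0 by simp
  then obtain m' where m': "m' \<ge> 1" "\<And>u. u \<in> ?U \<Longrightarrow> cg R m' u 1 \<Longrightarrow> \<exists>w\<in>?U. u = w ^ n'"
   using less.IH[OF _ n'0] by blast
  obtain m where m: "m \<ge> 1" "\<And>u. u \<in> ?U \<Longrightarrow> cg R m u 1 \<Longrightarrow> \<exists>w\<in>?U. u = w ^ (q ^ l)"
  proof -
   have "\<exists>m\<ge>1. \<forall>u\<in>?U. cg R m u 1 \<longrightarrow> (\<exists>w\<in>?U. u = w ^ (q ^ l))"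
    by (rule chevalley_prime_power[OF R0 q(1)]) (use g tf in blast)+
   then show ?thesis using that by blast
  qed
  have cop: "coprime (q ^ l) n'"
   using prime_imp_coprime_nat[OF q(1) n'(2)] coprime_power_left_iff by blast
  have "\<exists>w\<in>?U. u = w ^ n" if u: "u \<in> ?U" "cg R (m * m') u 1" for u
  proof -
   have u0: "u \<noteq> 0" using U(5)[OF u(1)] .
   have "cg R m u 1" "cg R m' u 1" using cg_dvd[OF order_subring[OF R0] u(2)] by auto
   then obtain w w' where w: "w \<in> ?U" "u = w ^ (q ^ l)" "w' \<in> ?U" "u = w' ^ n'" using m m' u(1) by metis
   show ?thesis
   proof (cases "n' = 1")
    case True then show ?thesis using w n'(1) by auto
   next
    case False
    then obtain x y where xy: "q ^ l * x = n' * y + 1"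
     using coprime_bezout_strong[OF cop False] by blast
    define z where "z = w' ^ x * inverse (w ^ y)"
    have "(w' ^ x) ^ n = u ^ (q ^ l * x)"
     unfolding n'(1) w(4) by (simp add: power_mult[symmetric] mult_ac)
    moreover have "(w ^ y) ^ n = u ^ (n' * y)"
     unfolding n'(1) by (subst w(2)) (simp add: power_mult[symmetric] mult_ac)
    ultimately have "z ^ n = u" unfolding z_def power_mult_distrib power_inverse xy using u0 by simp
    moreover have "z \<in> ?U" unfolding z_def by (intro U(2) U(3) U(4) w)
    ultimately show ?thesis by blast
   qed
  qed
  moreover have "m * m' \<ge> 1" using m(1) m'(1) by simp
  ultimately show ?thesis by blast
 qed
qed

section \<open>Virtually polycyclic groups\<close>

context group
begin

lemma cancel_left: "x \<in> carrier G \<Longrightarrow> y \<in> carrier G \<Longrightarrow> inv x \<otimes> (x \<otimes> y) = y"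
 "x \<in> carrier G \<Longrightarrow> y \<in> carrier G \<Longrightarrow> x \<otimes> (inv x \<otimes> y) = y"
 by (simp_all add: m_assoc[symmetric])

lemmas gsimps = m_assoc inv_mult_group cancel_left

abbreviation cj :: "'a \<Rightarrow> 'a \<Rightarrow> 'a" where "cj c x \<equiv> c \<otimes> x \<otimes> inv c"

text \<open>t normalizes P. The second half is not implied by the first for infinite P.\<close>
definition nz :: "'a \<Rightarrow> 'a set \<Rightarrow> bool" where
 "nz t P \<longleftrightarrow> t \<in> carrier G \<and> (\<forall>p\<in>P. t \<otimes> p \<otimes> inv t \<in> P \<and> inv t \<otimes> p \<otimes> t \<in> P)"

lemma nz_subgroup: assumes "P \<subseteq> carrier G" shows "subgroup {t. nz t P} G"
proof (rule subgroupI)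
 show "{t. nz t P} \<subseteq> carrier G" by (auto simp: nz_def)
 have "nz \<one> P" using assms by (auto simp: nz_def)
 then show "{t. nz t P} \<noteq> {}" by blast
next
 fix a assume "a \<in> {t. nz t P}"
 then show "inv a \<in> {t. nz t P}" by (auto simp: nz_def)
next
 fix a b assume ab: "a \<in> {t. nz t P}" "b \<in> {t. nz t P}"
 then have c: "a \<in> carrier G" "b \<in> carrier G" by (auto simp: nz_def)
 have "a \<otimes> b \<otimes> p \<otimes> inv (a \<otimes> b) \<in> P \<and> inv (a \<otimes> b) \<otimes> p \<otimes> (a \<otimes> b) \<in> P" if p: "p \<in> P" for p
 proof -
  have pc: "p \<in> carrier G" using p assms by blast
  have "cj a (b \<otimes> p \<otimes> inv b) \<in> P" "inv b \<otimes> (inv a \<otimes> p \<otimes> a) \<otimes> b \<in> P"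
   using ab p by (auto simp: nz_def)
  then show ?thesis using c pc by (simp add: gsimps)
 qed
 then show "a \<otimes> b \<in> {t. nz t P}" using c by (simp add: nz_def)
qed

lemma nz_self: assumes "subgroup P G" "t \<in> P" shows "nz t P"
 using assms unfolding nz_def by (meson sub_m sub_inv sub_mem)

lemma nz_int_pow: "P \<subseteq> carrier G \<Longrightarrow> nz t P \<Longrightarrow> nz (t [^] (k::int)) P"
 using subgroup_int_pow_closed[OF nz_subgroup, of P t k] by simp

text \<open>A relative notion inside the fixed group G, so that chains of subgroups are handled
  without changing the carrier.\<close>

definition fi :: "'a set \<Rightarrow> 'a set \<Rightarrow> bool" where
 "fi K H \<longleftrightarrow> subgroup K G \<and> subgroup H G \<and> K \<subseteq> H \<and> (\<exists>T. finite T \<and> T \<subseteq> H \<and> (\<forall>h\<in>H. \<exists>t\<in>T. h \<otimes> inv t \<in> K))"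

lemma fiD: assumes "fi K H" shows "subgroup K G" "subgroup H G" "K \<subseteq> H"
 using assms by (auto simp: fi_def)

lemma fi_reps: "fi K H \<Longrightarrow> \<exists>T. finite T \<and> T \<subseteq> H \<and> (\<forall>h\<in>H. \<exists>t\<in>T. h \<otimes> inv t \<in> K)"
 by (simp add: fi_def)

text \<open>The usual way to finite index below: a map with finitely many values that distinguishes
  the right cosets of K.\<close>

lemma fiI_fun:
 assumes "subgroup K G" "subgroup H G" "K \<subseteq> H" "finite (f ` H)"
  "\<And>x y. x \<in> H \<Longrightarrow> y \<in> H \<Longrightarrow> f x = f y \<Longrightarrow> x \<otimes> inv y \<in> K"
 shows "fi K H"
proof -
 have "\<forall>v. \<exists>y. v \<in> f ` H \<longrightarrow> y \<in> H \<and> f y = v" by auto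
 from choice[OF this] obtain r where r: "\<And>v. v \<in> f ` H \<Longrightarrow> r v \<in> H \<and> f (r v) = v" by blast
 have "\<forall>h\<in>H. \<exists>t\<in>r ` f ` H. h \<otimes> inv t \<in> K"
 proof
  fix h assume h: "h \<in> H"
  then have "h \<otimes> inv (r (f h)) \<in> K" using assms(5)[OF h, of "r (f h)"] r[of "f h"] by auto
  then show "\<exists>t\<in>r ` f ` H. h \<otimes> inv t \<in> K" using h by blast
 qed
 moreover have "finite (r ` f ` H)" "r ` f ` H \<subseteq> H" using assms(4) r by auto
 ultimately show ?thesis using assms(1-3) unfolding fi_def by blast
qed

lemma fi_fun:
 assumes "fi K H"
 shows "\<exists>f :: 'a \<Rightarrow> 'a. finite (f ` H) \<and> (\<forall>x\<in>H. \<forall>y\<in>H. f x = f y \<longrightarrow> x \<otimes> inv y \<in> K)"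
proof -
 obtain T where T: "finite T" "T \<subseteq> H" "\<And>h. h \<in> H \<Longrightarrow> \<exists>t\<in>T. h \<otimes> inv t \<in> K" using fi_reps[OF assms] by blast
 note K = fiD[OF assms]
 have "\<forall>h. \<exists>t. h \<in> H \<longrightarrow> t \<in> T \<and> h \<otimes> inv t \<in> K" using T(3) by blast
 from choice[OF this] obtain f where f: "\<And>h. h \<in> H \<Longrightarrow> f h \<in> T \<and> h \<otimes> inv (f h) \<in> K" by blast
 have "x \<otimes> inv y \<in> K" if xy: "x \<in> H" "y \<in> H" "f x = f y" for x y
 proof -
  have c: "x \<in> carrier G" "y \<in> carrier G" "f x \<in> carrier G"
   using xy f T(2) K sub_mem by (metis, metis, metis subsetD)
  have "(x \<otimes> inv (f x)) \<otimes> inv (y \<otimes> inv (f y)) \<in> K"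
   using f xy K by (meson sub_m sub_inv)
  then show ?thesis using c xy(3) by (simp add: gsimps)
 qed
 moreover have "finite (f ` H)" using f T(1) finite_subset by (metis image_subsetI)
 ultimately show ?thesis by blast
qed

lemma fi_finite: assumes "fi K H" "finite K" shows "finite H"
proof -
 obtain T where T: "finite T" "T \<subseteq> H" "\<And>h. h \<in> H \<Longrightarrow> \<exists>t\<in>T. h \<otimes> inv t \<in> K" using fi_reps[OF assms(1)] by blast
 have "h \<in> (\<lambda>(p,t). p \<otimes> t) ` (K \<times> T)" if h: "h \<in> H" for h
 proof -
  obtain t where t: "t \<in> T" "h \<otimes> inv t \<in> K" using T(3)[OF h] by blast
  have "h \<in> carrier G" "t \<in> carrier G" using h t(1) T(2) sub_mem[OF fiD(2)[OF assms(1)]] by auto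
  then have "h = (h \<otimes> inv t) \<otimes> t" by (simp add: m_assoc)
  then show ?thesis using t by force
 qed
 then show ?thesis using assms(2) T(1) finite_subset[of H "(\<lambda>(p,t). p \<otimes> t) ` (K \<times> T)"] by blast
qed

lemma fi_refl: "subgroup H G \<Longrightarrow> fi H H"
 by (rule fiI_fun[where f = "\<lambda>_. ()"]) (auto intro: sub_m sub_inv)

lemma fi_trans:
 assumes "fi K H" "fi H L" shows "fi K L"
proof -
 obtain T where T: "finite T" "T \<subseteq> H" "\<And>h. h \<in> H \<Longrightarrow> \<exists>t\<in>T. h \<otimes> inv t \<in> K" using fi_reps[OF assms(1)] by blast
 obtain S where S: "finite S" "S \<subseteq> L" "\<And>h. h \<in> L \<Longrightarrow> \<exists>t\<in>S. h \<otimes> inv t \<in> H" using fi_reps[OF assms(2)] by blast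
 note K = fiD[OF assms(1)] and H = fiD[OF assms(2)]
 have "\<exists>t\<in>(\<lambda>(t,s). t \<otimes> s) ` (T \<times> S). h \<otimes> inv t \<in> K" if h: "h \<in> L" for h
 proof -
  obtain s where s: "s \<in> S" "h \<otimes> inv s \<in> H" using S(3)[OF h] by blast
  obtain t where t: "t \<in> T" "(h \<otimes> inv s) \<otimes> inv t \<in> K" using T(3)[OF s(2)] by blast
  have "h \<in> carrier G" "s \<in> carrier G" "t \<in> carrier G"
   using h s(1) t(1) S(2) T(2) K H sub_mem by (metis, metis subsetD, metis subsetD)
  then have "h \<otimes> inv (t \<otimes> s) \<in> K" using t(2) by (simp add: gsimps)
  then show ?thesis using s(1) t(1) by force
 qed
 moreover have "(\<lambda>(t,s). t \<otimes> s) ` (T \<times> S) \<subseteq> L"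
  using T(2) S(2) H sub_m[OF H(2)] by fastforce
 moreover have "finite ((\<lambda>(t,s). t \<otimes> s) ` (T \<times> S))" using T(1) S(1) by simp
 ultimately show ?thesis unfolding fi_def using K H by (meson subset_trans)
qed

lemma fi_sub:
 assumes "fi K H" "subgroup L G" "L \<subseteq> H" shows "fi (K \<inter> L) L"
proof -
 obtain f :: "'a \<Rightarrow> 'a" where f: "finite (f ` H)" "\<And>x y. x \<in> H \<Longrightarrow> y \<in> H \<Longrightarrow> f x = f y \<Longrightarrow> x \<otimes> inv y \<in> K"
  using fi_fun[OF assms(1)] by blast
 show ?thesis
 proof (rule fiI_fun[where f = f])
  show "subgroup (K \<inter> L) G" using fiD(1)[OF assms(1)] assms(2) subgroups_Inter_pair by blast
  show "finite (f ` L)" using f(1) assms(3) finite_subset image_mono by metis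
  fix x y assume "x \<in> L" "y \<in> L" "f x = f y"
  then show "x \<otimes> inv y \<in> K \<inter> L" using f(2) assms(2,3) by (meson IntI sub_m sub_inv subsetD)
 qed (use assms in auto)
qed

lemma fi_Int: assumes "fi K H" "fi L H" shows "fi (K \<inter> L) H"
 using fi_trans[OF fi_sub[OF assms(1) fiD(1)[OF assms(2)] fiD(3)[OF assms(2)]] assms(2)] .

lemma fi_mono: assumes "fi K H" "subgroup L G" "K \<subseteq> L" "L \<subseteq> H" shows "fi L H"
proof -
 obtain T where T: "finite T" "T \<subseteq> H" "\<forall>h\<in>H. \<exists>t\<in>T. h \<otimes> inv t \<in> K" using fi_reps[OF assms(1)] by blast
 then have "\<forall>h\<in>H. \<exists>t\<in>T. h \<otimes> inv t \<in> L" using assms(3) by blast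
 then have "\<exists>T. finite T \<and> T \<subseteq> H \<and> (\<forall>h\<in>H. \<exists>t\<in>T. h \<otimes> inv t \<in> L)" using T(1,2) by blast
 then show ?thesis unfolding fi_def using assms(2,4) fiD(2)[OF assms(1)] by simp
qed

lemma fi_finite_Int:
 assumes "finite I" "subgroup H G" "\<And>i. i \<in> I \<Longrightarrow> fi (K i) H" shows "fi (H \<inter> (\<Inter>i\<in>I. K i)) H"
 using assms(1,3)
proof (induction I rule: finite_induct)
 case empty then show ?case using fi_refl assms(2) by simp
next
 case (insert i I)
 have "H \<inter> (\<Inter>i\<in>insert i I. K i) = K i \<inter> (H \<inter> (\<Inter>i\<in>I. K i))" by auto
 then show ?case using fi_Int[of "K i" H] insert by simp
qed

text \<open>Two of the powers with exponents 0, ..., N lie in one coset, where N counts the values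
  of a separating map; the factorial of N is a multiple of every exponent difference that may
  occur.\<close>

lemma fi_power:
 assumes "fi K H"
 obtains n :: nat where "n \<ge> 1" "\<And>x. x \<in> H \<Longrightarrow> x [^] n \<in> K"
proof -
 obtain f :: "'a \<Rightarrow> 'a" where f: "finite (f ` H)" "\<And>x y. x \<in> H \<Longrightarrow> y \<in> H \<Longrightarrow> f x = f y \<Longrightarrow> x \<otimes> inv y \<in> K"
  using fi_fun[OF assms] by blast
 note K = fiD[OF assms]
 define N where "N = card (f ` H)"
 have "x [^] (fact N :: nat) \<in> K" if x: "x \<in> H" for x
 proof -
  have xc: "x \<in> carrier G" using x K sub_mem by metis
  have pw: "x [^] (i::nat) \<in> H" for i
   using x K(2) by (induction i) (auto simp: sub_one sub_m)
  have "(\<lambda>i::nat. f (x [^] i)) ` {..N} \<subseteq> f ` H" using pw by auto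
  then have "card ((\<lambda>i::nat. f (x [^] i)) ` {..N}) \<le> N" unfolding N_def using f(1) by (intro card_mono)
  then have "\<not> inj_on (\<lambda>i::nat. f (x [^] i)) {..N}" by (intro pigeonhole) simp
  then obtain i j :: nat where ij: "i \<le> N" "j \<le> N" "i < j" "f (x [^] i) = f (x [^] j)"
   unfolding inj_on_def by (metis atMost_iff linorder_neqE_nat)
  have "x [^] j = x [^] (j - i) \<otimes> x [^] i" using xc ij(3) by (simp add: nat_pow_mult)
  then have "x [^] j \<otimes> inv (x [^] i) = x [^] (j - i)" using xc by (simp add: m_assoc)
  then have xd: "x [^] (j - i) \<in> K" using f(2)[OF pw pw ij(4)[symmetric]] by simp
  have "j - i dvd fact N" using ij by (intro dvd_fact) auto
  then obtain k where k: "fact N = (j - i) * k" by (auto simp: dvd_def)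
  have "(x [^] (j - i)) [^] k \<in> K"
   using xd K(1) by (induction k) (auto simp: sub_one sub_m)
  then show ?thesis unfolding k using xc by (simp add: nat_pow_pow)
 qed
 then show ?thesis using that[of "fact N"] by simp
qed

section \<open>Cyclic extensions and virtually polycyclic subgroups\<close>

definition cyc :: "'a set \<Rightarrow> 'a \<Rightarrow> 'a set" where
 "cyc P t = {p \<otimes> t [^] (k::int) | p k. p \<in> P}"

lemma int_pow_add: "t \<in> carrier G \<Longrightarrow> t [^] (i + j :: int) = t [^] i \<otimes> t [^] j"
 by (simp add: int_pow_mult)

lemma int_pow_minus_cancel: "t \<in> carrier G \<Longrightarrow> t [^] (k::int) \<otimes> t [^] (- k) = \<one>"
 "t \<in> carrier G \<Longrightarrow> t [^] (- k::int) \<otimes> t [^] k = \<one>"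
 by (simp_all add: int_pow_neg)

lemma cycI: "p \<in> P \<Longrightarrow> p \<otimes> t [^] (k::int) \<in> cyc P t" by (auto simp: cyc_def)

lemma cycE: assumes "x \<in> cyc P t" obtains p and k::int where "p \<in> P" "x = p \<otimes> t [^] k"
 using assms by (auto simp: cyc_def)

lemma cyc_subgroup:
 assumes P: "subgroup P G" and t: "nz t P" shows "subgroup (cyc P t) G"
proof (rule subgroupI)
 have tc: "t \<in> carrier G" using t by (simp add: nz_def)
 have Pc: "P \<subseteq> carrier G" using P subgroup.subset by blast
 show "cyc P t \<subseteq> carrier G" using tc Pc by (auto simp: cyc_def)
 show "cyc P t \<noteq> {}" using sub_one[OF P] by (auto simp: cyc_def)
 have nzk: "cj (t [^] k) p \<in> P" if "p \<in> P" for p and k :: int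
  using nz_int_pow[OF Pc t, of k] that by (simp add: nz_def)
 show "inv a \<in> cyc P t" if a: "a \<in> cyc P t" for a
 proof -
  obtain p and k::int where p: "p \<in> P" "a = p \<otimes> t [^] k" using a by (rule cycE)
  have pc: "p \<in> carrier G" using p Pc by blast
  have "inv a = (cj (t [^] (-k)) (inv p)) \<otimes> t [^] (- k)"
   using tc pc p by (simp add: gsimps int_pow_neg)
  then show ?thesis using nzk[OF sub_inv[OF P p(1)], of "-k"] cycI by metis
 qed
 show "a \<otimes> b \<in> cyc P t" if a: "a \<in> cyc P t" and b: "b \<in> cyc P t" for a b
 proof -
  obtain p and k::int where p: "p \<in> P" "a = p \<otimes> t [^] k" using a by (rule cycE)
  obtain q and l::int where q: "q \<in> P" "b = q \<otimes> t [^] l" using b by (rule cycE)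
  have c: "p \<in> carrier G" "q \<in> carrier G" using p q Pc by auto
  have "a \<otimes> b = (p \<otimes> (cj (t [^] k) q)) \<otimes> t [^] (k + l)"
   using tc c p q by (simp add: gsimps int_pow_add)
  then show ?thesis using nzk[OF q(1)] sub_m[OF P p(1)] cycI by metis
 qed
qed

lemma cyc_superset: assumes "P \<subseteq> carrier G" "t \<in> carrier G" shows "P \<subseteq> cyc P t"
proof
 fix p assume "p \<in> P"
 then have "p = p \<otimes> t [^] (0::int)" using assms by auto
 then show "p \<in> cyc P t" using \<open>p \<in> P\<close> cycI by metis
qed

lemma cyc_gen: assumes "subgroup P G" "t \<in> carrier G" shows "t [^] (k::int) \<in> cyc P t"
 using cycI[OF sub_one[OF assms(1)], of t k] assms(2) by simp

lemma cyc_subset: assumes "subgroup Q G" "P \<subseteq> Q" "t \<in> Q" shows "cyc P t \<subseteq> Q"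
 unfolding cyc_def using assms subgroup_int_pow_closed[OF assms(1,3)] sub_m[OF assms(1)] by blast

lemma cyc_fi:
 assumes D: "fi D P" and t: "nz t P" "nz t D" shows "fi (cyc D t) (cyc P t)"
proof -
 note K = fiD[OF D]
 have tc: "t \<in> carrier G" using t by (simp add: nz_def)
 have Pc: "P \<subseteq> carrier G" "D \<subseteq> carrier G" using K subgroup.subset by auto
 obtain T where T: "finite T" "T \<subseteq> P" "\<And>h. h \<in> P \<Longrightarrow> \<exists>t\<in>T. h \<otimes> inv t \<in> D" using fi_reps[OF D] by blast
 have "\<exists>r\<in>T. x \<otimes> inv r \<in> cyc D t" if x: "x \<in> cyc P t" for x
 proof -
  obtain p and k::int where p: "p \<in> P" "x = p \<otimes> t [^] k" using x by (rule cycE)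
  let ?p = "cj (t [^] (-k)) p"
  have "?p \<in> P" using nz_int_pow[OF Pc(1) t(1), of "-k"] p(1) by (simp add: nz_def)
  then obtain r where r: "r \<in> T" "?p \<otimes> inv r \<in> D" using T(3) by blast
  have c: "p \<in> carrier G" "r \<in> carrier G" using p r T(2) Pc by auto
  have "cj (t [^] k) (?p \<otimes> inv r) \<in> D"
   using nz_int_pow[OF Pc(2) t(2), of k] r(2) by (simp add: nz_def)
  moreover have "x \<otimes> inv r = (cj (t [^] k) (?p \<otimes> inv r)) \<otimes> t [^] k"
   unfolding p(2) using c tc by (simp add: gsimps int_pow_neg)
  ultimately show ?thesis using r(1) cycI by metis
 qed
 moreover have "T \<subseteq> cyc P t" using T(2) cyc_superset[OF Pc(1) tc] by blast
 moreover have "cyc D t \<subseteq> cyc P t" using K(3) by (auto simp: cyc_def)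
 ultimately show ?thesis unfolding fi_def using cyc_subgroup K t T(1) by blast
qed

lemma cyc_pow_reps:
 assumes P: "subgroup P G" and t: "nz t P" and n: "n \<ge> 1" and Q: "subgroup Q G" "P \<subseteq> Q" "t [^] (int n) \<in> Q" "Q \<subseteq> cyc P t"
 shows "fi Q (cyc P t)"
proof -
 have tc: "t \<in> carrier G" using t by (simp add: nz_def)
 have Pc: "P \<subseteq> carrier G" using P subgroup.subset by auto
 have "\<exists>r\<in>(\<lambda>m. t [^] int m) ` {..<n}. x \<otimes> inv r \<in> Q" if x: "x \<in> cyc P t" for x
 proof -
  obtain p and k::int where p: "p \<in> P" "x = p \<otimes> t [^] k" using x by (rule cycE)
  define m where "m = nat (k mod int n)"
  have m: "m < n" "k = int n * (k div int n) + int m" using n by (auto simp: m_def nat_less_iff)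
  have "t [^] k = (t [^] (int n)) [^] (k div int n) \<otimes> t [^] int m"
   using m(2) int_pow_add[OF tc] int_pow_pow[OF tc] by metis
  then have "x \<otimes> inv (t [^] int m) = p \<otimes> (t [^] (int n)) [^] (k div int n)"
   unfolding p(2) using tc p(1) Pc by (simp add: m_assoc subset_iff)
  also have "\<dots> \<in> Q" using subgroup_int_pow_closed[OF Q(1,3)] sub_m[OF Q(1)] p(1) Q(2) by blast
  finally show ?thesis using m(1) by blast
 qed
 moreover have "(\<lambda>m. t [^] int m) ` {..<n} \<subseteq> cyc P t" using cyc_gen[OF P tc] by blast
 ultimately show ?thesis unfolding fi_def using Q cyc_subgroup[OF P t] by (intro conjI exI[of _ "(\<lambda>m. t [^] int m) ` {..<n}"]) auto
qed

text \<open>Virtually polycyclic subgroups, with a bound n for the Hirsch length.\<close>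
inductive VP :: "nat \<Rightarrow> 'a set \<Rightarrow> bool" where
 VP_one: "VP 0 {\<one>}"
| VP_fin: "VP n P \<Longrightarrow> fi P H \<Longrightarrow> VP n H"
| VP_ext: "VP n P \<Longrightarrow> nz t P \<Longrightarrow> VP (Suc n) (cyc P t)"

lemma VP_subgroup: "VP n P \<Longrightarrow> subgroup P G"
 by (induction rule: VP.induct) (auto simp: cyc_subgroup fiD triv_subgroup)

lemma cyc_one: assumes "subgroup P G" shows "cyc P \<one> = P"
 using subgroup.subset[OF assms] by (force simp: cyc_def)

text \<open>Extending by t = \<one> raises the bound and leaves the group as it is.\<close>

lemma VP_Suc: assumes "VP n P" shows "VP (Suc n) P"
proof -
 have P: "subgroup P G" using VP_subgroup assms by blast
 have "nz \<one> P" using nz_self P sub_one by blast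
 then show ?thesis using VP_ext[OF assms, of \<one>] cyc_one[OF P] by simp
qed

definition fg :: "'a set \<Rightarrow> bool" where
 "fg P \<longleftrightarrow> (\<exists>S. finite S \<and> S \<subseteq> P \<and> (\<forall>Q. subgroup Q G \<longrightarrow> S \<subseteq> Q \<longrightarrow> P \<subseteq> Q))"

lemma VP_fg: "VP n P \<Longrightarrow> fg P"
proof (induction rule: VP.induct)
 case VP_one
 show ?case unfolding fg_def by (auto intro!: exI[of _ "{}"] sub_one)
next
 case (VP_fin n P H)
 obtain S where S: "finite S" "S \<subseteq> P" "\<And>Q. subgroup Q G \<Longrightarrow> S \<subseteq> Q \<Longrightarrow> P \<subseteq> Q" using VP_fin.IH by (auto simp: fg_def)
 obtain T where T: "finite T" "T \<subseteq> H" "\<And>h. h \<in> H \<Longrightarrow> \<exists>t\<in>T. h \<otimes> inv t \<in> P" using fi_reps[OF VP_fin.hyps(2)] by blast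
 note K = fiD[OF VP_fin.hyps(2)]
 have "H \<subseteq> Q" if Q: "subgroup Q G" "S \<union> T \<subseteq> Q" for Q
 proof
  fix h assume h: "h \<in> H"
  then obtain t where t: "t \<in> T" "h \<otimes> inv t \<in> P" using T(3) by blast
  have "h \<in> carrier G" "t \<in> carrier G" using h t(1) T(2) K(2) sub_mem by (metis, metis subsetD)
  then have "h = (h \<otimes> inv t) \<otimes> t" by (simp add: m_assoc)
  moreover have "h \<otimes> inv t \<in> Q" "t \<in> Q" using S(3)[OF Q(1)] Q(2) t by auto
  ultimately show "h \<in> Q" using sub_m[OF Q(1)] by metis
 qed
 then show ?case unfolding fg_def using S T K by (intro exI[of _ "S \<union> T"]) auto
next
 case (VP_ext n P t)
 obtain S where S: "finite S" "S \<subseteq> P" "\<And>Q. subgroup Q G \<Longrightarrow> S \<subseteq> Q \<Longrightarrow> P \<subseteq> Q" using VP_ext.IH by (auto simp: fg_def)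
 have P: "subgroup P G" using VP_subgroup VP_ext.hyps by blast
 have tc: "t \<in> carrier G" using VP_ext.hyps(2) by (simp add: nz_def)
 have "t \<in> cyc P t" using cyc_gen[OF P tc, of 1] tc by simp
 moreover have "P \<subseteq> cyc P t" using cyc_superset subgroup.subset[OF P] tc by blast
 moreover have "cyc P t \<subseteq> Q" if "subgroup Q G" "insert t S \<subseteq> Q" for Q
  using cyc_subset[OF that(1)] S(3)[OF that(1)] that(2) by blast
 ultimately show ?case unfolding fg_def using S by (intro exI[of _ "insert t S"]) auto
qed

section \<open>Finite index subgroups invariant under all endomorphisms\<close>

definition endo :: "'a set \<Rightarrow> ('a \<Rightarrow> 'a) \<Rightarrow> bool" where
 "endo P \<alpha> \<longleftrightarrow> \<alpha> ` P \<subseteq> P \<and> (\<forall>x\<in>P. \<forall>y\<in>P. \<alpha> (x \<otimes> y) = \<alpha> x \<otimes> \<alpha> y)"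

lemma endo_one: assumes "subgroup P G" "endo P \<alpha>" shows "\<alpha> \<one> = \<one>"
proof -
 have "\<alpha> \<one> \<in> P" "\<alpha> \<one> = \<alpha> \<one> \<otimes> \<alpha> \<one>"
  using assms sub_one[OF assms(1)] by (auto simp: endo_def) (metis one_closed r_one)
 then show ?thesis using sub_mem[OF assms(1)] by (metis r_cancel_one')
qed

lemma endo_conj: assumes "subgroup P G" "nz t P" shows "endo P (\<lambda>x. t \<otimes> x \<otimes> inv t)" "endo P (\<lambda>x. inv t \<otimes> x \<otimes> t)"
 using assms sub_mem[OF assms(1)] unfolding endo_def nz_def by (auto simp: gsimps)

text \<open>For an endomorphism \<alpha> of P, the action of P on the cosets of D through \<alpha> is determined by the images of
 generators of P. Hence there are finitely many such actions, and K is the intersection of their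
 kernels.\<close>

lemma invariant_fi:
 assumes P: "fg P" and D: "fi D P"
 obtains K where "fi K P" "K \<subseteq> D" "\<And>\<alpha>. endo P \<alpha> \<Longrightarrow> \<alpha> ` K \<subseteq> K"
proof -
 note DD = fiD[OF D]
 note Dc = subgroup.subset[OF DD(1)] and Pc = sub_mem[OF DD(2)] and Pi = sub_inv[OF DD(2)] and Pm = sub_m[OF DD(2)]
 have P1: "\<one> \<in> P" using DD(2) sub_one by blast
 define V where "V = (\<lambda>x. x <# D) ` P"
 have Vc: "v \<subseteq> carrier G" if "v \<in> V" for v using that Pc l_coset_subset_G[OF Dc] by (auto simp: V_def)
 have VV: "x <# v \<in> V" if "x \<in> P" "v \<in> V" for x v
  using that Pc Pm lcos_m_assoc[OF Dc] by (auto simp: V_def)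
 have assoc: "x <# (y <# v) = (x \<otimes> y) <# v" if "x \<in> P" "y \<in> P" "v \<in> V" for x y v
  using lcos_m_assoc[OF Vc[OF that(3)]] Pc that by blast
 have finV: "finite V"
 proof -
  obtain T where T: "finite T" "T \<subseteq> P" "\<And>h. h \<in> P \<Longrightarrow> \<exists>t\<in>T. h \<otimes> inv t \<in> D" using fi_reps[OF D] by blast
  have "x <# D \<in> (\<lambda>t. inv t <# D) ` T" if x: "x \<in> P" for x
  proof -
   obtain t where t: "t \<in> T" "inv x \<otimes> inv t \<in> D" using T(3)[OF Pi[OF x]] by blast
   have c: "x \<in> carrier G" "t \<in> carrier G" using x t(1) T(2) Pc by auto
   have "inv t <# D = x <# ((inv x \<otimes> inv t) <# D)" using c Dc by (simp add: lcos_m_assoc cancel_left)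
   then show ?thesis using coset_join3[OF _ DD(1) t(2)] c t(1) by auto
  qed
  then show ?thesis using T(1) finite_subset[of V "(\<lambda>t. inv t <# D) ` T"] by (auto simp: V_def)
 qed
 have al: "\<alpha> x \<in> P" "\<alpha> (x \<otimes> y) = \<alpha> x \<otimes> \<alpha> y" "\<alpha> (inv x) = inv (\<alpha> x)" if "endo P \<alpha>" "x \<in> P" "y \<in> P" for \<alpha> x y
 proof -
  show 1: "\<alpha> x \<in> P" "\<alpha> (x \<otimes> y) = \<alpha> x \<otimes> \<alpha> y" using that by (auto simp: endo_def)
  have "\<alpha> (inv x) \<otimes> \<alpha> x = \<alpha> (inv x \<otimes> x)" "\<alpha> (inv x) \<in> P" using that Pi by (auto simp: endo_def)
  then have "\<alpha> (inv x) \<otimes> \<alpha> x = \<one>" "\<alpha> (inv x) \<in> P" using Pc[OF that(2)] endo_one[OF DD(2) that(1)] by auto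
  then show "\<alpha> (inv x) = inv (\<alpha> x)" using inv_equality Pc 1(1) by metis
 qed
 define K where "K = {x \<in> P. \<forall>\<alpha>. endo P \<alpha> \<longrightarrow> \<alpha> x \<in> D}"
 obtain S where S: "finite S" "S \<subseteq> P" "\<And>Q. subgroup Q G \<Longrightarrow> S \<subseteq> Q \<Longrightarrow> P \<subseteq> Q" using P by (auto simp: fg_def)
 define dat where "dat \<alpha> = restrict (\<lambda>(x, v). \<alpha> x <# v) (S \<times> V)" for \<alpha>
 \<comment> \<open>For every endomorphism, its action data together with the map of the cosets given
   by the image of x. If x and y have equal records, some \<beta> acts like \<alpha> and the image
   of y under \<beta> acts like \<alpha> x; so \<alpha> x and \<alpha> y act alike.\<close>
 define F where "F x = {(dat \<alpha>, restrict (\<lambda>v. \<alpha> x <# v) V) | \<alpha>. endo P \<alpha>}" for x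
 \<comment> \<open>The elements on which the two actions agree form a subgroup containing the
   generators.\<close>
 have dat_eq: "\<alpha> x <# v = \<beta> x <# v"
  if e: "endo P \<alpha>" "endo P \<beta>" "dat \<alpha> = dat \<beta>" "x \<in> P" "v \<in> V" for \<alpha> \<beta> x v
 proof -
  define Q where "Q = {x \<in> P. \<forall>v\<in>V. \<alpha> x <# v = \<beta> x <# v}"
  have "subgroup Q G"
  proof (rule subgroupI)
   show "Q \<subseteq> carrier G" using Pc by (auto simp: Q_def)
   show "Q \<noteq> {}" using P1 endo_one[OF DD(2) e(1)] endo_one[OF DD(2) e(2)] by (auto simp: Q_def intro!: exI[of _ \<one>])
   fix a assume "a \<in> Q"
   then have a: "a \<in> P" "\<And>v. v \<in> V \<Longrightarrow> \<alpha> a <# v = \<beta> a <# v" by (auto simp: Q_def)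
   have "inv (\<alpha> a) <# v = inv (\<beta> a) <# v" if v: "v \<in> V" for v
   proof -
    define u where "u = inv (\<alpha> a) <# v"
    have p: "\<alpha> a \<in> P" "\<beta> a \<in> P" using al(1) e a by auto
    have u: "u \<in> V" unfolding u_def using VV[OF Pi[OF p(1)] v] .
    have "\<alpha> a <# u = v" unfolding u_def
     using assoc[OF p(1) Pi[OF p(1)] v] Pc[OF p(1)] lcos_mult_one[OF Vc[OF v]] by simp
    then have "inv (\<beta> a) <# (\<beta> a <# u) = inv (\<beta> a) <# v" using a(2)[OF u] by simp
    then show ?thesis
     using assoc[OF Pi[OF p(2)] p(2) u] Pc[OF p(2)] lcos_mult_one[OF Vc[OF u]] by (simp add: u_def)
   qed
   then show "inv a \<in> Q" using al(3) e a(1) Pi by (simp add: Q_def)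
   fix b assume "b \<in> Q"
   then have b: "b \<in> P" "\<And>v. v \<in> V \<Longrightarrow> \<alpha> b <# v = \<beta> b <# v" by (auto simp: Q_def)
   have "\<alpha> (a \<otimes> b) <# v = \<beta> (a \<otimes> b) <# v" if v: "v \<in> V" for v
    using assoc[OF al(1)[OF e(1) a(1) a(1)] al(1)[OF e(1) b(1) b(1)] v] assoc[OF al(1)[OF e(2) a(1) a(1)] al(1)[OF e(2) b(1) b(1)] v]
     a(2)[OF VV[OF al(1)[OF e(2) b(1) b(1)] v]] b(2)[OF v] al(2)[OF _ a(1) b(1)] e by simp
   then show "a \<otimes> b \<in> Q" using Pm[OF a(1) b(1)] by (simp add: Q_def)
  qed
  moreover have "s \<in> Q" if s: "s \<in> S" for s
  proof -
   have "\<alpha> s <# v = \<beta> s <# v" if "v \<in> V" for v using fun_cong[OF e(3), of "(s, v)"] s that by (simp add: dat_def)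
   then show ?thesis using s S(2) by (auto simp: Q_def)
  qed
  ultimately have "P \<subseteq> Q" using S(3) by blast
  then show ?thesis using e(4,5) by (auto simp: Q_def)
 qed
 have "fi K P"
 proof (rule fiI_fun[where f = F])
  show "subgroup K G"
  proof (rule subgroupI)
   show "K \<subseteq> carrier G" using Pc by (auto simp: K_def)
   have "\<alpha> \<one> \<in> D" if "endo P \<alpha>" for \<alpha> using endo_one[OF DD(2) that] sub_one[OF DD(1)] by simp
   then show "K \<noteq> {}" using P1 by (auto simp: K_def)
   fix a assume a: "a \<in> K"
   have "\<alpha> (inv a) \<in> D" if "endo P \<alpha>" for \<alpha> using al(3)[OF that, of a a] a that sub_inv[OF DD(1)] by (simp add: K_def)
   then show "inv a \<in> K" using a Pi by (simp add: K_def)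
   fix b assume b: "b \<in> K"
   have "\<alpha> (a \<otimes> b) \<in> D" if "endo P \<alpha>" for \<alpha> using al(2)[OF that, of a b] a b that sub_m[OF DD(1)] by (simp add: K_def)
   then show "a \<otimes> b \<in> K" using a b Pm by (simp add: K_def)
  qed
  have "dat \<alpha> \<in> S \<times> V \<rightarrow>\<^sub>E V \<and> restrict (\<lambda>v. \<alpha> x <# v) V \<in> V \<rightarrow>\<^sub>E V" if "x \<in> P" "endo P \<alpha>" for x \<alpha>
   using VV al(1)[OF that(2)] that(1) S(2) by (auto simp: dat_def PiE_def)
  then have "F ` P \<subseteq> Pow ((S \<times> V \<rightarrow>\<^sub>E V) \<times> (V \<rightarrow>\<^sub>E V))" unfolding F_def by blast
  moreover have "finite (Pow ((S \<times> V \<rightarrow>\<^sub>E V) \<times> (V \<rightarrow>\<^sub>E V)))" using S(1) finV by (intro finite_Pow_iff[THEN iffD2] finite_cartesian_product finite_PiE) auto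
  ultimately show "finite (F ` P)" by (rule finite_subset)
  fix x y assume xy: "x \<in> P" "y \<in> P" "F x = F y"
  have "\<alpha> (x \<otimes> inv y) \<in> D" if e: "endo P \<alpha>" for \<alpha>
  proof -
   have "(dat \<alpha>, restrict (\<lambda>v. \<alpha> x <# v) V) \<in> F y" unfolding xy(3)[symmetric] using e by (auto simp: F_def)
   then obtain \<beta> where b: "endo P \<beta>" "dat \<alpha> = dat \<beta>" "restrict (\<lambda>v. \<alpha> x <# v) V = restrict (\<lambda>v. \<beta> y <# v) V"
    by (auto simp: F_def)
   have p: "\<alpha> x \<in> P" "\<alpha> y \<in> P" using al(1) e xy by auto
   define v where "v = inv (\<alpha> y) <# D"
   have v: "v \<in> V" using Pi[OF p(2)] by (auto simp: v_def V_def)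
   have "\<alpha> x <# v = \<alpha> y <# v" using fun_cong[OF b(3), of v] v dat_eq[OF e b(1,2) xy(2) v] by simp
   then have "(\<alpha> x \<otimes> inv (\<alpha> y)) <# D = D" unfolding v_def using p Pc Dc by (simp add: lcos_m_assoc lcos_mult_one)
   moreover have "(\<alpha> x \<otimes> inv (\<alpha> y)) \<otimes> \<one> \<in> (\<alpha> x \<otimes> inv (\<alpha> y)) <# D" using sub_one[OF DD(1)] by (auto simp: l_coset_def)
   ultimately show ?thesis using al(2)[OF e xy(1) Pi[OF xy(2)]] al(3)[OF e xy(2,2)] p Pc by simp
  qed
  then show "x \<otimes> inv y \<in> K" using Pm[OF xy(1) Pi[OF xy(2)]] by (simp add: K_def)
 qed (use DD in \<open>auto simp: K_def\<close>)
 moreover have "endo P (\<lambda>x. x)" by (simp add: endo_def)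
 then have "K \<subseteq> D" by (auto simp: K_def)
 moreover have "\<alpha> ` K \<subseteq> K" if a: "endo P \<alpha>" for \<alpha>
 proof -
  have "endo P (\<lambda>x. \<beta> (\<alpha> x))" if "endo P \<beta>" for \<beta> using a that by (auto simp: endo_def image_subset_iff)
  then show ?thesis using al(1)[OF a] by (auto simp: K_def)
 qed
 ultimately show ?thesis using that by blast
qed

end

section \<open>Subgroups of cyclic extensions and their separability\<close>

context group
begin

lemma nz_D: assumes "nz t P" "p \<in> P" shows "t \<in> carrier G" "cj t p \<in> P" "inv t \<otimes> p \<otimes> t \<in> P"
 using assms by (auto simp: nz_def)

text \<open>A nonzero power of t in P leaves finitely many cosets; otherwise the extension of P is
  by an infinite cyclic group.\<close>

lemma cyc_torsion_cases:
 assumes P: "subgroup P G" and t: "nz t P"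
 shows "fi P (cyc P t) \<or> (\<forall>k::int. t [^] k \<in> P \<longrightarrow> k = 0)"
proof (rule disjCI)
 have tc: "t \<in> carrier G" using t by (simp add: nz_def)
 assume "\<not> (\<forall>k::int. t [^] k \<in> P \<longrightarrow> k = 0)"
 then obtain k :: int where k: "t [^] k \<in> P" "k \<noteq> 0" by blast
 have "t [^] (- k) \<in> P" using sub_inv[OF P k(1)] tc by (simp add: int_pow_neg)
 then have "t [^] (int (nat \<bar>k\<bar>)) \<in> P" using k(1) by (cases "k \<ge> 0") auto
 moreover have "nat \<bar>k\<bar> \<ge> 1" using k(2) by simp
 ultimately show "fi P (cyc P t)"
  using cyc_pow_reps[OF P t _ P subset_refl] cyc_superset[OF subgroup.subset[OF P] tc] by blast
qed

text \<open>Modulo P, which t normalizes, s is t ^ l and its j-th power is t ^ (l * j).\<close>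

lemma cyc_power_mod:
 assumes P: "subgroup P G" and t: "nz t P" and s: "s = p0 \<otimes> t [^] (l::int)" "p0 \<in> P"
 shows "s [^] (j::int) \<otimes> t [^] (- (l * j)) \<in> P"
proof -
 have tc: "t \<in> carrier G" using t by (simp add: nz_def)
 have Pc: "P \<subseteq> carrier G" using P subgroup.subset by blast
 have sc: "s \<in> carrier G" using s tc Pc by auto
 have nat: "s [^] (int n) \<otimes> t [^] (- (l * int n)) \<in> P" for n
 proof (induction n)
  case 0
  show ?case using sub_one[OF P] by simp
 next
  case (Suc n)
  define y where "y = s [^] (int n) \<otimes> t [^] (- (l * int n))"
  have yP: "y \<in> P" using Suc by (simp add: y_def)
  have yc: "y \<in> carrier G" "p0 \<in> carrier G" using yP s Pc by auto
  have e1: "s [^] (int (Suc n)) = s \<otimes> s [^] (int n)" using sc int_pow_add[OF sc, of 1 "int n"] by simp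
  have e2: "t [^] (- (l * int (Suc n))) = t [^] (- (l * int n)) \<otimes> t [^] (- l)"
   using int_pow_add[OF tc, of "- (l * int n)" "- l"] by (simp add: algebra_simps)
  have "s [^] (int (Suc n)) \<otimes> t [^] (- (l * int (Suc n))) = s \<otimes> y \<otimes> t [^] (- l)"
   unfolding e1 e2 y_def using sc tc by (simp add: m_assoc)
  also have "\<dots> = p0 \<otimes> (cj (t [^] l) y)"
   unfolding s(1) using tc yc by (simp add: m_assoc int_pow_neg)
  also have "\<dots> \<in> P" using sub_m[OF P s(2) nz_D(2)[OF nz_int_pow[OF Pc t] yP]] .
  finally show ?case .
 qed
 show ?thesis
 proof (cases "j \<ge> 0")
  case True
  then show ?thesis using nat[of "nat j"] by simp
 next
  case False
  define n where "n = nat (- j)"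
  have j: "j = - int n" using False by (simp add: n_def)
  define y where "y = s [^] (int n) \<otimes> t [^] (- (l * int n))"
  have yP: "y \<in> P" using nat by (simp add: y_def)
  have yc: "y \<in> carrier G" using yP Pc by auto
  have "s [^] (int n) = y \<otimes> t [^] (l * int n)" unfolding y_def using sc tc
   by (simp add: m_assoc int_pow_neg)
  then have "s [^] j = t [^] (- (l * int n)) \<otimes> inv y" unfolding j using sc tc yc by (simp add: int_pow_neg inv_mult_group)
  then have "s [^] j \<otimes> t [^] (- (l * j)) = t [^] (- (l * int n)) \<otimes> inv y \<otimes> inv (t [^] (- (l * int n)))"
   unfolding j using tc yc by (simp add: int_pow_neg)
  then show ?thesis using nz_D(2)[OF nz_int_pow[OF Pc t] sub_inv[OF P yP]] by metis
 qed
qed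

text \<open>The exponents k for which some p t ^ k lies in B form a subgroup of the integers; l is
  its positive generator and s an element of B realizing it. The last conclusion concerns elements
  outside B, for use in \<open>sep_ext\<close>.\<close>

lemma cyc_subgroup_decomp:
 assumes P: "subgroup P G" and t: "nz t P" and B: "subgroup B G" "B \<subseteq> cyc P t" "\<not> B \<subseteq> P"
 obtains s p0 and l :: nat where "l \<ge> 1" "s \<in> B" "p0 \<in> P" "s = p0 \<otimes> t [^] (int l)"
  "\<And>b. b \<in> B \<Longrightarrow> \<exists>j::int. b \<otimes> s [^] (- j) \<in> B \<inter> P"
  "\<And>p k. p \<in> P \<Longrightarrow> int l dvd k \<Longrightarrow> \<exists>j::int. p \<otimes> t [^] k \<otimes> s [^] (- j) \<in> P"
proof -
 have tc: "t \<in> carrier G" using t by (simp add: nz_def)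
 have Pc: "P \<subseteq> carrier G" using P subgroup.subset by blast
 have Bc: "B \<subseteq> carrier G" using B subgroup.subset by blast
 define I where "I k \<longleftrightarrow> (\<exists>p\<in>P. p \<otimes> t [^] (k::int) \<in> B)" for k
 have I_diff: "I (k - m)" if km: "I k" "I m" for k m
 proof -
  obtain p r where p: "p \<in> P" "p \<otimes> t [^] k \<in> B" "r \<in> P" "r \<otimes> t [^] m \<in> B" using km by (auto simp: I_def)
  have c: "p \<in> carrier G" "r \<in> carrier G" using p Pc by auto
  have e: "(p \<otimes> t [^] k) \<otimes> inv (r \<otimes> t [^] m) = (p \<otimes> (cj (t [^] (k - m)) (inv r))) \<otimes> t [^] (k - m)"
  proof -
   have "t [^] (k - m) = t [^] k \<otimes> inv (t [^] m)" using int_pow_add[OF tc, of k "- m"] tc by (simp add: int_pow_neg)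
   then show ?thesis using c tc by (simp add: gsimps)
  qed
  have "(p \<otimes> t [^] k) \<otimes> inv (r \<otimes> t [^] m) \<in> B"
   using p sub_m[OF B(1)] sub_inv[OF B(1)] by blast
  moreover have "p \<otimes> (cj (t [^] (k - m)) (inv r)) \<in> P"
   using sub_m[OF P p(1) nz_D(2)[OF nz_int_pow[OF Pc t] sub_inv[OF P p(3)]]] .
  ultimately show ?thesis unfolding I_def e by blast
 qed
 obtain b where b: "b \<in> B" "b \<notin> P" using B(3) by blast
 then have "b \<in> cyc P t" using B(2) by blast
 then obtain p and k::int where pk: "p \<in> P" "b = p \<otimes> t [^] k" by (rule cycE)
 have "k \<noteq> 0" using b pk Pc by auto
 moreover have "I k" using pk b by (auto simp: I_def)
 moreover have "I 0" using sub_one[OF B(1)] sub_one[OF P] tc by (auto simp: I_def intro!: bexI[of _ \<one>])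
 then have "I (- k)" if "I k" for k using I_diff[of 0 k] that by simp
 ultimately have ex: "\<exists>n::nat. n \<ge> 1 \<and> I (int n)"
  by (cases "k > 0") (auto intro!: exI[of _ "nat \<bar>k\<bar>"])
 define l where "l = (LEAST n::nat. n \<ge> 1 \<and> I (int n))"
 have l: "l \<ge> 1" "I (int l)" using LeastI_ex[OF ex] by (auto simp: l_def)
 have lmin: "l \<le> n" if "n \<ge> 1" "I (int n)" for n unfolding l_def using that by (intro Least_le) simp
 have I_mult: "I (int l * j)" for j :: int
 proof -
  have nat: "I (int l * int n)" for n
  proof (induction n)
   case (Suc n)
   have "I (- int l)" using \<open>\<And>k. I k \<Longrightarrow> I (- k)\<close> l(2) by blast
   then show ?case using I_diff[OF Suc, of "- int l"] by (simp add: algebra_simps)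
  qed (use \<open>I 0\<close> in simp)
  show ?thesis
  proof (cases "j \<ge> 0")
   case True then show ?thesis using nat[of "nat j"] by simp
  next
   case False then show ?thesis using nat[of "nat (- j)"] \<open>\<And>k. I k \<Longrightarrow> I (- k)\<close>[of "int l * int (nat (- j))"] by simp
  qed
 qed
 have I_dvd: "int l dvd k" if "I k" for k
 proof (rule ccontr)
  assume "\<not> int l dvd k"
  then have "k mod int l \<noteq> 0" by (simp add: dvd_eq_mod_eq_0)
  moreover have "0 \<le> k mod int l" "k mod int l < int l" using l(1) by auto
  moreover have "I (k - int l * (k div int l))" using I_diff[OF that I_mult] .
  then have "I (k mod int l)" by (simp add: minus_mult_div_eq_mod)
  ultimately show False using lmin[of "nat (k mod int l)"] by (smt (verit) nat_eq_iff2 nat_int nat_le_iff of_nat_1 of_nat_le_iff)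
 qed
 obtain p0 where p0: "p0 \<in> P" "p0 \<otimes> t [^] (int l) \<in> B" using l(2) by (auto simp: I_def)
 define s where "s = p0 \<otimes> t [^] (int l)"
 have sB: "s \<in> B" using p0 by (simp add: s_def)
 have sc: "s \<in> carrier G" using sB Bc by auto
 have dec: "p \<otimes> t [^] k \<otimes> s [^] (- j) \<in> P" if "p \<in> P" "k = int l * j" for p k j
 proof -
  have pc: "p \<in> carrier G" using that Pc by auto
  have "s [^] j \<otimes> t [^] (- (int l * j)) \<in> P" by (rule cyc_power_mod[OF P t s_def p0(1)])
  then have "inv (s [^] j \<otimes> t [^] (- (int l * j))) \<in> P" by (rule sub_inv[OF P])
  moreover have "inv (s [^] j \<otimes> t [^] (- (int l * j))) = t [^] k \<otimes> s [^] (- j)"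
   using that sc tc by (simp add: inv_mult_group int_pow_neg)
  ultimately have "p \<otimes> (t [^] k \<otimes> s [^] (- j)) \<in> P" using sub_m[OF P that(1)] by simp
  then show ?thesis using pc tc sc by (simp add: m_assoc)
 qed
 have "\<exists>j::int. b \<otimes> s [^] (- j) \<in> B \<inter> P" if bB: "b \<in> B" for b
 proof -
  have "b \<in> cyc P t" using B(2) bB by blast
  then obtain p and k::int where pk: "p \<in> P" "b = p \<otimes> t [^] k" by (rule cycE)
  then have "int l dvd k" using I_dvd bB by (auto simp: I_def)
  then obtain j where j: "k = int l * j" by (auto simp: dvd_def)
  have "b \<otimes> s [^] (- j) \<in> P" using dec[OF pk(1) j] pk(2) by simp
  moreover have "b \<otimes> s [^] (- j) \<in> B"
   using sub_m[OF B(1) bB subgroup_int_pow_closed[OF B(1) sB]] .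
  ultimately show ?thesis by blast
 qed
 moreover have "\<exists>j::int. p \<otimes> t [^] k \<otimes> s [^] (- j) \<in> P" if "p \<in> P" "int l dvd k" for p k
  using dec[OF that(1)] that(2) by (auto simp: dvd_def)
 ultimately show ?thesis using that[OF l(1) sB p0(1) s_def] by blast
qed

lemma cyc_cofinal:
 assumes P: "subgroup P G" and t: "nz t P" and s: "s = p0 \<otimes> t [^] (int l)" "p0 \<in> P" "l \<ge> 1"
 shows "nz s P" "fi (cyc P s) (cyc P t)"
proof -
 have tc: "t \<in> carrier G" using t by (simp add: nz_def)
 have Pc: "P \<subseteq> carrier G" using P subgroup.subset by blast
 have p0c: "p0 \<in> carrier G" using s Pc by auto
 have N: "subgroup {t. nz t P} G" by (rule nz_subgroup[OF Pc])
 have "p0 \<in> {t. nz t P}" "t [^] (int l) \<in> {t. nz t P}" using nz_self[OF P s(2)] nz_int_pow[OF Pc t] by auto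
 then show ns: "nz s P" unfolding s(1) using sub_m[OF N] by blast
 have sc: "s \<in> carrier G" using ns by (simp add: nz_def)
 have S: "subgroup (cyc P s) G" by (rule cyc_subgroup[OF P ns])
 have C: "subgroup (cyc P t) G" by (rule cyc_subgroup[OF P t])
 have "s \<in> cyc P t" unfolding s(1) using cycI[OF s(2)] .
 then have "cyc P s \<subseteq> cyc P t" using cyc_subset[OF C cyc_superset[OF Pc tc]] by blast
 moreover have "t [^] (int l) \<in> cyc P s"
 proof -
  have "t [^] (int l) = inv p0 \<otimes> s [^] (1::int)" unfolding s(1) using tc p0c by (simp add: gsimps)
  then show ?thesis using cycI[OF sub_inv[OF P s(2)]] by metis
 qed
 ultimately show "fi (cyc P s) (cyc P t)"
  using cyc_pow_reps[OF P t s(3) S cyc_superset[OF Pc sc]] by blast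
qed

text \<open>The alternative says that infinite index lowers the Hirsch bound. This is what makes the
  bound a measure for the recursion in \<open>Tri_exists\<close>.\<close>

lemma VP_subgroups:
 "VP n A \<Longrightarrow> subgroup B G \<Longrightarrow> B \<subseteq> A \<Longrightarrow> VP n B \<and> (fi B A \<or> (\<exists>m. n = Suc m \<and> VP m B))"
proof (induction arbitrary: B rule: VP.induct)
 case VP_one
 then have "B = {\<one>}" using sub_one by blast
 then show ?case using VP.VP_one fi_refl VP_one by auto
next
 case (VP_fin n P H)
 note K = fiD[OF VP_fin.hyps(2)]
 have BP: "subgroup (B \<inter> P) G" "B \<inter> P \<subseteq> P" using subgroups_Inter_pair VP_fin.prems K by auto
 have f: "fi (B \<inter> P) B" using fi_sub[OF VP_fin.hyps(2) VP_fin.prems] by (simp add: Int_commute)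
 have IH: "VP n (B \<inter> P)" "fi (B \<inter> P) P \<or> (\<exists>m. n = Suc m \<and> VP m (B \<inter> P))" using VP_fin.IH[OF BP] by auto
 have "VP n B" using VP.VP_fin[OF IH(1) f] .
 moreover have "fi B H" if "fi (B \<inter> P) P"
  using fi_mono[OF fi_trans[OF that VP_fin.hyps(2)] VP_fin.prems(1) _ VP_fin.prems(2)] by blast
 moreover have "VP m B" if "VP m (B \<inter> P)" for m using VP.VP_fin[OF that f] .
 ultimately show ?case using IH(2) by blast
next
 case (VP_ext n P t)
 have P: "subgroup P G" using VP_subgroup VP_ext.hyps by blast
 show ?case
 proof (cases "B \<subseteq> P")
  case True
  then have "VP n B" using VP_ext.IH VP_ext.prems by blast
  then show ?thesis using VP_Suc by blast
 next
  case False
  have BP: "subgroup (B \<inter> P) G" "B \<inter> P \<subseteq> P" using subgroups_Inter_pair VP_ext.prems P by auto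
  have IH: "VP n (B \<inter> P)" "fi (B \<inter> P) P \<or> (\<exists>m. n = Suc m \<and> VP m (B \<inter> P))" using VP_ext.IH[OF BP] by auto
  obtain s p0 and l :: nat where s: "l \<ge> 1" "s \<in> B" "p0 \<in> P" "s = p0 \<otimes> t [^] (int l)"
   "\<And>b. b \<in> B \<Longrightarrow> \<exists>j::int. b \<otimes> s [^] (- j) \<in> B \<inter> P"
   using cyc_subgroup_decomp[OF P VP_ext.hyps(2) VP_ext.prems False] by metis
  have cs: "nz s P" "fi (cyc P s) (cyc P t)" using cyc_cofinal[OF P VP_ext.hyps(2) s(4,3,1)] .
  have sc: "s \<in> carrier G" using cs by (simp add: nz_def)
  have "nz s B" using nz_self VP_ext.prems(1) s(2) by blast
  then have nsBP: "nz s (B \<inter> P)" using cs(1) by (auto simp: nz_def)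
  have "B = cyc (B \<inter> P) s"
  proof
   show "cyc (B \<inter> P) s \<subseteq> B" using cyc_subset[OF VP_ext.prems(1)] s(2) by blast
   show "B \<subseteq> cyc (B \<inter> P) s"
   proof
    fix b assume b: "b \<in> B"
    then obtain j :: int where j: "b \<otimes> s [^] (- j) \<in> B \<inter> P" using s(5) by blast
    have "b \<in> carrier G" using b VP_ext.prems(1) sub_mem by metis
    then have "b = (b \<otimes> s [^] (- j)) \<otimes> s [^] j" using sc by (simp add: m_assoc int_pow_minus_cancel)
    then show "b \<in> cyc (B \<inter> P) s" using cycI[OF j] by metis
   qed
  qed
  then have "VP (Suc n) B" using VP.VP_ext[OF IH(1) nsBP] by simp
  moreover have "fi B (cyc P t)" if "fi (B \<inter> P) P"
   using fi_trans[OF cyc_fi[OF that cs(1) nsBP] cs(2)] \<open>B = cyc (B \<inter> P) s\<close> by simp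
  moreover have "VP n B" if "n = Suc m" "VP m (B \<inter> P)" for m
   using VP.VP_ext[OF that(2) nsBP] that(1) \<open>B = cyc (B \<inter> P) s\<close> by simp
  ultimately show ?thesis using IH(2) by blast
 qed
qed

text \<open>P is subgroup separable: its subgroups are closed in the profinite topology.\<close>
definition sep :: "'a set \<Rightarrow> bool" where
 "sep P \<longleftrightarrow> (\<forall>L x. subgroup L G \<longrightarrow> L \<subseteq> P \<longrightarrow> x \<in> P - L \<longrightarrow> (\<exists>K. fi K P \<and> (\<forall>l\<in>L. inv l \<otimes> x \<notin> K)))"

lemma sepD: "sep P \<Longrightarrow> subgroup L G \<Longrightarrow> L \<subseteq> P \<Longrightarrow> x \<in> P \<Longrightarrow> x \<notin> L \<Longrightarrow> \<exists>K. fi K P \<and> (\<forall>l\<in>L. inv l \<otimes> x \<notin> K)"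
 unfolding sep_def by blast

text \<open>If no inv l \<otimes> x lies in P, then P itself separates x from L. Otherwise one such
  element is separated from L \<inter> P inside P, and translating back by l0 separates x.\<close>

lemma sep_fi:
 assumes "sep P" "fi P H" shows "sep H"
 unfolding sep_def
proof (intro allI impI)
 fix L x assume L: "subgroup L G" "L \<subseteq> H" and x: "x \<in> H - L"
 note K = fiD[OF assms(2)]
 have carr: "y \<in> carrier G" if "y \<in> H" for y using that K(2) sub_mem by metis
 show "\<exists>K. fi K H \<and> (\<forall>l\<in>L. inv l \<otimes> x \<notin> K)"
 proof (cases "\<exists>l\<in>L. inv l \<otimes> x \<in> P")
  case False
  then show ?thesis using assms(2) by blast
 next
  case True
  then obtain l0 where l0: "l0 \<in> L" "inv l0 \<otimes> x \<in> P" by blast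
  define p0 where "p0 = inv l0 \<otimes> x"
  have c: "l0 \<in> carrier G" "x \<in> carrier G" using l0 x L carr by auto
  have "p0 \<notin> L"
  proof
   assume "p0 \<in> L"
   then have "l0 \<otimes> p0 \<in> L" using l0 sub_m[OF L(1)] by blast
   then show False using x c by (simp add: p0_def cancel_left)
  qed
  then obtain K0 where K0: "fi K0 P" "\<forall>l\<in>L \<inter> P. inv l \<otimes> p0 \<notin> K0"
   using sepD[OF assms(1), of "L \<inter> P" p0] subgroups_Inter_pair L(1) K(1) l0(2) p0_def by blast
  have "inv l \<otimes> x \<notin> K0" if l: "l \<in> L" for l
  proof
   assume a: "inv l \<otimes> x \<in> K0"
   have lc: "l \<in> carrier G" using l L carr by auto
   have "(inv l0 \<otimes> x) \<otimes> inv (inv l \<otimes> x) \<in> P"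
    using a l0(2) fiD(3)[OF K0(1)] sub_m[OF K(1)] sub_inv[OF K(1)] by blast
   then have "inv l0 \<otimes> l \<in> P" using c lc by (simp add: gsimps)
   moreover have "inv l0 \<otimes> l \<in> L" using l l0(1) L(1) by (meson sub_m sub_inv)
   ultimately have "inv (inv l0 \<otimes> l) \<otimes> p0 \<notin> K0" using K0(2) by blast
   then show False using a c lc by (simp add: p0_def gsimps)
  qed
  then show ?thesis using fi_trans[OF K0(1) assms(2)] by blast
 qed
qed

text \<open>Mal'cev's induction step. Either x and L are told apart by the exponent of t modulo an
  integer (\<open>residue\<close>), or a power of s moves x into P and separation inside P is lifted
  (\<open>core\<close>).\<close>

lemma sep_ext:
 assumes P: "subgroup P G" "fg P" "sep P" and t: "nz t P"
 shows "sep (cyc P t)"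
proof (cases "fi P (cyc P t)")
 case True
 then show ?thesis using sep_fi P(3) by blast
next
 case False
 have tc: "t \<in> carrier G" using t by (simp add: nz_def)
 have Pc: "P \<subseteq> carrier G" using P subgroup.subset by blast
 have free: "k = 0" if "t [^] (k::int) \<in> P" for k using cyc_torsion_cases[OF P(1) t] False that by blast
 text \<open>Separation inside P extends to P s whenever L is (L meet P) s for an element s of L.\<close>
 have core: "\<exists>K. fi K (cyc P t) \<and> (\<forall>y\<in>L. inv y \<otimes> x \<notin> K)"
  if L: "subgroup L G" and s: "s = p0 \<otimes> t [^] (int l)" "p0 \<in> P" "l \<ge> 1"
   and dec: "\<And>y. y \<in> L \<Longrightarrow> \<exists>j::int. y \<otimes> s [^] (- j) \<in> L \<inter> P"
   and x: "x \<in> carrier G" "x \<otimes> s [^] (- j0) \<in> P" "x \<otimes> s [^] (- j0) \<notin> L" for L s p0 l x and j0 :: int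
 proof -
  have cs: "nz s P" "fi (cyc P s) (cyc P t)" using cyc_cofinal[OF P(1) t s] .
  have sc: "s \<in> carrier G" using cs by (simp add: nz_def)
  have sfree: "k = 0" if "s [^] (k::int) \<in> P" for k
  proof -
   have "s [^] k \<otimes> t [^] (- (int l * k)) \<in> P" by (rule cyc_power_mod[OF P(1) t s(1,2)])
   then have "inv (s [^] k) \<otimes> (s [^] k \<otimes> t [^] (- (int l * k))) \<in> P"
    using that sub_m[OF P(1)] sub_inv[OF P(1)] by blast
   then have "t [^] (- (int l * k)) \<in> P" using sc tc by (simp add: cancel_left)
   then have "int l * k = 0" using free by fastforce
   then show "k = 0" using s(3) by simp
  qed
  define p1 where "p1 = x \<otimes> s [^] (- j0)"
  have p1: "p1 \<in> P" "p1 \<notin> L" "p1 \<in> carrier G" using x Pc by (auto simp: p1_def)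
  obtain K0 where K0: "fi K0 P" "\<forall>l\<in>L \<inter> P. inv l \<otimes> p1 \<notin> K0"
   using sepD[OF P(3), of "L \<inter> P" p1] subgroups_Inter_pair L P(1) p1 by blast
  \<comment> \<open>Invariance makes s normalize D, so that D together with the powers of s is a
    subgroup. As s has infinite order modulo P, it meets P in D only.\<close>
  obtain D where D: "fi D P" "D \<subseteq> K0" "\<And>\<alpha>. endo P \<alpha> \<Longrightarrow> \<alpha> ` D \<subseteq> D" using invariant_fi[OF P(2) K0(1)] by blast
  have Dc: "D \<subseteq> carrier G" using fiD(3)[OF D(1)] Pc by blast
  have nD: "nz s D" unfolding nz_def using D(3)[OF endo_conj(1)[OF P(1) cs(1)]] D(3)[OF endo_conj(2)[OF P(1) cs(1)]] sc by blast
  have "fi (cyc D s) (cyc P t)" using fi_trans[OF cyc_fi[OF D(1) cs(1) nD] cs(2)] .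
  moreover have "inv y \<otimes> x \<notin> cyc D s" if y: "y \<in> L" for y
  proof
   assume "inv y \<otimes> x \<in> cyc D s"
   then obtain d i where d: "d \<in> D" "inv y \<otimes> x = d \<otimes> s [^] (i::int)" by (auto elim: cycE)
   obtain m :: int where m: "y \<otimes> s [^] (- m) \<in> L \<inter> P" using dec[OF y] by blast
   define a where "a = y \<otimes> s [^] (- m)"
   have a: "a \<in> L" "a \<in> P" "a \<in> carrier G" using m Pc by (auto simp: a_def)
   have yc: "y \<in> carrier G" using y L sub_mem by metis
   have dc: "d \<in> carrier G" "d \<in> P" using d Dc fiD(3)[OF D(1)] by auto
   have ya: "y = a \<otimes> s [^] m" unfolding a_def using yc sc by (simp add: m_assoc int_pow_minus_cancel)
   have xp: "x = p1 \<otimes> s [^] j0" unfolding p1_def using x sc by (simp add: m_assoc int_pow_minus_cancel)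
   have "inv y \<otimes> x = inv (s [^] m) \<otimes> (inv a \<otimes> p1) \<otimes> s [^] j0"
    unfolding ya xp using a p1 sc by (simp add: gsimps)
   then have e: "s [^] m \<otimes> (d \<otimes> s [^] i) = (inv a \<otimes> p1) \<otimes> s [^] j0"
    unfolding d(2)[symmetric] using a p1 sc by (simp add: gsimps)
   have ap: "inv a \<otimes> p1 \<in> P" using a p1 sub_m[OF P(1)] sub_inv[OF P(1)] by blast
   have apc: "inv a \<otimes> p1 \<in> carrier G" using a p1 by simp
   define d' where "d' = cj (s [^] m) d"
   have d': "d' \<in> D" unfolding d'_def by (rule nz_D(2)[OF nz_int_pow[OF Dc nD] d(1)])
   have d'c: "d' \<in> carrier G" "d' \<in> P" using d' Dc fiD(3)[OF D(1)] by auto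
   have "s [^] m \<otimes> (d \<otimes> s [^] i) = d' \<otimes> s [^] (m + i)"
    unfolding d'_def using dc sc by (simp add: gsimps int_pow_add)
   then have e2: "d' \<otimes> s [^] (m + i) = (inv a \<otimes> p1) \<otimes> s [^] j0" using e by simp
   then have "s [^] (m + i) \<otimes> s [^] (- j0) = inv d' \<otimes> (inv a \<otimes> p1)"
   proof -
    have "s [^] (m + i) = inv d' \<otimes> ((inv a \<otimes> p1) \<otimes> s [^] j0)"
     unfolding e2[symmetric] using d'c sc by (simp add: cancel_left)
    then show ?thesis using d'c apc sc a p1 by (simp add: m_assoc int_pow_minus_cancel)
   qed
   then have "s [^] (m + i - j0) = inv d' \<otimes> (inv a \<otimes> p1)" using int_pow_add[OF sc, of "m + i" "- j0"] by simp
   moreover have "inv d' \<otimes> (inv a \<otimes> p1) \<in> P" using d'c ap sub_m[OF P(1)] sub_inv[OF P(1)] by blast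
   ultimately have z: "m + i - j0 = 0" using sfree by metis
   then have "\<one> = inv d' \<otimes> (inv a \<otimes> p1)" using \<open>s [^] (m + i - j0) = inv d' \<otimes> (inv a \<otimes> p1)\<close> by simp
   then have "inv a \<otimes> p1 = d'" using d'c apc by (metis cancel_left(2) r_one)
   then show False using K0(2) a d' D(2) by blast
  qed
  ultimately show ?thesis by blast
 qed
 show ?thesis unfolding sep_def
 proof (intro allI impI)
  fix L x assume L: "subgroup L G" "L \<subseteq> cyc P t" and x: "x \<in> cyc P t - L"
  have Cc: "cyc P t \<subseteq> carrier G" using cyc_subgroup[OF P(1) t] subgroup.subset by blast
  obtain p k where pk: "p \<in> P" "x = p \<otimes> t [^] (k::int)" using x by (auto elim: cycE)
  have pc: "p \<in> carrier G" using pk Pc by auto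
  have residue: "\<exists>K. fi K (cyc P t) \<and> (\<forall>y\<in>L. inv y \<otimes> x \<notin> K)"
   if LP: "L \<subseteq> cyc P (t [^] (int n))" and n: "n \<ge> 1" "\<not> int n dvd k" for n :: nat
  proof -
   define K where "K = cyc P (t [^] (int n))"
   have tn: "t [^] (int n) = \<one> \<otimes> t [^] (int n)" using tc by simp
   have nf: "nz (t [^] (int n)) P" "fi K (cyc P t)"
    unfolding K_def using cyc_cofinal[OF P(1) t tn sub_one[OF P(1)] n(1)] .
   have "inv y \<otimes> x \<notin> K" if y: "y \<in> L" for y
   proof
    assume a: "inv y \<otimes> x \<in> K"
    have yK: "y \<in> K" using y LP by (auto simp: K_def)
    have yc: "y \<in> carrier G" using yK fiD(1)[OF nf(2)] sub_mem by metis
    have "y \<otimes> (inv y \<otimes> x) \<in> K" using sub_m[OF fiD(1)[OF nf(2)] yK a] .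
    then have "x \<in> K" using yc pc tc pk by (simp add: cancel_left)
    then obtain p' j where p': "p' \<in> P" "x = p' \<otimes> (t [^] (int n)) [^] (j::int)" unfolding K_def by (rule cycE)
    have p'c: "p' \<in> carrier G" using p' Pc by auto
    have "p \<otimes> t [^] k = p' \<otimes> t [^] (int n * j)" using pk p' tc by (simp add: int_pow_pow)
    then have "t [^] k \<otimes> t [^] (- (int n * j)) = inv p \<otimes> p'"
    proof -
     assume e: "p \<otimes> t [^] k = p' \<otimes> t [^] (int n * j)"
     have "t [^] k = inv p \<otimes> (p' \<otimes> t [^] (int n * j))" unfolding e[symmetric] using pc tc by (simp add: cancel_left)
     then show ?thesis using pc p'c tc by (simp add: m_assoc int_pow_minus_cancel)
    qed
    then have "t [^] (k - int n * j) \<in> P" using int_pow_add[OF tc, of k "- (int n * j)"]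
     sub_m[OF P(1) sub_inv[OF P(1) pk(1)] p'(1)] by simp
    then have "k - int n * j = 0" by (rule free)
    then show False using n(2) by simp
   qed
   then show ?thesis using nf(2) by blast
  qed
  show "\<exists>K. fi K (cyc P t) \<and> (\<forall>l\<in>L. inv l \<otimes> x \<notin> K)"
  proof (cases "L \<subseteq> P")
   case True
   show ?thesis
   proof (cases "k = 0")
    case False
    \<comment> \<open>Twice the absolute value of k does not divide the nonzero k.\<close>
    define n where "n = nat (2 * \<bar>k\<bar>)"
    have "\<not> int n dvd k" using False zdvd_not_zless[of "\<bar>k\<bar>" "int n"] by (simp add: n_def)
    moreover have "L \<subseteq> cyc P (t [^] (int n))" using True cyc_superset[OF Pc] tc by (meson int_pow_closed subset_trans)
    ultimately show ?thesis using residue[of n] False by (simp add: n_def)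
   next
    case 0: True
    have xP: "x \<in> P" using pk 0 pc by simp
    have tt: "t = \<one> \<otimes> t [^] (int 1)" using tc by simp
    have xc: "x \<in> carrier G" using xP Pc by auto
    show ?thesis
    proof (rule core[OF L(1) tt sub_one[OF P(1)], of x 0])
     fix y assume y: "y \<in> L"
     then have "y \<otimes> t [^] (- 0 :: int) = y" using True Pc by auto
     then show "\<exists>j::int. y \<otimes> t [^] (- j) \<in> L \<inter> P" using y True by (metis Int_iff subsetD)
    qed (use x xP xc in auto)
   qed
  next
   case False
   obtain s p0 and l :: nat where s: "l \<ge> 1" "s \<in> L" "p0 \<in> P" "s = p0 \<otimes> t [^] (int l)"
    "\<And>b. b \<in> L \<Longrightarrow> \<exists>j::int. b \<otimes> s [^] (- j) \<in> L \<inter> P"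
    "\<And>p k. p \<in> P \<Longrightarrow> int l dvd k \<Longrightarrow> \<exists>j::int. p \<otimes> t [^] k \<otimes> s [^] (- j) \<in> P"
    using cyc_subgroup_decomp[OF P(1) t L False] by metis
   have sc: "s \<in> carrier G" using s(2) L sub_mem by metis
   show ?thesis
   proof (cases "int l dvd k")
    case True
    then obtain j :: int where j: "x \<otimes> s [^] (- j) \<in> P" using s(6)[OF pk(1)] pk(2) by blast
    have xc: "x \<in> carrier G" using x Cc by auto
    have "x \<otimes> s [^] (- j) \<notin> L"
    proof
     assume "x \<otimes> s [^] (- j) \<in> L"
     then have "(x \<otimes> s [^] (- j)) \<otimes> s [^] j \<in> L"
      using sub_m[OF L(1)] subgroup_int_pow_closed[OF L(1) s(2)] by blast
     then show False using x xc sc by (simp add: m_assoc int_pow_minus_cancel)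
    qed
    then show ?thesis using core[OF L(1) s(4,3,1,5) xc j] by blast
   next
    case nd: False
    have "L \<subseteq> cyc P (t [^] (int l))"
    proof
     fix y assume y: "y \<in> L"
     obtain j :: int where j: "y \<otimes> s [^] (- j) \<in> L \<inter> P" using s(5)[OF y] by blast
     define a where "a = y \<otimes> s [^] (- j)"
     have a: "a \<in> P" using j by (simp add: a_def)
     have yc: "y \<in> carrier G" using y L sub_mem by metis
     have tl: "t [^] (int l) = \<one> \<otimes> t [^] (int l)" using tc by simp
     have nf: "nz (t [^] (int l)) P" "fi (cyc P (t [^] (int l))) (cyc P t)"
      using cyc_cofinal[OF P(1) t tl sub_one[OF P(1)] s(1)] .
     have C: "subgroup (cyc P (t [^] (int l))) G" using fiD(1)[OF nf(2)] .
     have "p0 \<otimes> (t [^] (int l)) [^] (1::int) \<in> cyc P (t [^] (int l))" by (rule cycI[OF s(3)])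
     then have "s \<in> cyc P (t [^] (int l))" using s(4) tc by simp
     then have "s [^] j \<in> cyc P (t [^] (int l))" by (rule subgroup_int_pow_closed[OF C])
     moreover have "a \<in> cyc P (t [^] (int l))" using a cyc_superset[OF Pc] tc by blast
     moreover have "y = a \<otimes> s [^] j" unfolding a_def using yc sc by (simp add: m_assoc int_pow_minus_cancel)
     ultimately show "y \<in> cyc P (t [^] (int l))" using sub_m[OF C] by metis
    qed
    then show ?thesis using residue[of l] s(1) nd by blast
   qed
  qed
 qed
qed

lemma VP_sep: "VP n P \<Longrightarrow> sep P"
proof (induction rule: VP.induct)
 case VP_one
 show ?case unfolding sep_def using sub_one by blast
next
 case (VP_fin n P H)
 then show ?case using sep_fi by blast
next
 case (VP_ext n P t)
 then show ?case using sep_ext VP_subgroup VP_fg by blast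
qed

text \<open>The profinite topology of P induces the full profinite topology on A: it is enough to
  separate D from representatives of its finitely many other cosets in A.\<close>

lemma sep_fi_subgroup:
 assumes P: "sep P" "subgroup P G" and A: "fi D A" "A \<subseteq> P"
 obtains K where "fi K P" "\<And>d a. d \<in> D \<Longrightarrow> a \<in> A \<Longrightarrow> inv d \<otimes> a \<in> K \<Longrightarrow> a \<in> D"
proof -
 obtain T where T: "finite T" "T \<subseteq> A" "\<forall>h\<in>A. \<exists>t\<in>T. h \<otimes> inv t \<in> D" using fi_reps[OF A(1)] by blast
 note DA = fiD[OF A(1)]
 have carr: "x \<in> carrier G" if "x \<in> A" for x using that DA(2) sub_mem by metis
 have "\<forall>t. \<exists>K. t \<in> T - D \<longrightarrow> fi K P \<and> (\<forall>l\<in>D. inv l \<otimes> t \<notin> K)"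
  using sepD[OF P(1) DA(1)] DA(3) A(2) T(2) by blast
 from choice[OF this] obtain K where K: "\<And>t. t \<in> T - D \<Longrightarrow> fi (K t) P \<and> (\<forall>l\<in>D. inv l \<otimes> t \<notin> K t)" by blast
 define K' where "K' = P \<inter> (\<Inter>t\<in>T - D. K t)"
 have "fi K' P" unfolding K'_def using T(1) K P(2) by (intro fi_finite_Int) auto
 moreover have "a \<in> D" if da: "d \<in> D" "a \<in> A" "inv d \<otimes> a \<in> K'" for d a
 proof (rule ccontr)
  assume aD: "a \<notin> D"
  have c: "a \<in> carrier G" "d \<in> carrier G" using da DA(3) carr by auto
  obtain t where t: "t \<in> T" "a \<otimes> inv t \<in> D" using T(3) da(2) by blast
  have tc: "t \<in> carrier G" using t T(2) carr by blast
  have "inv a \<otimes> d \<in> P" using da DA A(2) P(2) by (meson sub_m sub_inv subsetD)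
  text \<open>a = (a inv t) t, so t is outside D but congruent to an element of D modulo K t.\<close>
  have "t \<notin> D"
  proof
   assume "t \<in> D"
   then have "(a \<otimes> inv t) \<otimes> t \<in> D" using t(2) sub_m[OF DA(1)] by blast
   then show False using aD c tc by (simp add: m_assoc)
  qed
  then have Kt: "\<forall>l\<in>D. inv l \<otimes> t \<notin> K t" using K t(1) by blast
  have "inv d \<otimes> a \<in> K t" using da(3) t(1) \<open>t \<notin> D\<close> by (auto simp: K'_def)
  moreover have "inv d \<otimes> a = inv (inv (a \<otimes> inv t) \<otimes> d) \<otimes> t" using c tc by (simp add: gsimps)
  moreover have "inv (a \<otimes> inv t) \<otimes> d \<in> D" using t(2) da(1) DA(1) by (meson sub_m sub_inv)
  ultimately show False using Kt by metis
 qed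
 ultimately show ?thesis using that by blast
qed

end

section \<open>Orbits of multiplicative groups on additive groups\<close>

context group
begin

text \<open>In an abelian group every element normalizes P, so the generators are adjoined one by
  one. The last clause identifies P as the subgroup generated by S.\<close>

lemma abelian_VP:
 assumes comm: "\<And>x y. x \<in> carrier G \<Longrightarrow> y \<in> carrier G \<Longrightarrow> x \<otimes> y = y \<otimes> x" and S: "finite S" "S \<subseteq> carrier G"
 shows "\<exists>n P. VP n P \<and> S \<subseteq> P \<and> (\<forall>Q. subgroup Q G \<longrightarrow> S \<subseteq> Q \<longrightarrow> P \<subseteq> Q)"
 using S
proof (induction S rule: finite_induct)
 case empty
 have "VP 0 {\<one>}" by (rule VP_one)
 then show ?case using sub_one by blast
next
 case (insert s S)
 then obtain n P where P: "VP n P" "S \<subseteq> P" "\<And>Q. subgroup Q G \<Longrightarrow> S \<subseteq> Q \<Longrightarrow> P \<subseteq> Q" by blast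
 note sub = VP_subgroup[OF P(1)]
 have Pc: "P \<subseteq> carrier G" using sub subgroup.subset by blast
 have sc: "s \<in> carrier G" using insert.prems by blast
 have "cj s p = p" "inv s \<otimes> p \<otimes> s = p" if "p \<in> P" for p
 proof -
  have pc: "p \<in> carrier G" using that Pc by blast
  show "cj s p = p" using comm[OF sc pc] pc sc by (simp add: m_assoc)
  show "inv s \<otimes> p \<otimes> s = p" using comm[OF inv_closed[OF sc] pc] pc sc by (simp add: m_assoc)
 qed
 then have "nz s P" using sc by (simp add: nz_def)
 then have "VP (Suc n) (cyc P s)" using VP_ext[OF P(1)] by blast
 moreover have "insert s S \<subseteq> cyc P s" using cyc_gen[OF sub sc, of 1] cyc_superset[OF Pc sc] P(2) sc by auto
 moreover have "cyc P s \<subseteq> Q" if "subgroup Q G" "insert s S \<subseteq> Q" for Q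
  using cyc_subset[OF that(1)] P(3)[OF that(1)] that(2) by blast
 ultimately show ?case by blast
qed

lemma fg_abelian_VP:
 assumes "\<And>x y. x \<in> carrier G \<Longrightarrow> y \<in> carrier G \<Longrightarrow> x \<otimes> y = y \<otimes> x" and P: "subgroup P G" "fg P"
 shows "\<exists>n. VP n P"
proof -
 obtain S where S: "finite S" "S \<subseteq> P" "\<And>Q. subgroup Q G \<Longrightarrow> S \<subseteq> Q \<Longrightarrow> P \<subseteq> Q" using P(2) by (auto simp: fg_def)
 have "S \<subseteq> carrier G" using S(2) subgroup.subset[OF P(1)] by blast
 then obtain n P' where P': "VP n P'" "S \<subseteq> P'" "\<forall>Q. subgroup Q G \<longrightarrow> S \<subseteq> Q \<longrightarrow> P' \<subseteq> Q"
  using abelian_VP[OF assms(1) S(1)] by blast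
 have "P' = P" using P' S P(1) VP_subgroup[OF P'(1)] by blast
 then show ?thesis using P' by blast
qed

text \<open>Multiplicativity is required on P only, because the characters u and \<chi> of the main
  argument live on subgroups.\<close>

lemma hom_on:
 assumes P: "subgroup P G" and H: "group H" and f: "\<And>x y. x \<in> P \<Longrightarrow> y \<in> P \<Longrightarrow> f (x \<otimes> y) = f x \<otimes>\<^bsub>H\<^esub> f y"
  "\<And>x. x \<in> P \<Longrightarrow> f x \<in> carrier H"
 shows "f \<one> = \<one>\<^bsub>H\<^esub>" "x \<in> P \<Longrightarrow> f (inv x) = inv\<^bsub>H\<^esub> (f x)" "subgroup (f ` P) H"
  "subgroup Q H \<Longrightarrow> subgroup {x \<in> P. f x \<in> Q} G"
proof -
 interpret H: group H by (rule H)
 note Pp = sub_m[OF P] sub_inv[OF P] sub_one[OF P]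
 have f1: "f \<one> = \<one>\<^bsub>H\<^esub>" using f(1)[OF Pp(3,3)] f(2)[OF Pp(3)] by (metis H.r_cancel_one' l_one one_closed)
 then show "f \<one> = \<one>\<^bsub>H\<^esub>" .
 have fi: "f (inv x) = inv\<^bsub>H\<^esub> (f x)" if x: "x \<in> P" for x
 proof -
  have "f (inv x) \<otimes>\<^bsub>H\<^esub> f x = \<one>\<^bsub>H\<^esub>" using f(1)[OF Pp(2)[OF x] x] f1 sub_mem[OF P x] by simp
  then show ?thesis using H.inv_equality f(2) x Pp(2) by metis
 qed
 then show "x \<in> P \<Longrightarrow> f (inv x) = inv\<^bsub>H\<^esub> (f x)" .
 show "subgroup (f ` P) H"
 proof (rule H.subgroupI)
  show "f ` P \<subseteq> carrier H" using f by auto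
  show "f ` P \<noteq> {}" using Pp(3) by blast
  fix a assume "a \<in> f ` P"
  then obtain x where x: "x \<in> P" "a = f x" by blast
  then show "inv\<^bsub>H\<^esub> a \<in> f ` P" using fi[OF x(1), symmetric] Pp(2) by simp
  fix b assume "b \<in> f ` P"
  then obtain y where y: "y \<in> P" "b = f y" by blast
  then show "a \<otimes>\<^bsub>H\<^esub> b \<in> f ` P" using x f(1)[OF x(1) y(1), symmetric] Pp(1) by simp
 qed
 show "subgroup {x \<in> P. f x \<in> Q} G" if Q: "subgroup Q H"
 proof (rule subgroupI)
  show "{x \<in> P. f x \<in> Q} \<subseteq> carrier G" using subgroup.subset[OF P] by blast
  have "\<one> \<in> {x \<in> P. f x \<in> Q}" using f1 Pp(3) sub_one[OF Q] by simp
  then show "{x \<in> P. f x \<in> Q} \<noteq> {}" by blast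
 qed (use fi f(1) Pp sub_inv[OF Q] sub_m[OF Q] in auto)
qed

lemma fg_image:
 assumes P: "fg P" "subgroup P G" and H: "group H" and f: "\<And>x y. x \<in> P \<Longrightarrow> y \<in> P \<Longrightarrow> f (x \<otimes> y) = f x \<otimes>\<^bsub>H\<^esub> f y"
  "\<And>x. x \<in> P \<Longrightarrow> f x \<in> carrier H"
 shows "subgroup (f ` P) H" "group.fg H (f ` P)"
proof -
 interpret H: group H by (rule H)
 show "subgroup (f ` P) H" by (rule hom_on(3)[OF P(2) H f])
 obtain S where S: "finite S" "S \<subseteq> P" "\<And>Q. subgroup Q G \<Longrightarrow> S \<subseteq> Q \<Longrightarrow> P \<subseteq> Q" using P(1) by (auto simp: fg_def)
 have "f ` P \<subseteq> Q" if Q: "subgroup Q H" "f ` S \<subseteq> Q" for Q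
  using S(3)[OF hom_on(4)[where f = f, OF P(2) H f Q(1)]] S(2) Q(2) by blast
 then show "group.fg H (f ` P)" unfolding H.fg_def using S by (intro exI[of _ "f ` S"]) auto
qed

lemma fi_preimage:
 assumes P: "subgroup P G" and H: "group H" and f: "\<And>x y. x \<in> P \<Longrightarrow> y \<in> P \<Longrightarrow> f (x \<otimes> y) = f x \<otimes>\<^bsub>H\<^esub> f y"
  "\<And>x. x \<in> P \<Longrightarrow> f x \<in> carrier H" and Q: "group.fi H Q (f ` P)"
 shows "fi {x \<in> P. f x \<in> Q} P"
proof -
 interpret H: group H by (rule H)
 obtain h :: "'c \<Rightarrow> 'c" where h: "finite (h ` f ` P)" "\<And>x y. x \<in> f ` P \<Longrightarrow> y \<in> f ` P \<Longrightarrow> h x = h y \<Longrightarrow> x \<otimes>\<^bsub>H\<^esub> inv\<^bsub>H\<^esub> y \<in> Q"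
  using H.fi_fun[OF Q] by blast
 show ?thesis
 proof (rule fiI_fun[where f = "h \<circ> f"])
  show "subgroup {x \<in> P. f x \<in> Q} G" by (rule hom_on(4)[OF P H f H.fiD(1)[OF Q]])
  show "finite ((h \<circ> f) ` P)" using h(1) by (simp add: image_comp)
  fix x y assume xy: "x \<in> P" "y \<in> P" "(h \<circ> f) x = (h \<circ> f) y"
  have iy: "inv y \<in> P" using sub_inv[OF P xy(2)] .
  have "f (x \<otimes> inv y) = f x \<otimes>\<^bsub>H\<^esub> inv\<^bsub>H\<^esub> (f y)" using f(1)[OF xy(1) iy] hom_on(2)[where f = f, OF P H f xy(2)] by simp
  then show "x \<otimes> inv y \<in> {x \<in> P. f x \<in> Q}" using h(2)[of "f x" "f y"] xy sub_m[OF P xy(1) iy] by simp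
 qed (use P in auto)
qed

text \<open>If t has infinite order modulo P, a torsion element of the extension has exponent 0 and
  lies in the lower group; the latter is shrunk to an invariant subgroup so that t normalizes
  it.\<close>

lemma VP_torsion_free:
 "VP n P \<Longrightarrow> \<exists>K. fi K P \<and> (\<forall>x\<in>K. \<forall>j::nat. j \<ge> 1 \<longrightarrow> x [^] j = \<one> \<longrightarrow> x = \<one>)"
proof (induction rule: VP.induct)
 case VP_one
 then show ?case using fi_refl[OF triv_subgroup] by blast
next
 case (VP_fin n P H)
 then show ?case using fi_trans by blast
next
 case (VP_ext n P t)
 have P: "subgroup P G" using VP_subgroup VP_ext.hyps by blast
 have Pc: "P \<subseteq> carrier G" using P subgroup.subset by blast
 have t: "nz t P" using VP_ext.hyps by blast
 have tc: "t \<in> carrier G" using t by (simp add: nz_def)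
 obtain K0 where K0: "fi K0 P" "\<And>x j. x \<in> K0 \<Longrightarrow> (j::nat) \<ge> 1 \<Longrightarrow> x [^] j = \<one> \<Longrightarrow> x = \<one>" using VP_ext.IH by blast
 show ?case
 proof (cases "fi P (cyc P t)")
  case True
  then show ?thesis using fi_trans K0 by blast
 next
  case False
  obtain K where K: "fi K P" "K \<subseteq> K0" "\<And>\<alpha>. endo P \<alpha> \<Longrightarrow> \<alpha> ` K \<subseteq> K"
   using invariant_fi[OF VP_fg[OF VP_ext.hyps(1)] K0(1)] by blast
  have nK: "nz t K" unfolding nz_def using K(3)[OF endo_conj(1)[OF P t]] K(3)[OF endo_conj(2)[OF P t]] tc by blast
  have "x = \<one>" if x: "x \<in> cyc K t" "(j::nat) \<ge> 1" "x [^] j = \<one>" for x j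
  proof -
   obtain p and k::int where p: "p \<in> K" "x = p \<otimes> t [^] k" using x(1) by (rule cycE)
   have pP: "p \<in> P" using p(1) fiD(3)[OF K(1)] by blast
   have "x [^] (int j) \<otimes> t [^] (- (k * int j)) \<in> P" by (rule cyc_power_mod[OF P t p(2) pP])
   moreover have "x [^] (int j) = \<one>" using x(3) by (simp add: int_pow_int)
   ultimately have tk: "t [^] (- (k * int j)) \<in> P" using tc by simp
   have "k = 0" using cyc_torsion_cases[OF P t] False tk x(2) by fastforce
   then have "x = p" using p(2) pP Pc by auto
   then show ?thesis using K0(2)[of p j] p(1) K(2) x by blast
  qed
  then show ?thesis using cyc_fi[OF K(1) t nK] by blast
 qed
qed

text \<open>A subgroup of finite index contains all n-th powers for some n, so approximation modulo
  n-th powers is approximation in the profinite topology.\<close>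

lemma sep_closed:
 assumes "sep P" "subgroup L G" "L \<subseteq> P" "x \<in> P"
  and "\<And>n::nat. n \<ge> 1 \<Longrightarrow> \<exists>l\<in>L. \<exists>p\<in>P. inv l \<otimes> x = p [^] n"
 shows "x \<in> L"
proof (rule ccontr)
 assume "x \<notin> L"
 then obtain K where K: "fi K P" "\<forall>l\<in>L. inv l \<otimes> x \<notin> K" using sepD[OF assms(1-4)] by blast
 obtain n :: nat where n: "n \<ge> 1" "\<And>p. p \<in> P \<Longrightarrow> p [^] n \<in> K" using fi_power[OF K(1)] by blast
 then show False using assms(5)[OF n(1)] K(2) by metis
qed

end

section \<open>The additive and multiplicative groups of the complex numbers\<close>

definition AC :: "complex monoid" where "AC = \<lparr>carrier = UNIV, monoid.mult = (+), one = 0\<rparr>"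
definition MC :: "complex monoid" where "MC = \<lparr>carrier = UNIV - {0}, monoid.mult = (*), one = 1\<rparr>"

lemma AC_simps [simp]: "carrier AC = UNIV" "x \<otimes>\<^bsub>AC\<^esub> y = x + y" "\<one>\<^bsub>AC\<^esub> = 0"
 and MC_simps [simp]: "carrier MC = UNIV - {0}" "x \<otimes>\<^bsub>MC\<^esub> y = x * y" "\<one>\<^bsub>MC\<^esub> = 1"
 by (simp_all add: AC_def MC_def)

interpretation AC: group AC
proof (rule groupI)
 fix x assume "x \<in> carrier AC"
 show "\<exists>y\<in>carrier AC. y \<otimes>\<^bsub>AC\<^esub> x = \<one>\<^bsub>AC\<^esub>" by (intro bexI[of _ "- x"]) auto
qed auto

interpretation MC: group MC
proof (rule groupI)
 fix x assume "x \<in> carrier MC"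
 then show "\<exists>y\<in>carrier MC. y \<otimes>\<^bsub>MC\<^esub> x = \<one>\<^bsub>MC\<^esub>" by (intro bexI[of _ "inverse x"]) auto
qed auto

lemma AC_inv [simp]: "inv\<^bsub>AC\<^esub> x = - x" by (rule AC.inv_equality) auto
lemma MC_inv: "x \<noteq> 0 \<Longrightarrow> inv\<^bsub>MC\<^esub> x = inverse x" by (rule MC.inv_equality) auto
lemma AC_pow: "x [^]\<^bsub>AC\<^esub> (n::nat) = of_nat n * x" by (induction n) (auto simp: algebra_simps)
lemma MC_pow: "x [^]\<^bsub>MC\<^esub> (n::nat) = x ^ n" by (induction n) (auto simp: algebra_simps)

lemma AC_sub:
 assumes "subgroup M AC"
 shows "0 \<in> M" "x \<in> M \<Longrightarrow> y \<in> M \<Longrightarrow> x + y \<in> M" "x \<in> M \<Longrightarrow> - x \<in> M" "x \<in> M \<Longrightarrow> y \<in> M \<Longrightarrow> x - y \<in> M"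
  "x \<in> M \<Longrightarrow> of_nat n * x \<in> M" "x \<in> M \<Longrightarrow> of_int k * x \<in> M"
proof -
 show 0: "0 \<in> M" using sub_one[OF assms] by simp
 show p: "\<And>x y. x \<in> M \<Longrightarrow> y \<in> M \<Longrightarrow> x + y \<in> M" using sub_m[OF assms] by simp
 show m: "\<And>x. x \<in> M \<Longrightarrow> - x \<in> M" using sub_inv[OF assms] by simp
 show "x \<in> M \<Longrightarrow> y \<in> M \<Longrightarrow> x - y \<in> M" using p[of x "- y"] m[of y] by simp
 show n: "\<And>n. x \<in> M \<Longrightarrow> of_nat n * x \<in> M" subgoal for n by (induction n) (auto simp: 0 p algebra_simps) done
 show "x \<in> M \<Longrightarrow> of_int k * x \<in> M" by (cases k rule: int_cases2) (auto simp: n m)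
qed

lemma AC_subI: assumes "0 \<in> M" "\<And>x y. x \<in> M \<Longrightarrow> y \<in> M \<Longrightarrow> x - y \<in> M" shows "subgroup M AC"
proof -
 have m: "- x \<in> M" if "x \<in> M" for x using assms(2)[OF assms(1) that] by simp
 have p: "x + y \<in> M" if "x \<in> M" "y \<in> M" for x y using assms(2)[OF that(1) m[OF that(2)]] by simp
 show ?thesis by (rule AC.subgroupI) (use assms(1) m p in auto)
qed

lemma MC_sub:
 assumes "subgroup E MC"
 shows "1 \<in> E" "x \<in> E \<Longrightarrow> y \<in> E \<Longrightarrow> x * y \<in> E" "x \<in> E \<Longrightarrow> x \<noteq> 0" "x \<in> E \<Longrightarrow> inverse x \<in> E"
  "x \<in> E \<Longrightarrow> x ^ n \<in> E" "x \<in> E \<Longrightarrow> x powi k \<in> E"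
proof -
 show 0: "1 \<in> E" using sub_one[OF assms] by simp
 show p: "\<And>x y. x \<in> E \<Longrightarrow> y \<in> E \<Longrightarrow> x * y \<in> E" using sub_m[OF assms] by simp
 show nz: "\<And>x. x \<in> E \<Longrightarrow> x \<noteq> 0" using sub_mem[OF assms] by auto
 show m: "\<And>x. x \<in> E \<Longrightarrow> inverse x \<in> E" using sub_inv[OF assms] MC_inv nz by metis
 show n: "\<And>x n. x \<in> E \<Longrightarrow> x ^ n \<in> E" subgoal for x n by (induction n) (auto simp: 0 p) done
 show "x \<in> E \<Longrightarrow> x powi k \<in> E" by (auto simp: power_int_def n m)
qed

lemma MC_subI:
 assumes "1 \<in> E" "0 \<notin> E" "\<And>x y. x \<in> E \<Longrightarrow> y \<in> E \<Longrightarrow> x * y \<in> E" "\<And>x. x \<in> E \<Longrightarrow> inverse x \<in> E"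
 shows "subgroup E MC"
proof (rule MC.subgroupI)
 show "E \<subseteq> carrier MC" using assms(2) by auto
 fix a assume "a \<in> E"
 then show "inv\<^bsub>MC\<^esub> a \<in> E" using assms(2,4) MC_inv[of a] by metis
qed (use assms in auto)

lemma AC_sum:
 assumes "subgroup M AC" "\<And>i. i \<in> I \<Longrightarrow> w i \<in> M" shows "(\<Sum>i\<in>I. of_int (c i) * w i) \<in> M"
 using assms(2)
proof (induction I rule: infinite_finite_induct)
 case (insert x I)
 then show ?case using AC_sub(2,6)[OF assms(1)] by simp
qed (simp_all add: AC_sub(1)[OF assms(1)])

lemma MC_prod:
 assumes "subgroup E MC" "\<And>i. i \<in> I \<Longrightarrow> g i \<in> E" shows "(\<Prod>i\<in>I. g i powi k i) \<in> E"
 using assms(2)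
proof (induction I rule: infinite_finite_induct)
 case (insert x I)
 then show ?case using MC_sub(2,6)[OF assms(1)] by simp
qed (simp_all add: MC_sub(1)[OF assms(1)])

lemma finite_enum: assumes "finite S" obtains d :: nat and w :: "nat \<Rightarrow> 'a" where "S = w ` {..<d}"
 using finite_imp_nat_seg_image_inj_on[OF assms] by (auto simp: lessThan_def)

lemma zspan_subgroup: "subgroup (zspan d w) AC"
 by (rule AC_subI) (auto simp: zspan_0 zspan_diff)

lemma fg_zspan: assumes "subgroup M AC" "AC.fg M" shows "\<exists>d w. M = zspan d w"
proof -
 obtain S where S: "finite S" "S \<subseteq> M" "\<And>Q. subgroup Q AC \<Longrightarrow> S \<subseteq> Q \<Longrightarrow> M \<subseteq> Q" using assms(2) by (auto simp: AC.fg_def)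
 obtain d and w :: "nat \<Rightarrow> complex" where w: "S = w ` {..<d}" using finite_enum[OF S(1)] by blast
 have "M \<subseteq> zspan d w" using S(3)[OF zspan_subgroup] w zspan_base by blast
 moreover have "zspan d w \<subseteq> M"
 proof
  fix x assume "x \<in> zspan d w"
  then obtain c :: "nat \<Rightarrow> int" where x: "x = (\<Sum>i<d. of_int (c i) * w i)" by (rule zspanE)
  show "x \<in> M" unfolding x by (rule AC_sum[OF assms(1)]) (use S(2) w in auto)
 qed
 ultimately show ?thesis by blast
qed

lemma mspan_subgroup: assumes "\<And>i. i < e \<Longrightarrow> g i \<noteq> 0" shows "subgroup (mspan e g) MC"
 by (rule MC_subI)
  (use mspan_group[of e g] assms in blast)+

lemma mspan_gen: "i < e \<Longrightarrow> g i \<in> mspan e g"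
 by (rule mspanI[where k = "\<lambda>j. if j = i then 1 else 0"])
   (simp add: if_distrib[of "\<lambda>k. _ powi k"] prod.delta cong: if_cong)

lemma fg_mspan: assumes "subgroup E MC" "MC.fg E" shows "\<exists>e g. E = mspan e g"
proof -
 obtain S where S: "finite S" "S \<subseteq> E" "\<And>Q. subgroup Q MC \<Longrightarrow> S \<subseteq> Q \<Longrightarrow> E \<subseteq> Q" using assms(2) by (auto simp: MC.fg_def)
 obtain e and g :: "nat \<Rightarrow> complex" where g: "S = g ` {..<e}" using finite_enum[OF S(1)] by blast
 have gE: "g i \<in> E" if "i < e" for i using S(2) g that by blast
 have "E \<subseteq> mspan e g" using S(3)[OF mspan_subgroup[of e g]] g mspan_gen gE MC_sub(3)[OF assms(1)] by blast
 moreover have "mspan e g \<subseteq> E"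
 proof
  fix x assume "x \<in> mspan e g"
  then obtain k :: "nat \<Rightarrow> int" where x: "x = (\<Prod>i<e. g i powi k i)" by (rule mspanE)
  show "x \<in> E" unfolding x by (rule MC_prod[OF assms(1)]) (use gE in simp)
 qed
 ultimately show ?thesis by blast
qed

lemma AC_VP: "subgroup M AC \<Longrightarrow> AC.fg M \<Longrightarrow> \<exists>n. AC.VP n M"
 by (rule AC.fg_abelian_VP) (auto simp: add.commute)

lemma MC_VP: "subgroup E MC \<Longrightarrow> MC.fg E \<Longrightarrow> \<exists>n. MC.VP n E"
 by (rule MC.fg_abelian_VP) (auto simp: mult.commute)

lemma AC_fg_sub: "subgroup M AC \<Longrightarrow> AC.fg M \<Longrightarrow> subgroup L AC \<Longrightarrow> L \<subseteq> M \<Longrightarrow> AC.fg L"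
 using AC_VP AC.VP_subgroups AC.VP_fg by blast

lemma MC_fg_sub: "subgroup M MC \<Longrightarrow> MC.fg M \<Longrightarrow> subgroup L MC \<Longrightarrow> L \<subseteq> M \<Longrightarrow> MC.fg L"
 using MC_VP MC.VP_subgroups MC.VP_fg by blast

lemma AC_closed:
 assumes "subgroup M AC" "AC.fg M" "subgroup L AC" "L \<subseteq> M" "x \<in> M"
  and "\<And>n::nat. n \<ge> 1 \<Longrightarrow> \<exists>l\<in>L. \<exists>p\<in>M. x - l = of_nat n * p"
 shows "x \<in> L"
proof (rule AC.sep_closed[of M])
 show "AC.sep M" using AC_VP assms(1,2) AC.VP_sep by blast
 fix n :: nat assume "n \<ge> 1"
 then obtain l p where "l \<in> L" "p \<in> M" "x - l = of_nat n * p" using assms(6) by blast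
 then show "\<exists>l\<in>L. \<exists>p\<in>M. inv\<^bsub>AC\<^esub> l \<otimes>\<^bsub>AC\<^esub> x = p [^]\<^bsub>AC\<^esub> n" by (intro bexI[of _ l] bexI[of _ p]) (simp_all add: AC_pow)
qed (use assms in auto)

lemma zspan_mod:
 assumes "m \<ge> 1"
 shows "\<exists>f :: complex \<Rightarrow> nat \<Rightarrow> int. finite (f ` zspan d w) \<and>
  (\<forall>x\<in>zspan d w. \<forall>y\<in>zspan d w. f x = f y \<longrightarrow> (\<exists>r\<in>zspan d w. x - y = of_nat m * r))"
proof -
 have "\<forall>x. \<exists>c::nat \<Rightarrow> int. x \<in> zspan d w \<longrightarrow> x = (\<Sum>i<d. of_int (c i) * w i)" by (auto simp: zspan_def)
 from choice[OF this] obtain c :: "complex \<Rightarrow> nat \<Rightarrow> int"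
  where c: "\<And>x. x \<in> zspan d w \<Longrightarrow> x = (\<Sum>i<d. of_int (c x i) * w i)" by blast
 define f where "f x = (\<lambda>i\<in>{..<d}. c x i mod int m)" for x
 have "f ` zspan d w \<subseteq> {..<d} \<rightarrow>\<^sub>E {0..<int m}" using assms by (auto simp: f_def)
 then have "finite (f ` zspan d w)" by (rule finite_subset) (intro finite_PiE, auto)
 moreover have "\<exists>r\<in>zspan d w. x - y = of_nat m * r" if xy: "x \<in> zspan d w" "y \<in> zspan d w" "f x = f y" for x y
 proof -
  have "c x i mod int m = c y i mod int m" if "i < d" for i using fun_cong[OF xy(3), of i] that by (simp add: f_def)
  then have q: "c x i - c y i = int m * ((c x i - c y i) div int m)" if "i < d" for i
   using that by (simp add: mod_eq_dvd_iff)
  define r where "r = (\<Sum>i<d. of_int ((c x i - c y i) div int m) * w i)"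
  have "x - y = (\<Sum>i<d. of_int (c x i - c y i) * w i)"
   by (subst c[OF xy(1)], subst c[OF xy(2)]) (simp add: sum_subtractf algebra_simps)
  also have "\<dots> = (\<Sum>i<d. of_nat m * (of_int ((c x i - c y i) div int m) * w i))"
  proof (rule sum.cong)
   fix i assume "i \<in> {..<d}"
   then have "(of_int (c x i - c y i) :: complex) = of_int (int m * ((c x i - c y i) div int m))" using q by simp
   then show "of_int (c x i - c y i) * w i = of_nat m * (of_int ((c x i - c y i) div int m) * w i)"
    by (simp add: mult.assoc)
  qed simp
  also have "\<dots> = of_nat m * r" unfolding r_def by (simp add: sum_distrib_left)
  finally show ?thesis using zspanI[OF r_def] by blast
 qed
 ultimately show ?thesis by blast
qed

lemma AC_multiples_fi:
 assumes "subgroup M AC" "AC.fg M" "m \<ge> 1" shows "AC.fi ((\<lambda>x. of_nat m * x) ` M) M"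
proof -
 obtain d w where M: "M = zspan d w" using fg_zspan assms by blast
 obtain f :: "complex \<Rightarrow> nat \<Rightarrow> int" where f: "finite (f ` M)" "\<And>x y. x \<in> M \<Longrightarrow> y \<in> M \<Longrightarrow> f x = f y \<Longrightarrow> \<exists>r\<in>M. x - y = of_nat m * r"
  unfolding M using zspan_mod[OF assms(3), of d w] by blast
 show ?thesis
 proof (rule AC.fiI_fun[where f = f])
  show "subgroup ((\<lambda>x. of_nat m * x) ` M) AC"
  proof (rule AC_subI)
   show "0 \<in> (\<lambda>x. of_nat m * x) ` M" using AC_sub(1)[OF assms(1)] by force
   fix x y assume "x \<in> (\<lambda>x. of_nat m * x) ` M" "y \<in> (\<lambda>x. of_nat m * x) ` M"
   then obtain a b where "a \<in> M" "b \<in> M" "x = of_nat m * a" "y = of_nat m * b" by blast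
   then have "x - y = of_nat m * (a - b)" "a - b \<in> M" using AC_sub[OF assms(1)] by (auto simp: algebra_simps)
   then show "x - y \<in> (\<lambda>x. of_nat m * x) ` M" by blast
  qed
  fix x y assume "x \<in> M" "y \<in> M" "f x = f y"
  then show "x \<otimes>\<^bsub>AC\<^esub> inv\<^bsub>AC\<^esub> y \<in> (\<lambda>x. of_nat m * x) ` M" using f(2)[of x y] by auto
 qed (use f(1) assms(1) AC_sub(5)[OF assms(1)] in auto)
qed

text \<open>The subgroup n L has finite index in L. By \<open>sep_fi_subgroup\<close> it contains K
  \<inter> L for some K of finite index in M, and K contains m M for a suitable m.\<close>

lemma AC_artin_rees:
 assumes M: "subgroup M AC" "AC.fg M" and L: "subgroup L AC" "L \<subseteq> M" and n: "n \<ge> 1"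
 shows "\<exists>m\<ge>1. \<forall>x\<in>M. of_nat m * x \<in> L \<longrightarrow> (\<exists>y\<in>L. of_nat m * x = of_nat n * y)"
proof -
 have f: "AC.fi ((\<lambda>x. of_nat n * x) ` L) L" using AC_multiples_fi[OF L(1) AC_fg_sub[OF M L] n] .
 have "AC.sep M" using AC_VP M AC.VP_sep by blast
 then obtain K where K: "AC.fi K M"
  "\<And>d a. d \<in> (\<lambda>x. of_nat n * x) ` L \<Longrightarrow> a \<in> L \<Longrightarrow> inv\<^bsub>AC\<^esub> d \<otimes>\<^bsub>AC\<^esub> a \<in> K \<Longrightarrow> a \<in> (\<lambda>x. of_nat n * x) ` L"
  using AC.sep_fi_subgroup[OF _ M(1) f L(2)] by blast
 obtain m :: nat where m: "m \<ge> 1" "\<And>x. x \<in> M \<Longrightarrow> x [^]\<^bsub>AC\<^esub> m \<in> K" using AC.fi_power[OF K(1)] by blast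
 have "0 \<in> (\<lambda>x. of_nat n * x) ` L" using AC_sub(1)[OF L(1)] by force
 then have "of_nat m * x \<in> (\<lambda>x. of_nat n * x) ` L" if "x \<in> M" "of_nat m * x \<in> L" for x
  using K(2)[of 0 "of_nat m * x"] m(2)[OF that(1)] that by (simp add: AC_pow)
 then show ?thesis using m(1) by blast
qed

lemma princ_subgroup: assumes "subring_C R" shows "subgroup ((\<lambda>r. r * v) ` R) AC"
proof (rule AC_subI)
 show "0 \<in> (\<lambda>r. r * v) ` R" using ringC(1)[OF assms] by force
 fix x y assume "x \<in> (\<lambda>r. r * v) ` R" "y \<in> (\<lambda>r. r * v) ` R"
 then obtain a b where ab: "a \<in> R" "b \<in> R" "x = a * v" "y = b * v" by blast
 then have "x - y = (a - b) * v" by (simp add: algebra_simps)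
 then show "x - y \<in> (\<lambda>r. r * v) ` R" using ringC(5)[OF assms ab(1,2)] by blast
qed

text \<open>The map r \<mapsto> r * v embeds the multiplier ring into M, and subgroups of finitely
  generated abelian groups are finitely generated; generators of the image are divided by v.\<close>

lemma multiplier_order:
 assumes M: "subgroup M AC" "AC.fg M" and v: "v \<in> M" "v \<noteq> 0"
 shows "is_order {r. \<forall>x\<in>M. r * x \<in> M}" (is "is_order ?R")
proof -
 note Mp = AC_sub[OF M(1)]
 have sub: "subring_C ?R" unfolding subring_C_def using Mp(4) by (auto simp: left_diff_distrib mult.assoc)
 note L = princ_subgroup[OF sub, of v]
 have LM: "(\<lambda>r. r * v) ` ?R \<subseteq> M" using v by auto
 obtain d w where w: "(\<lambda>r. r * v) ` ?R = zspan d w" using fg_zspan[OF L AC_fg_sub[OF M L LM]] by blast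
 have "?R = zspan d (\<lambda>i. w i / v)"
 proof (intro equalityI subsetI)
  fix r assume "r \<in> ?R"
  then have "r * v \<in> zspan d w" using w by blast
  then obtain c :: "nat \<Rightarrow> int" where "r * v = (\<Sum>i<d. of_int (c i) * w i)" by (rule zspanE)
  then have "r = (\<Sum>i<d. of_int (c i) * w i) / v" using v(2) by (simp add: field_simps)
  then have "r = (\<Sum>i<d. of_int (c i) * (w i / v))" by (simp add: sum_divide_distrib)
  then show "r \<in> zspan d (\<lambda>i. w i / v)" by (rule zspanI)
 next
  fix r assume "r \<in> zspan d (\<lambda>i. w i / v)"
  then obtain c :: "nat \<Rightarrow> int" where "r = (\<Sum>i<d. of_int (c i) * (w i / v))" by (rule zspanE)
  then have "r = (\<Sum>i<d. of_int (c i) * w i) / v" by (simp add: sum_divide_distrib)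
  then have "r * v = (\<Sum>i<d. of_int (c i) * w i)" using v(2) by simp
  then have "r * v \<in> zspan d w" by (rule zspanI)
  then obtain r' where r': "r' \<in> ?R" "r * v = r' * v" unfolding w[symmetric] by blast
  then have "r = r'" using v(2) by simp
  then show "r \<in> ?R" using r'(1) by simp
 qed
 then show ?thesis unfolding is_order_def using sub by blast
qed

lemma order_fg: assumes "is_order R" shows "subgroup R AC" "AC.fg R"
proof -
 obtain d w where R: "R = zspan d w" using assms by (auto simp: is_order_def)
 show "subgroup R AC" unfolding R by (rule zspan_subgroup)
 show "AC.fg R" unfolding AC.fg_def
 proof (intro exI[of _ "w ` {..<d}"] conjI allI impI)
  show "w ` {..<d} \<subseteq> R" using zspan_base R by auto
  fix Q assume Q: "subgroup Q AC" "w ` {..<d} \<subseteq> Q"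
  show "R \<subseteq> Q"
  proof
   fix x assume "x \<in> R"
   then obtain c :: "nat \<Rightarrow> int" where x: "x = (\<Sum>i<d. of_int (c i) * w i)" unfolding R by (rule zspanE)
   show "x \<in> Q" unfolding x by (rule AC_sum[OF Q(1)]) (use Q(2) in auto)
  qed
 qed simp
qed

text \<open>Chevalley's theorem is applied to a torsion-free subgroup U of finite index; the torsion
  of F, which is finite, is kept away from 1 by a second modulus m2.\<close>

lemma congruence_subgroup_property:
 assumes R: "is_order R" and F: "subgroup F MC" "MC.fg F" "F \<subseteq> R" and D: "MC.fi D F"
 shows "\<exists>m\<ge>1. \<forall>u\<in>F. cg R m u 1 \<longrightarrow> u \<in> D"
proof -
 have sub: "subring_C R" using R by (simp add: is_order_def)
 note Fp = MC_sub[OF F(1)]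
 obtain nF where VF: "MC.VP nF F" using MC_VP[OF F(1,2)] by blast
 obtain U where U: "MC.fi U F" "\<forall>x\<in>U. \<forall>j::nat. j \<ge> 1 \<longrightarrow> x [^]\<^bsub>MC\<^esub> j = \<one>\<^bsub>MC\<^esub> \<longrightarrow> x = \<one>\<^bsub>MC\<^esub>"
  using MC.VP_torsion_free[OF VF] by blast
 have Us: "subgroup U MC" "U \<subseteq> F" using MC.fiD[OF U(1)] by auto
 have Utf: "x = 1" if "x \<in> U" "x ^ j = 1" "j \<ge> 1" for x and j :: nat using U(2) that by (simp add: MC_pow)
 obtain k :: nat where k: "k \<ge> 1" "\<And>x. x \<in> F \<Longrightarrow> x ^ k \<in> U" using MC.fi_power[OF U(1)] by (auto simp: MC_pow)
 define T where "T = {u \<in> F. \<exists>j::nat. j \<ge> 1 \<and> u ^ j = 1}"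
 have finT: "finite T"
 proof -
  obtain f :: "complex \<Rightarrow> complex" where f: "finite (f ` F)" "\<And>x y. x \<in> F \<Longrightarrow> y \<in> F \<Longrightarrow> f x = f y \<Longrightarrow> x \<otimes>\<^bsub>MC\<^esub> inv\<^bsub>MC\<^esub> y \<in> U"
   using MC.fi_fun[OF U(1)] by blast
  have "inj_on f T"
  proof (rule inj_onI)
   fix x y assume xy: "x \<in> T" "y \<in> T" "f x = f y"
   then have F': "x \<in> F" "y \<in> F" by (auto simp: T_def)
   obtain i j :: nat where ij: "i \<ge> 1" "x ^ i = 1" "j \<ge> 1" "y ^ j = 1" using xy by (auto simp: T_def)
   have u: "x * inverse y \<in> U" using f(2)[OF F' xy(3)] MC_inv[OF Fp(3)[OF F'(2)]] by simp
   have "(x * inverse y) ^ (i * j) = (x ^ i) ^ j * inverse ((y ^ j) ^ i)"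
    by (simp add: power_mult_distrib power_mult[symmetric] power_inverse mult.commute)
   also have "\<dots> = 1" using ij by simp
   finally have "x * inverse y = 1" using Utf[OF u, of "i * j"] ij by simp
   then show "x = y" using Fp(3)[OF F'(2)] by (simp add: field_simps)
  qed
  moreover have "finite (f ` T)" using f(1) by (rule finite_subset[rotated]) (auto simp: T_def)
  ultimately show ?thesis using finite_imageD by blast
 qed
 \<comment> \<open>The multiples m R intersect in 0, so a torsion element other than 1 is
   incongruent to 1 for some m.\<close>
 have "\<forall>z. \<exists>m::nat. z \<in> T - {1} \<longrightarrow> m \<ge> 1 \<and> \<not> cg R m z 1"
 proof (intro allI)
  fix z
  show "\<exists>m::nat. z \<in> T - {1} \<longrightarrow> m \<ge> 1 \<and> \<not> cg R m z 1"
  proof (rule ccontr)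
   assume a: "\<nexists>m::nat. z \<in> T - {1} \<longrightarrow> m \<ge> 1 \<and> \<not> cg R m z 1"
   then have z: "z \<in> T - {1}" "\<And>m::nat. m \<ge> 1 \<Longrightarrow> cg R m z 1" by auto
   have zR: "z - 1 \<in> R" using z(1) F(3) ringC(5)[OF sub _ ringC(2)[OF sub]] by (auto simp: T_def)
   have "z - 1 \<in> {0}"
   proof (rule AC_closed[OF order_fg[OF R]])
    show "subgroup {0} AC" by (rule AC_subI) auto
    show "{0} \<subseteq> R" using ringC(1)[OF sub] by simp
    fix n :: nat assume "n \<ge> 1"
    then show "\<exists>l\<in>{0}. \<exists>p\<in>R. z - 1 - l = of_nat n * p" using z(2)[of n] by (auto simp: cg_def)
   qed (rule zR)
   then show False using z(1) by simp
  qed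
 qed
 from choice[OF this] obtain mu :: "complex \<Rightarrow> nat" where mu: "\<And>z. z \<in> T - {1} \<Longrightarrow> mu z \<ge> 1 \<and> \<not> cg R (mu z) z 1" by blast
 define m2 where "m2 = (\<Prod>z\<in>T - {1}. mu z)"
 have m2: "m2 \<ge> 1" unfolding m2_def Suc_le_eq One_nat_def by (intro prod_pos) (use mu in force)
 have m2T: "z = 1" if z: "z \<in> T" "cg R m2 z 1" for z
 proof (rule ccontr)
  assume "z \<noteq> 1"
  then have z': "z \<in> T - {1}" using z by simp
  then have "mu z dvd m2" unfolding m2_def using finT by (intro dvd_prodI) auto
  then show False using cg_dvd[OF sub z(2)] mu[OF z'] by blast
 qed
 define C where "C = {u \<in> F. cg R m2 u 1}"
 have fC: "MC.fi C F"
 proof -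
  obtain d w where Rw: "R = zspan d w" using R by (auto simp: is_order_def)
  obtain f :: "complex \<Rightarrow> nat \<Rightarrow> int" where f: "finite (f ` R)" "\<And>x y. x \<in> R \<Longrightarrow> y \<in> R \<Longrightarrow> f x = f y \<Longrightarrow> \<exists>r\<in>R. x - y = of_nat m2 * r"
   unfolding Rw using zspan_mod[OF m2, of d w] by blast
  show ?thesis
  proof (rule MC.fiI_fun[where f = f])
   show "subgroup C MC"
   proof (rule MC_subI)
    show "1 \<in> C" using Fp(1) cg_refl[OF sub] by (simp add: C_def)
    show "0 \<notin> C" using Fp(3) by (auto simp: C_def)
    show "x * y \<in> C" if xy: "x \<in> C" "y \<in> C" for x y
    proof -
     have xy': "x \<in> F" "cg R m2 x 1" "y \<in> F" "cg R m2 y 1" using xy by (auto simp: C_def)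
     have yR: "y \<in> R" using xy'(3) F(3) by blast
     have "cg R m2 (x * y) (1 * 1)" by (rule cg_mult[OF sub xy'(2,4) yR ringC(2)[OF sub]])
     then show ?thesis using Fp(2)[OF xy'(1,3)] by (simp add: C_def)
    qed
    show "inverse x \<in> C" if x: "x \<in> C" for x
    proof -
     have x': "x \<in> F" "cg R m2 x 1" using x by (auto simp: C_def)
     have iR: "inverse x \<in> R" using Fp(4)[OF x'(1)] F(3) by blast
     have "cg R m2 (inverse x * 1) (inverse x * x)" using cg_lmult[OF sub cg_sym[OF sub x'(2)] iR] .
     then show ?thesis using Fp(3,4)[OF x'(1)] by (simp add: C_def)
    qed
   qed
   show "finite (f ` F)" using f(1) F(3) finite_subset image_mono by metis
   fix x y assume xy: "x \<in> F" "y \<in> F" "f x = f y"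
   have iy: "inverse y \<in> F" using Fp(4)[OF xy(2)] .
   have iyR: "inverse y \<in> R" using iy F(3) by blast
   have "cg R m2 x y" using f(2) xy F(3) by (auto simp: cg_def)
   then have "cg R m2 (inverse y * x) (inverse y * y)" by (rule cg_lmult[OF sub _ iyR])
   then have "x * inverse y \<in> C" using Fp(2)[OF xy(1) iy] Fp(3)[OF xy(2)] by (simp add: C_def mult.commute)
   then show "x \<otimes>\<^bsub>MC\<^esub> inv\<^bsub>MC\<^esub> y \<in> C" using MC_inv[OF Fp(3)[OF xy(2)]] by simp
  qed (use F(1) in \<open>auto simp: C_def\<close>)
 qed
 have "MC.fi (D \<inter> (U \<inter> C)) F" using MC.fi_Int[OF D MC.fi_Int[OF U(1) fC]] .
 then obtain n :: nat where n: "n \<ge> 1" "\<And>x. x \<in> F \<Longrightarrow> x ^ n \<in> D \<inter> (U \<inter> C)" using MC.fi_power by (metis MC_pow)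
 obtain e g where g: "U = mspan e g" using fg_mspan[OF Us(1) MC_fg_sub[OF F(1,2) Us]] by blast
 have gU: "g i \<in> F" if "i < e" for i using mspan_gen[OF that, of g] g Us(2) by blast
 \<comment> \<open>The exponent k brings u into U, and n brings w into D and into the congruence
   subgroup of m2. Then u / w ^ n is torsion and congruent to 1 modulo m2, so it equals 1.\<close>
 have "\<exists>m\<ge>1. \<forall>u\<in>mspan e g. cg R m u 1 \<longrightarrow> (\<exists>w\<in>mspan e g. u = w ^ (k * n))"
 proof (rule chevalley[OF R])
  show "g i \<noteq> 0 \<and> g i \<in> R \<and> inverse (g i) \<in> R" if "i < e" for i
   using Fp(3,4)[OF gU[OF that]] gU[OF that] F(3) by blast
  show "u = 1" if "u \<in> mspan e g" "j \<ge> 1" "u ^ j = 1" for u and j :: nat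
   using Utf[of u j] that unfolding g by blast
  show "k * n \<ge> 1" using k(1) n(1) by simp
 qed
 then obtain m1 where m1: "m1 \<ge> 1" "\<And>u. u \<in> U \<Longrightarrow> cg R m1 u 1 \<Longrightarrow> \<exists>w\<in>U. u = w ^ (k * n)" unfolding g by blast
 have "u \<in> D" if u: "u \<in> F" "cg R (m1 * m2) u 1" for u
 proof -
  have uR: "u \<in> R" "1 \<in> R" using u(1) F(3) ringC(2)[OF sub] by auto
  have "cg R m1 (u ^ k) (1 ^ k)" by (rule cg_power[OF sub cg_dvd[OF sub u(2)] uR]) simp
  then obtain w where w: "w \<in> U" "u ^ k = w ^ (k * n)" using m1(2)[OF k(2)[OF u(1)]] by auto
  have wn: "w ^ n \<in> D" "cg R m2 (w ^ n) 1" "w ^ n \<in> F" using n(2)[of w] w(1) Us(2) by (auto simp: C_def)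
  define z where "z = inverse (w ^ n) * u"
  have nz: "w ^ n \<noteq> 0" "inverse (w ^ n) \<in> F" using Fp(3,4)[OF wn(3)] by auto
  have zF: "z \<in> F" unfolding z_def using Fp(2)[OF nz(2) u(1)] .
  have "z ^ k = inverse ((w ^ n) ^ k) * u ^ k" by (simp add: z_def power_mult_distrib power_inverse)
  also have "\<dots> = 1" using nz(1) unfolding w(2) by (simp add: power_mult[symmetric] mult.commute)
  finally have "z \<in> T" using zF k(1) by (auto simp: T_def)
  moreover have "cg R m2 z 1"
  proof -
   have "cg R m2 u (w ^ n)" using cg_trans[OF sub cg_dvd[OF sub u(2), of m2] cg_sym[OF sub wn(2)]] by simp
   then have "cg R m2 z (inverse (w ^ n) * w ^ n)" unfolding z_def
    by (rule cg_lmult[OF sub]) (use nz(2) F(3) in blast)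
   then show ?thesis using nz(1) by simp
  qed
  ultimately have "z = 1" by (rule m2T)
  then have "u = w ^ n" using nz(1) by (simp add: z_def field_simps)
  then show ?thesis using wn(1) by simp
 qed
 then show ?thesis using m1(1) m2 by (intro exI[of _ "m1 * m2"]) simp
qed

text \<open>\<open>AC_artin_rees\<close> for the subgroup R v of M, with v cancelled; congruences
  modulo m M thereby become congruences in the ring.\<close>

lemma multiplier_artin_rees:
 assumes M: "subgroup M AC" "AC.fg M" and v: "v \<in> M" "v \<noteq> 0" and R: "R = {r. \<forall>x\<in>M. r * x \<in> M}" and n: "n \<ge> 1"
 shows "\<exists>m\<ge>1. \<forall>r\<in>R. \<forall>x\<in>M. r * v = of_nat m * x \<longrightarrow> (\<exists>y\<in>R. r = of_nat n * y)"
proof -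
 have sub: "subring_C R" using multiplier_order[OF M v] unfolding R is_order_def by blast
 have "(\<lambda>r. r * v) ` R \<subseteq> M" using v(1) by (auto simp: R)
 then obtain m where m: "m \<ge> 1" "\<And>x. x \<in> M \<Longrightarrow> of_nat m * x \<in> (\<lambda>r. r * v) ` R \<Longrightarrow> \<exists>y\<in>(\<lambda>r. r * v) ` R. of_nat m * x = of_nat n * y"
  using AC_artin_rees[OF M princ_subgroup[OF sub] _ n, of v] by blast
 have "\<exists>y\<in>R. r = of_nat n * y" if r: "r \<in> R" "x \<in> M" "r * v = of_nat m * x" for r x
 proof -
  have "of_nat m * x \<in> (\<lambda>r. r * v) ` R" using r(1) unfolding r(3)[symmetric] by (rule imageI)
  then obtain y where y: "y \<in> R" "of_nat m * x = of_nat n * (y * v)" using m(2)[OF r(2)] by blast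
  then have "r * v = (of_nat n * y) * v" using r(3) by simp
  then have "r = of_nat n * y" using v(2) by simp
  then show ?thesis using y(1) by blast
 qed
 then show ?thesis using m(1) by blast
qed

text \<open>As e - 1 sends v into m M, it lies in n R; so e is congruent to 1 modulo n, and the
  congruence subgroup property applies.\<close>

lemma orbit_congruence_stabilizer:
 assumes M: "subgroup M AC" "AC.fg M" and E: "subgroup E MC" "MC.fg E" and st: "\<And>e x. e \<in> E \<Longrightarrow> x \<in> M \<Longrightarrow> e * x \<in> M"
  and v: "v \<in> M" "v \<noteq> 0" and D: "MC.fi D E"
 shows "\<exists>m\<ge>1. \<forall>e\<in>E. (\<exists>x\<in>M. e * v - v = of_nat m * x) \<longrightarrow> e \<in> D"
proof -
 define R where "R = {r. \<forall>x\<in>M. r * x \<in> M}"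
 have R: "is_order R" unfolding R_def by (rule multiplier_order[OF M v])
 have ER: "E \<subseteq> R" using st by (auto simp: R_def)
 have sub: "subring_C R" using R by (simp add: is_order_def)
 obtain n where n: "n \<ge> 1" "\<And>u. u \<in> E \<Longrightarrow> cg R n u 1 \<Longrightarrow> u \<in> D"
  using congruence_subgroup_property[OF R E ER D] by blast
 obtain m where m: "m \<ge> 1" "\<And>r x. r \<in> R \<Longrightarrow> x \<in> M \<Longrightarrow> r * v = of_nat m * x \<Longrightarrow> \<exists>y\<in>R. r = of_nat n * y"
  using multiplier_artin_rees[OF M v R_def n(1)] by blast
 have "e \<in> D" if e: "e \<in> E" "x \<in> M" "e * v - v = of_nat m * x" for e x
 proof -
  have "e - 1 \<in> R" using e(1) ER ringC(5)[OF sub _ ringC(2)[OF sub]] by blast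
  moreover have "(e - 1) * v = of_nat m * x" using e(3) by (simp add: algebra_simps)
  ultimately have "cg R n e 1" using m(2) e(2) by (auto simp: cg_def)
  then show ?thesis using n(2)[OF e(1)] by blast
 qed
 then show ?thesis using m(1) by blast
qed

text \<open>The subgroup R v is closed, so w = c * v for some c in R, which is congruent to elements
  of E modulo every n. Once c is known to be a unit of R, separability of E in the group generated
  by E and c puts c into E.\<close>

lemma orbit_closed:
 assumes M: "subgroup M AC" "AC.fg M" and E: "subgroup E MC" "MC.fg E" and st: "\<And>e x. e \<in> E \<Longrightarrow> x \<in> M \<Longrightarrow> e * x \<in> M"
  and v: "v \<in> M" "v \<noteq> 0" and w: "w \<in> M" "\<And>m::nat. m \<ge> 1 \<Longrightarrow> \<exists>e\<in>E. \<exists>x\<in>M. w - e * v = of_nat m * x"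
 shows "\<exists>e\<in>E. w = e * v"
proof -
 define R where "R = {r. \<forall>x\<in>M. r * x \<in> M}"
 note Ep = MC_sub[OF E(1)]
 have R: "is_order R" unfolding R_def by (rule multiplier_order[OF M v])
 have ER: "E \<subseteq> R" using st by (auto simp: R_def)
 have sub: "subring_C R" using R by (simp add: is_order_def)
 have L: "subgroup ((\<lambda>r. r * a) ` R) AC" "(\<lambda>r. r * a) ` R \<subseteq> M" if "a \<in> M" for a
  using princ_subgroup[OF sub, of a] that by (auto simp: R_def)
 have "w \<in> (\<lambda>r. r * v) ` R"
 proof (rule AC_closed[OF M L[OF v(1)] w(1)])
  fix n :: nat assume "n \<ge> 1"
  then obtain e x where "e \<in> E" "x \<in> M" "w - e * v = of_nat n * x" using w(2) by blast
  then show "\<exists>l\<in>(\<lambda>r. r * v) ` R. \<exists>p\<in>M. w - l = of_nat n * p" using ER by blast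
 qed
 then obtain c where c: "c \<in> R" "w = c * v" by blast
 \<comment> \<open>Approximation is symmetric, because e can be inverted in E; this yields the
   inverse of c in R.\<close>
 have "v \<in> (\<lambda>r. r * w) ` R"
 proof (rule AC_closed[OF M L[OF w(1)] v(1)])
  fix n :: nat assume "n \<ge> 1"
  then obtain e x where e: "e \<in> E" "x \<in> M" "w - e * v = of_nat n * x" using w(2) by blast
  have i: "e \<noteq> 0" "inverse e \<in> E" using Ep(3,4) e(1) by auto
  have "v - inverse e * w = inverse e * (e * v - w)" using i by (simp add: algebra_simps)
  also have "\<dots> = of_nat n * (inverse e * (- x))" using e(3) by (simp add: algebra_simps)
  finally have "v - inverse e * w = of_nat n * (inverse e * (- x))" .
  moreover have "inverse e * (- x) \<in> M" using st[OF i(2) AC_sub(3)[OF M(1) e(2)]] .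
  ultimately show "\<exists>l\<in>(\<lambda>r. r * w) ` R. \<exists>p\<in>M. v - l = of_nat n * p" using ER i(2) by blast
 qed
 then obtain c' where c': "c' \<in> R" "v = c' * w" by blast
 have "c' * c = 1" using c(2) c'(2) v(2) by (metis mult.assoc mult_cancel_right1)
 then have cnz: "c \<noteq> 0" and ic: "inverse c = c'" by (auto simp: inverse_unique mult.commute)
 have cong: "\<exists>e\<in>E. cg R n c e" if n: "n \<ge> 1" for n :: nat
 proof -
  obtain m where m: "m \<ge> 1" "\<And>r x. r \<in> R \<Longrightarrow> x \<in> M \<Longrightarrow> r * v = of_nat m * x \<Longrightarrow> \<exists>y\<in>R. r = of_nat n * y"
   using multiplier_artin_rees[OF M v R_def n] by blast
  obtain e x where e: "e \<in> E" "x \<in> M" "w - e * v = of_nat m * x" using w(2)[OF m(1)] by blast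
  have "(c - e) * v = of_nat m * x" using e(3) c(2) by (simp add: algebra_simps)
  moreover have "c - e \<in> R" using e(1) ER c(1) ringC(5)[OF sub] by blast
  ultimately obtain y where y: "y \<in> R" "c - e = of_nat n * y" using m(2) e(2) by blast
  then show ?thesis using y(1) e(1) by (auto simp: cg_def)
 qed
 have Ec: "E \<subseteq> carrier MC" using Ep(3) by auto
 obtain S where S: "finite S" "S \<subseteq> E" "\<And>Q. subgroup Q MC \<Longrightarrow> S \<subseteq> Q \<Longrightarrow> E \<subseteq> Q" using E(2) by (auto simp: MC.fg_def)
 \<comment> \<open>The group F generated by E and c consists of units of R, so its finite index
   subgroups are detected by congruences.\<close>
 have "insert c S \<subseteq> carrier MC" using S(2) Ec cnz by auto
 then obtain nF F where F: "MC.VP nF F" "insert c S \<subseteq> F" "\<And>Q. subgroup Q MC \<Longrightarrow> insert c S \<subseteq> Q \<Longrightarrow> F \<subseteq> Q"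
  using MC.abelian_VP[of "insert c S"] S(1) by (auto simp: mult.commute)
 have Fs: "subgroup F MC" "MC.fg F" using MC.VP_subgroup[OF F(1)] MC.VP_fg[OF F(1)] by auto
 have EF: "E \<subseteq> F" using S(3)[OF Fs(1)] F(2) by blast
 have FR: "F \<subseteq> R"
 proof -
  have "subgroup {u. u \<noteq> 0 \<and> u \<in> R \<and> inverse u \<in> R} MC"
   by (rule MC_subI) (use ringC(2,6)[OF sub] in auto)
  moreover have "insert c S \<subseteq> {u. u \<noteq> 0 \<and> u \<in> R \<and> inverse u \<in> R}" using S(2) ER Ep(3,4) c(1) c'(1) ic cnz by blast
  ultimately show ?thesis using F(3) by blast
 qed
 have "c \<in> E"
 proof (rule ccontr)
  assume "c \<notin> E"
  then obtain K where K: "MC.fi K F" "\<forall>l\<in>E. inv\<^bsub>MC\<^esub> l \<otimes>\<^bsub>MC\<^esub> c \<notin> K"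
   using MC.sepD[OF MC.VP_sep[OF F(1)] E(1) EF] F(2) by blast
  obtain n where n: "n \<ge> 1" "\<And>u. u \<in> F \<Longrightarrow> cg R n u 1 \<Longrightarrow> u \<in> K"
   using congruence_subgroup_property[OF R Fs FR K(1)] by blast
  obtain e where e: "e \<in> E" "cg R n c e" using cong[OF n(1)] by blast
  have i: "inverse e \<in> E" "e \<noteq> 0" using Ep(3,4)[OF e(1)] by auto
  have "cg R n (inverse e * c) (inverse e * e)" by (rule cg_lmult[OF sub e(2)]) (use i ER in blast)
  then have "cg R n (inverse e * c) 1" using i by simp
  moreover have "inverse e * c \<in> F" using i EF F(2) MC_sub(2)[OF Fs(1)] by blast
  ultimately have "inverse e * c \<in> K" using n(2) by blast
  then show False using K(2) e(1) MC_inv[OF i(2)] by auto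
 qed
 then show ?thesis using c(2) by blast
qed

section \<open>Triangular actions\<close>

lemma linear_dependence:
 fixes f :: "'i \<Rightarrow> 's \<Rightarrow> complex"
 assumes "finite S" "finite I" "card I > card S"
 shows "\<exists>c. (\<exists>i\<in>I. c i \<noteq> 0) \<and> (\<forall>s\<in>S. (\<Sum>i\<in>I. c i * f i s) = 0)"
 using assms
proof (induction S arbitrary: I f rule: finite_induct)
 case empty
 then obtain i where "i \<in> I" by fastforce
 then show ?case by (intro exI[of _ "\<lambda>_. 1"]) auto
next
 case (insert s S)
 show ?case
 proof (cases "\<forall>i\<in>I. f i s = 0")
  case True
  then have "(\<Sum>i\<in>I. c i * f i s) = 0" for c by simp
  moreover obtain c where "\<exists>i\<in>I. c i \<noteq> 0" "\<forall>s\<in>S. (\<Sum>i\<in>I. c i * f i s) = 0"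
   using insert.IH[of I f] insert.hyps insert.prems by (metis Suc_lessD card_insert_disjoint)
  ultimately show ?thesis by (metis insert_iff)
 next
  case False
  then obtain j where j: "j \<in> I" "f j s \<noteq> 0" by blast
  define g where "g i x = f i x - f i s / f j s * f j x" for i x
  have "card (I - {j}) > card S" using insert j by simp
  then obtain c where c: "\<exists>i\<in>I - {j}. c i \<noteq> 0" "\<forall>x\<in>S. (\<Sum>i\<in>I - {j}. c i * g i x) = 0"
   using insert.IH[of "I - {j}" g] insert.prems by blast
  \<comment> \<open>The coefficient of the pivot j is chosen so that the relation among the reduced
    functions g becomes one among the f.\<close>
  define e where "e i = (if i = j then - (\<Sum>i\<in>I - {j}. c i * (f i s / f j s)) else c i)" for i
  have eq: "(\<Sum>i\<in>I. e i * f i x) = (\<Sum>i\<in>I - {j}. c i * g i x)" for x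
  proof -
   have "(\<Sum>i\<in>I. e i * f i x) = e j * f j x + (\<Sum>i\<in>I - {j}. e i * f i x)"
    using insert.prems(1) j(1) by (rule sum.remove)
   also have "(\<Sum>i\<in>I - {j}. e i * f i x) = (\<Sum>i\<in>I - {j}. c i * f i x)"
    by (intro sum.cong) (auto simp: e_def)
   also have "e j * f j x = - (\<Sum>i\<in>I - {j}. c i * (f i s / f j s * f j x))"
    by (simp add: e_def sum_distrib_right mult.assoc)
   finally show ?thesis by (simp add: g_def right_diff_distrib sum_subtractf)
  qed
  have "(\<Sum>i\<in>I. e i * f i x) = 0" if "x \<in> insert s S" for x
  proof (cases "x = s")
   case True
   have "g i s = 0" for i using j(2) by (simp add: g_def)
   then show ?thesis unfolding eq True by simp
  next
   case False
   then show ?thesis unfolding eq using c(2) that by simp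
  qed
  moreover have "\<exists>i\<in>I. e i \<noteq> 0" using c(1) by (auto simp: e_def)
  ultimately show ?thesis by blast
 qed
qed

text \<open>Dedekind's argument: transform a shortest relation by d and subtract its multiple by
  \<chi> i d. The i-th term cancels, so by minimality all terms do, and \<chi> j d = \<chi> i d for
  any other j in the relation.\<close>

lemma common_character:
 fixes f :: "'i \<Rightarrow> 'b \<Rightarrow> complex" and \<chi> :: "'i \<Rightarrow> 'd \<Rightarrow> complex"
 assumes I: "finite I" and nz: "\<And>i. i \<in> I \<Longrightarrow> \<exists>b. f i b \<noteq> 0"
  and dep: "\<exists>i\<in>I. c i \<noteq> 0" "\<And>b. (\<Sum>i\<in>I. c i * f i b) = 0"
  and act: "\<And>d c b. d \<in> \<Delta> \<Longrightarrow> (\<And>b. (\<Sum>i\<in>I. c i * f i b) = 0) \<Longrightarrow> (\<Sum>i\<in>I. (c i * \<chi> i d) * f i b) = 0"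
 shows "\<exists>i\<in>I. \<exists>j\<in>I. i \<noteq> j \<and> (\<forall>d\<in>\<Delta>. \<chi> i d = \<chi> j d)"
proof -
 define P where "P c \<longleftrightarrow> (\<exists>i\<in>I. c i \<noteq> 0) \<and> (\<forall>b. (\<Sum>i\<in>I. c i * f i b) = 0)" for c
 have "P c" using dep by (simp add: P_def)
 then obtain e where e: "P e" "\<And>e'. P e' \<Longrightarrow> card {i\<in>I. e i \<noteq> 0} \<le> card {i\<in>I. e' i \<noteq> 0}"
  using ex_has_least_nat[of P c "\<lambda>e. card {i\<in>I. e i \<noteq> 0}"] by blast
 obtain i where i: "i \<in> I" "e i \<noteq> 0" using e(1) by (auto simp: P_def)
 have "\<exists>j\<in>I - {i}. e j \<noteq> 0"
 proof (rule ccontr)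
  assume a: "\<not> (\<exists>j\<in>I - {i}. e j \<noteq> 0)"
  obtain b where b: "f i b \<noteq> 0" using nz[OF i(1)] by blast
  have "(\<Sum>j\<in>I. e j * f j b) = e i * f i b + (\<Sum>j\<in>I - {i}. e j * f j b)" using I i(1) by (rule sum.remove)
  also have "(\<Sum>j\<in>I - {i}. e j * f j b) = 0" using a by (intro sum.neutral) auto
  finally show False using e(1) i(2) b by (simp add: P_def)
 qed
 then obtain j where j: "j \<in> I" "j \<noteq> i" "e j \<noteq> 0" by blast
 have "\<chi> i d = \<chi> j d" if d: "d \<in> \<Delta>" for d
 proof (rule ccontr)
  assume ne: "\<chi> i d \<noteq> \<chi> j d"
  define e' where "e' l = e l * \<chi> l d - \<chi> i d * e l" for l
  have "(\<Sum>l\<in>I. e' l * f l b) = 0" for b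
  proof -
   have "(\<Sum>l\<in>I. e' l * f l b) = (\<Sum>l\<in>I. (e l * \<chi> l d) * f l b) - \<chi> i d * (\<Sum>l\<in>I. e l * f l b)"
    by (simp add: e'_def left_diff_distrib sum_subtractf sum_distrib_left mult.assoc)
   then show ?thesis using act[OF d, of e b] e(1) by (simp add: P_def)
  qed
  moreover have "e' j \<noteq> 0" using ne j(3) by (simp add: e'_def)
  ultimately have "P e'" using j(1) by (auto simp: P_def)
  then have "card {l\<in>I. e l \<noteq> 0} \<le> card {l\<in>I. e' l \<noteq> 0}" by (rule e(2))
  moreover have "{l\<in>I. e' l \<noteq> 0} \<subset> {l\<in>I. e l \<noteq> 0}" using i by (auto simp: e'_def)
  then have "card {l\<in>I. e' l \<noteq> 0} < card {l\<in>I. e l \<noteq> 0}" using I by (intro psubset_card_mono) auto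
  ultimately show False by simp
 qed
 then have "i \<noteq> j \<and> (\<forall>d\<in>\<Delta>. \<chi> i d = \<chi> j d)" using j(2) by simp
 then show ?thesis using i(1) j(1) by (intro bexI)
qed

text \<open>A Krylov argument with the shift i \<mapsto> Suc i as operator: a nonzero polynomial of
  least degree annihilating v 0 has a root z, and its cofactor of X - z, applied to v 0, is an
  eigenvector for z.\<close>

lemma shift_eigenvector:
 fixes v :: "nat \<Rightarrow> 'b \<Rightarrow> complex"
 assumes v0: "v 0 b0 \<noteq> 0" and dep: "\<exists>i\<le>N. c i \<noteq> 0" "\<And>b. (\<Sum>i\<le>N. c i * v i b) = 0"
 shows "\<exists>(n::nat) e z. (\<exists>b. (\<Sum>i\<le>n. e i * v i b) \<noteq> 0) \<and> (\<forall>b. (\<Sum>i\<le>n. e i * v (Suc i) b) = z * (\<Sum>i\<le>n. e i * v i b))"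
proof -
 define ev where "ev p b = (\<Sum>i\<le>Polynomial.degree p. Polynomial.coeff p i * v i b)" for p b
 have evM: "(\<Sum>i\<le>M. Polynomial.coeff p i * v i b) = ev p b" if "Polynomial.degree p \<le> M" for p M b
  unfolding ev_def using that by (intro sum.mono_neutral_right) (auto simp: coeff_eq_0)
 define P where "P p \<longleftrightarrow> p \<noteq> 0 \<and> (\<forall>b. ev p b = 0)" for p
 define p0 where "p0 = (\<Sum>i\<le>N. Polynomial.monom (c i) i)"
 have cp0: "Polynomial.coeff p0 i = (if i \<le> N then c i else 0)" for i
  by (simp add: p0_def coeff_sum sum.delta)
 have dp0: "Polynomial.degree p0 \<le> N" by (rule degree_le) (auto simp: cp0)
 have "P p0"
 proof -
  have "p0 \<noteq> 0" using dep(1) cp0 by (metis coeff_0)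
  moreover have "ev p0 b = 0" for b
  proof -
   have "ev p0 b = (\<Sum>i\<le>N. Polynomial.coeff p0 i * v i b)" using evM[OF dp0] by simp
   also have "\<dots> = (\<Sum>i\<le>N. c i * v i b)" by (intro sum.cong) (auto simp: cp0)
   finally show ?thesis using dep(2) by simp
  qed
  ultimately show ?thesis by (simp add: P_def)
 qed
 then obtain p where p: "P p" "\<And>q. P q \<Longrightarrow> Polynomial.degree p \<le> Polynomial.degree q"
  using ex_has_least_nat[of P p0 Polynomial.degree] by blast
 have "Polynomial.degree p \<noteq> 0"
 proof
  assume "Polynomial.degree p = 0"
  then obtain a where a: "p = [:a:]" by (rule degree_eq_zeroE)
  then have "a * v 0 b0 = 0" using p(1) by (auto simp: P_def ev_def)
  then show False using v0 a p(1) by (simp add: P_def)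
 qed
 then have "\<not> constant (poly p)" by (simp add: constant_degree)
 then obtain z where "poly p z = 0" using fundamental_theorem_of_algebra by blast
 then obtain q where q: "p = [:- z, 1:] * q" using poly_eq_0_iff_dvd by (auto simp: dvd_def)
 have q0: "q \<noteq> 0" using p(1) q by (auto simp: P_def)
 have dq: "Polynomial.degree p = Suc (Polynomial.degree q)" unfolding q using q0 by (subst degree_mult_eq) auto
 define n where "n = Polynomial.degree q"
 have "\<not> P q" using p(2)[of q] dq by auto
 then obtain b where b: "ev q b \<noteq> 0" using q0 by (auto simp: P_def)
 have "(\<Sum>i\<le>n. Polynomial.coeff q i * v (Suc i) b) = z * ev q b" for b
 proof -
  have "0 = (\<Sum>i\<le>Suc n. Polynomial.coeff p i * v i b)"
   using evM[of p "Suc n" b] dq p(1) by (simp add: P_def n_def)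
  also have "\<dots> = Polynomial.coeff p 0 * v 0 b + (\<Sum>i\<le>n. Polynomial.coeff p (Suc i) * v (Suc i) b)"
   by (rule sum.atMost_Suc_shift)
  also have "\<dots> = (\<Sum>i\<le>n. Polynomial.coeff q i * v (Suc i) b)
    - z * (Polynomial.coeff q 0 * v 0 b + (\<Sum>i\<le>n. Polynomial.coeff q (Suc i) * v (Suc i) b))"
   by (simp add: q left_diff_distrib sum_subtractf sum_distrib_left algebra_simps coeff_pCons)
  also have "Polynomial.coeff q 0 * v 0 b + (\<Sum>i\<le>n. Polynomial.coeff q (Suc i) * v (Suc i) b)
    = (\<Sum>i\<le>Suc n. Polynomial.coeff q i * v i b)"
   by (rule sum.atMost_Suc_shift[symmetric])
  also have "\<dots> = ev q b" by (rule evM) (simp add: n_def)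
  finally show ?thesis by simp
 qed
 then show ?thesis using b unfolding ev_def n_def[symmetric] by blast
qed

section \<open>Additive characters and their common eigenvectors\<close>

context group
begin

text \<open>The value 0 outside A makes equality of functions the same as equality of
  characters.\<close>

definition homs :: "'a set \<Rightarrow> ('a \<Rightarrow> complex) set" where
 "homs A = {u. (\<forall>x\<in>A. \<forall>y\<in>A. u (x \<otimes> y) = u x + u y) \<and> (\<forall>x. x \<notin> A \<longrightarrow> u x = 0)}"

text \<open>A right action of the normalizer of A on characters, by \<open>act_act\<close>.\<close>

definition act :: "'a set \<Rightarrow> 'a \<Rightarrow> ('a \<Rightarrow> complex) \<Rightarrow> 'a \<Rightarrow> complex" where
 "act A d u a = (if a \<in> A then u (cj d a) else 0)"

lemma additive_one:
 assumes "subgroup A G" "\<And>x y. x \<in> A \<Longrightarrow> y \<in> A \<Longrightarrow> u (x \<otimes> y) = u x + (u y :: complex)"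
 shows "u \<one> = 0" "x \<in> A \<Longrightarrow> u (inv x) = - u x" "x \<in> A \<Longrightarrow> u (x [^] (n::nat)) = of_nat n * u x"
proof -
 have 1: "\<one> \<in> A" using assms(1) sub_one by blast
 show z: "u \<one> = 0" using assms(2)[OF 1 1] by simp
 show "u (inv x) = - u x" if x: "x \<in> A"
 proof -
  have "x \<in> carrier G" "inv x \<in> A" using x assms(1) sub_mem sub_inv by (metis, metis)
  then show ?thesis using assms(2)[OF _ x, of "inv x"] z by (simp add: eq_neg_iff_add_eq_0)
 qed
 show "u (x [^] n) = of_nat n * u x" if x: "x \<in> A"
 proof (induction n)
  case (Suc n)
  have "x [^] n \<in> A" using x assms(1) 1 by (induction n) (auto simp: sub_m)
  then show ?case using Suc assms(2)[OF _ x, of "x [^] n"] by (simp add: algebra_simps)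
 qed (simp add: z)
qed

lemma additive_kernel:
 assumes A: "subgroup A G" "\<And>x y. x \<in> A \<Longrightarrow> y \<in> A \<Longrightarrow> u (x \<otimes> y) = u x + (u y :: complex)"
 shows "subgroup {x \<in> A. u x = 0} G"
 using hom_on(4)[OF A(1) AC.group_axioms, of u "{0}"] A(2) AC_subI[of "{0}"] by simp

lemma homs_add: "u \<in> homs A \<Longrightarrow> x \<in> A \<Longrightarrow> y \<in> A \<Longrightarrow> u (x \<otimes> y) = u x + u y"
 by (simp add: homs_def)

lemma homs_sum: "(\<And>i. i \<in> I \<Longrightarrow> f i \<in> homs A) \<Longrightarrow> (\<lambda>a. \<Sum>i\<in>I. c i * f i a) \<in> homs A"
 by (auto simp: homs_def sum.distrib[symmetric] algebra_simps intro!: sum.cong sum.neutral)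

text \<open>An additive map is determined on finitely many generators, whose number serves as N. The
  bound on the dimension is phrased through relations, as needed by the two preceding lemmas on
  families.\<close>

lemma homs_dependence:
 assumes A: "subgroup A G" "fg A"
 shows "\<exists>N::nat. \<forall>f. (\<forall>i. f i \<in> homs A) \<longrightarrow> (\<exists>c. (\<exists>i\<le>N. c i \<noteq> 0) \<and> (\<forall>a. (\<Sum>i\<le>N. c i * f i a) = 0))"
proof -
 obtain S where S: "finite S" "S \<subseteq> A" "\<And>Q. subgroup Q G \<Longrightarrow> S \<subseteq> Q \<Longrightarrow> A \<subseteq> Q" using A(2) by (auto simp: fg_def)
 have "\<exists>c. (\<exists>i\<le>card S. c i \<noteq> 0) \<and> (\<forall>a. (\<Sum>i\<le>card S. c i * f i a) = 0)" if f: "\<forall>i. f i \<in> homs A" for f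
 proof -
  obtain c where c: "\<exists>i\<in>{..card S}. c i \<noteq> 0" "\<forall>s\<in>S. (\<Sum>i\<le>card S. c i * f i s) = 0"
   using linear_dependence[OF S(1), of "{..card S}" f] by auto
  define h where "h a = (\<Sum>i\<le>card S. c i * f i a)" for a
  have h: "h \<in> homs A" unfolding h_def using homs_sum[of "{..card S}" f A c] f by blast
  have "subgroup {x \<in> A. h x = 0} G" by (rule additive_kernel[OF A(1) homs_add[OF h]])
  moreover have "S \<subseteq> {x \<in> A. h x = 0}" using c(2) S(2) by (auto simp: h_def)
  ultimately have "A \<subseteq> {x \<in> A. h x = 0}" using S(3) by blast
  then have "h a = 0" for a using h by (cases "a \<in> A") (auto simp: homs_def)
  then show ?thesis using c(1) unfolding h_def by (intro exI[of _ c]) auto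
 qed
 then show ?thesis by blast
qed

lemma act_homs: assumes "subgroup A G" "nz d A" "u \<in> homs A" shows "act A d u \<in> homs A"
proof -
 have "u (cj d (x \<otimes> y)) = u (cj d x) + u (cj d y)" if xy: "x \<in> A" "y \<in> A" for x y
 proof -
  have c: "x \<in> carrier G" "y \<in> carrier G" "d \<in> carrier G"
   using xy assms sub_mem nz_D(1) by (metis, metis, metis)
  have "cj d (x \<otimes> y) = (cj d x) \<otimes> (cj d y)" using c by (simp add: gsimps)
  then show ?thesis using homs_add[OF assms(3) nz_D(2)[OF assms(2) xy(1)] nz_D(2)[OF assms(2) xy(2)]] by simp
 qed
 then show ?thesis using sub_m[OF assms(1)] by (simp add: homs_def act_def)
qed

lemma act_act:
 assumes "subgroup A G" "nz d A" "e \<in> carrier G"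
 shows "act A d (act A e u) = act A (e \<otimes> d) u"
proof
 fix a
 show "act A d (act A e u) a = act A (e \<otimes> d) u a"
 proof (cases "a \<in> A")
  case True
  then have "a \<in> carrier G" "d \<in> carrier G" "cj d a \<in> A"
   using assms sub_mem nz_D by (metis, metis, metis)
  then show ?thesis using assms(3) by (simp add: act_def gsimps True)
 qed (simp add: act_def)
qed

lemma act_one: assumes "subgroup A G" "u \<in> homs A" shows "act A \<one> u = u"
proof
 fix a show "act A \<one> u a = u a"
  using assms sub_mem[OF assms(1)] by (cases "a \<in> A") (auto simp: act_def homs_def)
qed

lemma act_scale: "act A d (\<lambda>a. c * u a) = (\<lambda>a. c * act A d u a)" by (auto simp: act_def)

lemma act_sum: "act A d (\<lambda>a. \<Sum>i\<in>I. c i * f i a) = (\<lambda>a. \<Sum>i\<in>I. c i * act A d (f i) a)"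
 by (auto simp: act_def)

lemma eigen_subgroup:
 assumes A: "subgroup A G" and \<mu>: "\<mu> \<in> homs A" "\<mu> \<noteq> (\<lambda>_. 0)"
 shows "subgroup {g. nz g A \<and> (\<exists>c. act A g \<mu> = (\<lambda>a. c * \<mu> a))} G" (is "subgroup ?S G")
proof -
 have N: "subgroup {g. nz g A} G" by (rule nz_subgroup[OF subgroup.subset[OF A]])
 show ?thesis
 proof (rule subgroupI)
  show "?S \<subseteq> carrier G" by (auto simp: nz_def)
  have "act A \<one> \<mu> = (\<lambda>a. 1 * \<mu> a)" using act_one[OF A \<mu>(1)] by simp
  then have "\<one> \<in> ?S" using sub_one[OF N] by blast
  then show "?S \<noteq> {}" by blast
  fix g assume g: "g \<in> ?S"
  then obtain c where c: "act A g \<mu> = (\<lambda>a. c * \<mu> a)" by blast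
  have gn: "nz g A" "nz (inv g) A" using g sub_inv[OF N] by auto
  have gc: "g \<in> carrier G" using gn by (simp add: nz_def)
  show "inv g \<in> ?S"
  proof -
   have "act A (inv g) (act A g \<mu>) = \<mu>" using act_act[OF A gn(2) gc] gc act_one[OF A \<mu>(1)] by simp
   then have e: "(\<lambda>a. c * act A (inv g) \<mu> a) = \<mu>" unfolding c act_scale .
   have "c \<noteq> 0" using e \<mu>(2) by auto
   have "act A (inv g) \<mu> a = inverse c * \<mu> a" for a using fun_cong[OF e, of a] \<open>c \<noteq> 0\<close> by (simp add: field_simps)
   then show ?thesis using gn by blast
  qed
  fix h assume h: "h \<in> ?S"
  then obtain c' where c': "act A h \<mu> = (\<lambda>a. c' * \<mu> a)" by blast
  have "act A (g \<otimes> h) \<mu> = act A h (act A g \<mu>)" using act_act[OF A _ gc] h by simp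
  also have "\<dots> = (\<lambda>a. (c * c') * \<mu> a)" unfolding c act_scale c' by (simp add: mult.assoc)
  finally show "g \<otimes> h \<in> ?S" using sub_m[OF N, of g h] g h by blast
 qed
qed

text \<open>A virtual Lie-Kolchin theorem. When t is adjoined, the translates of an eigenvector by
  powers of t belong to conjugate characters. Finite dimension makes two of these agree, so a power
  s of t preserves the character on a subgroup of finite index, and s has an eigenvector among the
  eigenvectors of this character.\<close>

lemma common_eigenfunctional:
 assumes A: "subgroup A G" "fg A"
 shows "VP n D \<Longrightarrow> (\<And>d. d \<in> D \<Longrightarrow> nz d A) \<Longrightarrow> W \<subseteq> homs A \<Longrightarrow>
  (\<And>(I::nat set) c f. (\<And>i. i \<in> I \<Longrightarrow> f i \<in> W) \<Longrightarrow> (\<lambda>a. \<Sum>i\<in>I. c i * f i a) \<in> W) \<Longrightarrow>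
  (\<And>d u. d \<in> D \<Longrightarrow> u \<in> W \<Longrightarrow> act A d u \<in> W) \<Longrightarrow> u0 \<in> W \<Longrightarrow> u0 \<noteq> (\<lambda>_. 0) \<Longrightarrow>
  \<exists>D' u. fi D' D \<and> u \<in> W \<and> u \<noteq> (\<lambda>_. 0) \<and> (\<forall>d\<in>D'. \<exists>c. act A d u = (\<lambda>a. c * u a))"
proof (induction arbitrary: W u0 rule: VP.induct)
 case VP_one
 have "act A \<one> u0 = (\<lambda>a. 1 * u0 a)" using act_one[OF A(1)] VP_one by auto
 then show ?case using VP_one fi_refl[OF triv_subgroup] by blast
next
 case (VP_fin n P H)
 note PH = fiD[OF VP_fin.hyps(2)]
 have "\<exists>D' u. fi D' P \<and> u \<in> W \<and> u \<noteq> (\<lambda>_. 0) \<and> (\<forall>d\<in>D'. \<exists>c. act A d u = (\<lambda>a. c * u a))"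
  by (rule VP_fin.IH[OF _ VP_fin.prems(2,3) _ VP_fin.prems(5,6)]) (use VP_fin.prems(1,4) PH(3) in blast)+
 then show ?case using fi_trans[OF _ VP_fin.hyps(2)] by blast
next
 case (VP_ext n P t W u0)
 note W = VP_ext.prems(2,3)
 have P: "subgroup P G" using VP_subgroup VP_ext.hyps by blast
 have Pc: "P \<subseteq> carrier G" using P subgroup.subset by blast
 have t: "nz t P" using VP_ext.hyps by blast
 have tc: "t \<in> carrier G" using t by (simp add: nz_def)
 have PD: "P \<subseteq> cyc P t" using cyc_superset[OF Pc tc] .
 have tD: "t [^] (i::int) \<in> cyc P t" for i using cyc_gen[OF P tc] .
 have nzD: "nz d A" if "d \<in> cyc P t" for d using VP_ext.prems(1) that .
 have actW: "act A d u \<in> W" if "d \<in> cyc P t" "u \<in> W" for d u using VP_ext.prems(4) that .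
 have "\<exists>D' u. fi D' P \<and> u \<in> W \<and> u \<noteq> (\<lambda>_. 0) \<and> (\<forall>d\<in>D'. \<exists>c. act A d u = (\<lambda>a. c * u a))"
  by (rule VP_ext.IH[OF _ W _ VP_ext.prems(5,6)]) (use nzD actW PD in blast)+
 then obtain D1 u where D1: "fi D1 P" "u \<in> W" "u \<noteq> (\<lambda>_. 0)" "\<forall>d\<in>D1. \<exists>c. act A d u = (\<lambda>a. c * u a)" by blast
 \<comment> \<open>An invariant subgroup of finite index, as t need not normalize D1.\<close>
 obtain D2 where D2: "fi D2 P" "D2 \<subseteq> D1" "\<And>\<alpha>. endo P \<alpha> \<Longrightarrow> \<alpha> ` D2 \<subseteq> D2"
  using invariant_fi[OF VP_fg[OF VP_ext.hyps(1)] D1(1)] by blast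
 have D2P: "D2 \<subseteq> P" using fiD(3)[OF D2(1)] .
 have D2c: "D2 \<subseteq> carrier G" using D2P Pc by blast
 have nD2: "nz s D2" if s: "nz s P" for s
  unfolding nz_def using D2(3)[OF endo_conj(1)[OF P s]] D2(3)[OF endo_conj(2)[OF P s]] nz_D(1)[OF s sub_one[OF P]] by blast
 have "\<forall>d. \<exists>c. d \<in> D2 \<longrightarrow> act A d u = (\<lambda>a. c * u a)" using D1(4) D2(2) by blast
 from choice[OF this] obtain \<chi> where chi: "\<And>d. d \<in> D2 \<Longrightarrow> act A d u = (\<lambda>a. \<chi> d * u a)" by blast
 text \<open>Translating an eigenvector by a power of t conjugates its character.\<close>
 have move: "act A d (act A (t [^] i) \<mu>) = (\<lambda>a. \<chi> (cj (t [^] i) d) * act A (t [^] i) \<mu> a)"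
  if d: "d \<in> D2" and \<mu>: "\<And>d. d \<in> D2 \<Longrightarrow> act A d \<mu> = (\<lambda>a. \<chi> d * \<mu> a)" for d \<mu> and i :: int
 proof -
  define d' where "d' = cj (t [^] i) d"
  have dc: "d \<in> carrier G" "d \<in> cyc P t" using d D2c D2P PD by auto
  have d': "d' \<in> D2" unfolding d'_def by (rule nz_D(2)[OF nD2[OF nz_int_pow[OF Pc t]] d])
  have d'c: "d' \<in> carrier G" using d' D2c by auto
  have "act A d (act A (t [^] i) \<mu>) = act A (t [^] i \<otimes> d) \<mu>" using act_act[OF A(1) nzD[OF dc(2)]] tc by simp
  also have "t [^] i \<otimes> d = d' \<otimes> t [^] i" unfolding d'_def using dc tc by (simp add: gsimps)
  also have "act A (d' \<otimes> t [^] i) \<mu> = act A (t [^] i) (act A d' \<mu>)" using act_act[OF A(1) nzD[OF tD] d'c] by simp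
  also have "\<dots> = (\<lambda>a. \<chi> d' * act A (t [^] i) \<mu> a)" unfolding \<mu>[OF d'] act_scale ..
  finally show ?thesis unfolding d'_def .
 qed
 obtain N :: nat where N: "\<And>f. (\<forall>i. f i \<in> homs A) \<Longrightarrow> \<exists>c. (\<exists>i\<le>N. c i \<noteq> 0) \<and> (\<forall>a. (\<Sum>i\<le>N. c i * f i a) = 0)"
  using homs_dependence[OF A] by blast
 have nonzero: "\<exists>a. act A (t [^] (i::int)) u a \<noteq> 0" for i
 proof (rule ccontr)
  assume "\<nexists>a. act A (t [^] i) u a \<noteq> 0"
  then have z: "act A (t [^] i) u = (\<lambda>_. 0)" by auto
  have "act A (t [^] (- i)) (act A (t [^] i) u) = u"
   using act_act[OF A(1) nzD[OF tD]] tc act_one[OF A(1)] D1(2) W(1) by (simp add: int_pow_minus_cancel subset_iff)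
  then show False using D1(3) unfolding z by (auto simp: act_def)
 qed
 have "\<forall>i::nat. act A (t [^] (int i)) u \<in> homs A" using actW[OF tD D1(2)] W(1) by blast
 then obtain c where c: "\<exists>i\<le>N. c i \<noteq> 0" "\<forall>a. (\<Sum>i\<le>N. c i * act A (t [^] (int i)) u a) = 0"
  using N[of "\<lambda>i. act A (t [^] (int i)) u"] by blast
 \<comment> \<open>The N + 1 translates of u satisfy a linear relation, so two of their characters
   coincide on D2; the difference of the exponents will be k.\<close>
 have "\<exists>i\<in>{..N}. \<exists>j\<in>{..N}. i \<noteq> j \<and> (\<forall>d\<in>D2. \<chi> (cj (t [^] (int i)) d) = \<chi> (cj (t [^] (int j)) d))"
 proof (rule common_character[where f = "\<lambda>i. act A (t [^] (int i)) u" and c = c])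
  show "\<exists>i\<in>{..N}. c i \<noteq> 0" using c(1) by auto
  fix d e and b assume d: "d \<in> D2" and e: "\<And>b. (\<Sum>i\<le>N. e i * act A (t [^] int i) u b) = 0"
  have "(\<lambda>a. \<Sum>i\<le>N. e i * act A d (act A (t [^] int i) u) a) = act A d (\<lambda>a. \<Sum>i\<le>N. e i * act A (t [^] int i) u a)"
   by (rule act_sum[symmetric])
  also have "\<dots> = (\<lambda>_. 0)" unfolding e by (auto simp: act_def)
  finally have s: "(\<Sum>i\<le>N. e i * act A d (act A (t [^] int i) u) b) = 0" by (rule fun_cong)
  show "(\<Sum>i\<le>N. (e i * \<chi> (t [^] int i \<otimes> d \<otimes> inv (t [^] int i))) * act A (t [^] int i) u b) = 0"
  proof -
   have "act A d (act A (t [^] int i) u) b = \<chi> (t [^] int i \<otimes> d \<otimes> inv (t [^] int i)) * act A (t [^] int i) u b" for i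
    using fun_cong[OF move[OF d chi, of "int i"], of b] .
   then show ?thesis using s by (simp only: mult.assoc)
  qed
 qed (use nonzero c(2) in auto)
 then obtain i j :: nat where ij: "i < j" "\<And>d. d \<in> D2 \<Longrightarrow> \<chi> (cj (t [^] (int i)) d) = \<chi> (cj (t [^] (int j)) d)"
  by (metis linorder_neqE_nat)
 define k where "k = j - i"
 have k: "k \<ge> 1" "int j = int k + int i" using ij(1) by (auto simp: k_def)
 define s where "s = t [^] (int k)"
 have chi_inv: "\<chi> (cj s d) = \<chi> d" if d: "d \<in> D2" for d
 proof -
  define d' where "d' = inv (t [^] (int i)) \<otimes> d \<otimes> t [^] (int i)"
  have d': "d' \<in> D2" unfolding d'_def by (rule nz_D(3)[OF nD2[OF nz_int_pow[OF Pc t]] d])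
  have dc: "d \<in> carrier G" using d D2c by auto
  have "cj (t [^] (int i)) d' = d" unfolding d'_def using dc tc by (simp add: gsimps)
  moreover have "cj (t [^] (int j)) d' = cj s d"
   unfolding d'_def s_def k(2) using dc tc by (simp add: gsimps int_pow_add)
  ultimately show ?thesis using ij(2)[OF d'] by simp
 qed
 have s1: "s = \<one> \<otimes> t [^] (int k)" using tc by (simp add: s_def)
 have sP: "nz s P" "fi (cyc P s) (cyc P t)" using cyc_cofinal[OF P t s1 sub_one[OF P] k(1)] .
 have sD: "s \<in> cyc P t" using tD by (simp add: s_def)
 have sc: "s \<in> carrier G" using tc by (simp add: s_def)
 \<comment> \<open>Powers of s keep u among the \<chi>-eigenvectors of D2, where
   \<open>shift_eigenvector\<close> produces an eigenvector of s.\<close>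
 define v where "v i = act A (s [^] (int i)) u" for i :: nat
 have v0: "v 0 = u" using act_one[OF A(1)] D1(2) W(1) by (auto simp: v_def)
 have vS: "act A s (v i) = v (Suc i)" for i
  unfolding v_def using act_act[OF A(1) nzD[OF sD], of "s [^] (int i)" u] int_pow_add[OF sc, of "int i" 1] sc
  by (simp add: add.commute)
 have vW: "v i \<in> W" for i
  by (induction i) (use v0 D1(2) vS actW[OF sD] in \<open>auto simp flip: vS\<close>)
 have vchi: "act A d (v i) = (\<lambda>a. \<chi> d * v i a)" if "d \<in> D2" for d i
  using that
 proof (induction i arbitrary: d)
  case 0
  then show ?case using chi v0 by simp
 next
  case (Suc i)
  then show ?case using move[of d "v i" "int k"] chi_inv[of d] by (simp add: vS[symmetric] s_def)
 qed
 obtain b0 where b0: "v 0 b0 \<noteq> 0" using D1(3) v0 by auto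
 obtain c' where c': "\<exists>i\<le>N. c' i \<noteq> 0" "\<forall>a. (\<Sum>i\<le>N. c' i * v i a) = 0" using N[of v] vW W(1) by blast
 have "\<exists>(n::nat) e z. (\<exists>b. (\<Sum>i\<le>n. e i * v i b) \<noteq> 0) \<and> (\<forall>b. (\<Sum>i\<le>n. e i * v (Suc i) b) = z * (\<Sum>i\<le>n. e i * v i b))"
  using shift_eigenvector[where v = v and c = c', OF b0 c'(1)] c'(2) by blast
 then obtain n e z where e: "\<exists>b. (\<Sum>i\<le>(n::nat). e i * v i b) \<noteq> 0"
  "\<And>b. (\<Sum>i\<le>n. e i * v (Suc i) b) = z * (\<Sum>i\<le>n. e i * v i b)" by blast
 define \<mu> where "\<mu> a = (\<Sum>i\<le>n. e i * v i a)" for a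
 have \<mu>W: "\<mu> \<in> W" unfolding \<mu>_def using W(2)[of "{..n}" v e] vW by blast
 have \<mu>h: "\<mu> \<in> homs A" using \<mu>W W(1) by blast
 have \<mu>0: "\<mu> \<noteq> (\<lambda>_. 0)" using e(1) by (auto simp: \<mu>_def fun_eq_iff)
 have "act A s \<mu> = (\<lambda>a. z * \<mu> a)" unfolding \<mu>_def act_sum vS e(2) ..
 moreover have "act A d \<mu> = (\<lambda>a. \<chi> d * \<mu> a)" if "d \<in> D2" for d
  unfolding \<mu>_def act_sum vchi[OF that] by (simp add: sum_distrib_left mult.left_commute)
 moreover have "nz d A" if "d \<in> D2" for d using nzD D2P PD that by blast
 ultimately have "s \<in> {g. nz g A \<and> (\<exists>c. act A g \<mu> = (\<lambda>a. c * \<mu> a))}" "D2 \<subseteq> {g. nz g A \<and> (\<exists>c. act A g \<mu> = (\<lambda>a. c * \<mu> a))}"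
  using nzD[OF sD] by blast+
 then have "cyc D2 s \<subseteq> {g. nz g A \<and> (\<exists>c. act A g \<mu> = (\<lambda>a. c * \<mu> a))}"
  using cyc_subset[OF eigen_subgroup[OF A(1) \<mu>h \<mu>0]] by blast
 moreover have "fi (cyc D2 s) (cyc P t)" using fi_trans[OF cyc_fi[OF D2(1) sP(1) nD2[OF sP(1)]] sP(2)] .
 ultimately show ?case using \<mu>W \<mu>0 by blast
qed

text \<open>Finite extensions are peeled off until the outermost infinite cyclic one, where the
  exponent of t is an additive character.\<close>

lemma virtual_character:
 "VP n A \<Longrightarrow> infinite A \<Longrightarrow> \<exists>A' u. fi A' A \<and> (\<forall>x\<in>A'. \<forall>y\<in>A'. u (x \<otimes> y) = u x + (u y :: complex)) \<and> (\<exists>x\<in>A'. u x \<noteq> 0)"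
proof (induction rule: VP.induct)
 case VP_one
 then show ?case by simp
next
 case (VP_fin n P H)
 have "infinite P" using fi_finite[OF VP_fin.hyps(2)] VP_fin.prems by blast
 then show ?case using VP_fin.IH fi_trans[OF _ VP_fin.hyps(2)] by blast
next
 case (VP_ext n P t)
 have P: "subgroup P G" using VP_subgroup VP_ext.hyps by blast
 have Pc: "P \<subseteq> carrier G" using P subgroup.subset by blast
 have t: "nz t P" using VP_ext.hyps by blast
 have tc: "t \<in> carrier G" using t by (simp add: nz_def)
 have C: "subgroup (cyc P t) G" by (rule cyc_subgroup[OF P t])
 show ?case
 proof (cases "fi P (cyc P t)")
  case True
  then show ?thesis using VP_ext.IH fi_trans[OF _ True] fi_finite[OF True] VP_ext.prems by blast
 next
  case False
  have free: "k = l" if kl: "p \<in> P" "q \<in> P" "p \<otimes> t [^] k = q \<otimes> t [^] l" for p q and k l :: int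
  proof (rule ccontr)
   assume ne: "k \<noteq> l"
   have c: "p \<in> carrier G" "q \<in> carrier G" using kl Pc by auto
   have "t [^] k = inv p \<otimes> (q \<otimes> t [^] l)" unfolding kl(3)[symmetric] using c tc by (simp add: cancel_left)
   then have "t [^] k \<otimes> t [^] (- l) = inv p \<otimes> q" using c tc by (simp add: m_assoc int_pow_minus_cancel)
   then have "t [^] (k - l) = inv p \<otimes> q" using int_pow_add[OF tc, of k "- l"] by simp
   then have "t [^] (k - l) \<in> P" using kl sub_m[OF P] sub_inv[OF P] by simp
   then show False using cyc_torsion_cases[OF P t] False ne by fastforce
  qed
  \<comment> \<open>Well defined by \<open>free\<close>: the exponent of t depends on x
    alone.\<close>
  define u :: "'a \<Rightarrow> complex" where "u x = of_int (SOME k. \<exists>p\<in>P. x = p \<otimes> t [^] (k::int))" for x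
  have lam: "u (p \<otimes> t [^] k) = of_int k" if p: "p \<in> P" for p and k :: int
  proof -
   have "\<exists>q\<in>P. p \<otimes> t [^] k = q \<otimes> t [^] (SOME k'. \<exists>q\<in>P. p \<otimes> t [^] k = q \<otimes> t [^] (k'::int))"
    by (rule someI[of "\<lambda>k'. \<exists>q\<in>P. p \<otimes> t [^] k = q \<otimes> t [^] (k'::int)" k]) (use p in blast)
   then have "k = (SOME k'. \<exists>q\<in>P. p \<otimes> t [^] k = q \<otimes> t [^] (k'::int))" using free[OF p] by blast
   then show ?thesis unfolding u_def by presburger
  qed
  have "u (x \<otimes> y) = u x + u y" if xy: "x \<in> cyc P t" "y \<in> cyc P t" for x y
  proof -
   obtain p and k::int where p: "p \<in> P" "x = p \<otimes> t [^] k" using xy(1) by (rule cycE)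
   obtain q and l::int where q: "q \<in> P" "y = q \<otimes> t [^] l" using xy(2) by (rule cycE)
   have c: "p \<in> carrier G" "q \<in> carrier G" using p q Pc by auto
   have "x \<otimes> y = (p \<otimes> (cj (t [^] k) q)) \<otimes> t [^] (k + l)"
    unfolding p(2) q(2) using tc c by (simp add: gsimps int_pow_add)
   moreover have "p \<otimes> (cj (t [^] k) q) \<in> P"
    using sub_m[OF P p(1) nz_D(2)[OF nz_int_pow[OF Pc t] q(1)]] .
   ultimately have "u (x \<otimes> y) = of_int (k + l)" using lam by metis
   then show ?thesis using lam[OF p(1)] lam[OF q(1)] p(2) q(2) by simp
  qed
  moreover have "u (\<one> \<otimes> t [^] (1::int)) \<noteq> 0" using lam[OF sub_one[OF P]] by simp
  moreover have "\<one> \<otimes> t [^] (1::int) \<in> cyc P t" using cycI[OF sub_one[OF P]] .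
  ultimately show ?thesis using fi_refl[OF C] by blast
 qed
qed

text \<open>D acts triangularly on A by conjugation.\<close>
inductive Tri :: "'a set \<Rightarrow> 'a set \<Rightarrow> bool" where
 Tri_base: "subgroup A G \<Longrightarrow> subgroup D G \<Longrightarrow> (\<And>d a. d \<in> D \<Longrightarrow> a \<in> A \<Longrightarrow> d \<otimes> a = a \<otimes> d) \<Longrightarrow> Tri D A"
| Tri_step: "subgroup A G \<Longrightarrow> subgroup D G \<Longrightarrow> (\<And>d. d \<in> D \<Longrightarrow> nz d A) \<Longrightarrow>
  (\<And>a b. a \<in> A \<Longrightarrow> b \<in> A \<Longrightarrow> u (a \<otimes> b) = u a + (u b :: complex)) \<Longrightarrow>
  (\<And>d. d \<in> D \<Longrightarrow> \<exists>c. \<forall>a\<in>A. u (cj d a) = c * u a) \<Longrightarrow> Tri D {a \<in> A. u a = 0} \<Longrightarrow> Tri D A"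

lemma Tri_restrict: "Tri D A \<Longrightarrow> subgroup D' G \<Longrightarrow> D' \<subseteq> D \<Longrightarrow> Tri D' (A \<inter> D')"
proof (induction rule: Tri.induct)
 case (Tri_base A D)
 show ?case by (rule Tri.Tri_base) (use Tri_base subgroups_Inter_pair in auto)
next
 case (Tri_step A D u)
 have e: "{a \<in> A \<inter> D'. u a = 0} = {a \<in> A. u a = 0} \<inter> D'" by auto
 show ?case
 proof (rule Tri.Tri_step[where u = u])
  show "subgroup (A \<inter> D') G" "subgroup D' G" using Tri_step subgroups_Inter_pair by auto
  show "nz d (A \<inter> D')" if "d \<in> D'" for d
   using Tri_step.hyps(3)[of d] nz_self[OF Tri_step.prems(1) that] that Tri_step.prems(2) by (auto simp: nz_def)
  show "\<exists>c. \<forall>a\<in>A \<inter> D'. u (cj d a) = c * u a" if "d \<in> D'" for d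
   using Tri_step.hyps(5)[of d] that Tri_step.prems(2) by blast
  show "Tri D' {a \<in> A \<inter> D'. u a = 0}" unfolding e using Tri_step by blast
 qed (use Tri_step.hyps(4) in auto)
qed

text \<open>Induction on the Hirsch bound of A. An infinite A has an additive character on a
  subgroup of finite index, hence one that is an eigenvector of a finite index subgroup of P; its
  kernel has smaller bound. The conclusion speaks of A \<inter> D because the character is available
  only on a finite index part of A.\<close>

lemma Tri_exists:
 "VP n A \<Longrightarrow> VP m P \<Longrightarrow> A \<subseteq> P \<Longrightarrow> (\<And>g. g \<in> P \<Longrightarrow> nz g A) \<Longrightarrow> \<exists>D. fi D P \<and> Tri D (A \<inter> D)"
proof (induction n arbitrary: A m P rule: less_induct)
 case (less n)
 have A: "subgroup A G" and P: "subgroup P G" using VP_subgroup less.prems by auto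
 have Ac: "A \<subseteq> carrier G" and Pc: "P \<subseteq> carrier G" using A P subgroup.subset by auto
 show ?case
 proof (cases "finite A")
  case True
  \<comment> \<open>The centralizer of the finite group A in P, of finite index since P acts on A
    through finitely many maps.\<close>
  define D where "D = {g \<in> P. \<forall>a\<in>A. g \<otimes> a \<otimes> inv g = a}"
  have comm: "d \<otimes> a = a \<otimes> d" if "d \<in> D" "a \<in> A" for d a
  proof -
   have c: "d \<in> carrier G" "a \<in> carrier G" using that Pc Ac by (auto simp: D_def)
   have "(cj d a) \<otimes> d = a \<otimes> d" using that by (simp add: D_def)
   then show ?thesis using c by (simp add: m_assoc)
  qed
  have inD: "x \<otimes> inv y \<in> D" if xy: "x \<in> P" "y \<in> P" "\<And>a. a \<in> A \<Longrightarrow> x \<otimes> a \<otimes> inv x = cj y a" for x y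
  proof -
   have c: "x \<in> carrier G" "y \<in> carrier G" using xy Pc by auto
   have "cj (x \<otimes> inv y) a = a" if a: "a \<in> A" for a
   proof -
    have ac: "a \<in> carrier G" using a Ac by auto
    have b: "inv y \<otimes> a \<otimes> y \<in> A" using nz_D(3)[OF less.prems(4)[OF xy(2)] a] .
    have "cj x (inv y \<otimes> a \<otimes> y) = cj y (inv y \<otimes> a \<otimes> y)" by (rule xy(3)[OF b])
    then show ?thesis using c ac by (simp add: gsimps)
   qed
   moreover have "x \<otimes> inv y \<in> P" using sub_m[OF P xy(1) sub_inv[OF P xy(2)]] .
   ultimately show ?thesis by (simp add: D_def)
  qed
  have one: "cj \<one> a = a" if "a \<in> A" for a using that Ac by auto
  have P1: "\<one> \<in> P" using sub_one[OF P] .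
  have D: "subgroup D G"
  proof (rule subgroupI)
   show "D \<subseteq> carrier G" using Pc by (auto simp: D_def)
   show "D \<noteq> {}" using P1 one by (auto simp: D_def)
   show iD: "inv a \<in> D" if "a \<in> D" for a
    using inD[OF P1, of a] that one Pc by (auto simp: D_def)
   show "a \<otimes> b \<in> D" if ab: "a \<in> D" "b \<in> D" for a b
   proof -
    have "a \<otimes> inv (inv b) \<in> D" using inD[of a "inv b"] ab iD[OF ab(2)] by (auto simp: D_def)
    then show ?thesis using ab Pc by (auto simp: D_def)
   qed
  qed
  have "fi D P"
  proof (rule fiI_fun[where f = "\<lambda>g. restrict (\<lambda>a. g \<otimes> a \<otimes> inv g) A"])
   have "(\<lambda>g. restrict (\<lambda>a. g \<otimes> a \<otimes> inv g) A) ` P \<subseteq> A \<rightarrow>\<^sub>E A"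
    using nz_D(2)[OF less.prems(4)] by auto
   moreover have "finite (A \<rightarrow>\<^sub>E A)" using True by (intro finite_PiE) auto
   ultimately show "finite ((\<lambda>g. restrict (\<lambda>a. g \<otimes> a \<otimes> inv g) A) ` P)" by (rule finite_subset)
   fix x y assume xy: "x \<in> P" "y \<in> P" "restrict (\<lambda>a. x \<otimes> a \<otimes> inv x) A = restrict (\<lambda>a. y \<otimes> a \<otimes> inv y) A"
   show "x \<otimes> inv y \<in> D"
   proof (rule inD[OF xy(1,2)])
    fix a assume "a \<in> A"
    then show "cj x a = cj y a" using fun_cong[OF xy(3), of a] by simp
   qed
  qed (use D P in \<open>auto simp: D_def\<close>)
  moreover have "Tri D (A \<inter> D)" by (rule Tri_base) (use comm D A subgroups_Inter_pair in auto)
  ultimately show ?thesis by blast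
 next
  case False
  obtain A' u x0 where A': "fi A' A" "\<And>x y. x \<in> A' \<Longrightarrow> y \<in> A' \<Longrightarrow> u (x \<otimes> y) = u x + (u y :: complex)" "x0 \<in> A'" "u x0 \<noteq> 0"
   using virtual_character[OF less.prems(1) False] by blast
  obtain B where B: "fi B A" "B \<subseteq> A'" "\<And>\<alpha>. endo A \<alpha> \<Longrightarrow> \<alpha> ` B \<subseteq> B"
   using invariant_fi[OF VP_fg[OF less.prems(1)] A'(1)] by blast
  have Bs: "subgroup B G" "B \<subseteq> A" using fiD[OF B(1)] by auto
  have VB: "VP n B" using VP_subgroups[OF less.prems(1) Bs] by blast
  have nB: "nz g B" if g: "g \<in> P" for g
  proof -
   note ng = less.prems(4)[OF g]
   have "(\<lambda>x. g \<otimes> x \<otimes> inv g) ` B \<subseteq> B" "(\<lambda>x. inv g \<otimes> x \<otimes> g) ` B \<subseteq> B"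
    using B(3)[OF endo_conj(1)[OF A ng]] B(3)[OF endo_conj(2)[OF A ng]] .
   moreover have "g \<in> carrier G" using g Pc by blast
   ultimately show ?thesis unfolding nz_def by blast
  qed
  define u1 where "u1 a = (if a \<in> B then u a else 0)" for a
  have l1h: "u1 \<in> homs B" unfolding homs_def using A'(2) B(2) sub_m[OF Bs(1)] by (auto simp: u1_def subset_iff)
  have l10: "u1 \<noteq> (\<lambda>_. 0)"
  proof -
   obtain j :: nat where j: "j \<ge> 1" "\<And>x. x \<in> A \<Longrightarrow> x [^] j \<in> B" using fi_power[OF B(1)] by blast
   have "x0 [^] j \<in> B" using j(2) A'(3) fiD(3)[OF A'(1)] by blast
   then have "u1 (x0 [^] j) = of_nat j * u x0"
    using additive_one(3)[OF fiD(1)[OF A'(1)] A'(2) A'(3)] by (simp add: u1_def)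
   then have "u1 (x0 [^] j) \<noteq> 0" using j(1) A'(4) by simp
   then show ?thesis by (auto simp: fun_eq_iff)
  qed
  have "\<exists>D' u. fi D' P \<and> u \<in> homs B \<and> u \<noteq> (\<lambda>_. 0) \<and> (\<forall>d\<in>D'. \<exists>c. act B d u = (\<lambda>a. c * u a))"
   by (rule common_eigenfunctional[OF Bs(1) VP_fg[OF VB] less.prems(2) nB subset_refl homs_sum act_homs[OF Bs(1) nB] l1h l10])
  then obtain D1 \<mu> where D1: "fi D1 P" "\<mu> \<in> homs B" "\<mu> \<noteq> (\<lambda>_. 0)" "\<And>d. d \<in> D1 \<Longrightarrow> \<exists>c. act B d \<mu> = (\<lambda>a. c * \<mu> a)" by blast
  have eig: "\<exists>c. \<forall>a\<in>B. \<mu> (cj d a) = c * \<mu> a" if d: "d \<in> D1" for d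
  proof -
   obtain c where "act B d \<mu> = (\<lambda>a. c * \<mu> a)" using D1(4)[OF d] by blast
   then have "\<mu> (cj d a) = c * \<mu> a" if "a \<in> B" for a using that by (metis act_def)
   then show ?thesis by blast
  qed
  define C where "C = {a \<in> B. \<mu> a = 0}"
  have C: "subgroup C G" unfolding C_def by (rule additive_kernel[OF Bs(1) homs_add[OF D1(2)]])
  have CA: "C \<subseteq> A" using Bs by (auto simp: C_def)
  \<comment> \<open>A complex character vanishing on a subgroup of finite index vanishes. Hence the
    kernel has infinite index, and \<open>VP_subgroups\<close> lowers the bound.\<close>
  have "\<not> fi C A"
  proof
   assume "fi C A"
   then obtain j :: nat where j: "j \<ge> 1" "\<And>x. x \<in> A \<Longrightarrow> x [^] j \<in> C" using fi_power by blast
   have "\<mu> x = 0" for x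
   proof (cases "x \<in> B")
    case True
    then have "of_nat j * \<mu> x = 0" using additive_one(3)[OF Bs(1) homs_add[OF D1(2)] True, of j] j(2)[of x] Bs(2) by (auto simp: C_def)
    then show ?thesis using j(1) by simp
   qed (use D1(2) in \<open>simp add: homs_def\<close>)
   then show False using D1(3) by auto
  qed
  then obtain l where l: "n = Suc l" "VP l C" using VP_subgroups[OF less.prems(1) C CA] by blast
  note D1s = fiD[OF D1(1)]
  have CD: "subgroup (C \<inter> D1) G" using subgroups_Inter_pair C D1s(1) by blast
  have V1: "VP l (C \<inter> D1)" using VP_subgroups[OF l(2) CD] by blast
  have V2: "VP m D1" using VP_subgroups[OF less.prems(2) D1s(1,3)] by blast
  have conjC: "cj g a \<in> C" if g: "g \<in> D1" and a: "a \<in> C" for g a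
  proof -
   obtain c where "\<forall>a\<in>B. \<mu> (cj g a) = c * \<mu> a" using eig[OF g] by blast
   then have "\<mu> (cj g a) = 0" using a by (simp add: C_def)
   moreover have "cj g a \<in> B" using nz_D(2)[OF nB] g a D1s(3) by (auto simp: C_def)
   ultimately show ?thesis by (simp add: C_def)
  qed
  have nCD: "nz g (C \<inter> D1)" if g: "g \<in> D1" for g
  proof -
   have gc: "g \<in> carrier G" using g D1s(1) sub_mem by metis
   have ig: "inv g \<in> D1" using sub_inv[OF D1s(1) g] .
   have "nz g C" unfolding nz_def using conjC[OF g] conjC[OF ig] gc by simp
   then show ?thesis using nz_self[OF D1s(1) g] by (simp add: nz_def)
  qed
  obtain D2 where D2: "fi D2 D1" "Tri D2 (C \<inter> D1 \<inter> D2)"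
   using less.IH[OF _ V1 V2 Int_lower2 nCD] l(1) by blast
  have sP: "sep P" using VP_sep[OF less.prems(2)] .
  \<comment> \<open>Since \<mu> is additive on B only, K is chosen to force what remains of A into
    B.\<close>
  obtain K where K: "fi K P" "\<And>d a. d \<in> B \<Longrightarrow> a \<in> A \<Longrightarrow> inv d \<otimes> a \<in> K \<Longrightarrow> a \<in> B"
   using sep_fi_subgroup[OF sP P B(1) less.prems(3)] by blast
  have AK: "a \<in> B" if "a \<in> A" "a \<in> K" for a
   using K(2)[OF sub_one[OF Bs(1)] that(1)] that Ac by (simp add: subset_iff)
  define D3 where "D3 = D2 \<inter> K"
  have D3: "fi D3 P" unfolding D3_def using fi_Int[OF fi_trans[OF D2(1) D1(1)] K(1)] .
  note D3s = fiD[OF D3]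
  have D31: "D3 \<subseteq> D2" "D3 \<subseteq> D1" using fiD(3)[OF D2(1)] by (auto simp: D3_def)
  have AB: "A \<inter> D3 \<subseteq> B" using AK by (auto simp: D3_def)
  have "Tri D3 (A \<inter> D3)"
  proof (rule Tri_step[where u = \<mu>])
   show "subgroup (A \<inter> D3) G" "subgroup D3 G" using subgroups_Inter_pair A D3s(1) by auto
   show "nz d (A \<inter> D3)" if d: "d \<in> D3" for d
    using less.prems(4)[of d] nz_self[OF D3s(1) d] d D3s(3) by (auto simp: nz_def)
   show "\<mu> (a \<otimes> b) = \<mu> a + \<mu> b" if "a \<in> A \<inter> D3" "b \<in> A \<inter> D3" for a b
    using homs_add[OF D1(2)] that AB by blast
   show "\<exists>c. \<forall>a\<in>A \<inter> D3. \<mu> (cj d a) = c * \<mu> a" if "d \<in> D3" for d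
    using eig[of d] that AB D31 by blast
   have "{a \<in> A \<inter> D3. \<mu> a = 0} = (C \<inter> D1 \<inter> D2) \<inter> D3" using AB D31 Bs by (auto simp: C_def)
   then show "Tri D3 {a \<in> A \<inter> D3. \<mu> a = 0}" using Tri_restrict[OF D2(2) D3s(1) D31(1)] by simp
  qed
  then show ?thesis using D3 by blast
 qed
qed

end

section \<open>Automorphisms that are locally inner\<close>

context group
begin

lemma fg_sub: assumes "VP n P" "subgroup A G" "A \<subseteq> P" shows "fg A"
 using VP_subgroups[OF assms] VP_fg by blast

lemma image_fi:
 assumes K: "fi K P" and H: "group H" and f: "\<And>x y. x \<in> P \<Longrightarrow> y \<in> P \<Longrightarrow> f (x \<otimes> y) = f x \<otimes>\<^bsub>H\<^esub> f y"
  "\<And>x. x \<in> P \<Longrightarrow> f x \<in> carrier H"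
 shows "group.fi H (f ` K) (f ` P)"
proof -
 interpret H: group H by (rule H)
 note KP = fiD[OF K]
 have sK: "subgroup (f ` K) H" by (rule hom_on(3)[OF KP(1) H]) (use f KP(3) in blast)+
 have sP: "subgroup (f ` P) H" by (rule hom_on(3)[OF KP(2) H f])
 obtain T where T: "finite T" "T \<subseteq> P" "\<forall>h\<in>P. \<exists>t\<in>T. h \<otimes> inv t \<in> K" using fi_reps[OF K] by blast
 have "\<exists>t\<in>f ` T. y \<otimes>\<^bsub>H\<^esub> inv\<^bsub>H\<^esub> t \<in> f ` K" if y: "y \<in> f ` P" for y
 proof -
  obtain h where h: "h \<in> P" "y = f h" using y by blast
  obtain t where t: "t \<in> T" "h \<otimes> inv t \<in> K" using T(3) h(1) by blast
  have tP: "t \<in> P" "h \<otimes> inv t \<in> P" using t T(2) KP(3) by auto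
  have "h \<in> carrier G" "t \<in> carrier G" using h(1) tP(1) sub_mem[OF KP(2)] by auto
  then have "h = (h \<otimes> inv t) \<otimes> t" by (simp add: m_assoc)
  then have "f h = f (h \<otimes> inv t) \<otimes>\<^bsub>H\<^esub> f t" using f(1)[OF tP(2,1)] by simp
  then have "f h \<otimes>\<^bsub>H\<^esub> inv\<^bsub>H\<^esub> f t = f (h \<otimes> inv t)" using f(2)[OF tP(1)] f(2)[OF tP(2)] by (simp add: H.m_assoc)
  then show ?thesis using t h(2) by auto
 qed
 moreover have "finite (f ` T)" "f ` T \<subseteq> f ` P" "f ` K \<subseteq> f ` P" using T(1,2) KP(3) by auto
 ultimately show ?thesis unfolding H.fi_def using sK sP by blast
qed

text \<open>Congruence modulo K; for normal K, the cosets of x and y coincide.\<close>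
definition mc :: "'a set \<Rightarrow> 'a \<Rightarrow> 'a \<Rightarrow> bool" where "mc K x y \<longleftrightarrow> inv x \<otimes> y \<in> K"

definition nrm :: "'a set \<Rightarrow> 'a set \<Rightarrow> bool" where
 "nrm K N \<longleftrightarrow> subgroup K G \<and> subgroup N G \<and> (\<forall>g\<in>N. nz g K)"

lemma nrmD: assumes "nrm K N" shows "subgroup K G" "subgroup N G" "g \<in> N \<Longrightarrow> nz g K" "g \<in> N \<Longrightarrow> g \<in> carrier G"
 using assms sub_mem by (auto simp: nrm_def)

lemma mc_refl: "subgroup K G \<Longrightarrow> x \<in> carrier G \<Longrightarrow> mc K x x"
 by (simp add: mc_def sub_one)

lemma mc_sym: assumes "subgroup K G" "mc K x y" "x \<in> carrier G" "y \<in> carrier G" shows "mc K y x"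
proof -
 have "inv (inv x \<otimes> y) \<in> K" using assms sub_inv by (simp add: mc_def)
 then show ?thesis using assms(3,4) by (simp add: mc_def inv_mult_group)
qed

lemma mc_trans:
 assumes "subgroup K G" "mc K x y" "mc K y z" "x \<in> carrier G" "y \<in> carrier G" "z \<in> carrier G" shows "mc K x z"
proof -
 have "(inv x \<otimes> y) \<otimes> (inv y \<otimes> z) \<in> K" using assms sub_m by (simp add: mc_def)
 then show ?thesis using assms(4-6) by (simp add: mc_def gsimps)
qed

lemma mc_lmult: "mc K x y \<Longrightarrow> x \<in> carrier G \<Longrightarrow> y \<in> carrier G \<Longrightarrow> z \<in> carrier G \<Longrightarrow> mc K (z \<otimes> x) (z \<otimes> y)"
 by (simp add: mc_def gsimps)

lemma mc_rmult:
 assumes "nz z K" "mc K x y" "x \<in> carrier G" "y \<in> carrier G" shows "mc K (x \<otimes> z) (y \<otimes> z)"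
proof -
 have "inv z \<otimes> (inv x \<otimes> y) \<otimes> z \<in> K" using nz_D(3)[OF assms(1)] assms(2) by (simp add: mc_def)
 then show ?thesis using assms(3,4) nz_D(1)[OF assms(1)] assms(2) by (simp add: mc_def gsimps)
qed

lemma mc_mult:
 assumes K: "nrm K N" and "mc K x y" "mc K x' y'" "x \<in> N" "y \<in> N" "x' \<in> N" "y' \<in> N"
 shows "mc K (x \<otimes> x') (y \<otimes> y')"
proof -
 have c: "x \<in> carrier G" "y \<in> carrier G" "x' \<in> carrier G" "y' \<in> carrier G" using assms nrmD(4)[OF K] by auto
 show ?thesis
  by (rule mc_trans[OF nrmD(1)[OF K] mc_rmult[OF nrmD(3)[OF K assms(6)] assms(2)] mc_lmult[OF assms(3)]]) (use c in auto)
qed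

lemma mc_inv: assumes K: "nrm K N" and "mc K x y" "x \<in> N" "y \<in> N" shows "mc K (inv x) (inv y)"
proof -
 have c: "x \<in> carrier G" "y \<in> carrier G" using assms nrmD(4)[OF K] by auto
 have "mc K y x" using mc_sym[OF nrmD(1)[OF K] assms(2) c] .
 then have "cj x (inv y \<otimes> x) \<in> K" using nz_D(2)[OF nrmD(3)[OF K assms(3)]] by (simp add: mc_def)
 then show ?thesis using c by (simp add: mc_def gsimps)
qed

lemma mc_conj: assumes "nz c K" "mc K x y" "x \<in> carrier G" "y \<in> carrier G" shows "mc K (cj c x) (cj c y)"
proof -
 have "cj c (inv x \<otimes> y) \<in> K" using nz_D(2)[OF assms(1)] assms(2) by (simp add: mc_def)
 then show ?thesis using assms(3,4) nz_D(1)[OF assms(1)] assms(2) by (simp add: mc_def gsimps)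
qed

lemma mc_mem: assumes "subgroup K G" "mc K x y" "y \<in> K" "x \<in> carrier G" shows "x \<in> K"
proof -
 have "y \<in> carrier G" using assms sub_mem by metis
 moreover have "y \<otimes> inv (inv x \<otimes> y) \<in> K" using assms sub_m sub_inv by (metis mc_def)
 ultimately show ?thesis using assms(4) by (simp add: gsimps)
qed

definition nfi :: "'a set \<Rightarrow> bool" where "nfi K \<longleftrightarrow> fi K (carrier G) \<and> (\<forall>g\<in>carrier G. nz g K)"

lemma nfi_nrm: "nfi K \<Longrightarrow> nrm K (carrier G)"
 by (auto simp: nfi_def nrm_def dest: fiD)

lemma nfi_below:
 assumes "fg (carrier G)" "fi D (carrier G)" shows "\<exists>K. nfi K \<and> K \<subseteq> D"
proof -
 obtain K where K: "fi K (carrier G)" "K \<subseteq> D" "\<And>\<alpha>. endo (carrier G) \<alpha> \<Longrightarrow> \<alpha> ` K \<subseteq> K"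
  using invariant_fi[OF assms] by blast
 have "nz g K" if g: "g \<in> carrier G" for g
 proof -
  note n = nz_self[OF fiD(2)[OF assms(2)] g]
  show ?thesis unfolding nz_def
   using K(3)[OF endo_conj(1)[OF fiD(2)[OF assms(2)] n]] K(3)[OF endo_conj(2)[OF fiD(2)[OF assms(2)] n]] g by blast
 qed
 then show ?thesis using K by (auto simp: nfi_def)
qed

lemma nfi_Int: "nfi K \<Longrightarrow> nfi L \<Longrightarrow> nfi (K \<inter> L)"
 by (auto simp: nfi_def nz_def intro: fi_Int)

text \<open>Locally, \<phi> is conjugation by elements of C.\<close>
definition LI :: "('a \<Rightarrow> 'a) \<Rightarrow> 'a set \<Rightarrow> bool" where
 "LI \<phi> C \<longleftrightarrow> (\<forall>K. nfi K \<longrightarrow> (\<exists>c\<in>C. \<forall>x\<in>carrier G. mc K (cj c x) (\<phi> x)))"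

definition tw :: "('a \<Rightarrow> 'a) \<Rightarrow> 'a \<Rightarrow> 'a \<Rightarrow> 'a" where "tw \<phi> c x = inv c \<otimes> \<phi> x \<otimes> c"

lemma LI_D: "LI \<phi> C \<Longrightarrow> nfi K \<Longrightarrow> \<exists>c\<in>C. \<forall>x\<in>carrier G. mc K (cj c x) (\<phi> x)"
 by (simp add: LI_def)

lemma tw_cong:
 assumes K: "nfi K" and c: "c \<in> carrier G" "d \<in> carrier G" "x \<in> carrier G" "\<phi> x \<in> carrier G"
  and m: "mc K (cj d x) (\<phi> x)"
 shows "mc K (cj (inv c \<otimes> d) x) (tw \<phi> c x)"
proof -
 have "nz (inv c) K" using K c(1) by (simp add: nfi_def)
 from mc_conj[OF this m] have "mc K (inv c \<otimes> (cj d x) \<otimes> inv (inv c)) (inv c \<otimes> \<phi> x \<otimes> inv (inv c))" using c by simp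
 moreover have "cj (inv c \<otimes> d) x = inv c \<otimes> (cj d x) \<otimes> inv (inv c)" using c by (simp add: gsimps)
 ultimately show ?thesis using c by (simp add: tw_def)
qed

lemma LI_tw:
 assumes "LI \<phi> C" "subgroup C G" "c \<in> C" "\<And>x. x \<in> carrier G \<Longrightarrow> \<phi> x \<in> carrier G"
 shows "LI (tw \<phi> c) C"
 unfolding LI_def
proof (intro allI impI)
 fix K assume K: "nfi K"
 obtain d where d: "d \<in> C" "\<And>x. x \<in> carrier G \<Longrightarrow> mc K (cj d x) (\<phi> x)" using LI_D[OF assms(1) K] by blast
 have cc: "c \<in> carrier G" "d \<in> carrier G" using assms d sub_mem by (metis, metis)
 have "mc K (cj (inv c \<otimes> d) x) (tw \<phi> c x)" if "x \<in> carrier G" for x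
  using tw_cong[where \<phi> = \<phi>, OF K cc that assms(4)[OF that] d(2)[OF that]] .
 moreover have "inv c \<otimes> d \<in> C" using assms(2,3) d(1) by (simp add: sub_m sub_inv)
 ultimately show "\<exists>c'\<in>C. \<forall>x\<in>carrier G. mc K (cj c' x) (tw \<phi> c x)" by blast
qed

text \<open>Elements of K conjugate trivially modulo K, so an approximating c may be altered within
  its coset of K.\<close>

lemma LI_replace:
 assumes K: "nfi K" and c: "c \<in> carrier G" "k \<in> carrier G" "k \<in> K" "x \<in> carrier G" "\<phi> x \<in> carrier G"
  and m: "mc K (cj c x) (\<phi> x)"
 shows "mc K (cj (c \<otimes> inv k) x) (\<phi> x)"
proof -
 note N = nfi_nrm[OF K]
 note Ks = nrmD(1)[OF N]
 have "mc K (c \<otimes> inv k) c" unfolding mc_def using c by (simp add: gsimps)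
 then have "mc K (cj (c \<otimes> inv k) x) (cj c x)"
  using c by (intro mc_mult[OF N] mc_inv[OF N] mc_refl[OF Ks]) auto
 then show ?thesis by (rule mc_trans[OF Ks _ m]) (use c in auto)
qed

text \<open>Separability of L, with normal subgroups of finite index as test subgroups; they are
  cofinal by \<open>nfi_below\<close>.\<close>

lemma closed_mc:
 assumes V: "VP n (carrier G)" and L: "subgroup L G" and x: "x \<in> carrier G"
  and m: "\<And>K. nfi K \<Longrightarrow> \<exists>l\<in>L. mc K l x"
 shows "x \<in> L"
proof (rule ccontr)
 assume "x \<notin> L"
 then obtain K where K: "fi K (carrier G)" "\<forall>l\<in>L. inv l \<otimes> x \<notin> K"
  using sepD[OF VP_sep[OF V] L subgroup.subset[OF L] x] by blast
 obtain K' where "nfi K'" "K' \<subseteq> K" using nfi_below[OF VP_fg[OF V] K(1)] by blast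
 then show False using m[of K'] K(2) by (auto simp: mc_def)
qed

lemma fi_separated:
 assumes V: "VP n (carrier G)" and f: "fi D A"
 shows "\<exists>K. nfi K \<and> (\<forall>d\<in>D. \<forall>a\<in>A. mc K d a \<longrightarrow> a \<in> D)"
proof -
 have cs: "subgroup (carrier G) G" by (rule VP_subgroup[OF V])
 obtain K where K: "fi K (carrier G)" "\<And>d a. d \<in> D \<Longrightarrow> a \<in> A \<Longrightarrow> inv d \<otimes> a \<in> K \<Longrightarrow> a \<in> D"
  using sep_fi_subgroup[OF VP_sep[OF V] cs f subgroup.subset[OF fiD(2)[OF f]]] by blast
 obtain K' where "nfi K'" "K' \<subseteq> K" using nfi_below[OF VP_fg[OF V] K(1)] by blast
 then show ?thesis using K(2) by (intro exI[of _ K']) (auto simp: mc_def)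
qed

lemma additive_multiples_fi:
 assumes A: "subgroup A G" "fg A" and ad: "\<And>a b. a \<in> A \<Longrightarrow> b \<in> A \<Longrightarrow> u (a \<otimes> b) = u a + (u b :: complex)" and m: "m \<ge> 1"
 shows "fi {a \<in> A. \<exists>y\<in>u ` A. u a = of_nat m * y} A"
proof -
 have "AC.fi ((\<lambda>x. of_nat m * x) ` u ` A) (u ` A)"
  by (rule AC_multiples_fi[OF _ _ m]) (use fg_image[OF A(2,1) AC.group_axioms, of u] ad in auto)
 then have "fi {a \<in> A. u a \<in> (\<lambda>x. of_nat m * x) ` u ` A} A"
  using fi_preimage[OF A(1) AC.group_axioms, of u] ad by auto
 moreover have "{a \<in> A. u a \<in> (\<lambda>x. of_nat m * x) ` u ` A} = {a \<in> A. \<exists>y\<in>u ` A. u a = of_nat m * y}" by blast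
 ultimately show ?thesis by simp
qed

text \<open>One a0 with u a0 nonzero determines \<chi>. Closedness of the orbit of u a0 provides c0
  with u (\<phi> a0) = \<chi> c0 * u a0. After the twist, an approximating c moves u a0 by a
  multiple of m only, so \<chi> c is attained on C \<inter> K, and dividing c by such an element k
  puts it into the kernel.\<close>

lemma trivialize_character:
 assumes V: "VP n (carrier G)" and A: "subgroup A G" and C: "subgroup C G" and nC: "\<And>c. c \<in> C \<Longrightarrow> nz c A"
  and ad: "\<And>a b. a \<in> A \<Longrightarrow> b \<in> A \<Longrightarrow> u (a \<otimes> b) = u a + (u b :: complex)"
  and eig: "\<And>c. c \<in> C \<Longrightarrow> \<exists>z. \<forall>a\<in>A. u (cj c a) = z * u a"
  and \<phi>: "\<And>x. x \<in> carrier G \<Longrightarrow> \<phi> x \<in> carrier G" and LI: "LI \<phi> C"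
 shows "\<exists>c0\<in>C. \<exists>C1. subgroup C1 G \<and> C1 \<subseteq> C \<and> (\<forall>c\<in>C1. \<forall>a\<in>A. u (cj c a) = u a) \<and> LI (tw \<phi> c0) C1"
proof (cases "\<forall>a\<in>A. u a = 0")
 case True
 have 1: "\<one> \<in> C" using sub_one[OF C] .
 have "u (cj c a) = u a" if "c \<in> C" "a \<in> A" for c a
  using True nz_D(2)[OF nC] that by simp
 then show ?thesis using LI_tw[OF LI C 1 \<phi>] C 1 by blast
next
 case False
 then obtain a0 where a0: "a0 \<in> A" "u a0 \<noteq> 0" by blast
 note Ac = sub_mem[OF A]
 note Cc = sub_mem[OF C]
 have Acj: "cj c a \<in> A" if "c \<in> C" "a \<in> A" for c a using nz_D(2)[OF nC] that by blast
 note Cinv = sub_inv[OF C]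
 note Cmul = sub_m[OF C]
 note Ainv = sub_inv[OF A]
 have one: "u \<one> = 0" "\<And>x. x \<in> A \<Longrightarrow> u (inv x) = - u x"
  by (rule additive_one(1)[of A u, OF A], erule (1) ad, rule additive_one(2)[of A u, OF A], erule (1) ad)
 have "\<forall>c. \<exists>z. c \<in> C \<longrightarrow> (\<forall>a\<in>A. u (cj c a) = z * u a)" using eig by blast
 from choice[OF this] obtain \<chi> where chi: "\<And>c a. c \<in> C \<Longrightarrow> a \<in> A \<Longrightarrow> u (cj c a) = \<chi> c * u a" by blast
 have chi_mult: "\<chi> (c \<otimes> d) = \<chi> c * \<chi> d" if cd: "c \<in> C" "d \<in> C" for c d
 proof -
  have "cj (c \<otimes> d) a0 = cj c (d \<otimes> a0 \<otimes> inv d)" using cd Cc Ac[OF a0(1)] by (simp add: gsimps)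
  then have "\<chi> (c \<otimes> d) * u a0 = \<chi> c * (\<chi> d * u a0)"
   using chi[OF Cmul[OF cd] a0(1)] chi[OF cd(1) Acj[OF cd(2) a0(1)]] chi[OF cd(2) a0(1)] by metis
  then have "\<chi> (c \<otimes> d) * u a0 = (\<chi> c * \<chi> d) * u a0" by (simp only: mult.assoc)
  then show ?thesis using a0(2) by (simp only: mult_cancel_right) simp
 qed
 have 1: "\<one> \<in> C" using sub_one[OF C] .
 have chi1: "\<chi> \<one> = 1" using chi[OF 1 a0(1)] Ac[OF a0(1)] a0(2) by simp
 have chi_inv: "\<chi> (inv c) * \<chi> c = 1" if "c \<in> C" for c
  using chi_mult[OF Cinv[OF that] that] chi1 Cc[OF that] by simp
 then have chi0: "\<chi> c \<noteq> 0" if "c \<in> C" for c using that by force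
 have fA: "fg A" and fC: "fg C" using fg_sub[OF V] A C subgroup.subset by blast+
 define M where "M = u ` A"
 define E where "E = \<chi> ` C"
 have M: "subgroup M AC" "AC.fg M" unfolding M_def using fg_image[OF fA A AC.group_axioms, of u] ad by auto
 have E: "subgroup E MC" "MC.fg E" unfolding E_def using fg_image[OF fC C MC.group_axioms, of \<chi>] chi_mult chi0 by auto
 have st: "e * x \<in> M" if ex: "e \<in> E" "x \<in> M" for e x
 proof -
  obtain c a where "c \<in> C" "e = \<chi> c" "a \<in> A" "x = u a" using ex by (auto simp: E_def M_def)
  then show ?thesis using chi[of c a] Acj[of c a] by (auto simp: M_def intro!: image_eqI[of _ _ "cj c a"])
 qed
 define v where "v = u a0"
 have v: "v \<in> M" "v \<noteq> 0" using a0 by (auto simp: v_def M_def)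
 \<comment> \<open>Congruences in G become congruences in the lattice M: elements of A in a small K
   have values divisible by m.\<close>
 have key: "\<exists>K. nfi K \<and> (\<forall>a\<in>A \<inter> K. \<exists>y\<in>M. u a = of_nat m * y)" if m: "m \<ge> 1" for m
 proof -
  define D where "D = {a \<in> A. \<exists>y\<in>u ` A. u a = of_nat m * y}"
  have f: "fi D A" unfolding D_def by (rule additive_multiples_fi[OF A fA ad m])
  obtain K where K: "nfi K" "\<And>d a. d \<in> D \<Longrightarrow> a \<in> A \<Longrightarrow> mc K d a \<Longrightarrow> a \<in> D" using fi_separated[OF V f] by blast
  have "a \<in> D" if "a \<in> A \<inter> K" for a
   using K(2)[OF sub_one[OF fiD(1)[OF f]], of a] that Ac by (simp add: mc_def)
  then show ?thesis using K(1) by (auto simp: D_def M_def)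
 qed
 have a0c: "a0 \<in> carrier G" "\<phi> a0 \<in> carrier G" using Ac[OF a0(1)] \<phi> by auto
 have phiA: "\<phi> a0 \<in> A"
 proof (rule closed_mc[OF V A a0c(2)])
  fix K assume "nfi K"
  then obtain c where "c \<in> C" "mc K (cj c a0) (\<phi> a0)" using LI_D[OF LI] a0c by blast
  then show "\<exists>l\<in>A. mc K l (\<phi> a0)" using Acj a0(1) by blast
 qed
 define w where "w = u (\<phi> a0)"
 have diff: "u (inv (cj c a0) \<otimes> b) = u b - \<chi> c * v" if "c \<in> C" "b \<in> A" for c b
  using ad[OF Ainv[OF Acj[OF that(1) a0(1)]] that(2)] one(2)[OF Acj[OF that(1) a0(1)]] chi[OF that(1) a0(1)] by (simp add: v_def)
 have diffA: "inv (cj c a0) \<otimes> b \<in> A" if "c \<in> C" "b \<in> A" for c b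
  using sub_m[OF A Ainv[OF Acj[OF that(1) a0(1)]] that(2)] .
 \<comment> \<open>Approximating elements c bring \<chi> c * v close to w, so w lies in the closure
   of the orbit.\<close>
 have "\<exists>e\<in>E. w = e * v"
 proof (rule orbit_closed[OF M E st v])
  show "w \<in> M" using phiA by (simp add: w_def M_def)
  fix m :: nat assume "m \<ge> 1"
  then obtain K where K: "nfi K" "\<And>a. a \<in> A \<inter> K \<Longrightarrow> \<exists>y\<in>M. u a = of_nat m * y" using key by blast
  obtain c where c: "c \<in> C" "mc K (cj c a0) (\<phi> a0)" using LI_D[OF LI K(1)] a0c by blast
  have "\<exists>y\<in>M. u (inv (cj c a0) \<otimes> \<phi> a0) = of_nat m * y"
   using K(2) diffA[OF c(1) phiA] c(2) by (simp add: mc_def)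
  then show "\<exists>e\<in>E. \<exists>x\<in>M. w - e * v = of_nat m * x" unfolding diff[OF c(1) phiA] using c(1) by (auto simp: w_def E_def)
 qed auto
 then obtain c0 where c0: "c0 \<in> C" "w = \<chi> c0 * v" by (auto simp: E_def)
 define \<psi> where "\<psi> = tw \<phi> c0"
 have LI': "LI \<psi> C" unfolding \<psi>_def by (rule LI_tw[OF LI C c0(1) \<phi>])
 have psi: "\<psi> x \<in> carrier G" if "x \<in> carrier G" for x using \<phi>[OF that] Cc[OF c0(1)] by (simp add: \<psi>_def tw_def)
 have psiA: "\<psi> a0 \<in> A" using nz_D(3)[OF nC[OF c0(1)] phiA] by (simp add: \<psi>_def tw_def)
 have psi0: "u (\<psi> a0) = v"
 proof -
  have "\<psi> a0 = inv c0 \<otimes> \<phi> a0 \<otimes> inv (inv c0)" using Cc[OF c0(1)] by (simp add: \<psi>_def tw_def)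
  then have "u (\<psi> a0) = \<chi> (inv c0) * w" using chi[OF Cinv[OF c0(1)] phiA] by (simp add: w_def)
  then show ?thesis using c0(2) chi_inv[OF c0(1)] by (simp add: mult.assoc[symmetric])
 qed
 define C1 where "C1 = {c \<in> C. \<chi> c = 1}"
 have C1: "subgroup C1 G"
 proof (rule subgroupI)
  show "C1 \<subseteq> carrier G" using Cc by (auto simp: C1_def)
  show "C1 \<noteq> {}" using 1 chi1 by (auto simp: C1_def)
  show "inv c \<in> C1" if "c \<in> C1" for c using that chi_inv[of c] Cinv by (simp add: C1_def)
  show "c \<otimes> d \<in> C1" if "c \<in> C1" "d \<in> C1" for c d using that chi_mult[of c d] Cmul by (simp add: C1_def)
 qed
 have "LI \<psi> C1" unfolding LI_def
 proof (intro allI impI)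
  fix K assume K: "nfi K"
  have Kf: "fi K (carrier G)" using K by (simp add: nfi_def)
  have CK: "fi (C \<inter> K) C" using fi_sub[OF Kf C] subgroup.subset[OF C] by (simp add: Int_commute)
  have "MC.fi (\<chi> ` (C \<inter> K)) E" unfolding E_def
   by (rule image_fi[OF CK MC.group_axioms]) (use chi_mult chi0 in auto)
  \<comment> \<open>The modulus at which the stabilizer condition on character values forces them
    into the finite index subgroup coming from C \<inter> K.\<close>
  then obtain m where m: "m \<ge> 1" "\<And>e x. e \<in> E \<Longrightarrow> x \<in> M \<Longrightarrow> e * v - v = of_nat m * x \<Longrightarrow> e \<in> \<chi> ` (C \<inter> K)"
   using orbit_congruence_stabilizer[OF M E st v] by blast
  obtain K1 where K1: "nfi K1" "\<And>a. a \<in> A \<inter> K1 \<Longrightarrow> \<exists>y\<in>M. u a = of_nat m * y" using key[OF m(1)] by blast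
  obtain c where c: "c \<in> C" "\<And>x. x \<in> carrier G \<Longrightarrow> mc (K \<inter> K1) (cj c x) (\<psi> x)"
   using LI_D[OF LI' nfi_Int[OF K K1(1)]] by blast
  have "inv (cj c a0) \<otimes> \<psi> a0 \<in> A \<inter> K1" using c(2)[OF a0c(1)] diffA[OF c(1) psiA] by (simp add: mc_def)
  then obtain y where y: "y \<in> M" "u (inv (cj c a0) \<otimes> \<psi> a0) = of_nat m * y" using K1(2) by blast
  then have "\<chi> c * v - v = of_nat m * (- y)" using diff[OF c(1) psiA] psi0 by (simp add: algebra_simps)
  then have "\<chi> c \<in> \<chi> ` (C \<inter> K)" using m(2)[of "\<chi> c" "- y"] AC_sub(3)[OF M(1) y(1)] c(1) by (simp add: E_def)
  then obtain k where k: "k \<in> C" "k \<in> K" "\<chi> c = \<chi> k" by blast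
  have "\<chi> (c \<otimes> inv k) = 1" using chi_mult[OF c(1) Cinv[OF k(1)]] chi_inv[OF k(1)] k(3) by (simp add: mult.commute)
  then have "c \<otimes> inv k \<in> C1" using Cmul[OF c(1) Cinv[OF k(1)]] by (simp add: C1_def)
  moreover have "mc K (cj (c \<otimes> inv k) x) (\<psi> x)" if x: "x \<in> carrier G" for x
   by (rule LI_replace[where \<phi> = \<psi>, OF K Cc[OF c(1)] Cc[OF k(1)] k(2) x psi[OF x]]) (use c(2)[OF x] in \<open>simp add: mc_def\<close>)
  ultimately show "\<exists>c\<in>C1. \<forall>x\<in>carrier G. mc K (cj c x) (\<psi> x)" by blast
 qed
 moreover have "u (cj c a) = u a" if "c \<in> C1" "a \<in> A" for c a
  using chi[of c a] that by (simp add: C1_def)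
 moreover have "C1 \<subseteq> C" by (auto simp: C1_def)
 ultimately show ?thesis using c0(1) C1 unfolding \<psi>_def by blast
qed

text \<open>The order of the factors gives the crossed multiplication rule \<open>cm_mult\<close> in
  c.\<close>

definition cm :: "'a \<Rightarrow> 'a \<Rightarrow> 'a" where "cm c x = cj c x \<otimes> inv x"

lemma cm_closed: "c \<in> carrier G \<Longrightarrow> x \<in> carrier G \<Longrightarrow> cm c x \<in> carrier G" by (simp add: cm_def)

lemma cm_mult:
 "c \<in> carrier G \<Longrightarrow> d \<in> carrier G \<Longrightarrow> x \<in> carrier G \<Longrightarrow> cm (c \<otimes> d) x = (cj c (cm d x)) \<otimes> cm c x"
 by (simp add: cm_def gsimps)

text \<open>As C acts trivially on A / B, c \<mapsto> cm c x is an anti-homomorphism from C to A / B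
  (\<open>fm\<close>). Its image is closed, so \<phi> x \<otimes> inv x, a limit of commutators,
  equals one modulo B, and the twist by that c0 moves it into B. An approximating c then has its
  commutator in the image of C \<inter> K and is corrected by an element of K.\<close>

lemma deepen_commutators:
 assumes V: "VP n (carrier G)" and x: "x \<in> carrier G" and A: "subgroup A G" and B: "subgroup B G" "B \<subseteq> A"
  and AB: "\<And>a. a \<in> A \<Longrightarrow> nz a B" and C: "subgroup C G" and nC: "\<And>c. c \<in> C \<Longrightarrow> nz c A" "\<And>c. c \<in> C \<Longrightarrow> nz c B"
  and triv: "\<And>c a. c \<in> C \<Longrightarrow> a \<in> A \<Longrightarrow> mc B (cj c a) a"
  and cmA: "\<And>c. c \<in> C \<Longrightarrow> cm c x \<in> A"
  and \<phi>: "\<And>x. x \<in> carrier G \<Longrightarrow> \<phi> x \<in> carrier G" and LI: "LI \<phi> C"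
 shows "\<exists>c0\<in>C. LI (tw \<phi> c0) {c \<in> C. cm c x \<in> B} \<and> subgroup {c \<in> C. cm c x \<in> B} G"
proof -
 have N: "nrm B A" using A B AB by (simp add: nrm_def)
 note Ac = sub_mem[OF A]
 note Cc = sub_mem[OF C]
 note Cinv = sub_inv[OF C]
 note Cmul = sub_m[OF C]
 note Amul = sub_m[OF A]
 note Ainv = sub_inv[OF A]
 have C1: "\<one> \<in> C" and A1: "\<one> \<in> A" and B1: "\<one> \<in> B" using sub_one C A B by blast+
 have f1: "cm \<one> x = \<one>" using x by (simp add: cm_def)
 have fm: "mc B (cm (c \<otimes> d) x) (cm d x \<otimes> cm c x)" if cd: "c \<in> C" "d \<in> C" for c d
 proof -
  have "cj c (cm d x) \<in> A" using nz_D(2)[OF nC(1)[OF cd(1)] cmA[OF cd(2)]] .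
  then show ?thesis unfolding cm_mult[OF Cc[OF cd(1)] Cc[OF cd(2)] x]
   by (intro mc_mult[OF N] triv[OF cd(1) cmA[OF cd(2)]] mc_refl[OF B(1)] cmA[OF cd(1)] cmA[OF cd(2)] Ac)
 qed
 have finv: "mc B (inv (cm c x)) (cm (inv c) x)" if c: "c \<in> C" for c
 proof -
  have "mc B (cm (inv c \<otimes> c) x) (cm c x \<otimes> cm (inv c) x)" by (rule fm[OF Cinv[OF c] c])
  then have "mc B \<one> (cm c x \<otimes> cm (inv c) x)" using f1 Cc[OF c] by simp
  then have "mc B (inv (cm c x) \<otimes> \<one>) (inv (cm c x) \<otimes> (cm c x \<otimes> cm (inv c) x))"
   by (rule mc_lmult) (use Ac cmA[OF c] cmA[OF Cinv[OF c]] Amul Ainv in auto)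
  then show ?thesis using Ac[OF cmA[OF c]] Ac[OF cmA[OF Cinv[OF c]]] by (simp add: cancel_left)
 qed
 \<comment> \<open>The preimage in A of the image of C' in A / B. Subgroups of A take the place of
   the quotient, so that separability applies to them directly.\<close>
 define \<Delta> where "\<Delta> C' = {a \<in> A. \<exists>c\<in>C'. mc B a (cm c x)}" for C'
 have fD: "cm c x \<in> \<Delta> C'" if "c \<in> C'" "C' \<subseteq> C" for c C'
  using that mc_refl[OF B(1) Ac[OF cmA]] cmA by (auto simp: \<Delta>_def)
 have BD: "b \<in> \<Delta> C'" if b: "b \<in> B" "\<one> \<in> C'" for b C'
 proof -
  have "mc B b (cm \<one> x)" unfolding f1 mc_def
   using sub_inv[OF B(1) b(1)] sub_mem[OF B(1) b(1)] by simp
  then show ?thesis using b B(2) by (auto simp: \<Delta>_def)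
 qed
 have Dsub: "subgroup (\<Delta> C') G" if C': "subgroup C' G" "C' \<subseteq> C" for C'
 proof (rule subgroupI)
  show "\<Delta> C' \<subseteq> carrier G" using Ac by (auto simp: \<Delta>_def)
  show "\<Delta> C' \<noteq> {}" using BD[OF B1 sub_one[OF C'(1)]] by blast
  fix a assume "a \<in> \<Delta> C'"
  then obtain c where a: "a \<in> A" "c \<in> C'" "mc B a (cm c x)" by (auto simp: \<Delta>_def)
  have cC: "c \<in> C" using a C' by blast
  have "mc B (inv a) (inv (cm c x))" by (rule mc_inv[OF N a(3,1) cmA[OF cC]])
  then have "mc B (inv a) (cm (inv c) x)"
   by (rule mc_trans[OF B(1) _ finv[OF cC]]) (use Ac Ainv a(1) cmA[OF cC] cmA[OF Cinv[OF cC]] in auto)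
  then show "inv a \<in> \<Delta> C'" using Ainv[OF a(1)] sub_inv[OF C'(1) a(2)] by (auto simp: \<Delta>_def)
  fix b assume "b \<in> \<Delta> C'"
  then obtain d where b: "b \<in> A" "d \<in> C'" "mc B b (cm d x)" by (auto simp: \<Delta>_def)
  have dC: "d \<in> C" using b C' by blast
  have "mc B (a \<otimes> b) (cm c x \<otimes> cm d x)" by (rule mc_mult[OF N a(3) b(3) a(1) cmA[OF cC] b(1) cmA[OF dC]])
  moreover have "mc B (cm c x \<otimes> cm d x) (cm (d \<otimes> c) x)"
   by (rule mc_sym[OF B(1) fm[OF dC cC]]) (use Ac Amul cmA[OF cC] cmA[OF dC] cmA[OF Cmul[OF dC cC]] in auto)
  ultimately have "mc B (a \<otimes> b) (cm (d \<otimes> c) x)"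
   by (rule mc_trans[OF B(1)]) (use Ac Amul a(1) b(1) cmA[OF cC] cmA[OF dC] cmA[OF Cmul[OF dC cC]] in auto)
  then show "a \<otimes> b \<in> \<Delta> C'" using Amul[OF a(1) b(1)] sub_m[OF C'(1) b(2) a(2)] by (auto simp: \<Delta>_def)
 qed
 note DC = Dsub[OF C subset_refl]
 define a where "a = \<phi> x \<otimes> inv x"
 have ac: "a \<in> carrier G" using x \<phi>[OF x] by (simp add: a_def)
 have "a \<in> \<Delta> C"
 proof (rule closed_mc[OF V DC ac])
  fix K assume K: "nfi K"
  then obtain c where c: "c \<in> C" "mc K (cj c x) (\<phi> x)" using LI_D[OF LI] x by blast
  have "nz (inv x) K" using K x by (simp add: nfi_def)
  then have "mc K (cm c x) a" unfolding cm_def a_def by (rule mc_rmult[OF _ c(2)]) (use Cc[OF c(1)] x \<phi>[OF x] in auto)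
  then show "\<exists>l\<in>\<Delta> C. mc K l a" using fD[OF c(1)] by blast
 qed
 then obtain c0 where c0: "c0 \<in> C" "a \<in> A" "mc B a (cm c0 x)" by (auto simp: \<Delta>_def)
 note c0c = Cc[OF c0(1)]
 define \<psi> where "\<psi> = tw \<phi> c0"
 have LI': "LI \<psi> C" unfolding \<psi>_def by (rule LI_tw[OF LI C c0(1) \<phi>])
 have psi: "\<psi> x \<in> carrier G" if "x \<in> carrier G" for x using \<phi>[OF that] c0c by (simp add: \<psi>_def tw_def)
 define b where "b = \<psi> x \<otimes> inv x"
 have bB: "b \<in> B"
 proof -
  have "inv (inv a \<otimes> cm c0 x) \<in> B" using sub_inv[OF B(1)] c0(3) by (simp add: mc_def)
  then have "a \<otimes> inv (inv a \<otimes> cm c0 x) \<otimes> inv a \<in> B" using nz_D(2)[OF AB[OF c0(2)]] by blast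
  then have "a \<otimes> inv (cm c0 x) \<in> B" using ac cm_closed[OF c0c x] by (simp add: gsimps)
  then have "inv c0 \<otimes> (a \<otimes> inv (cm c0 x)) \<otimes> c0 \<in> B" using nz_D(3)[OF nC(2)[OF c0(1)]] by blast
  moreover have "b = inv c0 \<otimes> (a \<otimes> inv (cm c0 x)) \<otimes> c0"
   unfolding b_def \<psi>_def tw_def a_def cm_def using c0c x \<phi>[OF x] by (simp add: gsimps)
  ultimately show ?thesis by simp
 qed
 define C2 where "C2 = {c \<in> C. cm c x \<in> B}"
 have C2: "subgroup C2 G"
 proof (rule subgroupI)
  show "C2 \<subseteq> carrier G" using Cc by (auto simp: C2_def)
  show "C2 \<noteq> {}" using C1 f1 B1 by (auto simp: C2_def)
  fix c assume c: "c \<in> C2"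
  then have cC: "c \<in> C" "cm c x \<in> B" by (auto simp: C2_def)
  have "mc B (cm (inv c) x) (inv (cm c x))"
   by (rule mc_sym[OF B(1) finv[OF cC(1)]]) (use Ac Ainv cmA[OF cC(1)] cmA[OF Cinv[OF cC(1)]] in auto)
  then have "cm (inv c) x \<in> B"
   by (rule mc_mem[OF B(1)]) (use sub_inv[OF B(1) cC(2)] Ac[OF cmA[OF Cinv[OF cC(1)]]] in auto)
  then show "inv c \<in> C2" using Cinv[OF cC(1)] by (simp add: C2_def)
  fix d assume "d \<in> C2"
  then have dC: "d \<in> C" "cm d x \<in> B" by (auto simp: C2_def)
  have "cm (c \<otimes> d) x \<in> B"
   by (rule mc_mem[OF B(1) fm[OF cC(1) dC(1)]])
     (use sub_m[OF B(1) dC(2) cC(2)] Ac[OF cmA[OF Cmul[OF cC(1) dC(1)]]] in auto)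
  then show "c \<otimes> d \<in> C2" using Cmul[OF cC(1) dC(1)] by (simp add: C2_def)
 qed
 have "LI \<psi> C2" unfolding LI_def
 proof (intro allI impI)
  fix K assume K: "nfi K"
  have Kf: "fi K (carrier G)" using K by (simp add: nfi_def)
  have CK: "fi (C \<inter> K) C" using fi_sub[OF Kf C] subgroup.subset[OF C] by (simp add: Int_commute)
  note CKs = fiD(1)[OF CK]
  have "fi (\<Delta> (C \<inter> K)) (\<Delta> C)"
  proof -
   obtain h :: "'a \<Rightarrow> 'a" where h: "finite (h ` C)" "\<And>x y. x \<in> C \<Longrightarrow> y \<in> C \<Longrightarrow> h x = h y \<Longrightarrow> x \<otimes> inv y \<in> C \<inter> K"
    using fi_fun[OF CK] by blast
   have "\<forall>a. \<exists>c. a \<in> \<Delta> C \<longrightarrow> c \<in> C \<and> mc B a (cm c x)" by (auto simp: \<Delta>_def)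
   from choice[OF this] obtain g where g: "\<And>a. a \<in> \<Delta> C \<Longrightarrow> g a \<in> C \<and> mc B a (cm (g a) x)" by blast
   show ?thesis
   \<comment> \<open>Inverses appear because \<open>fi_fun\<close> compares through x \<otimes> inv
     y, while the anti-homomorphism asks for inv d \<otimes> c in K.\<close>
   proof (rule fiI_fun[where f = "\<lambda>a. h (inv (g a))"])
    show "subgroup (\<Delta> (C \<inter> K)) G" by (rule Dsub[OF CKs]) auto
    show "\<Delta> (C \<inter> K) \<subseteq> \<Delta> C" by (auto simp: \<Delta>_def)
    have "(\<lambda>a. h (inv (g a))) ` \<Delta> C \<subseteq> h ` C" using g Cinv by blast
    then show "finite ((\<lambda>a. h (inv (g a))) ` \<Delta> C)" using h(1) finite_subset by blast
    fix u w assume uw: "u \<in> \<Delta> C" "w \<in> \<Delta> C" "h (inv (g u)) = h (inv (g w))"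
    define c where "c = g u"
    define d where "d = g w"
    have c: "c \<in> C" "mc B u (cm c x)" and d: "d \<in> C" "mc B w (cm d x)" using g uw by (auto simp: c_def d_def)
    have uA: "u \<in> A" "w \<in> A" using uw by (auto simp: \<Delta>_def)
    have cd: "c \<in> carrier G" "d \<in> carrier G" using Cc c d by auto
    define k where "k = inv d \<otimes> c"
    have "inv d \<otimes> inv (inv c) \<in> C \<inter> K" using h(2)[of "inv d" "inv c"] uw(3) Cinv c d by (simp add: c_def d_def)
    then have k: "k \<in> C" "k \<in> K" using cd by (auto simp: k_def)
    have cdk: "c = d \<otimes> k" using cd by (simp add: k_def cancel_left)
    have e1: "mc B (cm c x) (cm k x \<otimes> cm d x)" unfolding cdk by (rule fm[OF d(1) k(1)])
    have "mc B u (cm k x \<otimes> cm d x)"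
     by (rule mc_trans[OF B(1) c(2) e1]) (use Ac Amul uA cmA[OF c(1)] cmA[OF d(1)] cmA[OF k(1)] in auto)
    moreover have "mc B (inv w) (inv (cm d x))" by (rule mc_inv[OF N d(2) uA(2) cmA[OF d(1)]])
    ultimately have "mc B (u \<otimes> inv w) ((cm k x \<otimes> cm d x) \<otimes> inv (cm d x))"
     by (rule mc_mult[OF N]) (use Amul Ainv uA cmA[OF d(1)] cmA[OF k(1)] in auto)
    then have "mc B (u \<otimes> inv w) (cm k x)" using Ac[OF cmA[OF d(1)]] Ac[OF cmA[OF k(1)]] by (simp add: m_assoc)
    then show "u \<otimes> inv w \<in> \<Delta> (C \<inter> K)" using Amul[OF uA(1) Ainv[OF uA(2)]] k by (auto simp: \<Delta>_def)
   qed (rule DC)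
  qed
  then obtain K1 where K1: "nfi K1" "\<And>d a. d \<in> \<Delta> (C \<inter> K) \<Longrightarrow> a \<in> \<Delta> C \<Longrightarrow> mc K1 d a \<Longrightarrow> a \<in> \<Delta> (C \<inter> K)"
   using fi_separated[OF V] by blast
  obtain c where c: "c \<in> C" "\<And>x. x \<in> carrier G \<Longrightarrow> mc (K \<inter> K1) (cj c x) (\<psi> x)"
   using LI_D[OF LI' nfi_Int[OF K K1(1)]] by blast
  have "mc K1 (cj c x) (\<psi> x)" using c(2)[OF x] by (simp add: mc_def)
  moreover have "nz (inv x) K1" using K1(1) x by (simp add: nfi_def)
  ultimately have "mc K1 (cm c x) b" unfolding cm_def b_def by (intro mc_rmult) (use Cc[OF c(1)] x psi[OF x] in auto)
  then have "mc K1 b (cm c x)"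
   by (rule mc_sym[OF nrmD(1)[OF nfi_nrm[OF K1(1)]]]) (use Ac[OF cmA[OF c(1)]] bB B(2) Ac in auto)
  then have "cm c x \<in> \<Delta> (C \<inter> K)"
   by (rule K1(2)[OF BD[OF bB sub_one[OF CKs]] fD[OF c(1) subset_refl]])
  then obtain k where k: "k \<in> C" "k \<in> K" "mc B (cm c x) (cm k x)" by (auto simp: \<Delta>_def)
  define c1 where "c1 = c \<otimes> inv k"
  have c1: "c1 \<in> C" using Cmul[OF c(1) Cinv[OF k(1)]] by (simp add: c1_def)
  have "c = c1 \<otimes> k" using Cc[OF c(1)] Cc[OF k(1)] by (simp add: c1_def m_assoc)
  then have e: "mc B (cm c x) (cm k x \<otimes> cm c1 x)" using fm[OF c1 k(1)] by simp
  have "mc B (cm k x) (cm c x)" by (rule mc_sym[OF B(1) k(3)]) (use Ac cmA[OF c(1)] cmA[OF k(1)] in auto)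
  then have "mc B (cm k x) (cm k x \<otimes> cm c1 x)"
   by (rule mc_trans[OF B(1) _ e]) (use Ac Amul cmA[OF c(1)] cmA[OF k(1)] cmA[OF c1] in auto)
  then have "cm c1 x \<in> B" using Ac[OF cmA[OF k(1)]] Ac[OF cmA[OF c1]] by (simp add: mc_def cancel_left)
  then have "c1 \<in> C2" using c1 by (simp add: C2_def)
  moreover have "mc K (cj c1 y) (\<psi> y)" if y: "y \<in> carrier G" for y
   unfolding c1_def
   by (rule LI_replace[where \<phi> = \<psi>, OF K Cc[OF c(1)] Cc[OF k(1)] k(2) y psi[OF y]]) (use c(2)[OF y] in \<open>simp add: mc_def\<close>)
  ultimately show "\<exists>c\<in>C2. \<forall>x\<in>carrier G. mc K (cj c x) (\<psi> x)" by blast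
 qed
 then show ?thesis using c0(1) C2 unfolding \<psi>_def C2_def by blast
qed

lemma LI_cong: assumes "LI \<phi> C" "\<And>x. x \<in> carrier G \<Longrightarrow> \<phi> x = \<psi> x" shows "LI \<psi> C"
 unfolding LI_def
proof (intro allI impI)
 fix K assume "nfi K"
 then obtain c where c: "c \<in> C" "\<And>x. x \<in> carrier G \<Longrightarrow> mc K (cj c x) (\<phi> x)" using LI_D[OF assms(1)] by blast
 then have "\<forall>x\<in>carrier G. mc K (cj c x) (\<psi> x)" using assms(2) by simp
 then show "\<exists>c\<in>C. \<forall>x\<in>carrier G. mc K (cj c x) (\<psi> x)" using c(1) by blast
qed

lemma tw_tw: "c \<in> carrier G \<Longrightarrow> d \<in> carrier G \<Longrightarrow> \<phi> x \<in> carrier G \<Longrightarrow> tw (tw \<phi> c) d x = tw \<phi> (c \<otimes> d) x"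
 by (simp add: tw_def gsimps)

lemma deepen_commutators_all:
 assumes V: "VP n (carrier G)" and A: "subgroup A G" and B: "subgroup B G" "B \<subseteq> A"
  and AB: "\<And>a. a \<in> A \<Longrightarrow> nz a B" and C: "subgroup C G" and nC: "\<And>c. c \<in> C \<Longrightarrow> nz c A" "\<And>c. c \<in> C \<Longrightarrow> nz c B"
  and triv: "\<And>c a. c \<in> C \<Longrightarrow> a \<in> A \<Longrightarrow> mc B (cj c a) a"
  and \<phi>: "\<And>x. x \<in> carrier G \<Longrightarrow> \<phi> x \<in> carrier G" and LI: "LI \<phi> C"
  and S: "finite S" "S \<subseteq> carrier G" "\<And>c x. c \<in> C \<Longrightarrow> x \<in> S \<Longrightarrow> cm c x \<in> A"
 shows "\<exists>c0\<in>C. \<exists>C'. subgroup C' G \<and> C' \<subseteq> C \<and> (\<forall>c\<in>C'. \<forall>x\<in>S. cm c x \<in> B) \<and> LI (tw \<phi> c0) C'"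
 using S
proof (induction S rule: finite_induct)
 case empty
 have "LI (tw \<phi> \<one>) C" by (rule LI_tw[OF LI C sub_one[OF C] \<phi>])
 then show ?case using C sub_one[OF C] by blast
next
 case (insert s S)
 have "\<exists>c0\<in>C. \<exists>C'. subgroup C' G \<and> C' \<subseteq> C \<and> (\<forall>c\<in>C'. \<forall>x\<in>S. cm c x \<in> B) \<and> LI (tw \<phi> c0) C'"
  using insert.IH insert.prems by blast
 then obtain c0 C' where c0: "c0 \<in> C" and C': "subgroup C' G" "C' \<subseteq> C" "\<forall>c\<in>C'. \<forall>x\<in>S. cm c x \<in> B" "LI (tw \<phi> c0) C'" by blast
 have sc: "s \<in> carrier G" using insert.prems by blast
 have c0c: "c0 \<in> carrier G" using c0 C sub_mem by metis
 have "\<exists>c1\<in>C'. LI (tw (tw \<phi> c0) c1) {c \<in> C'. cm c s \<in> B} \<and> subgroup {c \<in> C'. cm c s \<in> B} G"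
 proof (rule deepen_commutators[OF V sc A B AB C'(1) _ _ _ _ _ C'(4)])
  show "tw \<phi> c0 x \<in> carrier G" if "x \<in> carrier G" for x using \<phi>[OF that] c0c by (simp add: tw_def)
 qed (use C'(2) nC triv insert.prems(2) in blast)+
 then obtain c1 where c1: "c1 \<in> C'" "LI (tw (tw \<phi> c0) c1) {c \<in> C'. cm c s \<in> B}" "subgroup {c \<in> C'. cm c s \<in> B} G" by blast
 have c1c: "c1 \<in> carrier G" using c1(1) C'(1) sub_mem by metis
 have "LI (tw \<phi> (c0 \<otimes> c1)) {c \<in> C'. cm c s \<in> B}" using LI_cong[OF c1(2), of "tw \<phi> (c0 \<otimes> c1)"] tw_tw[where \<phi> = \<phi>, OF c0c c1c \<phi>] by blast
 moreover have "c0 \<otimes> c1 \<in> C" using sub_m[OF C c0] c1(1) C'(2) by blast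
 moreover have "{c \<in> C'. cm c s \<in> B} \<subseteq> C" "\<forall>c\<in>{c \<in> C'. cm c s \<in> B}. \<forall>x\<in>insert s S. cm c x \<in> B" using C' by auto
 ultimately show ?case using c1(3) by blast
qed

lemma tw_inner:
 assumes "c \<in> carrier G" "g \<in> carrier G" "x \<in> carrier G" "\<phi> x \<in> carrier G" "tw \<phi> c x = cj g x"
 shows "\<phi> x = cj (c \<otimes> g) x"
proof -
 have "\<phi> x = c \<otimes> tw \<phi> c x \<otimes> inv c" using assms(1-4) by (simp add: tw_def gsimps)
 then show ?thesis unfolding assms(5) using assms(1-4) by (simp add: gsimps)
qed

text \<open>Induction down the chain. Both \<phi> and C vary, since each step twists the one and
  shrinks the other; finitely many generators suffice to control the commutators with all of
  G.\<close>

lemma locally_inner_imp_inner: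
 assumes V: "VP n (carrier G)" and S: "finite S" "S \<subseteq> carrier G" "\<And>Q. subgroup Q G \<Longrightarrow> S \<subseteq> Q \<Longrightarrow> carrier G \<subseteq> Q"
 shows "Tri D A \<Longrightarrow> subgroup C G \<Longrightarrow> C \<subseteq> D \<Longrightarrow> (\<And>x. x \<in> carrier G \<Longrightarrow> \<phi> x \<in> carrier G) \<Longrightarrow> LI \<phi> C \<Longrightarrow>
  (\<And>c x. c \<in> C \<Longrightarrow> x \<in> S \<Longrightarrow> cm c x \<in> A) \<Longrightarrow> \<exists>g\<in>carrier G. \<forall>x\<in>carrier G. \<phi> x = cj g x"
proof (induction arbitrary: C \<phi> rule: Tri.induct)
 case (Tri_base A D)
 note C = Tri_base.prems(1) and \<phi> = Tri_base.prems(3)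
 note Cc = sub_mem[OF C]
 have Ac: "a \<in> carrier G" if "a \<in> A" for a using that Tri_base.hyps(1) sub_mem by metis
 have fix_conj: "cj c a = a" "inv c \<otimes> a \<otimes> c = a" if "c \<in> C" "a \<in> A" for c a
 proof -
  have e: "c \<otimes> a = a \<otimes> c" using Tri_base that by blast
  show "cj c a = a" unfolding e using Cc[OF that(1)] Ac[OF that(2)] by (simp add: m_assoc)
  show "inv c \<otimes> a \<otimes> c = a" using Cc[OF that(1)] Ac[OF that(2)] by (simp add: m_assoc e[symmetric] cancel_left)
 qed
 have nz1: "nz g {\<one>}" if "g \<in> carrier G" for g using that by (simp add: nz_def)
 \<comment> \<open>At the bottom the commutators are pushed into the trivial subgroup, on which
   everything acts trivially; the surviving C' is central.\<close>
 have "\<exists>c0\<in>C. \<exists>C'. subgroup C' G \<and> C' \<subseteq> C \<and> (\<forall>c\<in>C'. \<forall>x\<in>S. cm c x \<in> {\<one>}) \<and> LI (tw \<phi> c0) C'"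
 proof (rule deepen_commutators_all[OF V Tri_base.hyps(1) triv_subgroup _ nz1[OF Ac] C _ nz1[OF Cc] _ \<phi> Tri_base.prems(4) S(1,2) Tri_base.prems(5)])
  show "{\<one>} \<subseteq> A" using sub_one[OF Tri_base.hyps(1)] by simp
  show "nz c A" if "c \<in> C" for c using fix_conj[OF that] Cc[OF that] by (simp add: nz_def)
  show "mc {\<one>} (cj c a) a" if "c \<in> C" "a \<in> A" for c a
   using fix_conj(1)[OF that] Ac[OF that(2)] by (simp add: mc_def)
 qed auto
 then obtain c0 C' where c0: "c0 \<in> C" and C': "subgroup C' G" "C' \<subseteq> C" "\<And>c x. c \<in> C' \<Longrightarrow> x \<in> S \<Longrightarrow> cm c x = \<one>" "LI (tw \<phi> c0) C'" by auto
 have central: "cj c x = x" if c: "c \<in> C'" and x: "x \<in> carrier G" for c x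
 proof -
  have cc: "c \<in> carrier G" using c C'(2) Cc by blast
  define Q where "Q = {x \<in> carrier G. c \<otimes> x \<otimes> inv c = x}"
  have "subgroup Q G"
  proof (rule subgroupI)
   show "Q \<subseteq> carrier G" by (auto simp: Q_def)
   show "Q \<noteq> {}" using cc by (auto simp: Q_def intro!: exI[of _ \<one>])
   fix u assume "u \<in> Q"
   then have u: "u \<in> carrier G" "cj c u = u" by (auto simp: Q_def)
   have "cj c (inv u) = inv (cj c u)" using u(1) cc by (simp add: gsimps)
   then show "inv u \<in> Q" using u by (simp add: Q_def)
   fix w assume "w \<in> Q"
   then have w: "w \<in> carrier G" "cj c w = w" by (auto simp: Q_def)
   have "cj c (u \<otimes> w) = (cj c u) \<otimes> (cj c w)" using u(1) w(1) cc by (simp add: gsimps)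
   then show "u \<otimes> w \<in> Q" using u w by (simp add: Q_def)
  qed
  moreover have "S \<subseteq> Q"
  proof
   fix s assume s: "s \<in> S"
   have sc: "s \<in> carrier G" using s S(2) by blast
   have "cm c s \<otimes> s = s" using C'(3)[OF c s] sc by simp
   then show "s \<in> Q" using sc cc by (simp add: Q_def cm_def m_assoc)
  qed
  ultimately show ?thesis using S(3) x by (auto simp: Q_def)
 qed
 \<comment> \<open>Central elements conjugate trivially, so the twisted map is the identity modulo
   every normal subgroup of finite index. Closedness of the trivial subgroup is residual
   finiteness.\<close>
 have "\<phi> x = cj (c0 \<otimes> \<one>) x" if x: "x \<in> carrier G" for x
 proof (rule tw_inner[where \<phi> = \<phi>, OF Cc[OF c0] one_closed x \<phi>[OF x]])
  have tc: "tw \<phi> c0 x \<in> carrier G" using \<phi>[OF x] Cc[OF c0] by (simp add: tw_def)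
  have "inv x \<otimes> tw \<phi> c0 x \<in> {\<one>}"
  proof (rule closed_mc[OF V triv_subgroup])
   show "inv x \<otimes> tw \<phi> c0 x \<in> carrier G" using tc x by simp
   fix K assume "nfi K"
   then obtain c where "c \<in> C'" "mc K (cj c x) (tw \<phi> c0 x)" using LI_D[OF C'(4)] x by blast
   then have "mc K x (tw \<phi> c0 x)" using central x by simp
   then show "\<exists>l\<in>{\<one>}. mc K l (inv x \<otimes> tw \<phi> c0 x)" using tc x by (simp add: mc_def)
  qed
  then have "x \<otimes> (inv x \<otimes> tw \<phi> c0 x) = x" using x by simp
  then show "tw \<phi> c0 x = cj \<one> x" using tc x by (simp add: cancel_left)
 qed
 then show ?case using Cc[OF c0] by blast
next
 case (Tri_step A D u)
 note A = Tri_step.hyps(1) and ad = Tri_step.hyps(4) and C = Tri_step.prems(1) and \<phi> = Tri_step.prems(3)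
 note Ac = sub_mem[OF A]
 note Cc = sub_mem[OF C]
 have nC: "nz c A" if "c \<in> C" for c using Tri_step.hyps(3) Tri_step.prems(2) that by blast
 have eigC: "\<exists>z. \<forall>a\<in>A. u (cj c a) = z * u a" if "c \<in> C" for c using Tri_step.hyps(5) Tri_step.prems(2) that by blast
 obtain c0 C1 where c0: "c0 \<in> C" and C1: "subgroup C1 G" "C1 \<subseteq> C" "\<And>c a. c \<in> C1 \<Longrightarrow> a \<in> A \<Longrightarrow> u (cj c a) = u a" "LI (tw \<phi> c0) C1"
  using trivialize_character[OF V A C nC ad eigC \<phi> Tri_step.prems(4)] by blast
 define \<phi>1 where "\<phi>1 = tw \<phi> c0"
 have ph1: "\<phi>1 x \<in> carrier G" if "x \<in> carrier G" for x using \<phi>[OF that] Cc[OF c0] by (simp add: \<phi>1_def tw_def)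
 define B where "B = {a \<in> A. u a = 0}"
 have B: "subgroup B G" "B \<subseteq> A" unfolding B_def using additive_kernel[OF A ad] by auto
 have one: "u \<one> = 0" "\<And>x. x \<in> A \<Longrightarrow> u (inv x) = - u x"
  by (rule additive_one(1)[of A u, OF A], erule (1) ad, rule additive_one(2)[of A u, OF A], erule (1) ad)
 note Ainv = sub_inv[OF A]
 note Amul = sub_m[OF A]
 have rho_conj: "u (cj a b) = u b" if "a \<in> A" "b \<in> A" for a b
  using ad[OF Amul[OF that] Ainv[OF that(1)]] ad[OF that] one(2)[OF that(1)] by simp
 have AB: "nz a B" if a: "a \<in> A" for a
 proof -
  have "inv a \<otimes> b \<otimes> a \<in> B \<and> a \<otimes> b \<otimes> inv a \<in> B" if b: "b \<in> B" for b
  proof -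
   have bA: "b \<in> A" "u b = 0" using b by (auto simp: B_def)
   have "u (inv a \<otimes> b \<otimes> a) = 0" using rho_conj[OF Ainv[OF a] bA(1)] bA(2) Ac[OF a] by simp
   moreover have "u (cj a b) = 0" using rho_conj[OF a bA(1)] bA(2) by simp
   moreover have "inv a \<otimes> b \<otimes> a \<in> A" "cj a b \<in> A" using a bA(1) Amul Ainv by auto
   ultimately show ?thesis by (simp add: B_def)
  qed
  then show ?thesis using Ac[OF a] by (simp add: nz_def)
 qed
 have C1c: "c \<in> carrier G" if "c \<in> C1" for c using that C1(2) Cc by blast
 have nC1: "nz c A" if "c \<in> C1" for c using that C1(2) nC by blast
 have CB: "nz c B" if c: "c \<in> C1" for c
 proof -
  have ic: "inv c \<in> C1" using sub_inv[OF C1(1) c] .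
  have "inv c \<otimes> b \<otimes> c \<in> B \<and> c \<otimes> b \<otimes> inv c \<in> B" if b: "b \<in> B" for b
  proof -
   have bA: "b \<in> A" "u b = 0" using b by (auto simp: B_def)
   have "u (inv c \<otimes> b \<otimes> c) = 0" using C1(3)[OF ic bA(1)] bA(2) C1c[OF c] by simp
   moreover have "u (cj c b) = 0" using C1(3)[OF c bA(1)] bA(2) by simp
   ultimately show ?thesis using nz_D(2,3)[OF nC1[OF c] bA(1)] by (simp add: B_def)
  qed
  then show ?thesis using C1c[OF c] by (simp add: nz_def)
 qed
 have "\<exists>c1\<in>C1. \<exists>C'. subgroup C' G \<and> C' \<subseteq> C1 \<and> (\<forall>c\<in>C'. \<forall>x\<in>S. cm c x \<in> B) \<and> LI (tw \<phi>1 c1) C'"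
 proof (rule deepen_commutators_all[OF V A B AB C1(1) nC1 CB _ ph1 _ S(1,2)])
  show "mc B (cj c a) a" if "c \<in> C1" "a \<in> A" for c a
  proof -
   have cA: "cj c a \<in> A" using nz_D(2)[OF nC1[OF that(1)] that(2)] .
   have "u (inv (cj c a) \<otimes> a) = 0" using ad[OF Ainv[OF cA] that(2)] one(2)[OF cA] C1(3)[OF that] by simp
   then show ?thesis using Amul[OF Ainv[OF cA] that(2)] by (simp add: mc_def B_def)
  qed
  show "LI \<phi>1 C1" using C1(4) by (simp add: \<phi>1_def)
  show "cm c x \<in> A" if "c \<in> C1" "x \<in> S" for c x using Tri_step.prems(5) that C1(2) by blast
 qed
 then obtain c1 C' where c1: "c1 \<in> C1" and C': "subgroup C' G" "C' \<subseteq> C1" "\<And>c x. c \<in> C' \<Longrightarrow> x \<in> S \<Longrightarrow> cm c x \<in> B" "LI (tw \<phi>1 c1) C'" by blast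
 have "\<exists>g\<in>carrier G. \<forall>x\<in>carrier G. tw \<phi>1 c1 x = cj g x"
 proof (rule Tri_step.IH[OF C'(1) _ _ C'(4)])
  show "C' \<subseteq> D" using C'(2) C1(2) Tri_step.prems(2) by blast
  show "tw \<phi>1 c1 x \<in> carrier G" if "x \<in> carrier G" for x using ph1[OF that] C1c[OF c1] by (simp add: tw_def)
  show "cm c x \<in> {a \<in> A. u a = 0}" if "c \<in> C'" "x \<in> S" for c x using C'(3)[OF that] by (simp add: B_def)
 qed
 then obtain g where g: "g \<in> carrier G" "\<And>x. x \<in> carrier G \<Longrightarrow> tw \<phi>1 c1 x = cj g x" by blast
 have "\<phi> x = (c0 \<otimes> (c1 \<otimes> g)) \<otimes> x \<otimes> inv (c0 \<otimes> (c1 \<otimes> g))" if x: "x \<in> carrier G" for x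
 proof (rule tw_inner[where \<phi> = \<phi>, OF Cc[OF c0] _ x \<phi>[OF x]])
  show "c1 \<otimes> g \<in> carrier G" using C1c[OF c1] g(1) by simp
  show "tw \<phi> c0 x = cj (c1 \<otimes> g) x"
   using tw_inner[where \<phi> = \<phi>1, OF C1c[OF c1] g(1) x ph1[OF x] g(2)[OF x]] by (simp add: \<phi>1_def)
 qed
 then show ?case using Cc[OF c0] C1c[OF c1] g(1) by (intro bexI[of _ "c0 \<otimes> (c1 \<otimes> g)"]) auto
qed

end

section \<open>From polycyclic series and characteristic subgroups to the theorem\<close>

context group
begin

lemma finite_index_imp_fi: assumes "finite_index H G" shows "fi H (carrier G)"
proof -
 have H: "subgroup H G" and fin: "finite (rcosets H)" using assms by (auto simp: finite_index_def)
 show ?thesis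
 proof (rule fiI_fun[where f = "\<lambda>x. H #> x"])
  show "subgroup (carrier G) G" by (rule subgroup_self)
  have "(\<lambda>x. H #> x) ` carrier G \<subseteq> rcosets H" by (auto simp: RCOSETS_def)
  then show "finite ((\<lambda>x. H #> x) ` carrier G)" using fin finite_subset by blast
  fix x y assume xy: "x \<in> carrier G" "y \<in> carrier G" "H #> x = H #> y"
  have "x \<in> H #> y" using rcos_self[OF xy(1) H] xy(3) by simp
  then obtain h where h: "h \<in> H" "x = h \<otimes> y" by (auto simp: r_coset_def)
  then have "x \<otimes> inv y = h" using xy(2) sub_mem[OF H h(1)] by (simp add: m_assoc)
  then show "x \<otimes> inv y \<in> H" using h(1) by simp
 qed (use H subgroup.subset in auto)
qed

lemma fi_imp_finite_index: assumes "fi K (carrier G)" shows "finite_index K G"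
proof -
 note K = fiD(1)[OF assms]
 obtain T where T: "finite T" "T \<subseteq> carrier G" "\<forall>h\<in>carrier G. \<exists>t\<in>T. h \<otimes> inv t \<in> K" using fi_reps[OF assms] by blast
 have "rcosets K \<subseteq> (\<lambda>t. K #> t) ` T"
 proof
  fix C assume "C \<in> rcosets K"
  then obtain h where h: "h \<in> carrier G" "C = K #> h" by (auto simp: RCOSETS_def)
  obtain t where t: "t \<in> T" "h \<otimes> inv t \<in> K" using T(3) h(1) by blast
  have tc: "t \<in> carrier G" using t(1) T(2) by blast
  have "h = (h \<otimes> inv t) \<otimes> t" using h(1) tc by (simp add: m_assoc)
  then have "h \<in> K #> t" using t(2) by (auto simp: r_coset_def)
  then have "K #> t = K #> h" by (rule repr_independence[OF _ tc K])
  then show "C \<in> (\<lambda>t. K #> t) ` T" using h(2) t(1) by blast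
 qed
 then have "finite (rcosets K)" using T(1) finite_surj by blast
 then show ?thesis using K by (simp add: finite_index_def)
qed

text \<open>A lift t of a generator of the cyclic quotient normalizes K, and K with the powers of t
  exhausts L.\<close>

lemma polycyclic_seq_VP:
 assumes H: "subgroup H G"
 shows "polycyclic_seq (G\<lparr>carrier := H\<rparr>) L \<Longrightarrow> \<exists>n. VP n L"
proof (induction rule: polycyclic_seq.induct)
 case unity
 show ?case using VP_one by auto
next
 case (extension K L)
 obtain n where n: "VP n K" using extension.IH by blast
 have L: "subgroup L G" using incl_subgroup[OF H] extension.hyps(3) by blast
 have N: "K \<lhd> (G\<lparr>carrier := L\<rparr>)" using extension.hyps(2) by simp
 have cyc: "cyclic_group ((G\<lparr>carrier := L\<rparr>) Mod K)" using extension.hyps(4) by simp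
 interpret L: group "G\<lparr>carrier := L\<rparr>" by (rule subgroup.subgroup_is_group[OF L group_axioms])
 interpret N: normal K "G\<lparr>carrier := L\<rparr>" by (rule N)
 interpret M: group "(G\<lparr>carrier := L\<rparr>) Mod K" by (rule N.factorgroup_is_group)
 note K = VP_subgroup[OF n]
 have KL: "K \<subseteq> L" using N.subset by simp
 have inv_eq: "inv\<^bsub>G\<lparr>carrier := L\<rparr>\<^esub> x = inv x" if "x \<in> L" for x using m_inv_consistent[OF L that] .
 have rc: "r_coset (G\<lparr>carrier := L\<rparr>) K x = K #> x" for x by (simp add: r_coset_def)
 obtain C where C: "C \<in> carrier ((G\<lparr>carrier := L\<rparr>) Mod K)"
  "carrier ((G\<lparr>carrier := L\<rparr>) Mod K) = range (\<lambda>k::int. C [^]\<^bsub>(G\<lparr>carrier := L\<rparr>) Mod K\<^esub> k)"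
  using cyc M.cyclic_group by blast
 obtain t where t: "t \<in> L" "C = K #> t" using C(1) by (auto simp: FactGroup_def RCOSETS_def rc)
 have tc: "t \<in> carrier G" using t(1) L sub_mem by metis
 have "nz t K"
 proof -
  have "cj t k \<in> K \<and> inv t \<otimes> k \<otimes> t \<in> K" if "k \<in> K" for k
   using N.inv_op_closed1[of t k] N.inv_op_closed2[of t k] that t(1) inv_eq[OF t(1)] by simp
  then show ?thesis using tc by (simp add: nz_def)
 qed
 moreover have "L = cyc K t"
 proof
  show "cyc K t \<subseteq> L" by (rule cyc_subset[OF L KL t(1)])
  show "L \<subseteq> cyc K t"
  proof
   fix x assume x: "x \<in> L"
   have "K #> x \<in> carrier ((G\<lparr>carrier := L\<rparr>) Mod K)" using x by (auto simp: FactGroup_def RCOSETS_def rc)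
   then obtain k :: int where k: "K #> x = C [^]\<^bsub>(G\<lparr>carrier := L\<rparr>) Mod K\<^esub> k" using C(2) by blast
   also have "\<dots> = K #> (t [^]\<^bsub>G\<lparr>carrier := L\<rparr>\<^esub> k)" using N.FactGroup_int_pow[of t k] t by (simp add: rc)
   also have "t [^]\<^bsub>G\<lparr>carrier := L\<rparr>\<^esub> k = t [^] k" using int_pow_consistent[OF L t(1)] by simp
   finally have "K #> x = K #> (t [^] k)" .
   moreover have "x \<in> K #> x" using rcos_self[OF sub_mem[OF L x] K] .
   ultimately obtain p where "p \<in> K" "x = p \<otimes> t [^] k" by (auto simp: r_coset_def)
   then show "x \<in> cyc K t" using cycI by simp
  qed
 qed
 ultimately show ?case using VP_ext[OF n] by metis
qed

lemma virtually_polycyclic_VP: assumes "virtually_polycyclic G" shows "\<exists>n. VP n (carrier G)"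
proof -
 obtain H where H: "finite_index H G" "polycyclic (G\<lparr>carrier := H\<rparr>)" using assms by (auto simp: virtually_polycyclic_def)
 have "polycyclic_seq (G\<lparr>carrier := H\<rparr>) H" using H(2) by (simp add: polycyclic_def)
 moreover have "subgroup H G" using H(1) by (simp add: finite_index_def)
 ultimately show ?thesis using polycyclic_seq_VP VP_fin[OF _ finite_index_imp_fi[OF H(1)]] by blast
qed

lemma auto_endo:
 assumes "\<alpha> \<in> auto G" shows "endo (carrier G) \<alpha>" "endo (carrier G) (inv_into (carrier G) \<alpha>)"
  "\<alpha> ` carrier G = carrier G" "inj_on \<alpha> (carrier G)"
proof -
 have h: "\<alpha> (x \<otimes> y) = \<alpha> x \<otimes> \<alpha> y" if "x \<in> carrier G" "y \<in> carrier G" for x y using assms that by (simp add: auto_def hom_def)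
 have b: "bij_betw \<alpha> (carrier G) (carrier G)" using assms by (simp add: auto_def Bij_def)
 then show im: "\<alpha> ` carrier G = carrier G" and inj: "inj_on \<alpha> (carrier G)" by (auto simp: bij_betw_def)
 show "endo (carrier G) \<alpha>" using h im by (simp add: endo_def)
 let ?i = "inv_into (carrier G) \<alpha>"
 have i: "?i x \<in> carrier G" "\<alpha> (?i x) = x" if "x \<in> carrier G" for x
  using that im inv_into_into[of x \<alpha> "carrier G"] f_inv_into_f[of x \<alpha> "carrier G"] by auto
 have "?i (x \<otimes> y) = ?i x \<otimes> ?i y" if xy: "x \<in> carrier G" "y \<in> carrier G" for x y
 proof (rule inj_onD[OF inj])
  show "\<alpha> (?i (x \<otimes> y)) = \<alpha> (?i x \<otimes> ?i y)" using h[OF i(1)[OF xy(1)] i(1)[OF xy(2)]] i(2) xy by simp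
 qed (use i xy in auto)
 then show "endo (carrier G) ?i" using i by (auto simp: endo_def)
qed

text \<open>An automorphism and its inverse are both endomorphisms, so invariance under
  endomorphisms gives equality of K with its image.\<close>

lemma characteristic_below:
 assumes "fg (carrier G)" "fi D (carrier G)" shows "\<exists>K. characteristic K G \<and> fi K (carrier G) \<and> K \<subseteq> D"
proof -
 obtain K where K: "fi K (carrier G)" "K \<subseteq> D" "\<And>\<alpha>. endo (carrier G) \<alpha> \<Longrightarrow> \<alpha> ` K \<subseteq> K"
  using invariant_fi[OF assms] by blast
 have "\<alpha> ` K = K" if al: "\<alpha> \<in> auto G" for \<alpha>
 proof
  note e = auto_endo[OF al]
  show "\<alpha> ` K \<subseteq> K" by (rule K(3)[OF e(1)])
  show "K \<subseteq> \<alpha> ` K"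
  proof
   fix x assume x: "x \<in> K"
   have "inv_into (carrier G) \<alpha> x \<in> K" using K(3)[OF e(2)] x by blast
   moreover have "\<alpha> (inv_into (carrier G) \<alpha> x) = x"
    by (rule f_inv_into_f) (use x e(3) fiD(3)[OF K(1)] in auto)
   ultimately show "x \<in> \<alpha> ` K" by (metis image_eqI)
  qed
 qed
 then show ?thesis using K fiD(1)[OF K(1)] by (auto simp: characteristic_def)
qed

lemma quotient_inner:
 assumes K: "characteristic K G" and \<phi>: "\<phi> \<in> auto G" and q: "quotient_auto G K \<phi> \<in> inner_auto (G Mod K)"
 shows "\<exists>g\<in>carrier G. \<forall>x\<in>carrier G. mc K (cj g x) (\<phi> x)"
proof -
 have NK: "K \<lhd> G" by (rule characteristic_imp_normal[OF K])
 interpret N: normal K G by (rule NK)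
 interpret M: group "G Mod K" by (rule N.factorgroup_is_group)
 obtain C where C: "C \<in> carrier (G Mod K)"
  "quotient_auto G K \<phi> = (\<lambda>x\<in>carrier (G Mod K). C \<otimes>\<^bsub>G Mod K\<^esub> x \<otimes>\<^bsub>G Mod K\<^esub> inv\<^bsub>G Mod K\<^esub> C)"
  using q by (auto simp: inner_auto_def)
 obtain g where g: "g \<in> carrier G" "C = K #> g" using C(1) by (auto simp: FactGroup_def RCOSETS_def)
 have "mc K (cj g x) (\<phi> x)" if x: "x \<in> carrier G" for x
 proof -
  have px: "\<phi> x \<in> carrier G" using \<phi> x by (auto simp: auto_def hom_def)
  have xM: "K #> x \<in> carrier (G Mod K)" using x by (auto simp: FactGroup_def RCOSETS_def)
  have "\<phi> x <# K = quotient_auto G K \<phi> (K #> x)" using quotient_auto_coset[OF K \<phi> x] N.coset_eq x by simp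
  also have "\<dots> = C \<otimes>\<^bsub>G Mod K\<^esub> (K #> x) \<otimes>\<^bsub>G Mod K\<^esub> inv\<^bsub>G Mod K\<^esub> C" unfolding C(2) using xM by simp
  also have "inv\<^bsub>G Mod K\<^esub> C = K #> inv g" using N.inv_FactGroup[OF C(1)] N.rcos_inv[OF g(1)] g(2) by simp
  also have "C \<otimes>\<^bsub>G Mod K\<^esub> (K #> x) \<otimes>\<^bsub>G Mod K\<^esub> (K #> inv g) = K #> (cj g x)"
   unfolding g(2) using N.rcos_sum g(1) x by (simp add: FactGroup_def)
  finally have e: "\<phi> x <# K = (cj g x) <# K" using N.coset_eq g(1) x by simp
  have "\<phi> x \<otimes> \<one> \<in> \<phi> x <# K" using N.one_closed by (auto simp: l_coset_def)
  then have "\<phi> x \<in> (cj g x) <# K" using e px by simp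
  then obtain k where k: "k \<in> K" "\<phi> x = cj g x \<otimes> k" by (auto simp: l_coset_def)
  have "inv (cj g x) \<otimes> \<phi> x = k" unfolding k(2) using g(1) x N.mem_carrier[OF k(1)] by (simp add: gsimps)
  then show ?thesis using k(1) by (simp add: mc_def)
 qed
 then show ?thesis using g(1) by blast
qed

lemma nfi_finite_Int:
 assumes "finite I" "\<And>i. i \<in> I \<Longrightarrow> nfi (K i)" shows "nfi (carrier G \<inter> (\<Inter>i\<in>I. K i))"
proof -
 have "fi (carrier G \<inter> (\<Inter>i\<in>I. K i)) (carrier G)"
  by (rule fi_finite_Int[OF assms(1) subgroup_self]) (use assms(2) in \<open>simp add: nfi_def\<close>)
 moreover have "nz g (carrier G \<inter> (\<Inter>i\<in>I. K i))" if "g \<in> carrier G" for g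
  using assms(2) that unfolding nfi_def nz_def by simp
 ultimately show ?thesis by (simp add: nfi_def)
qed

text \<open>If each of the finitely many coset representatives t failed at some K t, the
  approximating h for the intersection would lie in the coset of some t and contradict its failure.
  So one representative works for all K.\<close>

lemma LI_coset:
 assumes LI: "LI \<phi> (carrier G)" and \<phi>: "\<And>x. x \<in> carrier G \<Longrightarrow> \<phi> x \<in> carrier G" and G0: "nfi G0"
 shows "\<exists>t\<in>carrier G. LI (tw \<phi> t) G0"
proof (rule ccontr)
 assume neg: "\<not> (\<exists>t\<in>carrier G. LI (tw \<phi> t) G0)"
 have G0f: "fi G0 (carrier G)" and G0n: "\<And>g. g \<in> carrier G \<Longrightarrow> nz g G0" using G0 by (auto simp: nfi_def)
 obtain T where T: "finite T" "T \<subseteq> carrier G" "\<forall>h\<in>carrier G. \<exists>t\<in>T. h \<otimes> inv t \<in> G0" using fi_reps[OF G0f] by blast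
 have "\<forall>t. \<exists>K. t \<in> T \<longrightarrow> nfi K \<and> \<not> (\<exists>c\<in>G0. \<forall>x\<in>carrier G. mc K (cj c x) (tw \<phi> t x))"
  using neg T(2) unfolding LI_def by blast
 from choice[OF this] obtain K where K: "\<And>t. t \<in> T \<Longrightarrow> nfi (K t)"
  "\<And>t. t \<in> T \<Longrightarrow> \<not> (\<exists>c\<in>G0. \<forall>x\<in>carrier G. mc (K t) (cj c x) (tw \<phi> t x))" by blast
 define L where "L = carrier G \<inter> (\<Inter>t\<in>T. K t)"
 have "nfi L" unfolding L_def by (rule nfi_finite_Int[OF T(1) K(1)])
 then obtain h where h: "h \<in> carrier G" "\<And>x. x \<in> carrier G \<Longrightarrow> mc L (cj h x) (\<phi> x)"
  using LI_D[OF LI] by blast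
 obtain t where t: "t \<in> T" "h \<otimes> inv t \<in> G0" using T(3) h(1) by blast
 have tc: "t \<in> carrier G" using t(1) T(2) by blast
 have "inv t \<otimes> (h \<otimes> inv t) \<otimes> t \<in> G0" using nz_D(3)[OF G0n[OF tc] t(2)] .
 then have "inv t \<otimes> h \<in> G0" using h(1) tc by (simp add: m_assoc)
 moreover have "mc (K t) (cj (inv t \<otimes> h) x) (tw \<phi> t x)" if x: "x \<in> carrier G" for x
  by (rule tw_cong[where \<phi> = \<phi>, OF K(1)[OF t(1)] tc h(1) x \<phi>[OF x]]) (use h(2)[OF x] t(1) in \<open>simp add: mc_def L_def\<close>)
 ultimately show False using K(2)[OF t(1)] by blast
qed

text \<open>\<open>Tri_exists\<close> with A and P both the whole group, restricted to a normal
  subgroup so that the acting group and the top of the chain coincide.\<close>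

lemma Tri_nfi: assumes V: "VP n (carrier G)" shows "\<exists>G0. nfi G0 \<and> Tri G0 G0"
proof -
 obtain D where D: "fi D (carrier G)" "Tri D (carrier G \<inter> D)"
  using Tri_exists[OF V V subset_refl nz_self[OF subgroup_self]] by blast
 obtain G0 where G0: "nfi G0" "G0 \<subseteq> D" using nfi_below[OF VP_fg[OF V] D(1)] by blast
 have "subgroup G0 G" using nrmD(1)[OF nfi_nrm[OF G0(1)]] .
 then have "Tri G0 (carrier G \<inter> D \<inter> G0)" using Tri_restrict[OF D(2)] G0(2) by blast
 moreover have "carrier G \<inter> D \<inter> G0 = G0" using G0(2) fiD(3)[OF D(1)] by blast
 ultimately show ?thesis using G0(1) by auto
qed

lemma VP_inner_automorphism_separable: assumes V: "VP n (carrier G)" shows "inner_automorphism_separable G"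
 unfolding inner_automorphism_separable_def
proof (rule ballI, rule ccontr)
 fix \<phi> assume "\<phi> \<in> auto G - inner_auto G"
 then have \<phi>: "\<phi> \<in> auto G" "\<phi> \<notin> inner_auto G" by auto
 have phc: "\<phi> x \<in> carrier G" if "x \<in> carrier G" for x using \<phi>(1) that by (auto simp: auto_def hom_def)
 assume "\<not> (\<exists>K. characteristic K G \<and> finite_index K G \<and> quotient_auto G K \<phi> \<notin> inner_auto (G Mod K))"
 then have all: "quotient_auto G K \<phi> \<in> inner_auto (G Mod K)" if "characteristic K G" "fi K (carrier G)" for K
  using that fi_imp_finite_index by blast
 \<comment> \<open>Characteristic subgroups of finite index are cofinal, so inner behaviour in their
   quotients gives it modulo every normal subgroup of finite index.\<close>
 have LI: "LI \<phi> (carrier G)" unfolding LI_def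
 proof (intro allI impI)
  fix K assume "nfi K"
  then have "fi K (carrier G)" by (simp add: nfi_def)
  then obtain K' where K': "characteristic K' G" "fi K' (carrier G)" "K' \<subseteq> K"
   using characteristic_below[OF VP_fg[OF V]] by blast
  obtain g where g: "g \<in> carrier G" "\<forall>x\<in>carrier G. mc K' (cj g x) (\<phi> x)"
   using quotient_inner[OF K'(1) \<phi>(1) all[OF K'(1,2)]] by blast
  then show "\<exists>c\<in>carrier G. \<forall>x\<in>carrier G. mc K (cj c x) (\<phi> x)" using K'(3) unfolding mc_def by blast
 qed
 obtain G0 where G0: "nfi G0" "Tri G0 G0" using Tri_nfi[OF V] by blast
 have G0s: "subgroup G0 G" using nrmD(1)[OF nfi_nrm[OF G0(1)]] .
 obtain t where t: "t \<in> carrier G" "LI (tw \<phi> t) G0" using LI_coset[OF LI phc G0(1)] by blast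
 obtain S where S: "finite S" "S \<subseteq> carrier G" "\<And>Q. subgroup Q G \<Longrightarrow> S \<subseteq> Q \<Longrightarrow> carrier G \<subseteq> Q"
  using VP_fg[OF V] by (auto simp: fg_def)
 have "\<exists>g\<in>carrier G. \<forall>x\<in>carrier G. tw \<phi> t x = cj g x"
 proof (rule locally_inner_imp_inner[OF V S G0(2) G0s subset_refl _ t(2)])
  show "tw \<phi> t x \<in> carrier G" if "x \<in> carrier G" for x using phc[OF that] t(1) by (simp add: tw_def)
  \<comment> \<open>Normality of G0 supplies the initial condition on the commutators, with the
    chain starting at A = G0.\<close>
  show "cm c x \<in> G0" if c: "c \<in> G0" and x: "x \<in> S" for c x
  proof -
   have xc: "x \<in> carrier G" using x S(2) by blast
   have cc: "c \<in> carrier G" using c G0s sub_mem by metis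
   have n: "nz x G0" using G0(1) xc by (simp add: nfi_def)
   have "c \<otimes> (cj x (inv c)) \<in> G0"
    using sub_m[OF G0s c nz_D(2)[OF n sub_inv[OF G0s c]]] .
   then show ?thesis using cc xc by (simp add: cm_def m_assoc)
  qed
 qed
 then obtain g where g: "g \<in> carrier G" "\<And>x. x \<in> carrier G \<Longrightarrow> tw \<phi> t x = cj g x" by blast
 define h where "h = t \<otimes> g"
 have h: "h \<in> carrier G" using t(1) g(1) by (simp add: h_def)
 have ph: "\<phi> x = cj h x" if x: "x \<in> carrier G" for x
  unfolding h_def by (rule tw_inner[where \<phi> = \<phi>, OF t(1) g(1) x phc[OF x] g(2)[OF x]])
 have "\<phi> = (\<lambda>x\<in>carrier G. h \<otimes> x \<otimes> inv h)"
 proof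
  fix x
  have "\<phi> \<in> extensional (carrier G)" using \<phi>(1) by (simp add: auto_def Bij_def)
  then show "\<phi> x = (\<lambda>x\<in>carrier G. h \<otimes> x \<otimes> inv h) x"
   using ph[of x] by (cases "x \<in> carrier G") (auto simp: extensional_def)
 qed
 then have "\<phi> \<in> inner_auto G" using h unfolding inner_auto_def by blast
 then show False using \<phi>(2) by simp
qed

end

theorem lemma3p5:
  fixes G :: "('a, 'b) monoid_scheme"
  assumes "group G" and "virtually_polycyclic G"
  shows "inner_automorphism_separable G"
proof -
  interpret group G by (rule assms(1))
  show ?thesis using virtually_polycyclic_VP[OF assms(2)] VP_inner_automorphism_separable by blast
qed

end
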